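(* There is a polynomial-time constant-factor approximation algorithm for the a priori traveling repairman problem under independent (possibly non-uniform) activation probabilities.
   Context: An instance of the a priori traveling repairman problem (TRP) consists of a finite metric space $(V,d)$ ($d$ symmetric, nonnegative, satisfying the triangle inequality), a root $r\in V$, and activation probabilities $p_v\in[0,1]$ for $v\in V$. A random active set $A\subseteq V$ contains each $v$ independently with probability $p_v$. A solution is a master tour $\tau$: a tour starting at $r$ visiting all vertices of $V$. Given $A$, the tour $\tau_A$ visits the vertices of $A$ starting from $r$ in the order given by $\tau$ (shortcutting over $V\setminus A$). For $v\in A$, the latency $\mathsf{LAT}^A_\tau(v)$ is the length of the path from $r$ to $v$ along $\tau_A$, and $\mathsf{LAT}^A_\tau=\sum_{v\in A}\mathsf{LAT}^A_\tau(v)$. The objective is to find a master tour minimizing the expected latency $\mathbb{E}_A[\mathsf{LAT}^A_\tau]$. A constant-factor approximation algorithm outputs a master tour whose expected latency is at most a fixed constant times the optimum, for every instance. *)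

theory Defs
  imports Complex_Main
begin

text \<open>Instances: vertex set V = {0..<n}, root r < n, rational distances d i j and
rational activation probabilities p i (rational so that instances are finite inputs
to an algorithm).\<close>

definition valid_instance :: "nat \<Rightarrow> nat \<Rightarrow> (nat \<Rightarrow> nat \<Rightarrow> rat) \<Rightarrow> (nat \<Rightarrow> rat) \<Rightarrow> bool" where
  "valid_instance n r d p \<longleftrightarrow>
     r < n \<and>
     (\<forall>i<n. \<forall>j<n. 0 \<le> d i j \<and> d i j = d j i) \<and>
     (\<forall>i<n. d i i = 0) \<and>
     (\<forall>i<n. \<forall>j<n. \<forall>k<n. d i k \<le> d i j + d j k) \<and>
     (\<forall>i<n. 0 \<le> p i \<and> p i \<le> 1)"

definition master_tour :: "nat \<Rightarrow> nat \<Rightarrow> nat list \<Rightarrow> bool" where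
  "master_tour n r \<tau> \<longleftrightarrow> distinct \<tau> \<and> set \<tau> = {..<n} \<and> \<tau> \<noteq> [] \<and> hd \<tau> = r"

definition path_len :: "(nat \<Rightarrow> nat \<Rightarrow> rat) \<Rightarrow> nat list \<Rightarrow> real" where
  "path_len d xs = (\<Sum>i < length xs - 1. real_of_rat (d (xs ! i) (xs ! Suc i)))"

definition shortcut :: "nat list \<Rightarrow> nat set \<Rightarrow> nat list" where
  "shortcut \<tau> A = hd \<tau> # filter (\<lambda>v. v \<in> A) (tl \<tau>)"

text \<open>Total latency LAT^A_tau: sum over active vertices of the length of the path from r
to them along tau_A (the root, if active, has latency 0).\<close>
definition latency :: "(nat \<Rightarrow> nat \<Rightarrow> rat) \<Rightarrow> nat list \<Rightarrow> nat set \<Rightarrow> real" where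
  "latency d \<tau> A = (let L = shortcut \<tau> A in
      (\<Sum>k \<in> {1..<length L}. path_len d (take (Suc k) L)))"

definition exp_latency :: "nat \<Rightarrow> (nat \<Rightarrow> nat \<Rightarrow> rat) \<Rightarrow> (nat \<Rightarrow> rat) \<Rightarrow> nat list \<Rightarrow> real" where
  "exp_latency n d p \<tau> =
     (\<Sum>A \<in> Pow {..<n}.
        (\<Prod>v\<in>A. real_of_rat (p v)) * (\<Prod>v\<in>{..<n} - A. 1 - real_of_rat (p v)) * latency d \<tau> A)"

definition opt_latency :: "nat \<Rightarrow> nat \<Rightarrow> (nat \<Rightarrow> nat \<Rightarrow> rat) \<Rightarrow> (nat \<Rightarrow> rat) \<Rightarrow> real" where
  "opt_latency n r d p = Min (exp_latency n d p ` {\<tau>. master_tour n r \<tau>})"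

section \<open>Encodings (tape symbols: 0 blank, 1 bit 0, 2 bit 1, 3,4,5 separators)\<close>

fun bits :: "nat \<Rightarrow> bool list" where
  "bits 0 = []"
| "bits (Suc n) = odd (Suc n) # bits (Suc n div 2)"

definition nat_enc :: "nat \<Rightarrow> nat list" where
  "nat_enc m = map (\<lambda>b. if b then 2 else 1) (bits m)"

definition rat_enc :: "rat \<Rightarrow> nat list" where
  "rat_enc q = (case quotient_of q of (a, b) \<Rightarrow>
      nat_enc (nat a) @ [3] @ nat_enc (nat b) @ [4])"

definition inst_enc :: "nat \<Rightarrow> nat \<Rightarrow> (nat \<Rightarrow> nat \<Rightarrow> rat) \<Rightarrow> (nat \<Rightarrow> rat) \<Rightarrow> nat list" where
  "inst_enc n r d p =
     nat_enc n @ [5] @ nat_enc r @ [5] @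
     concat (map (\<lambda>i. concat (map (\<lambda>j. rat_enc (d i j)) [0..<n])) [0..<n]) @ [5] @
     concat (map (\<lambda>i. rat_enc (p i)) [0..<n])"

definition tour_enc :: "nat list \<Rightarrow> nat list" where
  "tour_enc \<tau> = concat (map (\<lambda>v. nat_enc v @ [3]) \<tau>)"

text \<open>A machine is (Q, S, delta): states {0..<Q} (0 = start, 1 = halt),
tape alphabet {0..<S} (0 = blank), and a transition table delta q a = (q', a', move)
with move in {-1,0,1}. Only the finite part of delta on states < Q and symbols < S matters.\<close>
type_synonym tm = "nat \<times> nat \<times> (nat \<Rightarrow> nat \<Rightarrow> nat \<times> nat \<times> int)"
type_synonym config = "nat \<times> (int \<Rightarrow> nat) \<times> int"

definition wf_tm :: "tm \<Rightarrow> bool" where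
  "wf_tm M = (case M of (Q, S, \<delta>) \<Rightarrow> 2 \<le> Q \<and> 6 \<le> S \<and>
     (\<forall>q<Q. \<forall>a<S. case \<delta> q a of (q', a', m) \<Rightarrow> q' < Q \<and> a' < S \<and> m \<in> {-1, 0, 1}))"

definition tm_step :: "tm \<Rightarrow> config \<Rightarrow> config" where
  "tm_step M c = (case M of (Q, S, \<delta>) \<Rightarrow> case c of (q, tp, h) \<Rightarrow>
     if q = 1 then c else
       (case \<delta> q (tp h) of (q', a', m) \<Rightarrow> (q', tp(h := a'), h + m)))"

definition init_config :: "nat list \<Rightarrow> config" where
  "init_config w = (0, (\<lambda>i. if 0 \<le> i \<and> nat i < length w then w ! nat i else 0), 0)"

definition tm_run :: "tm \<Rightarrow> nat list \<Rightarrow> nat \<Rightarrow> config" where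
  "tm_run M w t = (tm_step M ^^ t) (init_config w)"

definition computes_within :: "tm \<Rightarrow> nat list \<Rightarrow> nat \<Rightarrow> nat list \<Rightarrow> bool" where
  "computes_within M w T ys \<longleftrightarrow>
     (\<exists>t\<le>T. case tm_run M w t of (q, tp, h) \<Rightarrow>
        q = 1 \<and> (\<forall>i<length ys. tp (int i) = ys ! i) \<and> tp (int (length ys)) = 0)"

end

theory Submission
  imports Defs "HOL-Library.Sublist" "HOL-Library.More_List"
begin

text \<open>Give every vertex the radius \<open>R v\<close> of the smallest ball around it of activation mass at least 1/2,
  the root counting as always active.  An active vertex is isolated at this radius with probability at
  least 1/2, so serving it costs the optimum of the order of \<open>R v\<close>, and one may move the vertices
  greedily to centres whose cells have mass at least 1/2.  For every scale \<open>t = 16^j\<close> the Goemans-Williamson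
  primal-dual algorithm solves the prize-collecting tree problem on the centres, the prize of a cell being
  the sum of \<open>p v * (t - d v c)\<close>.  Its dual moats bound every prefix of the optimal tour from below: a moat
  around cells half of whose mass lies in the prefix is crossed with probability at least 1/5, and the
  prizes of the other cells are paid for by the unserved mass.  Traversing the trees scale by scale gives
  the master tour; its expected latency is a sum over scales which is compared with the area below the
  staircase of (expected length of a prefix, remaining mass) of the optimum.

  For the running time, functions on binary trees that are closed under composition, case distinction and
  iteration of polynomially bounded length and size are implemented by programs on four stacks, which a
  one-tape machine with four tracks simulates.\<close>

section \<open>Stack programs and their simulation on a single tape\<close>

type_synonym store = "nat \<Rightarrow> nat list"

definition top_sym :: "nat \<Rightarrow> store \<Rightarrow> nat" where
  "top_sym i s = (case s i of [] \<Rightarrow> 0 | x # _ \<Rightarrow> x)"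

datatype instr = IPush nat nat | IPop nat | ITest nat nat nat nat

fun instr_step :: "instr list \<Rightarrow> nat \<times> store \<Rightarrow> nat \<times> store" where
  "instr_step P (pc, s) = (if pc < length P then
     (case P ! pc of
        IPush i a \<Rightarrow> (Suc pc, s(i := a # s i))
      | IPop i \<Rightarrow> (Suc pc, s(i := tl (s i)))
      | ITest i a l1 l2 \<Rightarrow> (if top_sym i s = a then l1 else l2, s))
     else (pc, s))"

definition track :: "nat \<Rightarrow> nat \<Rightarrow> nat" where
  "track i x = (x div 6 ^ i) mod 6"

definition set_track :: "nat \<Rightarrow> nat \<Rightarrow> nat \<Rightarrow> nat" where
  "set_track i a x = (x div 6 ^ Suc i * 6 + a) * 6 ^ i + x mod 6 ^ i"

lemma set_track_div: "set_track i a x div 6 ^ i = x div 6 ^ Suc i * 6 + a"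
  unfolding set_track_def by (subst div_mult_self3) simp_all

lemma set_track_mod: "set_track i a x mod 6 ^ i = x mod 6 ^ i"
  unfolding set_track_def by (subst mod_mult_self3) simp

lemma track_mod: "j < i \<Longrightarrow> track j (x mod 6 ^ i) = track j x"
proof -
  assume "j < i"
  then obtain m where "i = j + Suc m" using less_imp_Suc_add by force
  then have "x mod 6 ^ i = 6 ^ j * (x div 6 ^ j mod 6 ^ Suc m) + x mod 6 ^ j"
    by (simp only: power_add mod_mult2_eq)
  then have "x mod 6 ^ i div 6 ^ j = x div 6 ^ j mod 6 ^ Suc m" by simp
  then show ?thesis by (simp add: track_def mod_mod_cancel)
qed

lemma track_set_track:
  assumes "a < 6"
  shows "track j (set_track i a x) = (if j = i then a else track j x)"
proof (rule linorder_cases[of i j])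
  assume "i = j"
  then show ?thesis using set_track_div[of i a x] assms by (simp add: track_def)
next
  assume "j < i"
  then show ?thesis
    using track_mod[of j i x] track_mod[of j i "set_track i a x"] by (simp add: set_track_mod)
next
  assume "i < j"
  then obtain m where "j = Suc i + m" using less_iff_Suc_add by auto
  have "set_track i a x div 6 ^ i div 6 = x div 6 ^ i div 6"
    unfolding set_track_div using assms by (simp add: div_mult2_eq mult.commute[of 6])
  then have "set_track i a x div 6 ^ Suc i = x div 6 ^ Suc i" by (simp only: power_Suc2 div_mult2_eq)
  then show ?thesis
    using \<open>i < j\<close> unfolding track_def \<open>j = Suc i + m\<close> by (simp only: power_add div_mult2_eq) simp
qed

lemma set_track_less:
  assumes "i < k" "a < 6" "x < 6 ^ k"
  shows "set_track i a x < 6 ^ k"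
proof -
  obtain m where m: "k = Suc i + m" using assms(1) less_iff_Suc_add by auto
  have "x div 6 ^ Suc i < 6 ^ m"
    using assms(3) by (simp add: m power_add less_mult_imp_div_less mult.commute mult.left_commute)
  then have "(x div 6 ^ Suc i * 6 + a) < 6 ^ Suc m" using assms(2) by simp
  then have "set_track i a x div 6 ^ i < 6 ^ Suc m" unfolding set_track_div .
  then show ?thesis by (simp add: m div_less_iff_less_mult power_add mult_ac)
qed

lemma mod_power_eq_if_tracks_eq:
  assumes "\<And>i. i < k \<Longrightarrow> track i x = track i y"
  shows "x mod 6 ^ k = y mod 6 ^ k"
  using assms
proof (induction k)
  case (Suc k)
  have "x mod 6 ^ Suc k = 6 ^ k * track k x + x mod 6 ^ k" for x
    using mod_mult2_eq[of x "6 ^ k" 6] by (simp add: track_def mult.commute)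
  then show ?case using Suc by simp
qed simp

lemma track_less_6: "a < 6 \<Longrightarrow> track i a = (if i = 0 then a else 0)"
  by (cases i) (simp_all add: track_def div_mult2_eq)

text \<open>Tape symbols are base-6 numbers with one digit per stack; stack \<open>i\<close> lies with its bottom in
  cell 0 on track \<open>i\<close>.  All cells left of 0 stay blank and stop the return walk to cell 0.\<close>

definition represents :: "store \<Rightarrow> (int \<Rightarrow> nat) \<Rightarrow> bool" where
  "represents s tp \<longleftrightarrow> (\<forall>h. tp h < 6 ^ 4 \<and>
     (\<forall>i<4. track i (tp h) = (if 0 \<le> h \<and> nat h < length (s i) then rev (s i) ! nat h else 0)))"

definition wf_store :: "store \<Rightarrow> bool" where
  "wf_store s \<longleftrightarrow> (\<forall>i<4. \<forall>a\<in>set (s i). 0 < a \<and> a < 6)"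

fun wf_instr :: "instr \<Rightarrow> bool" where
  "wf_instr (IPush i a) \<longleftrightarrow> i < 4 \<and> 0 < a \<and> a < 6"
| "wf_instr (IPop i) \<longleftrightarrow> i < 4"
| "wf_instr (ITest i a l1 l2) \<longleftrightarrow> i < 4"

definition tm_state :: "instr list \<Rightarrow> nat \<Rightarrow> nat \<Rightarrow> nat" where
  "tm_state P pc phase = (if length P \<le> pc then 1 else 2 + 4 * pc + phase)"

definition tm_return :: "instr list \<Rightarrow> nat \<Rightarrow> nat \<Rightarrow> nat \<Rightarrow> nat \<Rightarrow> nat \<Rightarrow> nat \<times> nat \<times> int" where
  "tm_return P pc phase i l x = (if track i x \<noteq> 0 then (tm_state P pc phase, x, -1) else (tm_state P l 0, x, 1))"

text \<open>Phase 0 walks right to the first blank of the track, phase 2 acts on the top cell, phases 1 and 3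
  walk back to cell 0; the latter two remember the outcome of a test.\<close>

definition tm_trans :: "instr list \<Rightarrow> nat \<Rightarrow> nat \<Rightarrow> nat \<Rightarrow> nat \<times> nat \<times> int" where
  "tm_trans P pc phase x = (case P ! pc of
     IPush i a \<Rightarrow>
       if phase = 0 then (if track i x \<noteq> 0 then (tm_state P pc 0, x, 1) else (tm_state P pc 1, set_track i a x, 0))
       else tm_return P pc 1 i (Suc pc) x
   | IPop i \<Rightarrow>
       if phase = 0 then (if track i x \<noteq> 0 then (tm_state P pc 0, x, 1) else (tm_state P pc 2, x, -1))
       else if phase = 2 then (if track i x = 0 then (tm_state P (Suc pc) 0, x, 1) else (tm_state P pc 1, set_track i 0 x, -1))
       else tm_return P pc 1 i (Suc pc) x
   | ITest i a l1 l2 \<Rightarrow>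
       if phase = 0 then (if track i x \<noteq> 0 then (tm_state P pc 0, x, 1) else (tm_state P pc 2, x, -1))
       else if phase = 2 then (if track i x = a then (tm_state P pc 1, x, 0) else (tm_state P pc 3, x, 0))
       else if phase = 1 then tm_return P pc 1 i l1 x
       else tm_return P pc 3 i l2 x)"

definition tm_of :: "instr list \<Rightarrow> tm" where
  "tm_of P = (2 + 4 * length P, 6 ^ 4,
     \<lambda>q x. tm_trans P ((q - 2) div 4) ((q - 2) mod 4) x)"

lemma tm_state_less: "phase < 4 \<Longrightarrow> tm_state P pc phase < 2 + 4 * length P"
  by (auto simp: tm_state_def)

lemma wf_tm_of:
  assumes "P \<noteq> []" "\<forall>c\<in>set P. wf_instr c"
  shows "wf_tm (tm_of P)"
proof -
  have "case tm_trans P ((q - 2) div 4) ((q - 2) mod 4) x of (q', a', m) \<Rightarrow>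
      q' < 2 + 4 * length P \<and> a' < 6 ^ 4 \<and> m \<in> {-1, 0, 1}"
    if "q < 2 + 4 * length P" "x < 6 ^ 4" for q x
  proof -
    have "(q - 2) div 4 < length P" using that(1) assms(1) by (cases P) auto
    then have "wf_instr (P ! ((q - 2) div 4))" using assms(2) nth_mem by blast
    then show ?thesis
      using that(2) tm_state_less set_track_less[of _ 4]
      by (auto simp: tm_trans_def tm_return_def split: instr.split)
  qed
  then show ?thesis using assms(1) by (auto simp: wf_tm_def tm_of_def)
qed

lemma tm_step_of:
  assumes "pc < length P" "phase < 4"
  shows "tm_step (tm_of P) (tm_state P pc phase, tp, h) =
     (case tm_trans P pc phase (tp h) of (q', a', m) \<Rightarrow> (q', tp(h := a'), h + m))"
proof -
  have "tm_state P pc phase \<noteq> 1" "(tm_state P pc phase - 2) div 4 = pc" "(tm_state P pc phase - 2) mod 4 = phase"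
    using assms by (auto simp: tm_state_def)
  then show ?thesis by (simp add: tm_step_def tm_of_def)
qed

lemma tm_step_start: "P \<noteq> [] \<Longrightarrow> tm_step (tm_of P) (0, tp, h) = tm_step (tm_of P) (tm_state P 0 0, tp, h)"
  by (simp add: tm_step_def tm_of_def tm_state_def)

lemma represents_track:
  "represents s tp \<Longrightarrow> i < 4 \<Longrightarrow> track i (tp h) = (if 0 \<le> h \<and> nat h < length (s i) then rev (s i) ! nat h else 0)"
  by (auto simp: represents_def)

lemma represents_track_top:
  assumes "represents s tp" "i < 4"
  shows "track i (tp (int (length (s i)) - 1)) = top_sym i s"
  using represents_track[OF assms, of "int (length (s i)) - 1"]
  by (auto simp: top_sym_def nth_append split: list.split)

lemma represents_track_nonzero:
  assumes "represents s tp" "wf_store s" "i < 4"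
  shows "track i (tp h) \<noteq> 0 \<longleftrightarrow> 0 \<le> h \<and> nat h < length (s i)"
proof -
  have "rev (s i) ! k \<noteq> 0" if "k < length (s i)" for k
  proof -
    have "rev (s i) ! k \<in> set (s i)" using that by (metis length_rev nth_mem set_rev)
    then show ?thesis using assms by (auto simp: wf_store_def)
  qed
  then show ?thesis using represents_track[OF assms(1,3)] by auto
qed

lemma represents_push:
  assumes "represents s tp" "i < 4" "a < 6"
  shows "represents (s(i := a # s i)) (tp(int (length (s i)) := set_track i a (tp (int (length (s i))))))"
  using assms set_track_less[of i 4] unfolding represents_def by (auto simp: track_set_track nth_append)

lemma represents_pop:
  assumes "represents s tp" "i < 4" "s i = a # xs"
  shows "represents (s(i := xs)) (tp(int (length xs) := set_track i 0 (tp (int (length xs)))))"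
  using assms set_track_less[of i 4] unfolding represents_def by (auto simp: track_set_track nth_append)

fun instr_stack :: "instr \<Rightarrow> nat" where
  "instr_stack (IPush i a) = i" | "instr_stack (IPop i) = i" | "instr_stack (ITest i a l1 l2) = i"

lemma wf_instr_stack: "wf_instr c \<Longrightarrow> instr_stack c < 4"
  by (cases c) auto

lemma in_set_tl: "x \<in> set (tl xs) \<Longrightarrow> x \<in> set xs"
  by (cases xs) auto

lemma wf_store_instr_step:
  assumes "wf_store s" "\<forall>c\<in>set P. wf_instr c"
  shows "wf_store (snd (instr_step P (pc, s)))"
proof (cases "pc < length P")
  case True
  then have "wf_instr (P ! pc)" using assms(2) by simp
  then show ?thesis
    using assms(1) True by (cases "P ! pc") (auto simp: wf_store_def dest: in_set_tl)
qed (use assms in auto)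

lemma funpow_trans: "(f ^^ k) x = y \<Longrightarrow> (f ^^ l) y = z \<Longrightarrow> m = k + l \<Longrightarrow> (f ^^ m) x = z"
  by (simp add: funpow_add add.commute[of k])

lemma tm_walk_right:
  assumes "represents s tp" "wf_store s" "pc < length P" "wf_instr (P ! pc)" "k \<le> length (s (instr_stack (P ! pc)))"
  shows "(tm_step (tm_of P) ^^ k) (tm_state P pc 0, tp, 0) = (tm_state P pc 0, tp, int k)"
  using assms(5)
proof (induction k)
  case (Suc k)
  have "track (instr_stack (P ! pc)) (tp (int k)) \<noteq> 0"
    using represents_track_nonzero[OF assms(1,2) wf_instr_stack[OF assms(4)]] Suc.prems by auto
  then have "tm_trans P pc 0 (tp (int k)) = (tm_state P pc 0, tp (int k), 1)"
    by (cases "P ! pc") (auto simp: tm_trans_def)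
  then show ?case using Suc by (simp add: tm_step_of[OF assms(3)])
qed simp

lemma tm_walk_left:
  assumes "represents s tp" "wf_store s" "pc < length P" "phase < 4" "i < 4" "k \<le> length (s i)"
    and trans: "\<And>x. tm_trans P pc phase x = tm_return P pc phase i l x"
  shows "(tm_step (tm_of P) ^^ Suc k) (tm_state P pc phase, tp, int k - 1) = (tm_state P l 0, tp, 0)"
  using assms(6)
proof (induction k)
  case 0
  have "track i (tp (-1)) = 0" using represents_track[OF assms(1,5), of "-1"] by simp
  then show ?case by (simp add: tm_step_of[OF assms(3,4)] trans tm_return_def)
next
  case (Suc k)
  have "track i (tp (int k)) \<noteq> 0" using represents_track_nonzero[OF assms(1,2,5)] Suc.prems by auto
  then have "tm_step (tm_of P) (tm_state P pc phase, tp, int (Suc k) - 1) = (tm_state P pc phase, tp, int k - 1)"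
    by (simp add: tm_step_of[OF assms(3,4)] trans tm_return_def)
  then have "(tm_step (tm_of P) ^^ Suc (Suc k)) (tm_state P pc phase, tp, int (Suc k) - 1) =
    (tm_step (tm_of P) ^^ Suc k) (tm_state P pc phase, tp, int k - 1)" by (simp only: funpow_Suc_right o_apply)
  then show ?case using Suc by simp
qed

definition tm_config :: "instr list \<Rightarrow> nat \<times> store \<Rightarrow> config \<Rightarrow> bool" where
  "tm_config P c C \<longleftrightarrow> (\<exists>tp. represents (snd c) tp \<and> C = (tm_state P (fst c) 0, tp, 0))"

lemma tm_configI:
  "C = (tm_state P pc 0, tp, 0) \<Longrightarrow> represents s tp \<Longrightarrow> tm_config P (pc, s) C"
  by (auto simp: tm_config_def)

context
  fixes P :: "instr list" and pc i :: nat and s :: store and tp :: "int \<Rightarrow> nat"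
  assumes tape: "represents s tp" and store: "wf_store s" and pc: "pc < length P"
    and instr: "wf_instr (P ! pc)" and stack: "instr_stack (P ! pc) = i"
begin

lemmas stack_less_4 = wf_instr_stack[OF instr, unfolded stack]

lemmas tm_walk_to_top = tm_walk_right[OF tape store pc instr, unfolded stack, OF order_refl]

lemma track_above_top: "track i (tp (int (length (s i)))) = 0"
  using represents_track[OF tape stack_less_4] by simp

lemma tm_push:
  assumes "P ! pc = IPush i a"
  shows "tm_config P (Suc pc, s(i := a # s i))
    ((tm_step (tm_of P) ^^ (2 * length (s i) + 3)) (tm_state P pc 0, tp, 0))"
proof -
  let ?h = "length (s i)"
  let ?tp = "tp(int ?h := set_track i a (tp (int ?h)))"
  have a: "i < 4" "0 < a" "a < 6" using instr assms by auto
  have tape': "represents (s(i := a # s i)) ?tp" by (rule represents_push[OF tape a(1,3)])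
  have "wf_store (s(i := a # s i))" using store a by (auto simp: wf_store_def)
  then have walk_back: "(tm_step (tm_of P) ^^ Suc (Suc ?h)) (tm_state P pc 1, ?tp, int (Suc ?h) - 1)
    = (tm_state P (Suc pc) 0, ?tp, 0)"
    by (intro tm_walk_left[OF tape' _ pc]) (use a assms in \<open>auto simp: tm_trans_def\<close>)
  have "(tm_step (tm_of P) ^^ 1) (tm_state P pc 0, tp, int ?h) = (tm_state P pc 1, ?tp, int (Suc ?h) - 1)"
    using track_above_top by (simp add: tm_step_of[OF pc] tm_trans_def assms)
  then show ?thesis
    by (intro tm_configI[OF funpow_trans[OF funpow_trans[OF tm_walk_to_top _ HOL.refl] walk_back] tape'])
      (simp_all add: assms)
qed

lemma tm_leave_top:
  assumes "P ! pc = IPop i \<or> P ! pc = ITest i a l1 l2"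
  shows "(tm_step (tm_of P) ^^ Suc (length (s i))) (tm_state P pc 0, tp, 0)
    = (tm_state P pc 2, tp, int (length (s i)) - 1)"
proof -
  have "tm_trans P pc 0 (tp (int (length (s i)))) = (tm_state P pc 2, tp (int (length (s i))), -1)"
    using assms track_above_top by (auto simp: tm_trans_def)
  then show ?thesis using tm_walk_to_top by (simp add: tm_step_of[OF pc])
qed

lemma tm_pop_empty:
  assumes "P ! pc = IPop i" "s i = []"
  shows "tm_config P (Suc pc, s) ((tm_step (tm_of P) ^^ 2) (tm_state P pc 0, tp, 0))"
proof -
  have "track i (tp (-1)) = 0" using represents_track[OF tape stack_less_4] by simp
  then have "(tm_step (tm_of P) ^^ 1) (tm_state P pc 2, tp, int (length (s i)) - 1) = (tm_state P (Suc pc) 0, tp, 0)"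
    using assms by (simp add: tm_step_of[OF pc] tm_trans_def)
  then show ?thesis by (intro tm_configI[OF funpow_trans[OF tm_leave_top[OF disjI1[OF assms(1)]]] tape])
    (simp_all add: assms)
qed

lemma tm_pop:
  assumes "P ! pc = IPop i" "s i = a # xs"
  shows "tm_config P (Suc pc, s(i := xs)) ((tm_step (tm_of P) ^^ (2 * length (s i) + 2)) (tm_state P pc 0, tp, 0))"
proof -
  let ?h = "length (s i)"
  let ?tp = "tp(int (length xs) := set_track i 0 (tp (int (length xs))))"
  have tape': "represents (s(i := xs)) ?tp" by (rule represents_pop[OF tape stack_less_4 assms(2)])
  have "wf_store (s(i := xs))" using store assms(2) stack_less_4 by (auto simp: wf_store_def)
  then have walk_back: "(tm_step (tm_of P) ^^ Suc (length xs)) (tm_state P pc 1, ?tp, int (length xs) - 1)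
    = (tm_state P (Suc pc) 0, ?tp, 0)"
    by (intro tm_walk_left[OF tape' _ pc]) (use assms stack_less_4 in \<open>auto simp: tm_trans_def\<close>)
  have "track i (tp (int (length xs))) \<noteq> 0"
    using represents_track_nonzero[OF tape store stack_less_4] assms(2) by simp
  then have "(tm_step (tm_of P) ^^ 1) (tm_state P pc 2, tp, int ?h - 1) = (tm_state P pc 1, ?tp, int (length xs) - 1)"
    using assms by (simp add: tm_step_of[OF pc] tm_trans_def)
  then show ?thesis
    by (intro tm_configI[OF funpow_trans[OF funpow_trans[OF tm_leave_top[OF disjI1[OF assms(1)]] _ HOL.refl]
      walk_back] tape']) (simp_all add: assms)
qed

lemma tm_test:
  assumes "P ! pc = ITest i a l1 l2"
  shows "tm_config P (if top_sym i s = a then l1 else l2, s)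
    ((tm_step (tm_of P) ^^ (2 * length (s i) + 3)) (tm_state P pc 0, tp, 0))"
proof -
  let ?h = "length (s i)"
  let ?phase = "if top_sym i s = a then 1 else 3 :: nat" and ?l = "if top_sym i s = a then l1 else l2"
  have walk_back: "(tm_step (tm_of P) ^^ Suc ?h) (tm_state P pc ?phase, tp, int ?h - 1) = (tm_state P ?l 0, tp, 0)"
    by (rule tm_walk_left[OF tape store pc]) (use stack_less_4 assms in \<open>auto simp: tm_trans_def\<close>)
  have "(tm_step (tm_of P) ^^ 1) (tm_state P pc 2, tp, int ?h - 1) = (tm_state P pc ?phase, tp, int ?h - 1)"
    using represents_track_top[OF tape stack_less_4] by (simp add: tm_step_of[OF pc] tm_trans_def assms)
  then show ?thesis
    by (intro tm_configI[OF funpow_trans[OF funpow_trans[OF tm_leave_top[OF disjI2[OF assms]] _ HOL.refl] walk_back] tape]) (simp_all add: assms)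
qed

end

lemma tm_simulates_instr_step:
  assumes "represents s tp" "wf_store s" "pc < length P" "wf_instr (P ! pc)"
  shows "\<exists>t\<le>2 * length (s (instr_stack (P ! pc))) + 3.
    tm_config P (instr_step P (pc, s)) ((tm_step (tm_of P) ^^ t) (tm_state P pc 0, tp, 0))"
proof (cases "P ! pc")
  case (IPush i a)
  then show ?thesis using tm_push[OF assms, of i a] assms(3) by auto
next
  case (IPop i)
  show ?thesis
  proof (cases "s i")
    case Nil
    then have "s(i := tl (s i)) = s" by auto
    then show ?thesis using tm_pop_empty[OF assms _ IPop Nil] IPop assms(3) by (intro exI[of _ 2]) auto
  next
    case (Cons a xs)
    then show ?thesis using tm_pop[OF assms _ IPop Cons] IPop assms(3) by (intro exI[of _ "2 * length (s i) + 2"]) auto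
  qed
next
  case (ITest i a l1 l2)
  then show ?thesis using tm_test[OF assms, of i a l1 l2] assms(3) by auto
qed

definition store_size :: "store \<Rightarrow> nat" where "store_size s = (\<Sum>i<4. length (s i))"

lemma store_size_instr_step:
  assumes "\<forall>c\<in>set P. wf_instr c"
  shows "store_size (snd (instr_step P (pc, s))) \<le> Suc (store_size s)"
proof -
  let ?s = "snd (instr_step P (pc, s))"
  have "length (?s i) \<le> length (s i) + (if i = instr_stack (P ! pc) then 1 else 0)" for i
    by (auto split: instr.split)
  then have "store_size ?s \<le> (\<Sum>i<4. length (s i) + (if i = instr_stack (P ! pc) then 1 else 0))"
    unfolding store_size_def by (rule sum_mono)
  also have "\<dots> \<le> Suc (store_size s)" by (simp add: store_size_def sum.distrib sum.delta)
  finally show ?thesis .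
qed

lemma length_le_store_size: "i < 4 \<Longrightarrow> length (s i) \<le> store_size s"
  unfolding store_size_def by (rule member_le_sum[where f = "\<lambda>i. length (s i)"]) auto

lemma tm_simulates_instr_steps:
  assumes "tm_config P (pc, s) C" "wf_store s" "\<forall>c\<in>set P. wf_instr c"
  shows "\<exists>t\<le>k * (2 * (store_size s + k) + 3). tm_config P ((instr_step P ^^ k) (pc, s)) ((tm_step (tm_of P) ^^ t) C)"
  using assms(1,2)
proof (induction k arbitrary: s pc C)
  case 0
  then show ?case by auto
next
  case (Suc k)
  show ?case
  proof (cases "pc < length P")
    case False
    then have "(instr_step P ^^ j) (pc, s) = (pc, s)" for j by (induction j) auto
    then show ?thesis using Suc.prems(1) by (metis funpow_0 le0)
  next
    case True
    let ?s = "snd (instr_step P (pc, s))"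
    have instr: "wf_instr (P ! pc)" using True assms(3) by simp
    obtain tp where tp: "represents s tp" "C = (tm_state P pc 0, tp, 0)" using Suc.prems(1)
      by (auto simp: tm_config_def)
    obtain t where t: "t \<le> 2 * length (s (instr_stack (P ! pc))) + 3"
      "tm_config P (instr_step P (pc, s)) ((tm_step (tm_of P) ^^ t) C)"
      using tm_simulates_instr_step[OF tp(1) Suc.prems(2) True instr] tp(2) by blast
    obtain t' where t': "t' \<le> k * (2 * (store_size ?s + k) + 3)"
      "tm_config P ((instr_step P ^^ k) (instr_step P (pc, s))) ((tm_step (tm_of P) ^^ t') ((tm_step (tm_of P) ^^ t) C))"
      using Suc.IH[of _ ?s, OF _ wf_store_instr_step[OF Suc.prems(2) assms(3)]] t(2) by (metis prod.collapse)
    have "store_size ?s + k \<le> store_size s + Suc k" using store_size_instr_step[OF assms(3)] by simp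
    then have "k * (2 * (store_size ?s + k) + 3) \<le> k * (2 * (store_size s + Suc k) + 3)"
      by (intro mult_le_mono2 add_le_mono1)
    moreover have "t \<le> 2 * (store_size s + Suc k) + 3"
      using t(1) length_le_store_size[OF wf_instr_stack[OF instr], of s] by simp
    ultimately have "t' + t \<le> Suc k * (2 * (store_size s + Suc k) + 3)" using t'(1) unfolding mult_Suc by linarith
    then show ?thesis using t'(2) by (auto simp: funpow_add funpow_swap1 simp del: instr_step.simps)
  qed
qed

datatype com = Push nat nat | Pop nat | Seq com com (infixr ";;" 60)
  | If nat nat com com | While nat nat com

text \<open>\<open>While i a c\<close> iterates \<open>c\<close> as long as the top of stack \<open>i\<close> differs from \<open>a\<close>; the top of an
  empty stack is 0.\<close>

inductive exec :: "com \<Rightarrow> store \<Rightarrow> nat \<Rightarrow> store \<Rightarrow> bool" where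
  Push: "exec (Push i a) s 1 (s(i := a # s i))"
| Pop: "exec (Pop i) s 1 (s(i := tl (s i)))"
| Seq: "exec c1 s t1 s1 \<Longrightarrow> exec c2 s1 t2 s2 \<Longrightarrow> exec (c1 ;; c2) s (t1 + t2) s2"
| IfT: "top_sym i s = a \<Longrightarrow> exec c1 s t s' \<Longrightarrow> exec (If i a c1 c2) s (t + 2) s'"
| IfF: "top_sym i s \<noteq> a \<Longrightarrow> exec c2 s t s' \<Longrightarrow> exec (If i a c1 c2) s (t + 2) s'"
| WhileF: "top_sym i s = a \<Longrightarrow> exec (While i a c) s 1 s"
| WhileT: "top_sym i s \<noteq> a \<Longrightarrow> exec c s t s1 \<Longrightarrow> exec (While i a c) s1 t' s2 \<Longrightarrow> exec (While i a c) s (t + t' + 2) s2"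

fun com_length :: "com \<Rightarrow> nat" where
  "com_length (Push i a) = 1" | "com_length (Pop i) = 1" | "com_length (c1 ;; c2) = com_length c1 + com_length c2"
| "com_length (If i a c1 c2) = com_length c1 + com_length c2 + 2" | "com_length (While i a c) = com_length c + 2"

fun compile :: "nat \<Rightarrow> com \<Rightarrow> instr list" where
  "compile p (Push i a) = [IPush i a]"
| "compile p (Pop i) = [IPop i]"
| "compile p (c1 ;; c2) = compile p c1 @ compile (p + com_length c1) c2"
| "compile p (If i a c1 c2) = ITest i a (p + 1) (p + com_length c1 + 2) # compile (p + 1) c1 @
     [ITest 0 0 (p + com_length c1 + com_length c2 + 2) (p + com_length c1 + com_length c2 + 2)] @
     compile (p + com_length c1 + 2) c2"
| "compile p (While i a c) = ITest i a (p + com_length c + 2) (p + 1) # compile (p + 1) c @ [ITest 0 0 p p]"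

fun wf_com :: "com \<Rightarrow> bool" where
  "wf_com (Push i a) \<longleftrightarrow> i < 4 \<and> 0 < a \<and> a < 6"
| "wf_com (Pop i) \<longleftrightarrow> i < 4"
| "wf_com (c1 ;; c2) \<longleftrightarrow> wf_com c1 \<and> wf_com c2"
| "wf_com (If i a c1 c2) \<longleftrightarrow> i < 4 \<and> wf_com c1 \<and> wf_com c2"
| "wf_com (While i a c) \<longleftrightarrow> i < 4 \<and> wf_com c"

lemma length_compile [simp]: "length (compile p c) = com_length c"
  by (induction c arbitrary: p) auto

lemma wf_compile: "wf_com c \<Longrightarrow> \<forall>x\<in>set (compile p c). wf_instr x"
  by (induction c arbitrary: p) auto

definition code_at :: "instr list \<Rightarrow> nat \<Rightarrow> instr list \<Rightarrow> bool" where
  "code_at P p is \<longleftrightarrow> (\<exists>pre post. P = pre @ is @ post \<and> length pre = p)"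

lemma code_at_append:
  assumes "code_at P p (is @ js)"
  shows "code_at P p is" "code_at P (p + length is) js"
proof -
  obtain pre post where P: "P = pre @ is @ js @ post" "length pre = p" using assms by (auto simp: code_at_def)
  show "code_at P p is" unfolding code_at_def using P by (intro exI[of _ pre] exI[of _ "js @ post"]) simp
  show "code_at P (p + length is) js"
    unfolding code_at_def using P by (intro exI[of _ "pre @ is"] exI[of _ post]) simp
qed

lemma code_at_Cons:
  assumes "code_at P p (x # xs)"
  shows "p < length P \<and> P ! p = x \<and> code_at P (p + 1) xs"
proof
  show "p < length P" using assms by (auto simp: code_at_def)
  have "P ! p = x" using assms by (auto simp: code_at_def)
  moreover have "code_at P (p + 1) xs" using code_at_append(2)[of P p "[x]" xs] assms by simp
  ultimately show "P ! p = x \<and> code_at P (p + 1) xs" ..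
qed

definition instr_reaches :: "instr list \<Rightarrow> nat \<Rightarrow> nat \<times> store \<Rightarrow> nat \<times> store \<Rightarrow> bool" where
  "instr_reaches P t c c' \<longleftrightarrow> (\<exists>k\<le>t. (instr_step P ^^ k) c = c')"

lemma instr_reaches_step: "instr_step P c = c' \<Longrightarrow> instr_reaches P 1 c c'"
  unfolding instr_reaches_def by (intro exI[of _ 1]) auto

lemma instr_reaches_mono: "instr_reaches P t c c' \<Longrightarrow> t \<le> t' \<Longrightarrow> instr_reaches P t' c c'"
  unfolding instr_reaches_def using order_trans by blast

lemma instr_reaches_trans: "instr_reaches P t c c' \<Longrightarrow> instr_reaches P t' c' c'' \<Longrightarrow> instr_reaches P (t + t') c c''"
  unfolding instr_reaches_def by (meson add_mono funpow_trans[OF _ _ HOL.refl])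

lemma instr_step_compile_If:
  assumes "code_at P p (compile p (If i a c1 c2))"
  shows "code_at P (p + 1) (compile (p + 1) c1)"
    "code_at P (p + com_length c1 + 2) (compile (p + com_length c1 + 2) c2)"
    "instr_step P (p, s) = (if top_sym i s = a then p + 1 else p + com_length c1 + 2, s)"
    "instr_step P (p + 1 + com_length c1, s) = (p + com_length (If i a c1 c2), s)"
proof -
  let ?q = "p + 1 + com_length c1" and ?end = "p + com_length (If i a c1 c2)"
  note code = code_at_Cons[OF assms[unfolded compile.simps]]
  note branches = code_at_append[OF code[THEN conjunct2, THEN conjunct2]]
  show "code_at P (p + 1) (compile (p + 1) c1)" by (rule branches(1))
  show "code_at P (p + com_length c1 + 2) (compile (p + com_length c1 + 2) c2)"
    using code_at_append(2)[OF branches(2)] by (simp add: ac_simps)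
  show "instr_step P (p, s) = (if top_sym i s = a then p + 1 else p + com_length c1 + 2, s)" using code by simp
  have "code_at P ?q (ITest 0 0 ?end ?end # compile (p + com_length c1 + 2) c2)" using branches(2)
    by (simp add: ac_simps)
  from code_at_Cons[OF this] show "instr_step P (?q, s) = (?end, s)" by simp
qed

lemma instr_step_compile_While:
  assumes "code_at P p (compile p (While i a c))"
  shows "code_at P (p + 1) (compile (p + 1) c)"
    "instr_step P (p, s) = (if top_sym i s = a then p + com_length (While i a c) else p + 1, s)"
    "instr_step P (p + 1 + com_length c, s) = (p, s)"
proof -
  note code = code_at_Cons[OF assms[unfolded compile.simps]]
  note body = code_at_append[OF code[THEN conjunct2, THEN conjunct2]]
  show "code_at P (p + 1) (compile (p + 1) c)" by (rule body(1))
  show "instr_step P (p, s) = (if top_sym i s = a then p + com_length (While i a c) else p + 1, s)" using code by simp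
  show "instr_step P (p + 1 + com_length c, s) = (p, s)" using code_at_Cons[OF body(2)] by simp
qed

lemma compile_correct:
  "exec c s t s' \<Longrightarrow> code_at P p (compile p c) \<Longrightarrow> instr_reaches P t (p, s) (p + com_length c, s')"
proof (induction arbitrary: p rule: exec.induct)
  case (Push i a s)
  then have "instr_step P (p, s) = (p + com_length (Push i a), s(i := a # s i))" using code_at_Cons by auto
  then show ?case by (rule instr_reaches_step)
next
  case (Pop i s)
  then have "instr_step P (p, s) = (p + com_length (Pop i), s(i := tl (s i)))" using code_at_Cons by auto
  then show ?case by (rule instr_reaches_step)
next
  case (Seq c1 s t1 s1 c2 t2 s2)
  then have "code_at P p (compile p c1)" "code_at P (p + com_length c1) (compile (p + com_length c1) c2)"
    using code_at_append by fastforce+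
  from instr_reaches_trans[OF Seq.IH(1)[OF this(1)] Seq.IH(2)[OF this(2)]] show ?case by (simp add: add.assoc)
next
  case (IfT i s a c1 t s' c2)
  note code = instr_step_compile_If[OF IfT.prems]
  have "instr_step P (p, s) = (p + 1, s)" using code(3) IfT.hyps(1) by simp
  then have "instr_reaches P (1 + t + 1) (p, s) (p + com_length (If i a c1 c2), s')"
    using IfT.IH[OF code(1)] code(4) instr_reaches_trans instr_reaches_step by blast
  then show ?case by (rule instr_reaches_mono) simp
next
  case (IfF i s a c2 t s' c1)
  note code = instr_step_compile_If[OF IfF.prems]
  have "instr_step P (p, s) = (p + com_length c1 + 2, s)" using code(3) IfF.hyps(1) by simp
  from instr_reaches_trans[OF instr_reaches_step[OF this] IfF.IH[OF code(2)]]
  have "instr_reaches P (1 + t) (p, s) (p + com_length (If i a c1 c2), s')" by (simp add: ac_simps)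
  then show ?case by (rule instr_reaches_mono) simp
next
  case (WhileF i s a c)
  then show ?case using instr_step_compile_While(2)[OF WhileF.prems, of s] by (intro instr_reaches_step) auto
next
  case (WhileT i s a c t s1 t' s2)
  note code = instr_step_compile_While[OF WhileT.prems]
  have "instr_step P (p, s) = (p + 1, s)" using code(2) WhileT.hyps(1) by simp
  then have "instr_reaches P (1 + t + 1) (p, s) (p, s1)"
    using WhileT.IH(1)[OF code(1)] code(3) instr_reaches_trans instr_reaches_step by blast
  from instr_reaches_trans[OF this WhileT.IH(2)[OF WhileT.prems]] show ?case by (simp add: ac_simps)
qed

definition stacks :: "nat list \<Rightarrow> nat list \<Rightarrow> nat list \<Rightarrow> nat list \<Rightarrow> store" where
  "stacks a m b e = (\<lambda>i. if i = 0 then a else if i = 1 then m else if i = 2 then b else if i = 3 then e else [])"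

lemma represents_input:
  assumes "\<forall>a\<in>set w. a < 6"
  shows "represents (stacks (rev w) [] [] []) (\<lambda>h. if 0 \<le> h \<and> nat h < length w then w ! nat h else 0)"
  unfolding represents_def
proof (intro allI conjI impI)
  fix h :: int and i :: nat
  let ?a = "if 0 \<le> h \<and> nat h < length w then w ! nat h else 0"
  have "?a < 6" using assms by auto
  then show "?a < 6 ^ 4" by simp
  show "track i ?a = (if 0 \<le> h \<and> nat h < length (stacks (rev w) [] [] [] i) then rev (stacks (rev w) [] [] [] i) ! nat h else 0)"
    using track_less_6[OF \<open>?a < 6\<close>, of i] by (cases "i = 0") (simp_all add: stacks_def)
qed

lemma represents_output:
  assumes "represents (stacks (rev ys) [] [] []) tp" "\<forall>a\<in>set ys. a < 6"
  shows "tp (int i) = (if i < length ys then ys ! i else 0)"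
proof -
  let ?y = "if i < length ys then ys ! i else 0"
  have "?y < 6" using assms(2) by simp
  then have "tp (int i) mod 6 ^ 4 = ?y mod 6 ^ 4"
    by (intro mod_power_eq_if_tracks_eq) (simp add: represents_track[OF assms(1)] track_less_6 stacks_def)
  moreover have "tp (int i) < 6 ^ 4" using assms(1) by (simp add: represents_def)
  ultimately show ?thesis using \<open>?y < 6\<close> by simp
qed

theorem exec_computes_within:
  assumes c: "wf_com c" and w: "\<forall>a\<in>set w. 0 < a \<and> a < 6" and ys: "\<forall>a\<in>set ys. a < 6"
    and exec: "exec c (stacks (rev w) [] [] []) t (stacks (rev ys) [] [] [])"
  shows "computes_within (tm_of (compile 0 c)) w (t * (2 * (length w + t) + 3)) ys"
proof -
  let ?P = "compile 0 c" and ?s = "stacks (rev w) [] [] []"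
  let ?input = "\<lambda>i::int. if 0 \<le> i \<and> nat i < length w then w ! nat i else 0"
  have pos: "0 < com_length c" using c by (induction c) auto
  obtain k where k: "k \<le> t" "(instr_step ?P ^^ k) (0, ?s) = (com_length c, stacks (rev ys) [] [] [])"
    using compile_correct[OF exec, of ?P 0] by (auto simp: code_at_def instr_reaches_def)
  have "tm_config ?P (0, ?s) (tm_state ?P 0 0, ?input, 0)"
    by (rule tm_configI[OF HOL.refl represents_input]) (use w in auto)
  moreover have "wf_store ?s" using w by (auto simp: wf_store_def stacks_def)
  ultimately obtain t' where t': "t' \<le> k * (2 * (store_size ?s + k) + 3)"
    "tm_config ?P (com_length c, stacks (rev ys) [] [] []) ((tm_step (tm_of ?P) ^^ t') (tm_state ?P 0 0, ?input, 0))"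
    using tm_simulates_instr_steps[OF _ _ wf_compile[OF c], of 0 0 ?s] unfolding k(2)[symmetric] by blast
  then obtain tp where tp: "represents (stacks (rev ys) [] [] []) tp"
    "(tm_step (tm_of ?P) ^^ t') (tm_state ?P 0 0, ?input, 0) = (1, tp, 0)"
    by (auto simp: tm_config_def tm_state_def)
  then obtain m where m: "t' = Suc m" using pos by (cases t') (auto simp: tm_state_def)
  have "?P \<noteq> []" using pos by (metis length_compile length_greater_0_conv)
  then have run: "tm_run (tm_of ?P) w t' = (1, tp, 0)"
    unfolding tm_run_def init_config_def using tp(2) tm_step_start by (simp add: m funpow_swap1)
  have "store_size ?s = length w" by (simp add: store_size_def stacks_def eval_nat_numeral)
  then have "k * (2 * (store_size ?s + k) + 3) \<le> t * (2 * (length w + t) + 3)" using k(1) by (intro mult_le_mono) auto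
  then show ?thesis
    unfolding computes_within_def
    using t'(1) run represents_output[OF tp(1) ys] by (intro exI[of _ t']) auto
qed

declare One_nat_def [simp del] add_2_eq_Suc [simp del] add_2_eq_Suc' [simp del]

section \<open>Polynomially bounded functions of a size\<close>

definition poly_bounded :: "(nat \<Rightarrow> nat) \<Rightarrow> bool" where
  "poly_bounded T \<longleftrightarrow> (\<exists>k. \<forall>n. T n \<le> (n + 2) ^ k)"

lemma poly_bounded_id: "poly_bounded (\<lambda>n. n)" unfolding poly_bounded_def by (rule exI[of _ 1]) simp

lemma poly_bounded_const: "poly_bounded (\<lambda>n. c)"
proof -
  have "c \<le> (n + 2) ^ c" for n
  proof -
    have "c \<le> 2 ^ c" by (simp add: less_imp_le)
    also have "\<dots> \<le> (n + 2) ^ c" by (rule power_mono) auto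
    finally show ?thesis .
  qed
  then show ?thesis unfolding poly_bounded_def by blast
qed

lemma poly_bounded_mult: assumes "poly_bounded S" "poly_bounded T" shows "poly_bounded (\<lambda>n. S n * T n)"
proof -
  obtain a b where "\<And>n. S n \<le> (n + 2) ^ a" "\<And>n. T n \<le> (n + 2) ^ b" using assms unfolding poly_bounded_def by blast
  then have "S n * T n \<le> (n + 2) ^ (a + b)" for n by (simp add: power_add mult_le_mono)
  then show ?thesis unfolding poly_bounded_def by blast
qed

lemma poly_bounded_add: assumes "poly_bounded S" "poly_bounded T" shows "poly_bounded (\<lambda>n. S n + T n)"
proof -
  obtain a b where ab: "\<And>n. S n \<le> (n + 2) ^ a" "\<And>n. T n \<le> (n + 2) ^ b" using assms unfolding poly_bounded_def by blast
  have "S n + T n \<le> (n + 2) ^ Suc (a + b)" for n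
  proof -
    have "(n + 2) ^ a \<le> (n + 2) ^ (a + b)" "(n + 2) ^ b \<le> (n + 2) ^ (a + b)" by (rule power_increasing; simp)+
    then have "S n + T n \<le> 2 * (n + 2) ^ (a + b)" using ab[of n] by linarith
    also have "\<dots> \<le> (n + 2) * (n + 2) ^ (a + b)" by (rule mult_le_mono1) simp
    finally show ?thesis by simp
  qed
  then show ?thesis unfolding poly_bounded_def by blast
qed

lemma poly_bounded_power: "poly_bounded S \<Longrightarrow> poly_bounded (\<lambda>n. S n ^ k)"
  by (induction k) (simp_all add: poly_bounded_const poly_bounded_mult)

lemmas poly_bounded_intros = poly_bounded_id poly_bounded_const poly_bounded_mult poly_bounded_add poly_bounded_power

section \<open>Binary trees on a stack\<close>

datatype tree = Leaf | Node tree tree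

fun tree_code :: "tree \<Rightarrow> nat list" where
  "tree_code Leaf = [1]" | "tree_code (Node a b) = 2 # tree_code a @ tree_code b"

definition tree_size :: "tree \<Rightarrow> nat" where "tree_size x = length (tree_code x)"

lemma tree_size_simps [simp]: "tree_size Leaf = 1" "tree_size (Node a b) = 1 + tree_size a + tree_size b"
  by (simp_all add: tree_size_def)

lemma tree_size_pos: "tree_size x > 0" by (cases x) auto

lemma set_tree_code: "set (tree_code x) \<subseteq> {1, 2}" by (induction x) auto

definition runs :: "com \<Rightarrow> store \<Rightarrow> nat \<Rightarrow> store \<Rightarrow> bool" where
  "runs c s T s' \<longleftrightarrow> (\<exists>t\<le>T. exec c s t s')"

lemma runs_mono: "runs c s T s' \<Longrightarrow> T \<le> T' \<Longrightarrow> runs c s T' s'"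
  unfolding runs_def using order_trans by blast

lemma runs_Push: "runs (Push i a) s 1 (s(i := a # s i))" unfolding runs_def using exec.Push by blast

lemma runs_Pop: "runs (Pop i) s 1 (s(i := tl (s i)))" unfolding runs_def using exec.Pop by blast

lemma runs_Seq: "runs c1 s T1 s1 \<Longrightarrow> runs c2 s1 T2 s2 \<Longrightarrow> runs (c1 ;; c2) s (T1 + T2) s2"
  unfolding runs_def using exec.Seq add_mono by blast

lemma runs_IfT: "top_sym i s = a \<Longrightarrow> runs c1 s T s' \<Longrightarrow> T + 2 \<le> T' \<Longrightarrow> runs (If i a c1 c2) s T' s'"
  unfolding runs_def using exec.IfT by (meson add_le_mono1 order_trans)

lemma runs_IfF: "top_sym i s \<noteq> a \<Longrightarrow> runs c2 s T s' \<Longrightarrow> T + 2 \<le> T' \<Longrightarrow> runs (If i a c1 c2) s T' s'"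
  unfolding runs_def using exec.IfF by (meson add_le_mono1 order_trans)

lemma runs_WhileF: "top_sym i s = a \<Longrightarrow> runs (While i a c) s 1 s" unfolding runs_def using exec.WhileF by blast

lemma runs_WhileT:
  "top_sym i s \<noteq> a \<Longrightarrow> runs c s T s1 \<Longrightarrow> runs (While i a c) s1 T' s2 \<Longrightarrow> runs (While i a c) s (T + T' + 2) s2"
  unfolding runs_def using exec.WhileT by (meson add_mono order_refl)

lemma stacks_upd [simp]:
  "(stacks a m b e)(0 := x) = stacks x m b e" "(stacks a m b e)(1 := x) = stacks a x b e"
    "(stacks a m b e)(Suc 0 := x) = stacks a x b e"
  "(stacks a m b e)(2 := x) = stacks a m x e" "(stacks a m b e)(3 := x) = stacks a m b x"
  "stacks a m b e 0 = a" "stacks a m b e 1 = m" "stacks a m b e (Suc 0) = m" "stacks a m b e 2 = b"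
    "stacks a m b e 3 = e"
  by (auto simp: stacks_def fun_eq_iff)

lemma runs_Pop_Push: "i \<noteq> j \<Longrightarrow> s i = x # xs \<Longrightarrow> runs (Pop i ;; Push j a) s 2 (s(i := xs, j := a # s j))"
  using runs_Seq[OF runs_Pop[of i s] runs_Push[of j a "s(i := tl (s i))"]] by (simp add: numeral_2_eq_2)

definition move_sym :: "nat \<Rightarrow> nat \<Rightarrow> com" where
  "move_sym i j = If i 2 (Pop i ;; Push j 2) (Pop i ;; Push j 1)"

definition pour :: "nat \<Rightarrow> nat \<Rightarrow> com" where
  "pour i j = While i 0 (move_sym i j)"

lemma runs_move_sym:
  assumes "i \<noteq> j" "s i = x # xs" "x \<in> {1, 2}"
  shows "runs (move_sym i j) s 4 (s(i := xs, j := x # s j))"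
proof -
  have "runs (Pop i ;; Push j a) s 2 (s(i := xs, j := a # s j))" for a by (rule runs_Pop_Push) (use assms in auto)
  from runs_IfT[OF _ this[of 2], of i 2 4] runs_IfF[OF _ this[of 1], of i 2 4] show ?thesis
    unfolding move_sym_def using assms by (cases "x = 2") (auto simp: top_sym_def)
qed

lemma runs_pour:
  assumes "i \<noteq> j" "set (s i) \<subseteq> {1, 2}"
  shows "runs (pour i j) s (6 * length (s i) + 1) (s(i := [], j := rev (s i) @ s j))"
  using assms(2)
proof (induction "s i" arbitrary: s)
  case Nil
  then have "s(i := [], j := rev (s i) @ s j) = s" using assms(1) by (auto simp: fun_eq_iff)
  moreover have "runs (pour i j) s (6 * length (s i) + 1) s"
    using runs_WhileF[of i s 0] Nil(1)[symmetric] by (simp add: pour_def top_sym_def)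
  ultimately show ?case by (simp only:)
next
  case (Cons x xs)
  let ?s = "s(i := xs, j := x # s j)"
  have x: "x \<in> {1, 2}" "set xs \<subseteq> {1, 2}" using Cons.prems unfolding Cons.hyps(2)[symmetric] by auto
  have step: "runs (move_sym i j) s 4 ?s" by (rule runs_move_sym) (use Cons x assms in auto)
  have rest: "runs (pour i j) ?s (6 * length xs + 1) (?s(i := [], j := rev xs @ x # s j))"
    using Cons.hyps(1)[of ?s] x assms(1) by (auto simp: fun_upd_twist)
  have "top_sym i s \<noteq> 0" using x Cons.hyps(2)[symmetric] by (auto simp: top_sym_def)
  from runs_WhileT[OF this step rest[unfolded pour_def]]
  have "runs (pour i j) s (4 + (6 * length xs + 1) + 2) (?s(i := [], j := rev xs @ x # s j))" unfolding pour_def .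
  moreover have "?s(i := [], j := rev xs @ x # s j) = s(i := [], j := rev (s i) @ s j)"
    using Cons assms(1) by (auto simp: fun_eq_iff simp flip: Cons.hyps(2))
  moreover have "6 * length (s i) + 1 = 4 + (6 * length xs + 1) + 2" using Cons.hyps(2)[symmetric] by simp
  ultimately show ?case by metis
qed

lemma runs_pour_stacks:
  assumes "set a \<subseteq> {1, 2}"
  shows "runs (pour 0 1) (stacks a m b e) (6 * length a + 1) (stacks [] (rev a @ m) b e)"
    "runs (pour 2 1) (stacks a' m a e) (6 * length a + 1) (stacks a' (rev a @ m) [] e)"
    "runs (pour 2 0) (stacks a' m a e) (6 * length a + 1) (stacks (rev a @ a') m [] e)"
  using runs_pour[of 0 1 "stacks a m b e"] runs_pour[of 2 1 "stacks a' m a e"]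
    runs_pour[of 2 0 "stacks a' m a e"] assms by simp_all

text \<open>Stack 3 counts in unary the subtrees that are still to be moved.\<close>

definition move_loop :: "nat \<Rightarrow> com" where
  "move_loop j = While 3 0 (If 1 2 (Pop 1 ;; Push j 2 ;; Push 3 1) (Pop 1 ;; Push j 1 ;; Pop 3))"

definition move_tree :: "nat \<Rightarrow> com" where
  "move_tree j = Push 3 1 ;; move_loop j"

lemma runs_move_loop:
  assumes "j = 0 \<or> j = 2" "s 1 = tree_code t @ rest" "s 3 = 1 # cs"
    and "runs (move_loop j) (s(1 := rest, 3 := cs, j := rev (tree_code t) @ s j)) T s'"
  shows "runs (move_loop j) s (T + 7 * tree_size t) s'"
  using assms(2-4)
proof (induction t arbitrary: s rest cs T)
  case Leaf
  let ?s = "s(1 := rest, 3 := cs, j := 1 # s j)"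
  have "runs (Pop 1 ;; Push j 1 ;; Pop 3) s (1 + (1 + 1)) ?s"
    using runs_Seq[OF runs_Pop[of 1 s] runs_Seq[OF runs_Push[of j 1 "s(1 := tl (s 1))"] runs_Pop[of 3]]] Leaf assms(1)
    by (auto simp: fun_upd_twist)
  then have body: "runs (If 1 2 (Pop 1 ;; Push j 2 ;; Push 3 1) (Pop 1 ;; Push j 1 ;; Pop 3)) s 5 ?s"
    by (intro runs_IfF) (use Leaf in \<open>auto simp: top_sym_def\<close>)
  have "runs (move_loop j) ?s T s'" using Leaf(3) by (simp only: tree_code.simps rev.simps append.simps)
  with runs_WhileT[OF _ body, of 3 0 T s'] Leaf(2) show ?case
    unfolding move_loop_def by (simp only: top_sym_def tree_size_simps) (simp add: add.commute)
next
  case (Node l r)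
  let ?s = "s(1 := tree_code l @ tree_code r @ rest, 3 := 1 # 1 # cs, j := 2 # s j)"
  let ?s1 = "s(1 := tree_code r @ rest, 3 := 1 # cs, j := rev (tree_code l) @ 2 # s j)"
  have "runs (Pop 1 ;; Push j 2 ;; Push 3 1) s (1 + (1 + 1)) ?s"
    using runs_Seq[OF runs_Pop[of 1 s] runs_Seq[OF runs_Push[of j 2 "s(1 := tl (s 1))"] runs_Push[of 3 1]]]
      Node.prems assms(1)
    by (auto simp: fun_upd_twist)
  then have body: "runs (If 1 2 (Pop 1 ;; Push j 2 ;; Push 3 1) (Pop 1 ;; Push j 1 ;; Pop 3)) s 5 ?s"
    by (intro runs_IfT) (use Node.prems in \<open>auto simp: top_sym_def\<close>)
  have "?s1(1 := rest, 3 := cs, j := rev (tree_code r) @ ?s1 j)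
    = s(1 := rest, 3 := cs, j := rev (tree_code (Node l r)) @ s j)"
    using assms(1) by (auto simp: fun_eq_iff)
  then have right: "runs (move_loop j) ?s1 (T + 7 * tree_size r) s'"
    using Node.prems(3) assms(1) by (intro Node.IH(2)[of _ rest cs]) (simp_all only:, auto)
  have "?s(1 := tree_code r @ rest, 3 := 1 # cs, j := rev (tree_code l) @ ?s j) = ?s1"
    using assms(1) by (auto simp: fun_eq_iff)
  then have left: "runs (move_loop j) ?s (T + 7 * tree_size r + 7 * tree_size l) s'"
    using right assms(1) by (intro Node.IH(1)[of _ "tree_code r @ rest" "1 # cs"]) (simp_all only:, auto)
  have "top_sym 3 s \<noteq> 0" using Node.prems by (simp add: top_sym_def)
  from runs_WhileT[OF this body left[unfolded move_loop_def]] show ?case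
    unfolding move_loop_def by (rule runs_mono) simp
qed

lemma runs_move_tree:
  "runs (move_tree 0) (stacks a (tree_code t @ rest) b []) (7 * tree_size t + 2) (stacks (rev (tree_code t) @ a) rest b [])"
  "runs (move_tree 2) (stacks a (tree_code t @ rest) b []) (7 * tree_size t + 2) (stacks a rest (rev (tree_code t) @ b) [])"
proof -
  have stop: "runs (move_loop j) (stacks a' m' b' []) 1 (stacks a' m' b' [])" for a' m' b' j
    using runs_WhileF[of 3 "stacks a' m' b' []" 0] by (simp add: move_loop_def top_sym_def)
  have push: "runs (Push 3 1) (stacks a m b []) 1 (stacks a m b [1])" for m
    using runs_Push[of 3 1 "stacks a m b []"] by simp
  have "runs (move_loop 0) (stacks a (tree_code t @ rest) b [1]) (1 + 7 * tree_size t) (stacks (rev (tree_code t) @ a) rest b [])"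
    by (rule runs_move_loop) (use stop in auto)
  from runs_Seq[OF push this]
  show "runs (move_tree 0) (stacks a (tree_code t @ rest) b []) (7 * tree_size t + 2) (stacks (rev (tree_code t) @ a) rest b [])"
    unfolding move_tree_def by (rule runs_mono) simp
  have "runs (move_loop 2) (stacks a (tree_code t @ rest) b [1]) (1 + 7 * tree_size t) (stacks a rest (rev (tree_code t) @ b) [])"
    by (rule runs_move_loop) (use stop in auto)
  from runs_Seq[OF push this]
  show "runs (move_tree 2) (stacks a (tree_code t @ rest) b []) (7 * tree_size t + 2) (stacks a rest (rev (tree_code t) @ b) [])"
    unfolding move_tree_def by (rule runs_mono) simp
qed

definition clear :: com where "clear = While 0 0 (Pop 0)"

lemma runs_clear: "0 \<notin> set a \<Longrightarrow> runs clear (stacks a m b e) (3 * length a + 1) (stacks [] m b e)"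
proof (induction a)
  case Nil
  show ?case unfolding clear_def using runs_WhileF[of 0 "stacks [] m b e" 0] by (simp add: top_sym_def)
next
  case (Cons x a)
  have "top_sym 0 (stacks (x # a) m b e) \<noteq> 0" using Cons by (auto simp: top_sym_def)
  from runs_WhileT[OF this, of "Pop 0" 1 "stacks a m b e" "3 * length a + 1" "stacks [] m b e"]
  have "runs clear (stacks (x # a) m b e) (1 + (3 * length a + 1) + 2) (stacks [] m b e)"
    using Cons runs_Pop[of 0 "stacks (x # a) m b e"] unfolding clear_def by simp
  then show ?case by (rule runs_mono) simp
qed

definition copy_loop :: com where
  "copy_loop = While 0 0 (If 0 2 (Pop 0 ;; Push 1 2 ;; Push 2 2) (Pop 0 ;; Push 1 1 ;; Push 2 1))"

lemma runs_copy_loop: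
  assumes "set a \<subseteq> {1, 2}"
  shows "runs copy_loop (stacks a m b []) (7 * length a + 1) (stacks [] (rev a @ m) (rev a @ b) [])"
  using assms
proof (induction a arbitrary: m b)
  case Nil
  then show ?case using runs_WhileF[of 0 "stacks [] m b []" 0] by (simp add: copy_loop_def top_sym_def)
next
  case (Cons x a)
  have copy: "runs (Pop 0 ;; Push 1 x ;; Push 2 x) (stacks (x # a) m b []) 3 (stacks a (x # m) (x # b) [])" for x
    using runs_Seq[OF runs_Pop[of 0 "stacks (x # a) m b []"] runs_Seq[OF runs_Push[of 1 x] runs_Push[of 2 x]]]
    by (simp add: numeral_3_eq_3)
  have "x = 1 \<or> x = 2" using Cons.prems by auto
  then have body: "runs (If 0 2 (Pop 0 ;; Push 1 2 ;; Push 2 2) (Pop 0 ;; Push 1 1 ;; Push 2 1))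
    (stacks (x # a) m b []) 5 (stacks a (x # m) (x # b) [])"
    using runs_IfT[OF _ copy[of 2], of 0 2 5] runs_IfF[OF _ copy[of 1], of 0 2 5] by (auto simp: top_sym_def)
  have "top_sym 0 (stacks (x # a) m b []) \<noteq> 0" using Cons by (auto simp: top_sym_def)
  from runs_WhileT[OF this body Cons.IH[unfolded copy_loop_def]] Cons.prems show ?case
    unfolding copy_loop_def by (simp add: algebra_simps)
qed

text \<open>Between macros only the main stack 1 is occupied.\<close>

abbreviation runs_main :: "com \<Rightarrow> nat list \<Rightarrow> nat \<Rightarrow> nat list \<Rightarrow> bool" where
  "runs_main c m T m' \<equiv> runs c (stacks [] m [] []) T (stacks [] m' [] [])"

definition drop_tree :: com where "drop_tree = move_tree 0 ;; clear"

definition dup_tree :: com where "dup_tree = move_tree 0 ;; copy_loop ;; pour 2 0 ;; pour 0 1"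

definition swap_trees :: com where "swap_trees = move_tree 0 ;; move_tree 2 ;; pour 0 1 ;; pour 2 1"

lemma runs_drop_tree: "runs_main drop_tree (tree_code t @ rest) (10 * tree_size t + 3) rest"
proof -
  have "0 \<notin> set (rev (tree_code t))" using set_tree_code[of t] by auto
  from runs_Seq[OF runs_move_tree(1)[of "[]" t rest "[]", simplified] runs_clear[OF this]]
  show ?thesis unfolding drop_tree_def by (rule runs_mono) (simp add: tree_size_def)
qed

lemma runs_dup_tree: "runs_main dup_tree (tree_code t @ rest) (26 * tree_size t + 5) (tree_code t @ tree_code t @ rest)"
proof -
  have code: "set (rev (tree_code t)) \<subseteq> {1, 2}" "set (tree_code t) \<subseteq> {1, 2}" using set_tree_code by auto
  show ?thesis unfolding dup_tree_def
    using runs_Seq[OF runs_move_tree(1)[of "[]" t rest "[]", simplified] runs_Seq[OF runs_copy_loop[OF code(1), of rest "[]", simplified]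
      runs_Seq[OF runs_pour_stacks(3)[OF code(2), of "[]" "tree_code t @ rest" "[]", simplified]
        runs_pour_stacks(1)[OF code(1), of "tree_code t @ rest" "[]" "[]", simplified]]]]
    by (rule runs_mono) (simp add: tree_size_def)
qed

lemma runs_swap_trees:
  "runs_main swap_trees (tree_code x @ tree_code y @ rest) (13 * tree_size x + 13 * tree_size y + 6) (tree_code y @ tree_code x @ rest)"
proof -
  have code: "set (rev (tree_code t)) \<subseteq> {1, 2}" for t using set_tree_code by auto
  show ?thesis unfolding swap_trees_def
    using runs_Seq[OF runs_move_tree(1)[of "[]" x "tree_code y @ rest" "[]", simplified]
      runs_Seq[OF runs_move_tree(2)[of "rev (tree_code x)" y rest "[]", simplified]
        runs_Seq[OF runs_pour_stacks(1)[OF code, of x rest "rev (tree_code y)" "[]", simplified]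
          runs_pour_stacks(2)[OF code, of "[]" "tree_code x @ rest" y "[]", simplified]]]]
    by (rule runs_mono) (simp add: tree_size_def)
qed

lemma runs_Push_main: "runs_main (Push 1 a) m 1 (a # m)" using runs_Push[of 1 a "stacks [] m [] []"] by simp

lemma runs_Pop_main: "runs_main (Pop 1) (a # m) 1 m" using runs_Pop[of 1 "stacks [] (a # m) [] []"] by simp

definition skip :: com where "skip = Push 0 1 ;; Pop 0"

lemma runs_skip: "runs skip (stacks a m b e) 2 (stacks a m b e)"
  unfolding skip_def using runs_Seq[OF runs_Push[of 0 1 "stacks a m b e"] runs_Pop[of 0]] by (simp add: numeral_2_eq_2)

fun pushes :: "nat list \<Rightarrow> com" where
  "pushes [] = skip" | "pushes (a # as) = pushes as ;; Push 1 a"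

lemma runs_pushes: "runs (pushes as) (stacks a m b e) (length as + 2) (stacks a (as @ m) b e)"
proof (induction as)
  case Nil
  show ?case using runs_skip by (auto elim: runs_mono)
next
  case (Cons x as)
  have "runs (pushes (x # as)) (stacks a m b e) (length as + 2 + 1) (stacks a ((x # as) @ m) b e)"
    using runs_Seq[OF Cons runs_Push[of 1 x "stacks a (as @ m) b e"]] by simp
  then show ?case by (rule runs_mono) simp
qed

lemma wf_macros [simp]:
  "wf_com (move_tree 0)" "wf_com (move_tree 2)" "wf_com drop_tree" "wf_com dup_tree" "wf_com swap_trees" "wf_com skip"
  by (auto simp: move_tree_def move_loop_def drop_tree_def dup_tree_def swap_trees_def copy_loop_def pour_def move_sym_def clear_def skip_def)

lemma wf_pushes: "set as \<subseteq> {1, 2} \<Longrightarrow> wf_com (pushes as)"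
  by (induction as) auto

section \<open>Polynomial-time functions on trees\<close>

definition implements_on :: "tree set \<Rightarrow> com \<Rightarrow> nat \<Rightarrow> (tree \<Rightarrow> tree) \<Rightarrow> bool" where
  "implements_on X c k f \<longleftrightarrow> wf_com c \<and>
     (\<forall>x\<in>X. \<forall>rest n. tree_size x \<le> n \<longrightarrow> runs_main c (tree_code x @ rest) ((n + 2) ^ k) (tree_code (f x) @ rest))"

lemma implements_onD:
  "implements_on X c k f \<Longrightarrow> x \<in> X \<Longrightarrow> tree_size x \<le> n \<Longrightarrow>
    runs_main c (tree_code x @ rest) ((n + 2) ^ k) (tree_code (f x) @ rest)"
  "implements_on X c k f \<Longrightarrow> wf_com c"
  by (auto simp: implements_on_def)

definition polytime_on :: "tree set \<Rightarrow> (tree \<Rightarrow> tree) \<Rightarrow> bool" where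
  "polytime_on X f \<longleftrightarrow> (\<exists>c k. implements_on X c k f)"

lemma polytime_onE:
  assumes "polytime_on X f"
  obtains c k where "implements_on X c k f"
  using assms unfolding polytime_on_def by blast

lemma polytime_onI:
  assumes "wf_com c" "poly_bounded T"
    and run: "\<And>x rest. x \<in> X \<Longrightarrow> runs_main c (tree_code x @ rest) (T (tree_size x)) (tree_code (f x) @ rest)"
  shows "polytime_on X f"
proof -
  obtain k where k: "\<And>n. T n \<le> (n + 2) ^ k" using assms(2) unfolding poly_bounded_def by blast
  have "runs_main c (tree_code x @ rest) ((n + 2) ^ k) (tree_code (f x) @ rest)"
    if "x \<in> X" "tree_size x \<le> n" for x rest n
  proof (rule runs_mono[OF run[OF that(1)]])
    have "T (tree_size x) \<le> (tree_size x + 2) ^ k" by (rule k)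
    also have "\<dots> \<le> (n + 2) ^ k" using that by (intro power_mono) auto
    finally show "T (tree_size x) \<le> (n + 2) ^ k" .
  qed
  then show ?thesis using assms(1) unfolding polytime_on_def implements_on_def by blast
qed

lemma exec_length: "exec c s t s' \<Longrightarrow> length (s' i) \<le> length (s i) + t"
  by (induction rule: exec.induct) auto

lemma polytime_on_size:
  assumes "polytime_on X f"
  obtains k where "\<And>x n. x \<in> X \<Longrightarrow> tree_size x \<le> n \<Longrightarrow> tree_size (f x) \<le> (n + 2) ^ k"
proof -
  obtain c k where c: "implements_on X c k f" using assms by (rule polytime_onE)
  have "poly_bounded (\<lambda>n. n + (n + 2) ^ k)" by (intro poly_bounded_intros)
  then obtain k' where k': "\<And>n::nat. n + (n + 2) ^ k \<le> (n + 2) ^ k'" unfolding poly_bounded_def by blast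
  have "tree_size (f x) \<le> (n + 2) ^ k'" if x: "x \<in> X" "tree_size x \<le> n" for x n
  proof -
    obtain t where t: "t \<le> (n + 2) ^ k"
      "exec c (stacks [] (tree_code x @ []) [] []) t (stacks [] (tree_code (f x) @ []) [] [])"
      using implements_onD(1)[OF c x, of "[]"] unfolding runs_def by blast
    have "tree_size (f x) \<le> tree_size x + t" using exec_length[OF t(2), of 1] by (simp add: tree_size_def)
    then show ?thesis using k'[of n] t(1) x(2) by linarith
  qed
  then show ?thesis using that by blast
qed

lemma polytime_on_id: "polytime_on X (\<lambda>x. x)"
  by (rule polytime_onI[of skip "\<lambda>_. 2"]) (auto simp: poly_bounded_intros runs_skip)

lemma polytime_on_subset: "polytime_on Y f \<Longrightarrow> X \<subseteq> Y \<Longrightarrow> polytime_on X f"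
  unfolding polytime_on_def implements_on_def by blast

lemma polytime_on_comp:
  assumes "polytime_on Y f" "polytime_on X g" "\<And>x. x \<in> X \<Longrightarrow> g x \<in> Y"
  shows "polytime_on X (\<lambda>x. f (g x))"
proof -
  obtain c k where c: "implements_on Y c k f" using assms(1) by (rule polytime_onE)
  obtain c' k' where c': "implements_on X c' k' g" using assms(2) by (rule polytime_onE)
  obtain m where m: "\<And>x n. x \<in> X \<Longrightarrow> tree_size x \<le> n \<Longrightarrow> tree_size (g x) \<le> (n + 2) ^ m"
    using polytime_on_size[OF assms(2)] by blast
  show ?thesis
    by (rule polytime_onI[of "c' ;; c" "\<lambda>n. (n + 2) ^ k' + ((n + 2) ^ m + 2) ^ k"])
      (use implements_onD(2)[OF c] implements_onD(2)[OF c'] in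
        \<open>auto intro!: poly_bounded_intros runs_Seq implements_onD(1)[OF c'] implements_onD(1)[OF c] m assms(3)\<close>)
qed

lemma polytime_on_const: "polytime_on X (\<lambda>x. t)"
proof (rule polytime_onI[of "drop_tree ;; pushes (tree_code t)" "\<lambda>n. (10 * n + 3) + (length (tree_code t) + 2)"])
  show "wf_com (drop_tree ;; pushes (tree_code t))" using wf_pushes set_tree_code by simp
  show "runs_main (drop_tree ;; pushes (tree_code t)) (tree_code x @ rest)
    (10 * tree_size x + 3 + (length (tree_code t) + 2)) (tree_code t @ rest)"
    for x rest by (rule runs_Seq[OF runs_drop_tree runs_pushes])
qed (intro poly_bounded_intros)

lemma polytime_on_Node:
  assumes "polytime_on X f" "polytime_on X g"
  shows "polytime_on X (\<lambda>x. Node (f x) (g x))"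
proof -
  obtain c k where c: "implements_on X c k f" using assms(1) by (rule polytime_onE)
  obtain c' k' where c': "implements_on X c' k' g" using assms(2) by (rule polytime_onE)
  obtain m where m: "\<And>x n. x \<in> X \<Longrightarrow> tree_size x \<le> n \<Longrightarrow> tree_size (g x) \<le> (n + 2) ^ m"
    using polytime_on_size[OF assms(2)] by blast
  let ?T = "\<lambda>n. (26 * n + 5) + ((n + 2) ^ k' + ((13 * (n + 2) ^ m + 13 * n + 6) + ((n + 2) ^ k + 1)))"
  show ?thesis
  proof (rule polytime_onI[of "dup_tree ;; c' ;; swap_trees ;; c ;; Push 1 2" ?T])
    show "wf_com (dup_tree ;; c' ;; swap_trees ;; c ;; Push 1 2)"
      using implements_onD(2)[OF c] implements_onD(2)[OF c'] by simp
    show "poly_bounded ?T" by (intro poly_bounded_intros)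
    fix x rest assume x: "x \<in> X"
    have swap: "runs_main swap_trees (tree_code (g x) @ tree_code x @ rest) (13 * (tree_size x + 2) ^ m + 13 * tree_size x + 6)
        (tree_code x @ tree_code (g x) @ rest)"
      using runs_mono[OF runs_swap_trees] m[of x "tree_size x"] x by simp
    show "runs_main (dup_tree ;; c' ;; swap_trees ;; c ;; Push 1 2) (tree_code x @ rest)
      (?T (tree_size x)) (tree_code (Node (f x) (g x)) @ rest)"
      by (rule runs_Seq[OF runs_dup_tree runs_Seq[OF implements_onD(1)[OF c' x order_refl]
            runs_Seq[OF swap runs_Seq[OF implements_onD(1)[OF c x order_refl]]]]])
        (simp add: runs_Push_main)
  qed
qed

fun car :: "tree \<Rightarrow> tree" where "car Leaf = Leaf" | "car (Node a b) = a"
fun cdr :: "tree \<Rightarrow> tree" where "cdr Leaf = Leaf" | "cdr (Node a b) = b"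

lemma polytime_on_destruct:
  assumes "wf_com c" "f Leaf = Leaf"
    and run: "\<And>l r rest. runs_main c (tree_code l @ tree_code r @ rest) (30 * tree_size (Node l r)) (tree_code (f (Node l r)) @ rest)"
  shows "polytime_on X f"
proof (rule polytime_onI[of "If 1 2 (Pop 1 ;; c) skip" "\<lambda>n. 30 * n + 30"])
  fix x rest
  show "runs_main (If 1 2 (Pop 1 ;; c) skip) (tree_code x @ rest) (30 * tree_size x + 30) (tree_code (f x) @ rest)"
  proof (cases x)
    case Leaf
    then show ?thesis using assms(2) by (intro runs_IfF[of _ _ _ _ 2]) (auto simp: top_sym_def runs_skip)
  next
    case (Node l r)
    have "runs_main (Pop 1 ;; c) (2 # tree_code l @ tree_code r @ rest) (1 + 30 * tree_size (Node l r)) (tree_code (f (Node l r)) @ rest)"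
      by (rule runs_Seq[OF runs_Pop_main run])
    then show ?thesis using Node by (intro runs_IfT) (auto simp: top_sym_def)
  qed
qed (use assms(1) in \<open>auto intro!: poly_bounded_intros\<close>)

lemma polytime_on_car: "polytime_on X car"
proof (rule polytime_on_destruct[of "swap_trees ;; drop_tree"])
  show "runs_main (swap_trees ;; drop_tree) (tree_code l @ tree_code r @ rest) (30 * tree_size (Node l r)) (tree_code (car (Node l r)) @ rest)"
    for l r rest using runs_mono[OF runs_Seq[OF runs_swap_trees[of l r rest] runs_drop_tree]]
      tree_size_pos[of l] by simp
qed auto

lemma polytime_on_cdr: "polytime_on X cdr"
proof (rule polytime_on_destruct[of drop_tree])
  show "runs_main drop_tree (tree_code l @ tree_code r @ rest) (30 * tree_size (Node l r)) (tree_code (cdr (Node l r)) @ rest)"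
    for l r rest using runs_mono[OF runs_drop_tree[of l]] by simp
qed auto

lemma polytime_on_if:
  assumes "polytime_on X f" "polytime_on X g" "polytime_on X h"
  shows "polytime_on X (\<lambda>x. if f x = Leaf then g x else h x)"
proof -
  obtain c k where c: "implements_on X c k f" using assms(1) by (rule polytime_onE)
  obtain cg kg where cg: "implements_on X cg kg g" using assms(2) by (rule polytime_onE)
  obtain ch kh where ch: "implements_on X ch kh h" using assms(3) by (rule polytime_onE)
  obtain m where m: "\<And>x n. x \<in> X \<Longrightarrow> tree_size x \<le> n \<Longrightarrow> tree_size (f x) \<le> (n + 2) ^ m"
    using polytime_on_size[OF assms(1)] by blast
  let ?branch = "If 1 1 (Pop 1 ;; cg) (drop_tree ;; ch)"
  let ?B = "\<lambda>n. 10 * (n + 2) ^ m + 3 + ((n + 2) ^ kg + (n + 2) ^ kh) + 2"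
  let ?T = "\<lambda>n. (26 * n + 5) + ((n + 2) ^ k + ?B n)"
  show ?thesis
  proof (rule polytime_onI[of "dup_tree ;; c ;; ?branch" ?T])
    show "wf_com (dup_tree ;; c ;; ?branch)"
      using implements_onD(2)[OF c] implements_onD(2)[OF cg] implements_onD(2)[OF ch] by simp
    show "poly_bounded ?T" by (intro poly_bounded_intros)
    fix x rest assume x: "x \<in> X"
    let ?n = "tree_size x"
    have "runs_main ?branch (tree_code (f x) @ tree_code x @ rest) (?B ?n) (tree_code (if f x = Leaf then g x else h x) @ rest)"
    proof (cases "f x")
      case Leaf
      from runs_Seq[OF runs_Pop_main implements_onD(1)[OF cg x order_refl]] Leaf show ?thesis
        by (intro runs_IfT) (auto simp: top_sym_def)
    next
      case (Node l r)
      have "tree_size (f x) \<le> (?n + 2) ^ m" using m x by blast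
      with runs_Seq[OF runs_drop_tree[of "f x"] implements_onD(1)[OF ch x order_refl]] Node show ?thesis
        by (intro runs_IfF) (auto simp: top_sym_def)
    qed
    then show "runs_main (dup_tree ;; c ;; ?branch) (tree_code x @ rest) (?T ?n) (tree_code (if f x = Leaf then g x else h x) @ rest)"
      by (rule runs_Seq[OF runs_dup_tree runs_Seq[OF implements_onD(1)[OF c x order_refl]]])
  qed
qed

fun right_length :: "tree \<Rightarrow> nat" where "right_length Leaf = 0" | "right_length (Node a b) = Suc (right_length b)"

lemma right_length_le_tree_size: "right_length x \<le> tree_size x" by (induction x rule: right_length.induct) auto

definition iterate_body :: "com \<Rightarrow> com" where
  "iterate_body c = Pop 1 ;; drop_tree ;; swap_trees ;; c ;; swap_trees"

lemma runs_iterate_body: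
  assumes c: "implements_on Y c k f" and x: "x \<in> Y" "tree_size x \<le> b" "tree_size (f x) \<le> b"
    and size: "tree_size l \<le> n" "tree_size r \<le> n"
  shows "runs_main (iterate_body c) (tree_code (Node l r) @ tree_code x @ rest) (36 * n + 26 * b + 16 + (b + 2) ^ k)
    (tree_code r @ tree_code (f x) @ rest)"
proof -
  have "runs_main (iterate_body c) (2 # tree_code l @ tree_code r @ tree_code x @ rest)
      (1 + ((10 * tree_size l + 3) + ((13 * tree_size r + 13 * tree_size x + 6) +
        ((b + 2) ^ k + (13 * tree_size (f x) + 13 * tree_size r + 6))))) (tree_code r @ tree_code (f x) @ rest)"
    unfolding iterate_body_def
    by (rule runs_Seq[OF runs_Pop_main runs_Seq[OF runs_drop_tree runs_Seq[OF runs_swap_trees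
          runs_Seq[OF implements_onD(1)[OF c x(1,2)] runs_swap_trees]]]])
  then show ?thesis using x size by (auto elim!: runs_mono)
qed

lemma runs_iterate_loop:
  assumes c: "implements_on Y c k f"
  defines "body \<equiv> \<lambda>n b. 36 * n + 26 * b + 16 + (b + 2) ^ k + 2"
  assumes "tree_size t \<le> n"
    and "\<And>i. i \<le> right_length t \<Longrightarrow> tree_size ((f ^^ i) x) \<le> b" "\<And>i. i < right_length t \<Longrightarrow> (f ^^ i) x \<in> Y"
  shows "runs_main (While 1 1 (iterate_body c)) (tree_code t @ tree_code x @ rest) (right_length t * body n b + 1)
    (1 # tree_code ((f ^^ right_length t) x) @ rest)"
  using assms(3-5)
proof (induction t arbitrary: x)
  case Leaf
  then show ?case using runs_WhileF[of 1 "stacks [] (tree_code Leaf @ tree_code x @ rest) [] []" 1]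
    by (simp add: top_sym_def)
next
  case (Node l r)
  have first: "tree_size x \<le> b" "x \<in> Y" using Node.prems(2,3)[of 0] by simp_all
  have second: "tree_size (f x) \<le> b" using Node.prems(2)[of "Suc 0"] by simp
  have size: "tree_size l \<le> n" "tree_size r \<le> n" using Node.prems(1) by auto
  have "tree_size ((f ^^ i) (f x)) \<le> b" if "i \<le> right_length r" for i
    using Node.prems(2)[of "Suc i"] that by (simp add: funpow_swap1)
  moreover have "(f ^^ i) (f x) \<in> Y" if "i < right_length r" for i
    using Node.prems(3)[of "Suc i"] that by (simp add: funpow_swap1)
  ultimately have rest: "runs_main (While 1 1 (iterate_body c)) (tree_code r @ tree_code (f x) @ rest) (right_length r * body n b + 1)
      (1 # tree_code ((f ^^ right_length r) (f x)) @ rest)"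
    using Node.IH(2)[of "f x"] size by blast
  have "top_sym 1 (stacks [] (tree_code (Node l r) @ tree_code x @ rest) [] []) \<noteq> 1" by (simp add: top_sym_def)
  from runs_WhileT[OF this runs_iterate_body[OF c first(2,1) second size] rest]
  have "runs_main (While 1 1 (iterate_body c)) (tree_code (Node l r) @ tree_code x @ rest) (right_length (Node l r) * body n b + 1)
      (1 # tree_code ((f ^^ right_length r) (f x)) @ rest)" by (rule runs_mono) (simp add: body_def)
  then show ?case by (simp add: funpow_swap1)
qed

lemma polytime_on_iterate:
  assumes f: "polytime_on Y f" and B: "poly_bounded B"
    and dom: "\<And>z i. z \<in> X \<Longrightarrow> i < right_length (car z) \<Longrightarrow> (f ^^ i) (cdr z) \<in> Y"
    and size: "\<And>z i. z \<in> X \<Longrightarrow> i \<le> right_length (car z) \<Longrightarrow> tree_size ((f ^^ i) (cdr z)) \<le> B (tree_size z)"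
  shows "polytime_on X (\<lambda>z. (f ^^ right_length (car z)) (cdr z))"
proof -
  obtain c k where c: "implements_on Y c k f" using f by (rule polytime_onE)
  let ?p = "If 1 2 (Pop 1 ;; While 1 1 (iterate_body c) ;; Pop 1) skip"
  let ?C = "\<lambda>n. 36 * n + 26 * B n + 16 + (B n + 2) ^ k + 2"
  let ?T = "\<lambda>n. (1 + ((n * ?C n + 1) + 1)) + 2"
  show ?thesis
  proof (rule polytime_onI[of ?p ?T])
    show "wf_com ?p" using implements_onD(2)[OF c] by (simp add: iterate_body_def)
    show "poly_bounded ?T" by (intro poly_bounded_intros B)
    fix z rest assume z: "z \<in> X"
    show "runs_main ?p (tree_code z @ rest) (?T (tree_size z)) (tree_code ((f ^^ right_length (car z)) (cdr z)) @ rest)"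
    proof (cases z)
      case Leaf
      then show ?thesis by (intro runs_IfF[of _ _ _ _ 2]) (auto simp: top_sym_def runs_skip)
    next
      case (Node t x)
      let ?n = "tree_size z" and ?y = "tree_code ((f ^^ right_length t) x) @ rest"
      have "runs_main (While 1 1 (iterate_body c)) (tree_code t @ tree_code x @ rest) (right_length t * ?C ?n + 1) (1 # ?y)"
        by (rule runs_iterate_loop[OF c]) (use Node size[OF z] dom[OF z] in auto)
      then have "runs_main (While 1 1 (iterate_body c)) (tree_code t @ tree_code x @ rest) (?n * ?C ?n + 1) (1 # ?y)"
        using Node right_length_le_tree_size[of t] by (auto elim!: runs_mono intro!: mult_le_mono1 simp del: mult_Suc)
      then have "runs_main (Pop 1 ;; While 1 1 (iterate_body c) ;; Pop 1) (2 # tree_code t @ tree_code x @ rest) (1 + ((?n * ?C ?n + 1) + 1)) ?y"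
        by (rule runs_Seq[OF runs_Pop_main runs_Seq[OF _ runs_Pop_main]])
      then show ?thesis using Node by (intro runs_IfT) (auto simp: top_sym_def)
    qed
  qed
qed

section \<open>Polynomial-time functions on encodable types\<close>

class enc = fixes enc :: "'a \<Rightarrow> tree"

instantiation unit :: enc begin
definition enc_unit :: "unit \<Rightarrow> tree" where "enc_unit x = Leaf"
instance ..
end

instantiation bool :: enc begin
definition enc_bool :: "bool \<Rightarrow> tree" where "enc_bool b = (if b then Node Leaf Leaf else Leaf)"
instance ..
end

instantiation prod :: (enc, enc) enc begin
definition enc_prod :: "'a \<times> 'b \<Rightarrow> tree" where "enc_prod p = Node (enc (fst p)) (enc (snd p))"
instance ..
end

instantiation list :: (enc) enc begin
primrec enc_list :: "'a list \<Rightarrow> tree" where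
  "enc_list [] = Leaf" | "enc_list (x # xs) = Node (enc x) (enc_list xs)"
instance ..
end

instantiation nat :: enc begin
definition enc_nat :: "nat \<Rightarrow> tree" where "enc_nat n = enc (bits n)"
instance ..
end

definition enc_size :: "'a::enc \<Rightarrow> nat" where "enc_size x = tree_size (enc x)"

lemma enc_size_simps [simp]:
  "enc_size () = 1" "enc_size False = 1" "enc_size True = 3" "enc_size (x, y) = 1 + enc_size x + enc_size y"
  "enc_size ([]::'b::enc list) = 1" "enc_size (z # zs) = 1 + enc_size z + enc_size zs"
  by (simp_all add: enc_size_def enc_unit_def enc_bool_def enc_prod_def)

lemma enc_size_pos: "enc_size x > 0" by (simp add: enc_size_def tree_size_pos)

lemma enc_size_bool: "enc_size (b::bool) \<le> 3" by (cases b) auto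

lemma enc_size_list: "enc_size xs = 1 + (\<Sum>x\<leftarrow>xs. 1 + enc_size x)"
  by (induction xs) auto

lemma enc_size_append: "enc_size (xs @ ys) + 1 = enc_size xs + enc_size ys" by (induction xs) auto

lemma enc_size_rev: "enc_size (rev xs) = enc_size xs" using enc_size_append by (induction xs) (auto simp: enc_size_list)

lemma enc_size_take: "enc_size (take i xs) \<le> enc_size xs"
  using enc_size_append[of "take i xs" "drop i xs"] enc_size_pos[of "drop i xs"] by simp

lemma enc_size_mem: "x \<in> set xs \<Longrightarrow> enc_size x \<le> enc_size xs" by (induction xs) auto

lemma length_le_enc_size: "length xs \<le> enc_size xs" by (induction xs) auto

lemma enc_size_list_le:
  assumes "\<And>x. x \<in> set xs \<Longrightarrow> enc_size x \<le> b" "length xs \<le> l"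
  shows "enc_size xs \<le> 1 + l * (1 + b)"
proof -
  have "(\<Sum>x\<leftarrow>xs. 1 + enc_size x) \<le> (\<Sum>x\<leftarrow>xs. 1 + b)" by (rule sum_list_mono) (use assms(1) in simp)
  also have "\<dots> \<le> l * (1 + b)" using mult_le_mono1[OF assms(2), of "1 + b"] by (simp add: sum_list_triv)
  finally show ?thesis unfolding enc_size_list by simp
qed

lemma enc_size_fst: "enc_size (fst z) \<le> enc_size z" and enc_size_snd: "enc_size (snd z) \<le> enc_size z"
  by (cases z; simp)+

lemma enc_size_pair: "enc_size z = 1 + enc_size (fst z) + enc_size (snd z)"
  by (cases z) simp

definition poly_in_size :: "('a::enc \<Rightarrow> nat) \<Rightarrow> bool" where
  "poly_in_size g \<longleftrightarrow> (\<exists>k. \<forall>x. g x \<le> (enc_size x + 2) ^ k)"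

lemma poly_in_sizeI: "poly_bounded T \<Longrightarrow> (\<And>x. g x \<le> T (enc_size x)) \<Longrightarrow> poly_in_size g"
  unfolding poly_in_size_def poly_bounded_def by (meson order_trans)

lemma poly_in_size_const: "poly_in_size (\<lambda>x. c)" by (rule poly_in_sizeI[OF poly_bounded_const]) auto
lemma poly_in_size_enc_size: "poly_in_size enc_size" by (rule poly_in_sizeI[OF poly_bounded_id]) auto

lemma poly_in_size_combine:
  assumes "poly_in_size f" "poly_in_size g"
    and op: "\<And>S T. poly_bounded S \<Longrightarrow> poly_bounded T \<Longrightarrow> poly_bounded (\<lambda>n. opr (S n) (T n))"
    and mono: "\<And>a b c d. a \<le> c \<Longrightarrow> b \<le> d \<Longrightarrow> opr a b \<le> opr c (d::nat)"
  shows "poly_in_size (\<lambda>x. opr (f x) (g x))"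
proof -
  obtain a b where a: "\<And>x. f x \<le> (enc_size x + 2) ^ a" "\<And>x. g x \<le> (enc_size x + 2) ^ b"
    using assms(1,2) unfolding poly_in_size_def by blast
  show ?thesis
    by (rule poly_in_sizeI[OF op[of "\<lambda>n. (n + 2) ^ a" "\<lambda>n. (n + 2) ^ b"]]) (auto intro!: poly_bounded_intros mono a)
qed

lemma poly_in_size_add: "poly_in_size f \<Longrightarrow> poly_in_size g \<Longrightarrow> poly_in_size (\<lambda>x. f x + g x)"
  by (rule poly_in_size_combine) (auto intro: poly_bounded_intros)
lemma poly_in_size_mult: "poly_in_size f \<Longrightarrow> poly_in_size g \<Longrightarrow> poly_in_size (\<lambda>x. f x * g x)"
  by (rule poly_in_size_combine) (auto intro: poly_bounded_intros mult_le_mono)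
lemma poly_in_size_power: "poly_in_size f \<Longrightarrow> poly_in_size (\<lambda>x. f x ^ k)"
  by (induction k) (simp_all add: poly_in_size_const poly_in_size_mult)

definition realizes :: "(tree \<Rightarrow> tree) \<Rightarrow> ('a::enc \<Rightarrow> 'b::enc) \<Rightarrow> bool" where
  "realizes F f \<longleftrightarrow> polytime_on (range (enc :: 'a \<Rightarrow> tree)) F \<and> (\<forall>x. F (enc x) = enc (f x))"

lemma realizesD:
  fixes f :: "'a::enc \<Rightarrow> 'b::enc"
  shows "realizes F f \<Longrightarrow> polytime_on (range (enc :: 'a \<Rightarrow> tree)) F" "realizes F f \<Longrightarrow> F (enc x) = enc (f x)"
  by (auto simp: realizes_def)

definition polytime :: "('a::enc \<Rightarrow> 'b::enc) \<Rightarrow> bool" where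
  "polytime f \<longleftrightarrow> (\<exists>F. realizes F f)"

lemma polytimeE:
  assumes "polytime f"
  obtains F where "realizes F f"
  using assms unfolding polytime_def by blast

lemma polytimeI:
  "polytime_on (range (enc :: 'a::enc \<Rightarrow> tree)) F \<Longrightarrow> (\<And>x. F (enc x) = enc (f x)) \<Longrightarrow> polytime (f :: 'a \<Rightarrow> 'b::enc)"
  unfolding polytime_def realizes_def by blast

lemma polytime_size:
  assumes "polytime f"
  obtains k where "\<And>x n. enc_size x \<le> n \<Longrightarrow> enc_size (f x) \<le> (n + 2) ^ k"
proof -
  obtain F where "realizes F f" using assms by (rule polytimeE)
  note F = realizesD[OF this]
  show ?thesis using polytime_on_size[OF F(1)] F(2) that unfolding enc_size_def by (metis rangeI)
qed

lemma poly_in_size_polytime: "polytime f \<Longrightarrow> poly_in_size (\<lambda>x. enc_size (f x))"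
  unfolding poly_in_size_def using polytime_size[of f] by (metis order_refl)

lemmas poly_in_size_intros =
  poly_in_size_const poly_in_size_enc_size poly_in_size_add poly_in_size_mult poly_in_size_power poly_in_size_polytime

named_theorems polytime_intros

lemma polytime_id [polytime_intros]: "polytime (\<lambda>x. x)" by (rule polytimeI[OF polytime_on_id]) simp

lemma polytime_comp:
  assumes "polytime f" "polytime g"
  shows "polytime (\<lambda>x. f (g x))"
proof -
  obtain F where "realizes F f" using assms(1) by (rule polytimeE)
  note F = realizesD[OF this]
  obtain G where "realizes G g" using assms(2) by (rule polytimeE)
  note G = realizesD[OF this]
  show ?thesis by (rule polytimeI[OF polytime_on_comp[OF F(1) G(1)]]) (auto simp: F G)
qed

lemma polytime_const [polytime_intros]: "polytime (\<lambda>x. c)"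
  by (rule polytimeI[OF polytime_on_const[of _ "enc c"]]) simp

lemma polytime_Pair [polytime_intros]:
  assumes "polytime f" "polytime g"
  shows "polytime (\<lambda>x. (f x, g x))"
proof -
  obtain F where "realizes F f" using assms(1) by (rule polytimeE)
  note F = realizesD[OF this]
  obtain G where "realizes G g" using assms(2) by (rule polytimeE)
  note G = realizesD[OF this]
  show ?thesis by (rule polytimeI[OF polytime_on_Node[OF F(1) G(1)]]) (auto simp: F G enc_prod_def)
qed

lemma polytime_app2:
  "polytime (\<lambda>z. g (fst z) (snd z)) \<Longrightarrow> polytime f \<Longrightarrow> polytime h \<Longrightarrow> polytime (\<lambda>x. g (f x) (h x))"
  using polytime_comp[of "\<lambda>z. g (fst z) (snd z)" "\<lambda>x. (f x, h x)"] polytime_Pair by auto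

lemma polytime_app3:
  "polytime (\<lambda>z. g (fst z) (fst (snd z)) (snd (snd z))) \<Longrightarrow> polytime a \<Longrightarrow> polytime b \<Longrightarrow> polytime c \<Longrightarrow>
    polytime (\<lambda>x. g (a x) (b x) (c x))"
  using polytime_comp[of "\<lambda>z. g (fst z) (fst (snd z)) (snd (snd z))" "\<lambda>x. (a x, b x, c x)"] by (simp add: polytime_Pair)

lemma polytime_Cons [polytime_intros]: "polytime f \<Longrightarrow> polytime g \<Longrightarrow> polytime (\<lambda>x. f x # g x)"
  by (rule polytime_app2[of "(#)"]) (rule polytimeI[OF polytime_on_id], simp add: enc_prod_def)

lemma polytime_fst [polytime_intros]: "polytime f \<Longrightarrow> polytime (\<lambda>x. fst (f x))"
  by (rule polytime_comp[of fst]) (rule polytimeI[OF polytime_on_car], simp add: enc_prod_def)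

lemma polytime_snd [polytime_intros]: "polytime f \<Longrightarrow> polytime (\<lambda>x. snd (f x))"
  by (rule polytime_comp[of snd]) (rule polytimeI[OF polytime_on_cdr], simp add: enc_prod_def)

lemma polytime_tl [polytime_intros]: "polytime f \<Longrightarrow> polytime (\<lambda>x. tl (f x))"
proof (rule polytime_comp[of tl])
  have "cdr (enc xs) = enc (tl xs)" for xs :: "'b list" by (cases xs) auto
  then show "polytime (tl :: 'b list \<Rightarrow> 'b list)" by (rule polytimeI[OF polytime_on_cdr])
qed

lemma polytime_if [polytime_intros]:
  assumes "polytime b" "polytime f" "polytime g"
  shows "polytime (\<lambda>x. if b x then f x else g x)"
proof -
  obtain F where "realizes F f" using assms(2) by (rule polytimeE)
  note F = realizesD[OF this]
  obtain G where "realizes G g" using assms(3) by (rule polytimeE)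
  note G = realizesD[OF this]
  obtain H where "realizes H b" using assms(1) by (rule polytimeE)
  note H = realizesD[OF this]
  show ?thesis by (rule polytimeI[OF polytime_on_if[OF H(1) G(1) F(1)]]) (auto simp: F G H enc_bool_def)
qed

lemma polytime_null [polytime_intros]: "polytime f \<Longrightarrow> polytime (\<lambda>x. f x = [])"
proof (rule polytime_comp[of "\<lambda>xs. xs = []"])
  have "(if enc xs = Leaf then Node Leaf Leaf else Leaf) = enc (xs = [])" for xs :: "'b list"
    by (cases xs) (auto simp: enc_bool_def)
  then show "polytime (\<lambda>xs::'b list. xs = [])"
    by (rule polytimeI[OF polytime_on_if[OF polytime_on_id polytime_on_const polytime_on_const]])
qed

definition hd_default :: "'a \<Rightarrow> 'a list \<Rightarrow> 'a" where
  "hd_default d xs = (case xs of [] \<Rightarrow> d | x # _ \<Rightarrow> x)"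

lemma polytime_hd_default [polytime_intros]: "polytime f \<Longrightarrow> polytime (\<lambda>x. hd_default d (f x))"
proof (rule polytime_comp[of "hd_default d"])
  have "(if enc xs = Leaf then enc d else car (enc xs)) = enc (hd_default d xs)" for xs :: "'b list"
    by (cases xs) (auto simp: hd_default_def)
  then show "polytime (hd_default d)"
    by (rule polytimeI[OF polytime_on_if[OF polytime_on_id polytime_on_const polytime_on_car]])
qed

lemma bool_if: "(if p then False else True) = (\<not> p)" "(if p then q else False) = (p \<and> q)"
  "(if p then True else q) = (p \<or> q)" "(if p then q else \<not> q) = (p = q)"
  by auto

lemma polytime_not [polytime_intros]: "polytime b \<Longrightarrow> polytime (\<lambda>x. \<not> b x)"
  using polytime_if[OF _ polytime_const[of False] polytime_const[of True], of b] by (simp only: bool_if)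

lemma polytime_conj [polytime_intros]: "polytime a \<Longrightarrow> polytime b \<Longrightarrow> polytime (\<lambda>x. a x \<and> b x)"
  using polytime_if[OF _ _ polytime_const[of False], of a b] by (simp only: bool_if)

lemma polytime_disj [polytime_intros]: "polytime a \<Longrightarrow> polytime b \<Longrightarrow> polytime (\<lambda>x. a x \<or> b x)"
  using polytime_if[OF _ polytime_const[of True], of a b] by (simp only: bool_if)

lemma polytime_eq_bool [polytime_intros]: "polytime a \<Longrightarrow> polytime b \<Longrightarrow> polytime (\<lambda>x. a x = (b x :: bool))"
  using polytime_if[OF _ _ polytime_not, of a b b] by (simp only: bool_if)

lemma right_length_enc_list [simp]: "right_length (enc xs) = length xs" by (induction xs) auto

text \<open>The loop for \<open>foldl (f x) s ys\<close> runs on the triples \<open>(ys, x, s)\<close>.\<close>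

abbreviation fold_state :: "'a::enc list \<Rightarrow> 'e::enc \<Rightarrow> 's::enc \<Rightarrow> tree" where
  "fold_state ys x s \<equiv> Node (enc ys) (Node (enc x) (enc s))"

definition fold_step :: "(tree \<Rightarrow> tree) \<Rightarrow> tree \<Rightarrow> tree" where
  "fold_step F t = Node (cdr (car t)) (Node (car (cdr t)) (F (Node (car (cdr t)) (Node (cdr (cdr t)) (car (car t))))))"

lemma polytime_on_fold_step:
  assumes "polytime_on (range (enc :: 'e::enc \<times> 's::enc \<times> 'a::enc \<Rightarrow> tree)) F"
  shows "polytime_on {fold_state ys x s | (ys :: 'a list) (x :: 'e) (s :: 's). ys \<noteq> []} (fold_step F)"
    (is "polytime_on ?Y _")
  unfolding fold_step_def
proof (intro polytime_on_Node)
  show "polytime_on ?Y (\<lambda>t. cdr (car t))" "polytime_on ?Y (\<lambda>t. car (cdr t))"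
    by (rule polytime_on_comp[OF polytime_on_cdr[of UNIV] polytime_on_car] polytime_on_comp[OF polytime_on_car[of UNIV] polytime_on_cdr]; simp)+
  show "polytime_on ?Y (\<lambda>t. F (Node (car (cdr t)) (Node (cdr (cdr t)) (car (car t)))))"
  proof (rule polytime_on_comp[OF assms])
    show "polytime_on ?Y (\<lambda>t. Node (car (cdr t)) (Node (cdr (cdr t)) (car (car t))))"
      by (intro polytime_on_Node polytime_on_comp[OF polytime_on_cdr[of UNIV] polytime_on_cdr]
          polytime_on_comp[OF polytime_on_car[of UNIV] polytime_on_cdr]
            polytime_on_comp[OF polytime_on_car[of UNIV] polytime_on_car]) auto
    fix t assume "t \<in> ?Y"
    then obtain ys :: "'a list" and x :: 'e and s :: 's where t: "t = fold_state ys x s" "ys \<noteq> []" by blast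
    then obtain y zs where "ys = y # zs" by (cases ys) auto
    then have "Node (car (cdr t)) (Node (cdr (cdr t)) (car (car t))) = enc (x, s, y)" using t(1)
      by (simp add: enc_prod_def)
    then show "Node (car (cdr t)) (Node (cdr (cdr t)) (car (car t))) \<in> range (enc :: 'e \<times> 's \<times> 'a \<Rightarrow> tree)" by blast
  qed
qed

definition fold_input :: "(tree \<Rightarrow> tree) \<Rightarrow> (tree \<Rightarrow> tree) \<Rightarrow> tree \<Rightarrow> tree" where
  "fold_input X A t = Node (X t) (Node (X t) (Node t (A t)))"

context
  fixes f :: "'e::enc \<Rightarrow> 's::enc \<Rightarrow> 'a::enc \<Rightarrow> 's" and a :: "'e \<Rightarrow> 's" and xs :: "'e \<Rightarrow> 'a list" and F A X
  assumes F: "realizes F (\<lambda>z. f (fst z) (fst (snd z)) (snd (snd z)))" and A: "realizes A a" and X: "realizes X xs"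
begin

lemma funpow_fold_step:
  assumes "i \<le> length ys"
  shows "(fold_step F ^^ i) (fold_state ys x s) = fold_state (drop i ys) x (foldl (f x) s (take i ys))"
  using assms
proof (induction i)
  case (Suc i)
  have "fold_step F (fold_state (y # zs) x s) = fold_state zs x (f x s y)" for y zs x s
    using realizesD(2)[OF F, of "(x, s, y)"] by (simp add: fold_step_def enc_prod_def)
  moreover have "drop i ys = ys ! i # drop (Suc i) ys" using Suc.prems by (simp add: Cons_nth_drop_Suc)
  ultimately show ?case using Suc by (simp add: take_Suc_conv_app_nth del: enc_list.simps)
qed simp

lemma fold_input_enc: "fold_input X A (enc x) = Node (enc (xs x)) (fold_state (xs x) x (a x))"
  using realizesD(2)[OF X] realizesD(2)[OF A] by (simp add: fold_input_def)

lemma polytime_on_fold_loop: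
  assumes b: "poly_in_size b" and bound: "\<And>x i. i \<le> length (xs x) \<Longrightarrow> enc_size (foldl (f x) (a x) (take i (xs x))) \<le> b x"
  shows "polytime_on (fold_input X A ` range (enc :: 'e \<Rightarrow> tree)) (\<lambda>z. (fold_step F ^^ right_length (car z)) (cdr z))"
proof -
  obtain k where k: "\<And>x. b x \<le> (enc_size x + 2) ^ k" using b unfolding poly_in_size_def by blast
  show ?thesis
  proof (rule polytime_on_iterate[OF polytime_on_fold_step[OF realizesD(1)[OF F]], of "\<lambda>n. n + n + (n + 2) ^ k + 2"])
    fix z i assume "z \<in> fold_input X A ` range (enc :: 'e \<Rightarrow> tree)"
    then obtain x :: 'e where z: "z = Node (enc (xs x)) (fold_state (xs x) x (a x))" using fold_input_enc by auto
    show "(fold_step F ^^ i) (cdr z) \<in> {fold_state ys x s | (ys :: 'a list) (x :: 'e) (s :: 's). ys \<noteq> []}"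
      if "i < right_length (car z)"
    proof -
      have "drop i (xs x) \<noteq> []" using that by (simp add: z)
      moreover have "(fold_step F ^^ i) (cdr z) = fold_state (drop i (xs x)) x (foldl (f x) (a x) (take i (xs x)))"
        using funpow_fold_step[of i "xs x" x "a x"] that by (simp add: z)
      ultimately show ?thesis by blast
    qed
    assume "i \<le> right_length (car z)"
    then have i: "i \<le> length (xs x)" by (simp add: z)
    have "tree_size (enc (drop i (xs x))) \<le> tree_size (enc (xs x))"
      using enc_size_append[of "take i (xs x)" "drop i (xs x)"] enc_size_pos[of "take i (xs x)"]
        by (simp add: enc_size_def)
    moreover have "tree_size (enc (foldl (f x) (a x) (take i (xs x)))) \<le> (tree_size z + 2) ^ k"
    proof -
      have "enc_size (foldl (f x) (a x) (take i (xs x))) \<le> (enc_size x + 2) ^ k"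
        using bound[OF i] k order_trans by blast
      also have "\<dots> \<le> (tree_size z + 2) ^ k" by (rule power_mono) (simp_all add: z enc_size_def)
      finally show ?thesis by (simp add: enc_size_def)
    qed
    ultimately show "tree_size ((fold_step F ^^ i) (cdr z)) \<le> tree_size z + tree_size z + (tree_size z + 2) ^ k + 2"
      using funpow_fold_step[OF i] by (simp add: z)
  qed (intro poly_bounded_intros)
qed

end

lemma polytime_foldl:
  fixes f :: "'e::enc \<Rightarrow> 's::enc \<Rightarrow> 'a::enc \<Rightarrow> 's"
  assumes f: "polytime (\<lambda>z. f (fst z) (fst (snd z)) (snd (snd z)))" and a: "polytime a" and xs: "polytime xs"
    and "poly_in_size b" "\<And>x i. i \<le> length (xs x) \<Longrightarrow> enc_size (foldl (f x) (a x) (take i (xs x))) \<le> b x"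
  shows "polytime (\<lambda>x. foldl (f x) (a x) (xs x))"
proof -
  obtain F where F: "realizes F (\<lambda>z. f (fst z) (fst (snd z)) (snd (snd z)))" using f by (rule polytimeE)
  obtain A where A: "realizes A a" using a by (rule polytimeE)
  obtain X where X: "realizes X xs" using xs by (rule polytimeE)
  have input: "polytime_on (range (enc :: 'e \<Rightarrow> tree)) (fold_input X A)"
    unfolding fold_input_def by (intro polytime_on_Node realizesD(1)[OF X] realizesD(1)[OF A] polytime_on_id)
  note loop = polytime_on_fold_loop[OF F A X assms(4,5)]
  show ?thesis
  proof (rule polytimeI[OF polytime_on_comp[OF
      polytime_on_comp[OF polytime_on_cdr[of UNIV] polytime_on_cdr[of UNIV]]
      polytime_on_comp[OF loop input]]])
    show "cdr (cdr ((fold_step F ^^ right_length (car (fold_input X A (enc x)))) (cdr (fold_input X A (enc x))))) = enc (foldl (f x) (a x) (xs x))"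
      for x using funpow_fold_step[OF F A X, of "length (xs x)" "xs x" x "a x"] by (simp add: fold_input_enc[OF F A X])
  qed auto
qed

lemma polytime_foldl_inv:
  fixes f :: "'e::enc \<Rightarrow> 's::enc \<Rightarrow> 'a::enc \<Rightarrow> 's"
  assumes "polytime (\<lambda>z. f (fst z) (fst (snd z)) (snd (snd z)))" "polytime a" "polytime xs" "poly_in_size b"
    and init: "\<And>x. I x 0 (a x)"
    and step: "\<And>x i s. i < length (xs x) \<Longrightarrow> I x i s \<Longrightarrow> I x (Suc i) (f x s (xs x ! i))"
    and bound: "\<And>x i s. i \<le> length (xs x) \<Longrightarrow> I x i s \<Longrightarrow> enc_size s \<le> b x"
  shows "polytime (\<lambda>x. foldl (f x) (a x) (xs x))"
proof (rule polytime_foldl[OF assms(1-4)])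
  fix x i assume i: "i \<le> length (xs x)"
  have "I x i (foldl (f x) (a x) (take i (xs x)))" using i
    by (induction i) (auto simp: init take_Suc_conv_app_nth intro!: step)
  then show "enc_size (foldl (f x) (a x) (take i (xs x))) \<le> b x" using bound i by blast
qed

lemma foldl_Cons_if: "foldl (\<lambda>s a. if P a then g a # s else s) ys xs = rev (map g (filter P xs)) @ ys"
  by (induction xs arbitrary: ys) auto

lemmas foldl_Cons = foldl_Cons_if[where P = "\<lambda>_. True", simplified]

lemma polytime_rev [polytime_intros]:
  fixes f :: "'a::enc \<Rightarrow> 'b::enc list"
  assumes "polytime f"
  shows "polytime (\<lambda>x. rev (f x))"
proof -
  have "polytime (\<lambda>x. foldl (\<lambda>s a. a # s) [] (f x))"
  proof (rule polytime_foldl[where b = "\<lambda>x. enc_size (f x)"])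
    show "enc_size (foldl (\<lambda>s a. a # s) [] (take i (f x))) \<le> enc_size (f x)" for x i
      using enc_size_take[of i "f x"] by (simp add: foldl_Cons enc_size_rev)
  qed (intro polytime_intros poly_in_size_intros assms)+
  then show ?thesis by (simp add: foldl_Cons)
qed

lemma polytime_append [polytime_intros]:
  fixes f :: "'a::enc \<Rightarrow> 'b::enc list"
  assumes "polytime f" "polytime g"
  shows "polytime (\<lambda>x. f x @ g x)"
proof -
  have "polytime (\<lambda>x. foldl (\<lambda>s a. a # s) (g x) (rev (f x)))"
  proof (rule polytime_foldl[where b = "\<lambda>x. enc_size (f x) + enc_size (g x)"])
    show "enc_size (foldl (\<lambda>s a. a # s) (g x) (take i (rev (f x)))) \<le> enc_size (f x) + enc_size (g x)" for x i
      using enc_size_append[of "rev (take i (rev (f x)))" "g x"] enc_size_take[of i "rev (f x)"]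
        by (simp add: foldl_Cons enc_size_rev)
  qed (intro polytime_intros poly_in_size_intros assms)+
  then show ?thesis by (simp add: foldl_Cons)
qed

lemma poly_in_size_elems:
  assumes f: "polytime (\<lambda>z. f (fst z) (snd z))" and xs: "polytime xs"
  obtains b where "poly_in_size b" "\<And>x a. a \<in> set (xs x) \<Longrightarrow> enc_size (f x a) \<le> b x"
proof -
  obtain k where k: "\<And>z n. enc_size z \<le> n \<Longrightarrow> enc_size (f (fst z) (snd z)) \<le> (n + 2) ^ k"
    using polytime_size[OF f] by blast
  have "enc_size (f x a) \<le> (1 + enc_size x + enc_size (xs x) + 2) ^ k" if "a \<in> set (xs x)" for x a
    using k[of "(x, a)" "1 + enc_size x + enc_size (xs x)"] enc_size_mem[OF that] by simp
  moreover have "poly_in_size (\<lambda>x. (1 + enc_size x + enc_size (xs x) + 2) ^ k)" by (intro poly_in_size_intros xs)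
  ultimately show ?thesis using that by blast
qed

lemma polytime_map [polytime_intros]:
  fixes f :: "'e::enc \<Rightarrow> 'a::enc \<Rightarrow> 'c::enc"
  assumes f: "polytime (\<lambda>z. f (fst z) (snd z))" and xs: "polytime xs"
  shows "polytime (\<lambda>x. map (f x) (xs x))"
proof -
  obtain b where b: "poly_in_size b" "\<And>x a. a \<in> set (xs x) \<Longrightarrow> enc_size (f x a) \<le> b x"
    using poly_in_size_elems[OF f xs] by blast
  have "polytime (\<lambda>x. foldl (\<lambda>s a. f x a # s) [] (xs x))"
  proof (rule polytime_foldl[where b = "\<lambda>x. 1 + enc_size (xs x) * (1 + b x)"])
    fix x i
    have "enc_size (map (f x) (take i (xs x))) \<le> 1 + enc_size (xs x) * (1 + b x)"
      using b(2) length_le_enc_size[of "xs x"] by (intro enc_size_list_le) (auto dest: in_set_takeD)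
    then show "enc_size (foldl (\<lambda>s a. f x a # s) [] (take i (xs x))) \<le> 1 + enc_size (xs x) * (1 + b x)"
      by (simp add: foldl_Cons enc_size_rev)
  qed (intro polytime_intros polytime_app2[OF f] poly_in_size_intros b xs)+
  from polytime_rev[OF this] show ?thesis by (simp add: foldl_Cons)
qed

lemma polytime_filter [polytime_intros]:
  fixes f :: "'e::enc \<Rightarrow> 'a::enc \<Rightarrow> bool"
  assumes f: "polytime (\<lambda>z. f (fst z) (snd z))" and xs: "polytime xs"
  shows "polytime (\<lambda>x. filter (f x) (xs x))"
proof -
  have filter_le: "enc_size (filter g zs) \<le> enc_size zs" for g :: "'a \<Rightarrow> bool" and zs by (induction zs) auto
  have "polytime (\<lambda>x. foldl (\<lambda>s a. if f x a then a # s else s) [] (xs x))"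
  proof (rule polytime_foldl[where b = "\<lambda>x. enc_size (xs x)"])
    show "enc_size (foldl (\<lambda>s a. if f x a then a # s else s) [] (take i (xs x))) \<le> enc_size (xs x)" for x i
      using order_trans[OF filter_le enc_size_take] by (simp add: foldl_Cons_if enc_size_rev)
  qed (intro polytime_intros polytime_app2[OF f] poly_in_size_intros xs)+
  from polytime_rev[OF this] show ?thesis by (simp add: foldl_Cons_if)
qed

lemma polytime_concat [polytime_intros]:
  fixes xss :: "'a::enc \<Rightarrow> 'b::enc list list"
  assumes "polytime xss"
  shows "polytime (\<lambda>x. concat (xss x))"
proof -
  have fold: "foldl (\<lambda>s a. s @ a) [] zs = concat zs" for zs :: "'b list list" by (induction zs rule: rev_induct) auto
  have concat_le: "enc_size (concat zs) \<le> enc_size zs" for zs :: "'b list list"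
  proof (induction zs)
    case (Cons z zs) then show ?case using enc_size_append[of z "concat zs"] by simp
  qed simp
  have "polytime (\<lambda>x. foldl (\<lambda>s a. s @ a) [] (xss x))"
  proof (rule polytime_foldl[where b = "\<lambda>x. enc_size (xss x)"])
    show "enc_size (foldl (\<lambda>s a. s @ a) [] (take i (xss x))) \<le> enc_size (xss x)" for x i
      unfolding fold by (rule order_trans[OF concat_le enc_size_take])
  qed (intro polytime_intros poly_in_size_intros assms)+
  then show ?thesis by (simp add: fold)
qed

lemma polytime_list_ex [polytime_intros]:
  assumes "polytime (\<lambda>z. f (fst z) (snd z))" "polytime xs"
  shows "polytime (\<lambda>x. \<exists>a\<in>set (xs x). f x a)"
proof -
  have "(\<exists>a\<in>set (xs x). f x a) \<longleftrightarrow> \<not> filter (f x) (xs x) = []" for x by (auto simp: filter_empty_conv)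
  moreover have "polytime (\<lambda>x. \<not> filter (f x) (xs x) = [])" by (intro polytime_intros assms)
  ultimately show ?thesis by simp
qed

section \<open>Arithmetic on binary numbers\<close>

lemma bits_pos: "n > 0 \<Longrightarrow> bits n = odd n # bits (n div 2)"
  by (cases n) auto

lemma bits_eq_Nil: "bits n = [] \<longleftrightarrow> n = 0" by (cases n) auto

lemma length_bits_le: "length (bits n) \<le> k \<longleftrightarrow> n < 2 ^ k"
proof (induction k arbitrary: n)
  case 0
  then show ?case by (auto simp: bits_eq_Nil)
next
  case (Suc k)
  show ?case
  proof (cases "n = 0")
    case False
    then have "length (bits n) \<le> Suc k \<longleftrightarrow> n div 2 < 2 ^ k" using Suc by (simp add: bits_pos)
    then show ?thesis by auto
  qed auto
qed

lemma less_power_length_bits: "n < 2 ^ length (bits n)" using length_bits_le by blast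

lemma length_bits_mono: "m \<le> n \<Longrightarrow> length (bits m) \<le> length (bits n)"
  using length_bits_le less_power_length_bits le_less_trans by blast

lemma length_bits_mult: "length (bits (a * b)) \<le> length (bits a) + length (bits b)"
  unfolding length_bits_le power_add by (intro mult_strict_mono' less_power_length_bits) auto

lemma length_bits_add: "length (bits (a + b)) \<le> length (bits a) + length (bits b)"
proof (cases "a = 0 \<or> b = 0")
  case False
  then have "1 \<le> length (bits a)" "1 \<le> length (bits b)" by (auto simp: bits_eq_Nil One_nat_def Suc_le_eq)
  then have "(2::nat) ^ length (bits a) \<ge> 2 ^ 1" "(2::nat) ^ length (bits b) \<ge> 2 ^ 1"
    by (simp_all only: power_increasing one_le_numeral)
  then have "(2::nat) ^ length (bits a) + 2 ^ length (bits b) \<le> 2 ^ length (bits a) * 2 ^ length (bits b)"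
    by (auto simp: algebra_simps dest!: le_Suc_ex)
  then show ?thesis
    unfolding length_bits_le power_add using less_power_length_bits[of a] less_power_length_bits[of b] by linarith
qed auto

lemma enc_size_nat_le: "enc_size (n::nat) \<le> 4 * length (bits n) + 1"
proof -
  have "enc_size (bits n) \<le> 1 + length (bits n) * (1 + 3)" by (rule enc_size_list_le[OF enc_size_bool order_refl])
  then show ?thesis by (simp add: enc_size_def enc_nat_def)
qed

lemma length_bits_le_enc_size: "length (bits n) \<le> enc_size n"
  using length_le_enc_size[of "bits n"] by (simp add: enc_size_def enc_nat_def)

lemma enc_size_nat_mono: "m \<le> n \<Longrightarrow> enc_size m \<le> 4 * enc_size (n::nat) + 1"
  using enc_size_nat_le[of m] length_bits_mono[of m n] length_bits_le_enc_size[of n] by linarith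

definition nat_cons :: "nat \<Rightarrow> bool \<Rightarrow> nat" where "nat_cons n b = of_bool b + 2 * n"

lemma bits_nat_cons: "bits (nat_cons n b) = (if \<not> b \<and> n = 0 then [] else b # bits n)"
  by (cases b) (auto simp: nat_cons_def bits_pos)

lemma polytime_bits [polytime_intros]: "polytime f \<Longrightarrow> polytime (\<lambda>x. bits (f x))"
  by (rule polytime_comp[of bits]) (rule polytimeI[OF polytime_on_id], simp add: enc_nat_def)

lemma polytime_eq_0: "polytime f \<Longrightarrow> polytime (\<lambda>x. f x = (0::nat))"
  using polytime_null[OF polytime_bits, of f] by (simp add: bits_eq_Nil)

lemma polytime_odd:
  assumes "polytime f"
  shows "polytime (\<lambda>x. odd (f x :: nat))"
proof -
  have "odd n = hd_default False (bits n)" for n by (cases n) (auto simp: hd_default_def)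
  then show ?thesis using polytime_hd_default[OF polytime_bits[OF assms]] by simp
qed

lemma polytime_div2 [polytime_intros]: "polytime f \<Longrightarrow> polytime (\<lambda>x. f x div (2::nat))"
proof (rule polytime_comp[of "\<lambda>n. n div 2"])
  have "tl (bits n) = bits (n div 2)" for n by (cases n) auto
  then have "cdr (enc n) = enc (n div 2)" for n :: nat
    unfolding enc_nat_def by (metis cdr.simps enc_list.simps list.collapse list.sel(2))
  then show "polytime (\<lambda>n::nat. n div 2)" by (intro polytimeI[OF polytime_on_cdr])
qed

lemma polytime_nat_cons:
  assumes "polytime f" "polytime b"
  shows "polytime (\<lambda>x. nat_cons (f x) (b x))"
proof -
  let ?nonzero = "\<lambda>t. if car t = Leaf then cdr t else Node Leaf Leaf"
  have nonzero: "polytime_on UNIV ?nonzero" by (intro polytime_on_if polytime_on_car polytime_on_cdr polytime_on_const)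
  have enc_0: "enc n = Leaf \<longleftrightarrow> n = 0" for n :: nat unfolding enc_nat_def by (cases n) auto
  have "polytime (\<lambda>p. nat_cons (snd p) (fst p))"
  proof (rule polytimeI[OF polytime_on_if[OF polytime_on_subset[OF nonzero] polytime_on_const[of _ Leaf] polytime_on_id]])
    fix p :: "bool \<times> nat"
    show "(if ?nonzero (enc p) = Leaf then Leaf else enc p) = enc (nat_cons (snd p) (fst p))"
      using enc_0[of "snd p"] by (cases p) (auto simp: enc_prod_def enc_nat_def bits_nat_cons enc_bool_def)
  qed simp
  from polytime_comp[OF this polytime_Pair[OF assms(2,1)]] show ?thesis by simp
qed

text \<open>The most significant bit comes first.\<close>

definition nat_of_bits :: "bool list \<Rightarrow> nat" where "nat_of_bits bs = foldl nat_cons 0 bs"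

lemma nat_of_bits_Cons: "nat_of_bits (b # bs) = of_bool b * 2 ^ length bs + nat_of_bits bs"
proof -
  have "foldl nat_cons n bs = n * 2 ^ length bs + foldl nat_cons 0 bs" for n
  proof (induction bs arbitrary: n)
    case (Cons a bs)
    show ?case using Cons[of "nat_cons n a"] Cons[of "nat_cons 0 a"] by (simp add: nat_cons_def algebra_simps)
  qed simp
  from this[of "of_bool b"] show ?thesis by (simp add: nat_of_bits_def nat_cons_def)
qed

lemma nat_of_bits_less: "nat_of_bits bs < 2 ^ length bs"
  by (induction bs) (auto simp: nat_of_bits_Cons, simp add: nat_of_bits_def)

lemma half_bit: "2 * (m div 2) + of_bool (odd m) = (m::nat)"
  by (cases "odd m") (auto elim!: oddE evenE)

lemma nat_of_bits_rev_bits: "nat_of_bits (rev (bits m)) = m"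
proof (induction m rule: bits.induct)
  case (2 m)
  have "nat_of_bits (rev (bits (Suc m))) = nat_cons (nat_of_bits (rev (bits (Suc m div 2)))) (odd (Suc m))"
    by (simp add: nat_of_bits_def)
  then show ?case using 2 half_bit[of "Suc m"] by (simp only: nat_cons_def add.commute)
qed (simp add: nat_of_bits_def)

lemma polytime_nat_of_bits [polytime_intros]:
  assumes "polytime f"
  shows "polytime (\<lambda>x. nat_of_bits (f x))"
  unfolding nat_of_bits_def
proof (rule polytime_foldl[where b = "\<lambda>x. 4 * enc_size (f x) + 1"])
  fix x i
  have "length (bits (nat_of_bits (take i (f x)))) \<le> length (take i (f x))"
    unfolding length_bits_le by (rule nat_of_bits_less)
  then show "enc_size (foldl nat_cons 0 (take i (f x))) \<le> 4 * enc_size (f x) + 1"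
    using enc_size_nat_le[of "nat_of_bits (take i (f x))"] length_le_enc_size[of "f x"]
      unfolding nat_of_bits_def by simp
qed (intro polytime_nat_cons polytime_intros poly_in_size_intros assms)+

text \<open>Ripple-carry addition and subtraction; \<open>t\<close> distinguishes the borrow from the carry.  A state consists
  of the remaining numbers, the carry and the digits computed so far.\<close>

type_synonym ripple_state = "nat \<times> nat \<times> bool \<times> bool list"

abbreviation carry :: "ripple_state \<Rightarrow> bool" where "carry s \<equiv> fst (snd (snd s))"
abbreviation digits :: "ripple_state \<Rightarrow> bool list" where "digits s \<equiv> snd (snd (snd s))"

definition ripple :: "bool \<Rightarrow> ripple_state \<Rightarrow> ripple_state" where
  "ripple t s = (fst s div 2, fst (snd s) div 2,
     (if odd (fst s) = t then odd (fst (snd s)) \<and> carry s else odd (fst (snd s)) \<or> carry s),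
     ((odd (fst s) = odd (fst (snd s))) = carry s) # digits s)"

definition ripples :: "bool \<Rightarrow> nat \<Rightarrow> nat \<Rightarrow> bool list \<Rightarrow> ripple_state" where
  "ripples t a b bs = foldl (\<lambda>s _. ripple t s) (a, b, False, []) bs"

definition ripple_sign :: "bool \<Rightarrow> int" where "ripple_sign t = (if t then -1 else 1)"

definition ripple_inv :: "bool \<Rightarrow> nat \<Rightarrow> nat \<Rightarrow> nat \<Rightarrow> ripple_state \<Rightarrow> bool" where
  "ripple_inv t a b k s \<longleftrightarrow> fst s = a div 2 ^ k \<and> fst (snd s) = b div 2 ^ k \<and> length (digits s) = k \<and>
     int (nat_of_bits (digits s)) + 2 ^ k *
       (int (fst s) + ripple_sign t * (int (fst (snd s)) + of_bool (carry s))) = int a + ripple_sign t * int b"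

lemma full_adder:
  "of_bool p + ripple_sign t * (of_bool q + of_bool c) =
    of_bool ((p = q) = c) + 2 * (ripple_sign t * of_bool (if p = t then q \<and> c else q \<or> c))"
  by (cases p; cases q; cases c; cases t) (simp_all add: ripple_sign_def)

lemma ripple_inv_step:
  assumes "ripple_inv t a b k s"
  shows "ripple_inv t a b (Suc k) (ripple t s)"
proof -
  obtain x y c out where s: "s = (x, y, c, out)" by (metis surj_pair)
  let ?\<sigma> = "ripple_sign t"
  define e where "e = ((odd x = odd y) = c)"
  define c' where "c' = (if odd x = t then odd y \<and> c else odd y \<or> c)"
  have inv: "x = a div 2 ^ k" "y = b div 2 ^ k" "length out = k"
    "int (nat_of_bits out) + 2 ^ k * (int x + ?\<sigma> * (int y + of_bool c)) = int a + ?\<sigma> * int b"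
    using assms unfolding ripple_inv_def s fst_conv snd_conv by blast+
  have halves: "2 * int (m div 2) + of_bool (odd m) = int m" for m
    using arg_cong[OF half_bit[of m], of int] by (simp only: of_nat_add of_nat_mult of_nat_numeral of_nat_of_bool)
  have "int x + ?\<sigma> * (int y + of_bool c) =
      2 * (int (x div 2) + ?\<sigma> * int (y div 2)) + (of_bool (odd x) + ?\<sigma> * (of_bool (odd y) + of_bool c))"
    by (subst (1) halves[of x, symmetric], subst (1) halves[of y, symmetric]) (simp only: algebra_simps)
  also have "\<dots> = of_bool e + 2 * (int (x div 2) + ?\<sigma> * (int (y div 2) + of_bool c'))"
    unfolding full_adder e_def c'_def by (simp only: algebra_simps)
  finally have step: "int x + ?\<sigma> * (int y + of_bool c)
    = of_bool e + 2 * (int (x div 2) + ?\<sigma> * (int (y div 2) + of_bool c'))" .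
  have "int (nat_of_bits (e # out)) + 2 ^ Suc k * (int (x div 2) + ?\<sigma> * (int (y div 2) + of_bool c'))
    = int a + ?\<sigma> * int b"
    using inv(3,4) unfolding step by (simp add: nat_of_bits_Cons algebra_simps)
  moreover have "x div 2 = a div 2 ^ Suc k" "y div 2 = b div 2 ^ Suc k"
    unfolding inv(1,2) by (simp_all add: div_mult2_eq[symmetric] mult.commute)
  moreover have "ripple t s = (x div 2, y div 2, c', e # out)" by (simp add: ripple_def s e_def c'_def)
  ultimately show ?thesis using inv(3) by (simp add: ripple_inv_def)
qed

lemma ripple_inv_ripples: "ripple_inv t a b (length bs) (ripples t a b bs)"
proof (induction bs rule: rev_induct)
  case Nil
  show ?case by (simp add: ripple_inv_def ripples_def nat_of_bits_def)
next
  case (snoc u bs)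
  have "ripples t a b (bs @ [u]) = ripple t (ripples t a b bs)" by (simp add: ripples_def)
  then show ?case using ripple_inv_step[OF snoc] by simp
qed

text \<open>One digit more than both numbers have leaves nothing but the last carry.\<close>

definition ripple_all :: "bool \<Rightarrow> nat \<Rightarrow> nat \<Rightarrow> ripple_state" where
  "ripple_all t a b = ripples t a b (bits a @ bits b @ [True])"

lemma ripple_all_value:
  fixes a b :: nat
  defines "k \<equiv> length (bits a @ bits b @ [True])"
  shows "int (nat_of_bits (digits (ripple_all False a b))) + 2 ^ k * of_bool (carry (ripple_all False a b))
    = int a + int b"
    "int (nat_of_bits (digits (ripple_all True a b))) - 2 ^ k * of_bool (carry (ripple_all True a b)) = int a - int b"
    "length (digits (ripple_all t a b)) = k" "a + b < 2 ^ k"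
proof -
  have "(2::nat) ^ length (bits a) \<le> 2 ^ (k - 1)" "(2::nat) ^ length (bits b) \<le> 2 ^ (k - 1)"
    by (rule power_increasing; simp add: k_def)+
  moreover have "(2::nat) ^ k = 2 ^ (k - 1) + 2 ^ (k - 1)" by (simp add: k_def)
  ultimately show sum: "a + b < 2 ^ k" using less_power_length_bits[of a] less_power_length_bits[of b] by linarith
  have inv: "ripple_inv t a b k (ripple_all t a b)" for t unfolding ripple_all_def k_def by (rule ripple_inv_ripples)
  have "a div 2 ^ k = 0" "b div 2 ^ k = 0" using sum by simp_all
  then have "int (nat_of_bits (digits (ripple_all t a b))) + 2 ^ k
    * (ripple_sign t * of_bool (carry (ripple_all t a b))) =
      int a + ripple_sign t * int b" for t
    using inv[of t] by (auto simp: ripple_inv_def)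
  from this[of False] this[of True]
  show "int (nat_of_bits (digits (ripple_all False a b))) + 2 ^ k * of_bool (carry (ripple_all False a b))
    = int a + int b"
    "int (nat_of_bits (digits (ripple_all True a b))) - 2 ^ k * of_bool (carry (ripple_all True a b)) = int a - int b"
    by (simp_all add: ripple_sign_def)
  show "length (digits (ripple_all t a b)) = k" using inv[of t] by (simp add: ripple_inv_def)
qed

lemma ripple_all_add: "nat_of_bits (digits (ripple_all False a b)) = a + b"
proof -
  note out = ripple_all_value(1,4)[where a = a and b = b]
  have "\<not> carry (ripple_all False a b)"
  proof
    assume "carry (ripple_all False a b)"
    then have "2 ^ length (bits a @ bits b @ [True]) \<le> int (a + b)" using out(1) by simp
    then show False using out(2) by (metis linorder_not_less of_nat_less_iff of_nat_numeral of_nat_power)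
  qed
  then show ?thesis using out(1) by simp
qed

lemma ripple_all_sub: "(if carry (ripple_all True a b) then 0 else nat_of_bits (digits (ripple_all True a b))) = a - b"
proof -
  let ?out = "digits (ripple_all True a b)"
  note out = ripple_all_value(2)[of a b] ripple_all_value(3)[of True a b]
  have "nat_of_bits ?out < 2 ^ length (bits a @ bits b @ [True])" using nat_of_bits_less[of ?out] unfolding out(2) .
  then have "int (nat_of_bits ?out) < 2 ^ length (bits a @ bits b @ [True])"
    by (metis of_nat_less_iff of_nat_numeral of_nat_power)
  then show ?thesis using out(1) by (auto split: if_splits)
qed

lemma polytime_ripple_all:
  assumes "polytime f" "polytime g"
  shows "polytime (\<lambda>x. ripple_all t (f x) (g x))"
  unfolding ripple_all_def ripples_def
proof (rule polytime_foldl[where b = "\<lambda>x. 1 + (4 * enc_size (f x) + 1) + (1 + (4 * enc_size (g x) + 1) +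
    (1 + 3 + (1 + (enc_size (f x) + enc_size (g x) + 1) * (1 + 3))))"])
  show "polytime (\<lambda>z. ripple t (fst (snd z)))" unfolding ripple_def by (intro polytime_intros polytime_odd)
  fix x i
  let ?bs = "take i (bits (f x) @ bits (g x) @ [True])"
  obtain a b c out where s: "foldl (\<lambda>s _. ripple t s) (f x, g x, False, []) ?bs = (a, b, c, out)" by (metis surj_pair)
  have "a \<le> f x" "b \<le> g x" "length out = length ?bs"
    using ripple_inv_ripples[of t "f x" "g x" ?bs] unfolding ripples_def s by (auto simp: ripple_inv_def)
  moreover have "length ?bs \<le> length (bits (f x) @ bits (g x) @ [True])" unfolding length_take by (rule min.cobounded1)
  ultimately have "a \<le> f x" "b \<le> g x" "length out \<le> enc_size (f x) + enc_size (g x) + 1"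
    using length_bits_le_enc_size[of "f x"] length_bits_le_enc_size[of "g x"] by (simp_all add: One_nat_def)
  moreover from this(3) have "enc_size out \<le> 1 + (enc_size (f x) + enc_size (g x) + 1) * (1 + 3)"
    by (intro enc_size_list_le enc_size_bool)
  ultimately show "enc_size (foldl (\<lambda>s _. ripple t s) (f x, g x, False, []) ?bs) \<le>
    1 + (4 * enc_size (f x) + 1) + (1 + (4 * enc_size (g x) + 1) + (1 + 3 + (1 + (enc_size (f x) + enc_size (g x) + 1) * (1 + 3))))"
    unfolding s using enc_size_nat_mono[of a "f x"] enc_size_nat_mono[of b "g x"] enc_size_bool[of c] by simp
qed (intro polytime_intros assms poly_in_size_intros)+

lemma polytime_add [polytime_intros]: "polytime f \<Longrightarrow> polytime g \<Longrightarrow> polytime (\<lambda>x. f x + g x :: nat)"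
  unfolding ripple_all_add[symmetric] by (intro polytime_intros polytime_ripple_all)

lemma polytime_diff [polytime_intros]: "polytime f \<Longrightarrow> polytime g \<Longrightarrow> polytime (\<lambda>x. f x - g x :: nat)"
  unfolding ripple_all_sub[symmetric] by (intro polytime_intros polytime_ripple_all)

lemma polytime_le [polytime_intros]: "polytime f \<Longrightarrow> polytime g \<Longrightarrow> polytime (\<lambda>x. f x \<le> (g x :: nat))"
  using polytime_eq_0[OF polytime_diff, of f g] by simp

lemma polytime_less [polytime_intros]: "polytime f \<Longrightarrow> polytime g \<Longrightarrow> polytime (\<lambda>x. f x < (g x :: nat))"
  using polytime_not[OF polytime_le[of g f]] by (simp only: not_le)

lemma polytime_eq [polytime_intros]: "polytime f \<Longrightarrow> polytime g \<Longrightarrow> polytime (\<lambda>x. f x = (g x :: nat))"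
  using polytime_conj[OF polytime_le[of f g] polytime_le[of g f]] by (simp only: order_eq_iff)

lemma polytime_min [polytime_intros]: "polytime f \<Longrightarrow> polytime g \<Longrightarrow> polytime (\<lambda>x. min (f x) (g x :: nat))"
  unfolding min_def by (intro polytime_intros)

lemma polytime_member [polytime_intros]: "polytime f \<Longrightarrow> polytime xs \<Longrightarrow> polytime (\<lambda>x. (f x :: nat) \<in> set (xs x))"
proof (rule polytime_app2[of "\<lambda>a ys. a \<in> set ys"])
  have "polytime (\<lambda>z. \<exists>b\<in>set (snd z). b = (fst z :: nat))" by (intro polytime_intros)
  then show "polytime (\<lambda>z. (fst z :: nat) \<in> set (snd z))" by simp
qed

lemma foldl_double_bits: "foldl (\<lambda>s b. s + s + (if b then c else 0)) 0 (rev (bits n)) = n * (c :: nat)"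
proof -
  have "foldr (\<lambda>b s. s + s + (if b then c else 0)) (bits n) 0 = n * c"
  proof (induction n rule: bits.induct)
    case (2 n)
    have "2 * (Suc n div 2) + of_bool (odd (Suc n)) = Suc n" by (rule half_bit)
    then have "(2 * (Suc n div 2) + of_bool (odd (Suc n))) * c = Suc n * c" by presburger
    moreover have "k * c + k * c + (if b then c else 0) = (2 * k + of_bool b) * c" for k b by (auto simp: algebra_simps)
    ultimately show ?case unfolding bits.simps foldr.simps o_apply 2 by metis
  qed simp
  then show ?thesis by (simp add: foldr_conv_foldl)
qed

lemma polytime_mult [polytime_intros]:
  assumes "polytime f" "polytime g"
  shows "polytime (\<lambda>x. f x * g x :: nat)"
proof -
  have "polytime (\<lambda>x. foldl (\<lambda>s b. s + s + (if b then g x else 0)) 0 (rev (bits (f x))))"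
  proof (rule polytime_foldl_inv[where I = "\<lambda>x i s. s + g x \<le> 2 ^ i * g x" and b = "\<lambda>x. 4 * (enc_size (f x) + enc_size (g x)) + 1"])
    fix x i s assume i: "i \<le> length (rev (bits (f x)))" "s + g x \<le> 2 ^ i * g x"
    have "s < 2 ^ (i + length (bits (g x)))"
    proof (cases "g x = 0")
      case False
      have "2 ^ i * g x < 2 ^ i * 2 ^ length (bits (g x))" using less_power_length_bits by simp
      moreover have "s \<le> 2 ^ i * g x" using i(2) by linarith
      ultimately show ?thesis unfolding power_add by linarith
    qed (use i in simp)
    then have "length (bits s) \<le> i + length (bits (g x))" by (simp add: length_bits_le)
    then show "enc_size s \<le> 4 * (enc_size (f x) + enc_size (g x)) + 1"
      using enc_size_nat_le[of s] length_bits_le_enc_size[of "f x"] length_bits_le_enc_size[of "g x"] i(1) by simp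
  qed (intro polytime_intros polytime_comp[OF assms(2)] assms poly_in_size_intros | simp)+
  then show ?thesis by (simp only: foldl_double_bits)
qed

lemma polytime_sum_list [polytime_intros]:
  assumes "polytime f"
  shows "polytime (\<lambda>x. sum_list (f x :: nat list))"
proof -
  have length: "length (bits (sum_list xs)) \<le> enc_size xs" for xs :: "nat list"
  proof (induction xs)
    case (Cons a xs)
    then show ?case using length_bits_add[of a "sum_list xs"] length_bits_le_enc_size[of a] by simp
  qed simp
  have fold: "foldl (+) 0 xs = sum_list xs" for xs :: "nat list" by (induction xs rule: rev_induct) auto
  have "polytime (\<lambda>x. foldl (+) 0 (f x))"
  proof (rule polytime_foldl[where b = "\<lambda>x. 4 * enc_size (f x) + 1"])
    show "enc_size (foldl (+) 0 (take i (f x))) \<le> 4 * enc_size (f x) + 1" for x i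
      using enc_size_nat_le[of "sum_list (take i (f x))"] length[of "take i (f x)"] enc_size_take[of i "f x"]
        unfolding fold by simp
  qed (intro polytime_intros assms poly_in_size_intros)+
  then show ?thesis by (simp only: fold)
qed

lemma enc_size_nat_le_of_le: "k \<le> b \<Longrightarrow> enc_size (k::nat) \<le> 4 * b + 1"
  using enc_size_nat_le[of k] le_less_trans[OF _ less_exp[of b]] length_bits_le[of k b] by fastforce

lemma polytime_nth_default [polytime_intros]:
  fixes f :: "'e::enc \<Rightarrow> 'a::enc list"
  assumes "polytime f" "polytime g"
  shows "polytime (\<lambda>x. nth_default d (f x) (g x))"
proof -
  let ?h = "\<lambda>j (s::nat\<times>'a) a. (fst s + 1, if fst s = j then a else snd s)"
  have fold: "foldl (?h j) (0, d) xs = (length xs, nth_default d xs j)" for xs j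
    by (induction xs rule: rev_induct) (auto simp: nth_default_def nth_append)
  have "polytime (\<lambda>x. foldl (?h (g x)) (0, d) (f x))"
  proof (rule polytime_foldl[where b = "\<lambda>x. 1 + (4 * enc_size (f x) + 1) + (enc_size d + enc_size (f x))"])
    show "polytime (\<lambda>z. ?h (g (fst z)) (fst (snd z)) (snd (snd z)))"
      by (intro polytime_intros polytime_comp[OF assms(2)])
    fix x i
    have "enc_size (nth_default d (take i (f x)) (g x)) \<le> enc_size d + enc_size (f x)"
      unfolding nth_default_def using enc_size_mem[of _ "f x"] by (auto intro: trans_le_add2)
    moreover have "enc_size (length (take i (f x))) \<le> 4 * enc_size (f x) + 1"
      using length_le_enc_size[of "f x"] by (intro enc_size_nat_le_of_le) simp
    ultimately show "enc_size (foldl (?h (g x)) (0, d) (take i (f x)))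
      \<le> 1 + (4 * enc_size (f x) + 1) + (enc_size d + enc_size (f x))"
      unfolding fold by (simp only: enc_size_simps)
  qed (intro polytime_const assms poly_in_size_intros)+
  then show ?thesis using polytime_snd[of "\<lambda>x. foldl (?h (g x)) (0, d) (f x)"] by (simp add: fold)
qed

lemma polytime_upt [polytime_intros]:
  fixes f :: "'e::enc \<Rightarrow> 'a::enc list"
  assumes "polytime f"
  shows "polytime (\<lambda>x. [0..<length (f x)])"
proof -
  let ?h = "\<lambda>(s::nat\<times>nat list) a. (fst s + 1, snd s @ [fst s])"
  have fold: "foldl ?h (0, []) xs = (length xs, [0..<length xs])" for xs :: "'a list"
    by (induction xs rule: rev_induct) auto
  have "polytime (\<lambda>x. foldl ?h (0, []) (f x))"
  proof (rule polytime_foldl[where b = "\<lambda>x. 1 + (4 * enc_size (f x) + 1) + (1 + enc_size (f x) * (1 + (4 * enc_size (f x) + 1)))"])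
    fix x i
    have l: "length (take i (f x)) \<le> enc_size (f x)" using length_le_enc_size[of "f x"] by simp
    have "enc_size [0..<length (take i (f x))] \<le> 1 + enc_size (f x) * (1 + (4 * enc_size (f x) + 1))"
      by (rule enc_size_list_le) (use l in \<open>auto intro!: enc_size_nat_le_of_le\<close>)
    then show "enc_size (foldl ?h (0, []) (take i (f x)))
      \<le> 1 + (4 * enc_size (f x) + 1) + (1 + enc_size (f x) * (1 + (4 * enc_size (f x) + 1)))"
      unfolding fold using enc_size_nat_le_of_le[OF l] by (simp only: enc_size_simps)
  qed (intro polytime_intros assms poly_in_size_intros)+
  then show ?thesis using polytime_snd[of "\<lambda>x. foldl ?h (0, []) (f x)"] by (simp add: fold)
qed

definition argmin :: "'a \<Rightarrow> ('a \<Rightarrow> nat) \<Rightarrow> 'a list \<Rightarrow> 'a" where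
  "argmin d k xs = foldl (\<lambda>s a. if k a < k s then a else s) (hd_default d xs) xs"

lemma argmin_foldl:
  "foldl (\<lambda>s a. if k a < k s then a else s) s xs \<in> insert s (set xs) \<and>
   (\<forall>a\<in>insert s (set xs). k (foldl (\<lambda>s a. if k a < k s then a else s) s xs) \<le> (k a :: nat))"
  by (induction xs arbitrary: s) (auto split: if_splits, (meson order_trans not_le less_imp_le)+)

lemma argmin_in: "xs \<noteq> [] \<Longrightarrow> argmin d k xs \<in> set xs"
  and argmin_le: "a \<in> set xs \<Longrightarrow> k (argmin d k xs) \<le> k a"
  using argmin_foldl[of k "hd_default d xs" xs] unfolding argmin_def by (auto simp: hd_default_def split: list.splits)

lemma polytime_argmin [polytime_intros]:
  fixes f :: "'e::enc \<Rightarrow> 'a::enc list"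
  assumes k: "polytime (\<lambda>z. k (fst z) (snd z))" and f: "polytime f"
  shows "polytime (\<lambda>x. argmin d (k x) (f x))"
  unfolding argmin_def
proof (rule polytime_foldl[where b = "\<lambda>x. enc_size d + enc_size (f x)"])
  show "polytime (\<lambda>z. if k (fst z) (snd (snd z)) < k (fst z) (fst (snd z)) then snd (snd z) else fst (snd z))"
    by (intro polytime_intros polytime_app2[OF k])
  fix x i
  have "foldl (\<lambda>s a. if k x a < k x s then a else s) (hd_default d (f x)) (take i (f x)) \<in> insert d (set (f x))"
    using argmin_foldl[of "k x" "hd_default d (f x)" "take i (f x)"] set_take_subset[of i "f x"]
    by (auto simp: hd_default_def split: list.splits)
  then show "enc_size (foldl (\<lambda>s a. if k x a < k x s then a else s) (hd_default d (f x)) (take i (f x)))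
    \<le> enc_size d + enc_size (f x)"
    using enc_size_mem[of _ "f x"] by (auto intro: trans_le_add2)
qed (intro polytime_intros f poly_in_size_intros)+

section \<open>Input and output\<close>

definition unary :: "nat \<Rightarrow> unit list" where "unary a = replicate a ()"

lemma enc_unary: "enc (unary 0) = Leaf" "enc (unary (Suc a)) = Node Leaf (enc (unary a))"
  by (simp_all add: unary_def enc_unit_def)

lemma enc_size_unary: "enc_size (unary a) = 2 * a + 1" by (induction a) (auto simp: enc_size_def enc_unary)

definition read_sym :: "nat \<Rightarrow> com" where
  "read_sym a = Pop 0 ;; pushes (2 # tree_code (enc (unary a)))"

definition read_any_sym :: com where
  "read_any_sym = If 0 1 (read_sym 1) (If 0 2 (read_sym 2) (If 0 3 (read_sym 3) (If 0 4 (read_sym 4) (read_sym 5))))"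

definition read_input :: com where
  "read_input = Push 1 1 ;; While 0 0 read_any_sym"

lemma runs_read_sym:
  assumes "a \<le> 5"
  shows "runs (read_sym a) (stacks (a # as) m [] []) 20 (stacks as ((2 # tree_code (enc (unary a))) @ m) [] [])"
proof -
  have "length (tree_code (enc (unary a))) = 2 * a + 1" using enc_size_unary[of a]
    by (simp add: enc_size_def tree_size_def)
  moreover have "runs (Pop 0) (stacks (a # as) m [] []) 1 (stacks as m [] [])"
    using runs_Pop[of 0 "stacks (a # as) m [] []"] by simp
  from runs_Seq[OF this runs_pushes]
  have "runs (read_sym a) (stacks (a # as) m [] []) (1 + (length (2 # tree_code (enc (unary a))) + 2))
      (stacks as ((2 # tree_code (enc (unary a))) @ m) [] [])" unfolding read_sym_def .
  ultimately show ?thesis using assms by (auto elim!: runs_mono)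
qed

lemma runs_read_any_sym:
  assumes "0 < a" "a < 6"
  shows "runs read_any_sym (stacks (a # as) m [] []) 28 (stacks as ((2 # tree_code (enc (unary a))) @ m) [] [])"
proof -
  let ?s = "stacks (a # as) m [] []" and ?s' = "stacks as ((2 # tree_code (enc (unary a))) @ m) [] []"
  have read: "runs (read_sym a) ?s 20 ?s'" using runs_read_sym assms by simp
  have choice: "runs (If 0 b (read_sym b) c) ?s (T + 2) ?s'" if "20 \<le> T" "a \<noteq> b \<Longrightarrow> runs c ?s T ?s'" for b c T
    using runs_IfT[OF _ read, of 0 b] runs_IfF[of 0 ?s b c T] that by (cases "a = b") (auto simp: top_sym_def)
  have "a \<in> {1, 2, 3, 4, 5}" using assms by auto
  then have "runs read_any_sym ?s (20 + 2 + 2 + 2 + 2) ?s'"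
    unfolding read_any_sym_def by (intro choice) (use read in auto)
  then show ?thesis by simp
qed

lemma runs_read_loop:
  assumes "\<forall>a\<in>set w. 0 < a \<and> a < 6"
  shows "runs (While 0 0 read_any_sym) (stacks (rev w) (tree_code (enc (map unary v))) [] []) (30 * length w + 1)
    (stacks [] (tree_code (enc (map unary (w @ v)))) [] [])"
  using assms
proof (induction w arbitrary: v rule: rev_induct)
  case Nil
  then show ?case using runs_WhileF[of 0 "stacks [] (tree_code (enc (map unary v))) [] []" 0] by (simp add: top_sym_def)
next
  case (snoc a w)
  let ?s = "stacks (rev (w @ [a])) (tree_code (enc (map unary v))) [] []"
  let ?s' = "stacks (rev w) (tree_code (enc (map unary (a # v)))) [] []"
  have read: "runs read_any_sym ?s 28 ?s'" using runs_read_any_sym[of a "rev w"] snoc.prems by simp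
  have "top_sym 0 ?s \<noteq> 0" using snoc.prems by (simp add: top_sym_def)
  from runs_WhileT[OF this read snoc.IH[of "a # v"]] snoc.prems show ?case by (auto elim!: runs_mono)
qed

lemma runs_read_input:
  assumes "\<forall>a\<in>set w. 0 < a \<and> a < 6"
  shows "runs read_input (stacks (rev w) [] [] []) (1 + (30 * length w + 1)) (stacks [] (tree_code (enc (map unary w))) [] [])"
proof -
  have "runs (Push 1 1) (stacks (rev w) [] [] []) 1 (stacks (rev w) (tree_code (enc (map unary []))) [] [])"
    using runs_Push[of 1 1 "stacks (rev w) [] [] []"] by simp
  from runs_Seq[OF this runs_read_loop[OF assms]] show ?thesis by (simp add: read_input_def)
qed

definition write_sym :: com where
  "write_sym = Pop 1 ;; Pop 1 ;; Pop 1 ;; If 1 1 (Pop 1 ;; Push 0 1)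
     (Pop 1 ;; Pop 1 ;; If 1 1 (Pop 1 ;; Push 0 2) (Pop 1 ;; Pop 1 ;; Pop 1 ;; Push 0 3))"

definition write_output :: com where
  "write_output = While 1 1 write_sym ;; Pop 1"

lemma runs_write_sym:
  assumes "y \<in> {1, 2, 3}"
  shows "runs write_sym (stacks out (2 # tree_code (enc (unary y)) @ m) [] []) 20 (stacks (y # out) m [] [])"
proof -
  have pop: "runs (Pop 1) (stacks a (x # m) b e) 1 (stacks a m b e)" for a x m b e
    using runs_Pop[of 1 "stacks a (x # m) b e"] by simp
  have push: "runs (Push 0 x) (stacks a m b e) 1 (stacks (x # a) m b e)" for a x m b e
    using runs_Push[of 0 x "stacks a m b e"] by simp
  have code: "tree_code (enc (unary 1)) = [2, 1, 1]" "tree_code (enc (unary 2)) = [2, 1, 2, 1, 1]"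
    "tree_code (enc (unary 3)) = [2, 1, 2, 1, 2, 1, 1]"
    by (simp_all add: enc_unary numeral_2_eq_2 numeral_3_eq_3 One_nat_def)
  have top: "top_sym 1 (stacks a (x # m) b e) = x" for a x m b e by (simp add: top_sym_def)
  have inner: "top_sym 1 (stacks out (2 # m) [] []) \<noteq> 1" for m by (simp add: top)
  from assms consider "y = 1" | "y = 2" | "y = 3" by blast
  then show ?thesis
  proof cases
    assume "y = 1"
    show ?thesis unfolding write_sym_def \<open>y = 1\<close> code append.simps
      by (intro runs_mono[OF runs_Seq[OF pop runs_Seq[OF pop runs_Seq[OF pop
        runs_IfT[OF top runs_Seq[OF pop push] order_refl]]]]]) simp
  next
    assume "y = 2"
    show ?thesis unfolding write_sym_def \<open>y = 2\<close> code append.simps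
      by (intro runs_mono[OF runs_Seq[OF pop runs_Seq[OF pop runs_Seq[OF pop runs_IfF[OF inner runs_Seq[OF pop runs_Seq[OF pop
        runs_IfT[OF top runs_Seq[OF pop push] order_refl]]] order_refl]]]]]) simp
  next
    assume "y = 3"
    show ?thesis unfolding write_sym_def \<open>y = 3\<close> code append.simps
      by (intro runs_mono[OF runs_Seq[OF pop runs_Seq[OF pop runs_Seq[OF pop runs_IfF[OF inner runs_Seq[OF pop runs_Seq[OF pop
        runs_IfF[OF inner runs_Seq[OF pop runs_Seq[OF pop runs_Seq[OF pop push]]] order_refl]]] order_refl]]]]]) simp
  qed
qed

lemma runs_write_output:
  assumes "set ys \<subseteq> {1, 2, 3}"
  shows "runs write_output (stacks out (tree_code (enc (map unary ys))) [] []) (30 * length ys + 2) (stacks (rev ys @ out) [] [] [])"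
proof -
  have loop: "runs (While 1 1 write_sym) (stacks out (tree_code (enc (map unary ys))) [] []) (30 * length ys + 1)
      (stacks (rev ys @ out) [1] [] [])"
    using assms
  proof (induction ys arbitrary: out)
    case Nil
    then show ?case using runs_WhileF[of 1 "stacks out (tree_code Leaf) [] []" 1] by (simp add: top_sym_def)
  next
    case (Cons y ys)
    have "top_sym 1 (stacks out (tree_code (enc (map unary (y # ys)))) [] []) \<noteq> 1" by (simp add: top_sym_def)
    from runs_WhileT[OF this _ Cons.IH[of "y # out"], of 20] runs_write_sym[of y out
      "tree_code (enc (map unary ys))"] Cons.prems
    show ?case by (auto elim!: runs_mono)
  qed
  have "runs (Pop 1) (stacks (rev ys @ out) [1] [] []) 1 (stacks (rev ys @ out) [] [] [])"
    using runs_Pop[of 1 "stacks (rev ys @ out) [1] [] []"] by simp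
  from runs_Seq[OF loop this] show ?thesis unfolding write_output_def by (rule runs_mono) simp
qed

lemma wf_read_input: "wf_com read_input" and wf_write_output: "wf_com write_output"
proof -
  have "wf_com (read_sym a)" for a
    unfolding read_sym_def using wf_pushes[of "2 # tree_code (enc (unary a))"] set_tree_code[of "enc (unary a)"] by simp
  then show "wf_com read_input" by (simp add: read_input_def read_any_sym_def)
qed (simp add: write_output_def write_sym_def)

definition io_program :: "com \<Rightarrow> com" where
  "io_program c = read_input ;; c ;; write_output"

lemma runs_io_program:
  fixes f :: "unit list list \<Rightarrow> unit list list"
  assumes F: "realizes F f" and c: "implements_on (range (enc :: unit list list \<Rightarrow> tree)) c k F"
    and size: "\<And>x n. x \<in> range (enc :: unit list list \<Rightarrow> tree) \<Longrightarrow> tree_size x \<le> n \<Longrightarrow> tree_size (F x) \<le> (n + 2) ^ m"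
    and w: "\<forall>a\<in>set w. 0 < a \<and> a < 6" and ys: "set ys \<subseteq> {1, 2, 3}" and f: "f (map unary w) = map unary ys"
  defines "l \<equiv> 1 + length w * (1 + 11)"
  shows "runs (io_program c) (stacks (rev w) [] [] []) ((1 + (30 * length w + 1)) + ((l + 2) ^ k + (30 * (l + 2) ^ m + 2)))
    (stacks (rev ys) [] [] [])"
proof -
  note F = realizesD(2)[OF F]
  have "enc_size (map unary w) \<le> l"
    unfolding l_def by (rule enc_size_list_le) (use w in \<open>auto simp: enc_size_unary\<close>)
  then have input: "tree_size (enc (map unary w)) \<le> l" by (simp add: enc_size_def)
  have run: "runs_main c (tree_code (enc (map unary w))) ((l + 2) ^ k) (tree_code (enc (map unary ys)))"
    using implements_onD(1)[OF c _ input, of "[]"] by (simp add: F f)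
  have "length ys \<le> enc_size (map unary ys)" using length_le_enc_size[of "map unary ys"] by simp
  also have "\<dots> \<le> (l + 2) ^ m" using size[OF _ input] by (simp add: F f enc_size_def)
  finally have written: "runs write_output (stacks [] (tree_code (enc (map unary ys))) [] []) (30 * (l + 2) ^ m + 2) (stacks (rev ys) [] [] [])"
    using runs_mono[OF runs_write_output[OF ys, of "[]"]] by simp
  show ?thesis unfolding io_program_def by (rule runs_Seq[OF runs_read_input[OF w] runs_Seq[OF run written]])
qed

lemma computes_within_mono: "computes_within M w T ys \<Longrightarrow> T \<le> T' \<Longrightarrow> computes_within M w T' ys"
  unfolding computes_within_def by (meson order_trans)

theorem polytime_computes_within:
  fixes f :: "unit list list \<Rightarrow> unit list list"
  assumes "polytime f"
  shows "\<exists>M c k. wf_tm M \<and> (\<forall>w ys. (\<forall>a\<in>set w. 0 < a \<and> a < 6) \<longrightarrow> f (map unary w) = map unary ys \<longrightarrow> set ys \<subseteq> {1, 2, 3} \<longrightarrow>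
     computes_within M w (c * (length w + 2) ^ k) ys)"
proof -
  obtain F where F: "realizes F f" using assms by (rule polytimeE)
  obtain c k where c: "implements_on (range (enc :: unit list list \<Rightarrow> tree)) c k F" using realizesD(1)[OF F]
    by (rule polytime_onE)
  obtain m where m: "\<And>x n. x \<in> range (enc :: unit list list \<Rightarrow> tree) \<Longrightarrow> tree_size x \<le> n \<Longrightarrow> tree_size (F x) \<le> (n + 2) ^ m"
    using polytime_on_size[OF realizesD(1)[OF F]] by blast
  have wf: "wf_com (io_program c)" using implements_onD(2)[OF c] wf_read_input wf_write_output
    by (simp add: io_program_def)
  define l where "l n = 1 + n * (1 + 11)" for n :: nat
  define T where "T n = (1 + (30 * n + 1)) + ((l n + 2) ^ k + (30 * (l n + 2) ^ m + 2))" for n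
  have "poly_bounded (\<lambda>n. T n * (2 * (n + T n) + 3))" unfolding T_def l_def by (intro poly_bounded_intros)
  then obtain K where K: "\<And>n. T n * (2 * (n + T n) + 3) \<le> (n + 2) ^ K" unfolding poly_bounded_def by blast
  have "computes_within (tm_of (compile 0 (io_program c))) w (1 * (length w + 2) ^ K) ys"
    if w: "\<forall>a\<in>set w. 0 < a \<and> a < 6" and f: "f (map unary w) = map unary ys" and ys: "set ys \<subseteq> {1, 2, 3}" for w ys
  proof -
    have "runs (io_program c) (stacks (rev w) [] [] []) (T (length w)) (stacks (rev ys) [] [] [])"
      unfolding T_def l_def using runs_io_program[OF F c m w ys f] by simp
    then obtain t where t: "t \<le> T (length w)"
      "exec (io_program c) (stacks (rev w) [] [] []) t (stacks (rev ys) [] [] [])"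
      unfolding runs_def by blast
    have "t * (2 * (length w + t) + 3) \<le> T (length w) * (2 * (length w + T (length w)) + 3)" using t(1)
      by (intro mult_le_mono add_mono) auto
    also have "\<dots> \<le> 1 * (length w + 2) ^ K" using K[of "length w"] by simp
    finally have "t * (2 * (length w + t) + 3) \<le> 1 * (length w + 2) ^ K" .
    moreover have "computes_within (tm_of (compile 0 (io_program c))) w (t * (2 * (length w + t) + 3)) ys"
      by (rule exec_computes_within[OF wf w _ t(2)]) (use ys in auto)
    ultimately show ?thesis by (rule computes_within_mono[rotated])
  qed
  moreover have "wf_tm (tm_of (compile 0 (io_program c)))"
    by (rule wf_tm_of[OF _ wf_compile[OF wf]]) (simp add: io_program_def read_input_def)
  ultimately show ?thesis by blast
qed

declare One_nat_def [simp] add_2_eq_Suc [simp] add_2_eq_Suc' [simp]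

section \<open>Expectation over a random active set\<close>

definition expectation :: "'a set \<Rightarrow> ('a \<Rightarrow> real) \<Rightarrow> ('a set \<Rightarrow> real) \<Rightarrow> real" where
  "expectation V p f = (\<Sum>A\<in>Pow V. (\<Prod>v\<in>A. p v) * (\<Prod>v\<in>V - A. 1 - p v) * f A)"

lemma expectation_insert:
  assumes "finite V" "v \<notin> V"
  shows "expectation (insert v V) p f = p v * expectation V p (\<lambda>A. f (insert v A)) + (1 - p v) * expectation V p f"
proof -
  have inj: "inj_on (insert v) (Pow V)" using assms(2) by (auto simp: inj_on_def)
  have disj: "Pow V \<inter> insert v ` Pow V = {}" using assms(2) by auto
  have "expectation (insert v V) p f = (\<Sum>A\<in>Pow V. (\<Prod>u\<in>A. p u) * (\<Prod>u\<in>insert v V - A. 1 - p u) * f A) +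
      (\<Sum>A\<in>Pow V. (\<Prod>u\<in>insert v A. p u) * (\<Prod>u\<in>insert v V - insert v A. 1 - p u) * f (insert v A))"
    unfolding expectation_def Pow_insert using assms disj by (simp add: sum.union_disjoint sum.reindex[OF inj])
  also have "(\<Sum>A\<in>Pow V. (\<Prod>u\<in>A. p u) * (\<Prod>u\<in>insert v V - A. 1 - p u) * f A) = (1 - p v) * expectation V p f"
    unfolding expectation_def sum_distrib_left
  proof (rule sum.cong[OF refl])
    fix A assume "A \<in> Pow V"
    then have "insert v V - A = insert v (V - A)" "v \<notin> V - A" "finite (V - A)" using assms by auto
    then show "(\<Prod>u\<in>A. p u) * (\<Prod>u\<in>insert v V - A. 1 - p u) * f A
      = (1 - p v) * ((\<Prod>u\<in>A. p u) * (\<Prod>u\<in>V - A. 1 - p u) * f A)" by simp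
  qed
  also have "(\<Sum>A\<in>Pow V. (\<Prod>u\<in>insert v A. p u) * (\<Prod>u\<in>insert v V - insert v A. 1 - p u) * f (insert v A))
    = p v * expectation V p (\<lambda>A. f (insert v A))"
    unfolding expectation_def sum_distrib_left
  proof (rule sum.cong[OF refl])
    fix A assume "A \<in> Pow V"
    then have "insert v V - insert v A = V - A" "v \<notin> A" "finite A" using assms finite_subset by auto
    then show "(\<Prod>u\<in>insert v A. p u) * (\<Prod>u\<in>insert v V - insert v A. 1 - p u) * f (insert v A)
      = p v * ((\<Prod>u\<in>A. p u) * (\<Prod>u\<in>V - A. 1 - p u) * f (insert v A))" by simp
  qed
  finally show ?thesis by simp
qed

lemma expectation_add: "expectation V p (\<lambda>A. f A + g A) = expectation V p f + expectation V p g"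
  by (simp add: expectation_def sum.distrib algebra_simps)

lemma expectation_cmult: "expectation V p (\<lambda>A. c * f A) = c * expectation V p f"
  by (simp add: expectation_def sum_distrib_left algebra_simps)

lemma expectation_diff: "expectation V p (\<lambda>A. f A - g A) = expectation V p f - expectation V p g"
  using expectation_add[of V p f "\<lambda>A. -1 * g A"] expectation_cmult[of V p "-1" g] by simp

lemma expectation_const: "finite V \<Longrightarrow> expectation V p (\<lambda>A. c) = c"
proof (induction V rule: finite_induct)
  case empty
  show ?case by (simp add: expectation_def)
next
  case (insert v V)
  then show ?case by (simp add: expectation_insert algebra_simps)
qed

lemma expectation_sum: "finite V \<Longrightarrow> expectation V p (\<lambda>A. \<Sum>i\<in>I. f i A) = (\<Sum>i\<in>I. expectation V p (f i))"
  by (induction I rule: infinite_finite_induct) (auto simp: expectation_add expectation_const)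

lemma expectation_mono:
  assumes "\<And>v. v \<in> V \<Longrightarrow> 0 \<le> p v \<and> p v \<le> 1" "\<And>A. A \<subseteq> V \<Longrightarrow> f A \<le> g A"
  shows "expectation V p f \<le> expectation V p g"
  unfolding expectation_def
proof (intro sum_mono mult_left_mono)
  fix A assume "A \<in> Pow V"
  then show "f A \<le> g A" using assms by auto
  show "0 \<le> (\<Prod>v\<in>A. p v) * (\<Prod>v\<in>V - A. 1 - p v)"
    using assms(1) \<open>A \<in> Pow V\<close> by (intro mult_nonneg_nonneg prod_nonneg) auto
qed

lemma expectation_indicator:
  assumes "finite V" "v \<in> V"
  shows "expectation V p (\<lambda>A. of_bool (v \<in> A) * f A) = p v * expectation V p (\<lambda>A. f (insert v A))"
proof -
  have "V = insert v (V - {v})" using assms by auto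
  have fin: "finite (V - {v})" "v \<notin> V - {v}" using assms by auto
  have "expectation (V - {v}) p (\<lambda>A. of_bool (v \<in> A) * f A) = expectation (V - {v}) p (\<lambda>A. 0)"
    unfolding expectation_def by (rule sum.cong) auto
  then have "expectation (insert v (V - {v})) p (\<lambda>A. of_bool (v \<in> A) * f A)
    = p v * expectation (V - {v}) p (\<lambda>A. f (insert v A))"
    unfolding expectation_insert[OF fin] by (simp add: expectation_const[OF fin(1)])
  moreover have "expectation (insert v (V - {v})) p (\<lambda>A. f (insert v A)) = expectation (V - {v}) p (\<lambda>A. f (insert v A))"
    unfolding expectation_insert[OF fin] by (simp add: algebra_simps)
  ultimately show ?thesis using \<open>V = insert v (V - {v})\<close> by metis
qed

section \<open>Lengths of paths\<close>

fun walk_len :: "('a \<Rightarrow> 'a \<Rightarrow> real) \<Rightarrow> 'a list \<Rightarrow> real" where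
  "walk_len d (x # y # zs) = d x y + walk_len d (y # zs)"
| "walk_len d _ = 0"

lemma walk_len_append: "walk_len d (xs @ a # ys) = walk_len d (xs @ [a]) + walk_len d (a # ys)"
  by (induction d xs rule: walk_len.induct) auto

lemma path_len_eq_walk_len: "path_len d xs = walk_len (\<lambda>i j. real_of_rat (d i j)) xs"
proof (induction "\<lambda>i j. real_of_rat (d i j)" xs rule: walk_len.induct)
  case (1 x y zs)
  then show ?case by (simp add: path_len_def sum.lessThan_Suc_shift del: sum.lessThan_Suc)
qed (auto simp: path_len_def)

lemma walk_len_scale: "walk_len (\<lambda>i j. c * d i j) xs = c * walk_len d xs"
  by (induction d xs rule: walk_len.induct) (auto simp: algebra_simps)

lemma walk_len_cong: "(\<And>x y. x \<in> set xs \<Longrightarrow> y \<in> set xs \<Longrightarrow> d x y = d' x y) \<Longrightarrow> walk_len d xs = walk_len d' xs"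
  by (induction d xs rule: walk_len.induct) auto

definition expected_latency :: "nat \<Rightarrow> nat \<Rightarrow> (nat \<Rightarrow> nat \<Rightarrow> real) \<Rightarrow> (nat \<Rightarrow> real) \<Rightarrow> nat list \<Rightarrow> real" where
  "expected_latency n r d p xs = (\<Sum>i<length xs. p (xs ! i) *
     expectation {..<n} p (\<lambda>A. walk_len d (r # filter (\<lambda>v. v \<in> insert (xs ! i) A) (take (Suc i) xs))))"

lemma latency_eq:
  "latency d (r # xs) A = (\<Sum>i<length xs. of_bool (xs ! i \<in> A) * path_len d (r # filter (\<lambda>v. v \<in> A) (take (Suc i) xs)))"
proof (induction xs rule: rev_induct)
  case Nil
  show ?case by (simp add: latency_def shortcut_def)
next
  case (snoc x xs)
  let ?active = "filter (\<lambda>v. v \<in> A) xs"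
  have "(\<Sum>i<length (xs @ [x]). of_bool ((xs @ [x]) ! i \<in> A) * path_len d (r # filter (\<lambda>v. v \<in> A) (take (Suc i) (xs @ [x])))) =
    (\<Sum>i<length xs. of_bool (xs ! i \<in> A) * path_len d (r # filter (\<lambda>v. v \<in> A) (take (Suc i) xs))) +
     of_bool (x \<in> A) * path_len d (r # filter (\<lambda>v. v \<in> A) (xs @ [x]))"
    by (simp add: nth_append)
  also have "\<dots> = latency d (r # (xs @ [x])) A"
  proof (cases "x \<in> A")
    case True
    have "{1..<length (r # ?active @ [x])} = insert (Suc (length ?active)) {1..<length (r # ?active)}" by auto
    then have "latency d (r # (xs @ [x])) A
      = path_len d (r # ?active @ [x]) +
      (\<Sum>k\<in>{1..<length (r # ?active)}. path_len d (take (Suc k) (r # ?active @ [x])))"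
      using True by (simp add: latency_def shortcut_def)
    also have "(\<Sum>k\<in>{1..<length (r # ?active)}. path_len d (take (Suc k) (r # ?active @ [x]))) = latency d (r # xs) A"
      unfolding latency_def shortcut_def Let_def by (intro sum.cong) auto
    finally show ?thesis using True snoc by simp
  qed (use snoc in \<open>simp add: latency_def shortcut_def\<close>)
  finally show ?case by simp
qed

lemma exp_latency_eq_expected_latency:
  assumes "set xs \<subseteq> {..<n}"
  shows "exp_latency n d p (r # xs) = expected_latency n r (\<lambda>i j. real_of_rat (d i j)) (\<lambda>v. real_of_rat (p v)) xs"
proof -
  have "exp_latency n d p (r # xs)
    = expectation {..<n} (\<lambda>v. real_of_rat (p v)) (\<lambda>A. \<Sum>i<length xs. of_bool (xs ! i \<in> A) *
      walk_len (\<lambda>i j. real_of_rat (d i j)) (r # filter (\<lambda>v. v \<in> A) (take (Suc i) xs)))"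
    by (simp add: exp_latency_def expectation_def latency_eq path_len_eq_walk_len)
  also have "\<dots> = expected_latency n r (\<lambda>i j. real_of_rat (d i j)) (\<lambda>v. real_of_rat (p v)) xs"
    unfolding expected_latency_def
      by (subst expectation_sum, simp, intro sum.cong refl, subst expectation_indicator)
      (use assms nth_mem in auto)
  finally show ?thesis .
qed

lemma expected_latency_scale:
  assumes "set xs \<subseteq> {..<n}" "r < n" "\<And>i j. i < n \<Longrightarrow> j < n \<Longrightarrow> d' i j = c * d i j" "\<And>i. i < n \<Longrightarrow> p' i = p i"
  shows "expected_latency n r d' p' xs = c * expected_latency n r d p xs"
proof -
  have scaled: "walk_len d' (r # filter Q (take k xs)) = c * walk_len d (r # filter Q (take k xs))" for Q k
  proof -
    have "set (r # filter Q (take k xs)) \<subseteq> {..<n}" using assms set_take_subset[of k xs] by auto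
    then show ?thesis unfolding walk_len_scale[symmetric] by (intro walk_len_cong assms(3)) auto
  qed
  have "expectation {..<n} p' f = expectation {..<n} p f" for f
    unfolding expectation_def using assms(4)
      by (intro sum.cong refl) (auto intro!: prod.cong arg_cong2[where f = "(*)"])
  moreover have "p' (xs ! i) = p (xs ! i)" if "i < length xs" for i
    using assms(1,4) nth_mem[OF that] by blast
  ultimately show ?thesis unfolding expected_latency_def sum_distrib_left scaled expectation_cmult
    by (intro sum.cong) (auto simp: algebra_simps)
qed

lemma subseq_filter_mono: "(\<And>v. v \<in> set xs \<Longrightarrow> P v \<Longrightarrow> Q v) \<Longrightarrow> subseq (filter P xs) (filter Q xs)"
  by (induction xs) auto

lemma walk_len_ge_sum:
  assumes "distinct (x # zs)" and "\<And>v u. v \<in> set zs \<Longrightarrow> u \<in> set (x # zs) \<Longrightarrow> u \<noteq> v \<Longrightarrow> g v \<le> d u v"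
  shows "(\<Sum>v\<in>set zs. g v) \<le> walk_len d (x # zs)"
  using assms
proof (induction zs arbitrary: x)
  case (Cons y zs)
  have "(\<Sum>v\<in>set zs. g v) \<le> walk_len d (y # zs)" by (rule Cons.IH) (use Cons.prems in auto)
  moreover have "g y \<le> d x y" using Cons.prems by auto
  ultimately show ?case using Cons.prems by (simp add: add_mono)
qed simp

locale apriori =
  fixes n r :: nat and d :: "nat \<Rightarrow> nat \<Rightarrow> real" and p :: "nat \<Rightarrow> real"
  assumes r: "r < n"
    and nonneg: "\<And>i j. i < n \<Longrightarrow> j < n \<Longrightarrow> 0 \<le> d i j"
    and sym: "\<And>i j. i < n \<Longrightarrow> j < n \<Longrightarrow> d i j = d j i"
    and refl: "\<And>i. i < n \<Longrightarrow> d i i = 0"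
    and tri: "\<And>i j k. i < n \<Longrightarrow> j < n \<Longrightarrow> k < n \<Longrightarrow> d i k \<le> d i j + d j k"
    and prob: "\<And>i. i < n \<Longrightarrow> 0 \<le> p i \<and> p i \<le> 1"
begin

abbreviation "E \<equiv> expectation {..<n} p"

lemma E_mono: "(\<And>A. A \<subseteq> {..<n} \<Longrightarrow> f A \<le> g A) \<Longrightarrow> E f \<le> E g"
  by (rule expectation_mono) (auto simp: prob)

lemma walk_len_nonneg: "set xs \<subseteq> {..<n} \<Longrightarrow> 0 \<le> walk_len d xs"
  by (induction xs rule: induct_list012) (auto simp: nonneg)

lemma walk_len_drop_second: "set (x # y # xs) \<subseteq> {..<n} \<Longrightarrow> walk_len d (x # xs) \<le> walk_len d (x # y # xs)"
  by (cases xs) (auto simp: nonneg, smt (verit) tri)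

lemma walk_len_subseq_Cons: "subseq xs ys \<Longrightarrow> set ys \<subseteq> {..<n} \<Longrightarrow> x < n \<Longrightarrow> walk_len d (x # xs) \<le> walk_len d (x # ys)"
proof (induction xs ys arbitrary: x rule: list_emb.induct)
  case (list_emb_Nil ys)
  then show ?case using walk_len_nonneg[of "x # ys"] by simp
next
  case (list_emb_Cons xs ys y)
  then show ?case using walk_len_drop_second[of x y ys] by fastforce
next
  case (list_emb_Cons2 a b xs ys)
  then show ?case by auto
qed

lemma subset_take: "set xs \<subseteq> {..<n} \<Longrightarrow> set (take k xs) \<subseteq> {..<n}"
  using set_take_subset by fast

definition prefix_cost :: "nat list \<Rightarrow> nat \<Rightarrow> real" where
  "prefix_cost xs k = E (\<lambda>A. walk_len d (r # filter (\<lambda>v. v \<in> A) (take k xs)))"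

lemma prefix_cost_0: "prefix_cost xs 0 = 0" by (simp add: prefix_cost_def expectation_const)

lemma prefix_cost_mono:
  assumes "set xs \<subseteq> {..<n}" "k \<le> l"
  shows "prefix_cost xs k \<le> prefix_cost xs l"
  unfolding prefix_cost_def
proof (rule E_mono)
  fix A
  have "prefix (take k xs) (take l xs)" using assms(2) by (metis min.absorb1 take_is_prefix take_take)
  then show "walk_len d (r # filter (\<lambda>v. v \<in> A) (take k xs)) \<le> walk_len d (r # filter (\<lambda>v. v \<in> A) (take l xs))"
    using subset_take[OF assms(1), of l] r by (intro walk_len_subseq_Cons) (auto intro: subseq_filter prefix_imp_subseq)
qed

lemma expected_latency_ge_prefix_costs:
  assumes "set xs \<subseteq> {..<n}"
  shows "(\<Sum>i<length xs. p (xs ! i) * prefix_cost xs (Suc i)) \<le> expected_latency n r d p xs"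
  unfolding expected_latency_def prefix_cost_def
proof (intro sum_mono mult_left_mono E_mono)
  fix i A assume "i \<in> {..<length xs}"
  then show "0 \<le> p (xs ! i)" using assms prob nth_mem by blast
  show "walk_len d (r # filter (\<lambda>v. v \<in> A) (take (Suc i) xs))
    \<le> walk_len d (r # filter (\<lambda>v. v \<in> insert (xs ! i) A) (take (Suc i) xs))"
    using subset_take[OF assms, of "Suc i"] r by (intro walk_len_subseq_Cons subseq_filter_mono) auto
qed

lemma expected_latency_ge_dists:
  assumes "set xs \<subseteq> {..<n}"
  shows "(\<Sum>i<length xs. p (xs ! i) * d r (xs ! i)) \<le> expected_latency n r d p xs"
  unfolding expected_latency_def
proof (intro sum_mono mult_left_mono)
  fix i assume i: "i \<in> {..<length xs}"
  then show "0 \<le> p (xs ! i)" using assms prob nth_mem by blast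
  have "d r (xs ! i) = E (\<lambda>A. walk_len d [r, xs ! i])" by (simp add: expectation_const)
  also have "\<dots> \<le> E (\<lambda>A. walk_len d (r # filter (\<lambda>v. v \<in> insert (xs ! i) A) (take (Suc i) xs)))"
  proof (rule E_mono, rule walk_len_subseq_Cons)
    fix A
    have "xs ! i \<in> set (filter (\<lambda>v. v \<in> insert (xs ! i) A) (take (Suc i) xs))"
      using i by (simp add: take_Suc_conv_app_nth)
    then show "subseq [xs ! i] (filter (\<lambda>v. v \<in> insert (xs ! i) A) (take (Suc i) xs))"
      by (simp add: subseq_singleton_left)
  qed (use r subset_take[OF assms, of "Suc i"] in auto)
  finally show "d r (xs ! i) \<le> E (\<lambda>A. walk_len d (r # filter (\<lambda>v. v \<in> insert (xs ! i) A) (take (Suc i) xs)))" .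
qed

lemma E_indicator: "v < n \<Longrightarrow> E (\<lambda>A. of_bool (v \<in> A)) = p v"
  using expectation_indicator[of "{..<n}" v p "\<lambda>_. 1"] by (simp add: expectation_const)

lemma E_sum_indicator:
  assumes "S \<subseteq> {..<n}"
  shows "E (\<lambda>A. \<Sum>v\<in>S. of_bool (v \<in> A) * f v) = (\<Sum>v\<in>S. p v * f v)"
  by (subst expectation_sum) (use assms in \<open>auto simp: expectation_indicator expectation_const intro!: sum.cong\<close>)

lemma E_indicator2:
  "v < n \<Longrightarrow> u < n \<Longrightarrow> E (\<lambda>A. of_bool (v \<in> A) * of_bool (u \<in> A)) = (if u = v then p v else p v * p u)"
  using expectation_indicator[of "{..<n}" v p "\<lambda>A. of_bool (u \<in> A)"] by (simp add: E_indicator expectation_const)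

definition punctured_ball :: "nat \<Rightarrow> real \<Rightarrow> nat set" where
  "punctured_ball v \<rho> = {u. u < n \<and> u \<noteq> v \<and> d u v < \<rho>}"

lemma walk_len_ge_isolated:
  assumes zs: "distinct (r # zs)" "set zs \<subseteq> {..<n}" "set zs \<subseteq> A"
    and R: "\<And>v. v < n \<Longrightarrow> 0 \<le> R v" "\<And>v. v < n \<Longrightarrow> R v \<le> d r v"
  shows "(\<Sum>v\<in>set zs. (1 - (\<Sum>u\<in>punctured_ball v (R v). of_bool (u \<in> A))) * R v) \<le> walk_len d (r # zs)"
proof (rule walk_len_ge_sum[OF zs(1)])
  fix v u assume vu: "v \<in> set zs" "u \<in> set (r # zs)" "u \<noteq> v"
  then have v: "v < n" "u < n" using zs r by auto
  let ?B = "punctured_ball v (R v)"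
  show "(1 - (\<Sum>u\<in>?B. of_bool (u \<in> A))) * R v \<le> d u v"
  proof (cases "d u v < R v")
    case True
    then have "u \<noteq> r" using R(2)[OF v(1)] by auto
    then have "u \<in> ?B" "u \<in> A" using True vu v zs by (auto simp: punctured_ball_def)
    then have "1 \<le> (\<Sum>u\<in>?B. of_bool (u \<in> A) :: real)"
      using member_le_sum[of u ?B "\<lambda>u. of_bool (u \<in> A) :: real"] by (simp add: punctured_ball_def)
    then have "(1 - (\<Sum>u\<in>?B. of_bool (u \<in> A))) * R v \<le> 0" using R(1)[OF v(1)] by (intro mult_nonpos_nonneg) auto
    then show ?thesis using nonneg[OF v(2,1)] by linarith
  next
    case False
    have "0 \<le> (\<Sum>u\<in>?B. of_bool (u \<in> A) :: real)" by (rule sum_nonneg) auto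
    then have "(1 - (\<Sum>u\<in>?B. of_bool (u \<in> A))) * R v \<le> 1 * R v" using R(1)[OF v(1)] by (intro mult_right_mono) auto
    then show ?thesis using False by simp
  qed
qed

lemma E_isolated:
  assumes "v < n"
  shows "E (\<lambda>A. of_bool (v \<in> A) * ((1 - (\<Sum>u\<in>punctured_ball v \<rho>. of_bool (u \<in> A))) * \<rho>)) =
    p v * ((1 - (\<Sum>u\<in>punctured_ball v \<rho>. p u)) * \<rho>)"
proof -
  let ?B = "punctured_ball v \<rho>"
  have "E (\<lambda>A. of_bool (v \<in> A) * ((1 - (\<Sum>u\<in>?B. of_bool (u \<in> A))) * \<rho>)) =
      E (\<lambda>A. \<rho> * (of_bool (v \<in> A) - (\<Sum>u\<in>?B. of_bool (v \<in> A) * of_bool (u \<in> A))))"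
    by (simp add: algebra_simps sum_distrib_left)
  also have "\<dots> = \<rho> * (p v - (\<Sum>u\<in>?B. p v * p u))"
    unfolding expectation_cmult expectation_diff
    by (subst expectation_sum) (use assms in \<open>auto simp: E_indicator E_indicator2 punctured_ball_def intro!: sum.cong\<close>)
  finally show ?thesis by (simp add: algebra_simps sum_distrib_left)
qed

text \<open>An active vertex \<open>v\<close> pays at least \<open>R v\<close> unless some other vertex of its open ball is active.\<close>

lemma prefix_cost_ge_radius:
  assumes xs: "set xs \<subseteq> {..<n} - {r}" "distinct xs"
    and R: "\<And>v. v < n \<Longrightarrow> 0 \<le> R v" "\<And>v. v < n \<Longrightarrow> R v \<le> d r v"
    and light: "\<And>v. v < n \<Longrightarrow> v \<noteq> r \<Longrightarrow> (\<Sum>u\<in>punctured_ball v (R v). p u) \<le> 1 / 2"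
  shows "(\<Sum>v\<in>set (take k xs). p v * R v) \<le> 2 * prefix_cost xs k"
proof -
  let ?S = "set (take k xs)"
  let ?g = "\<lambda>v A. (1 - (\<Sum>u\<in>punctured_ball v (R v). of_bool (u \<in> A))) * R v"
  have S: "?S \<subseteq> {..<n} - {r}" using xs set_take_subset by fast
  have pointwise: "(\<Sum>v\<in>?S. of_bool (v \<in> A) * ?g v A) \<le> walk_len d (r # filter (\<lambda>v. v \<in> A) (take k xs))" for A
  proof -
    have "(\<Sum>v\<in>?S. of_bool (v \<in> A) * ?g v A) = (\<Sum>v\<in>?S. if v \<in> A then ?g v A else 0)"
      by (intro sum.cong) auto
    also have "\<dots> = (\<Sum>v\<in>set (filter (\<lambda>v. v \<in> A) (take k xs)). ?g v A)"
      by (simp add: sum.If_cases Int_def Collect_conj_eq[symmetric])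
    also have "\<dots> \<le> walk_len d (r # filter (\<lambda>v. v \<in> A) (take k xs))"
      by (rule walk_len_ge_isolated) (use xs S R set_take_subset in auto)
    finally show ?thesis .
  qed
  have "(\<Sum>v\<in>?S. p v * R v) / 2 = (\<Sum>v\<in>?S. p v * (1 / 2 * R v))" by (simp add: sum_divide_distrib)
  also have "\<dots> \<le> (\<Sum>v\<in>?S. p v * ((1 - (\<Sum>u\<in>punctured_ball v (R v). p u)) * R v))"
  proof (intro sum_mono mult_left_mono mult_right_mono)
    fix v assume "v \<in> ?S"
    then have v: "v < n" "v \<noteq> r" using S by auto
    show "1 / 2 \<le> 1 - (\<Sum>u\<in>punctured_ball v (R v). p u)" using light[OF v] by simp
    show "0 \<le> p v" "0 \<le> R v" using prob R(1) v by simp_all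
  qed
  also have "\<dots> = E (\<lambda>A. \<Sum>v\<in>?S. of_bool (v \<in> A) * ?g v A)"
    by (subst expectation_sum) (use S in \<open>auto intro!: sum.cong E_isolated[symmetric]\<close>)
  also have "\<dots> \<le> prefix_cost xs k" unfolding prefix_cost_def by (rule E_mono) (rule pointwise)
  finally show ?thesis by simp
qed

lemma E_card_squared_le:
  assumes "Z \<subseteq> {..<n}"
  defines "s \<equiv> \<Sum>u\<in>Z. p u"
  shows "E (\<lambda>A. (\<Sum>u\<in>Z. of_bool (u \<in> A))\<^sup>2) \<le> s * (1 + s)"
proof -
  have fin: "finite Z" using assms finite_subset by blast
  have "E (\<lambda>A. (\<Sum>u\<in>Z. of_bool (u \<in> A))\<^sup>2) = (\<Sum>u\<in>Z. \<Sum>v\<in>Z. E (\<lambda>A. of_bool (u \<in> A) * of_bool (v \<in> A)))"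
    by (simp add: power2_eq_square sum_product expectation_sum)
  also have "\<dots> \<le> (\<Sum>u\<in>Z. p u + p u * s)"
  proof (rule sum_mono)
    fix u assume u: "u \<in> Z"
    have "(\<Sum>v\<in>Z. E (\<lambda>A. of_bool (u \<in> A) * of_bool (v \<in> A))) = (\<Sum>v\<in>Z. if v = u then p u else p u * p v)"
    proof (rule sum.cong)
      fix v assume "v \<in> Z"
      then have "u < n" "v < n" using assms(1) u by auto
      then show "E (\<lambda>A. of_bool (u \<in> A) * of_bool (v \<in> A)) = (if v = u then p u else p u * p v)"
        by (rule E_indicator2)
    qed simp
    also have "\<dots> \<le> (\<Sum>v\<in>Z. (if v = u then p u else 0) + p u * p v)"
      by (intro sum_mono) (use assms u prob in \<open>auto intro!: mult_nonneg_nonneg\<close>)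
    also have "\<dots> = p u + p u * s" using u fin by (simp add: sum.distrib s_def sum_distrib_left)
    finally show "(\<Sum>v\<in>Z. E (\<lambda>A. of_bool (u \<in> A) * of_bool (v \<in> A))) \<le> p u + p u * s" .
  qed
  also have "\<dots> = s * (1 + s)" by (simp add: sum.distrib s_def sum_distrib_right algebra_simps)
  finally show ?thesis .
qed

text \<open>Second moment bound from \<open>1[X > 0] \<ge> 2X/m - X\<^sup>2/m\<^sup>2\<close> with \<open>m = 1 + s\<close>.\<close>

lemma hit_probability:
  assumes Z: "Z \<subseteq> {..<n}"
  shows "(\<Sum>u\<in>Z. p u) / (1 + (\<Sum>u\<in>Z. p u)) \<le> E (\<lambda>A. of_bool (A \<inter> Z \<noteq> {}))"
proof -
  define s m where "s = (\<Sum>u\<in>Z. p u)" and "m = 1 + s"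
  let ?X = "\<lambda>A. \<Sum>u\<in>Z. of_bool (u \<in> A) :: real"
  have "0 \<le> s" unfolding s_def using prob Z by (intro sum_nonneg) auto
  then have m: "0 < m" by (simp add: m_def)
  have mean: "E ?X = s" using E_sum_indicator[OF Z, of "\<lambda>_. 1"] by (simp add: s_def)
  have "s / m = 2 / m * s - 1 / m\<^sup>2 * (s * m)" using m by (simp add: field_simps power2_eq_square)
  also have "\<dots> \<le> 2 / m * E ?X - 1 / m\<^sup>2 * E (\<lambda>A. (?X A)\<^sup>2)"
    unfolding mean using E_card_squared_le[OF Z] by (intro diff_left_mono mult_left_mono) (auto simp: m_def s_def)
  also have "\<dots> = E (\<lambda>A. 2 / m * ?X A - 1 / m\<^sup>2 * (?X A)\<^sup>2)" by (simp only: expectation_diff expectation_cmult)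
  also have "\<dots> \<le> E (\<lambda>A. of_bool (A \<inter> Z \<noteq> {}))"
  proof (rule E_mono)
    fix A
    show "2 / m * ?X A - 1 / m\<^sup>2 * (?X A)\<^sup>2 \<le> of_bool (A \<inter> Z \<noteq> {})"
    proof (cases "A \<inter> Z = {}")
      case True
      then have "?X A = 0" by (auto intro!: sum.neutral)
      then show ?thesis by simp
    next
      case False
      have "2 / m * x - 1 / m\<^sup>2 * x\<^sup>2 = 1 - (1 - x / m)\<^sup>2" for x using m by (simp add: field_simps power2_eq_square)
      then show ?thesis using False by (simp only:) simp
    qed
  qed
  finally show ?thesis by (simp add: m_def s_def)
qed

lemma walk_len_map_bounds:
  assumes "set (x # zs) \<subseteq> {..<n}" "\<And>v. v \<in> set (x # zs) \<Longrightarrow> c v < n"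
  shows "walk_len d (map c (x # zs)) \<le> walk_len d (x # zs) + 2 * (\<Sum>v\<leftarrow>zs. d v (c v)) + d x (c x) \<and>
    walk_len d (x # zs) \<le> walk_len d (map c (x # zs)) + 2 * (\<Sum>v\<leftarrow>zs. d v (c v)) + d x (c x)"
  using assms
proof (induction zs arbitrary: x)
  case Nil
  then show ?case using nonneg by simp
next
  case (Cons z zs)
  have bounds: "x < n" "z < n" "c x < n" "c z < n" using Cons.prems by auto
  have IH: "walk_len d (map c (z # zs)) \<le> walk_len d (z # zs) + 2 * (\<Sum>v\<leftarrow>zs. d v (c v)) + d z (c z)"
    "walk_len d (z # zs) \<le> walk_len d (map c (z # zs)) + 2 * (\<Sum>v\<leftarrow>zs. d v (c v)) + d z (c z)"
    using Cons.IH[of z] Cons.prems by auto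
  have "d (c x) (c z) \<le> d x (c x) + d x z + d z (c z)"
    using tri[OF bounds(3,1,4)] tri[OF bounds(1,2,4)] sym[OF bounds(3,1)] by linarith
  moreover have "d x z \<le> d x (c x) + d (c x) (c z) + d z (c z)"
    using tri[OF bounds(1,3,2)] tri[OF bounds(3,4,2)] sym[OF bounds(4,2)] by linarith
  ultimately show ?case using IH by simp
qed

lemma walk_len_map_le:
  assumes "set zs \<subseteq> {..<n}" "\<And>v. v < n \<Longrightarrow> c v < n" "c r = r"
  shows "walk_len d (r # map c zs) \<le> walk_len d (r # zs) + 2 * (\<Sum>v\<leftarrow>zs. d v (c v))"
    "walk_len d (r # zs) \<le> walk_len d (r # map c zs) + 2 * (\<Sum>v\<leftarrow>zs. d v (c v))"
  using walk_len_map_bounds[of r zs c] assms r refl[of r] by auto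

end

section \<open>Dual solutions of the prize-collecting tree problem\<close>

definition moat_sum :: "nat \<Rightarrow> (nat set \<Rightarrow> bool) \<Rightarrow> (nat set \<Rightarrow> 'a) \<Rightarrow> 'a::semiring_1" where
  "moat_sum n P y = (\<Sum>X\<in>Pow {..<n}. of_bool (P X) * y X)"

definition separates :: "nat \<Rightarrow> nat \<Rightarrow> nat set \<Rightarrow> bool" where
  "separates a b X \<longleftrightarrow> (a \<in> X) \<noteq> (b \<in> X)"

definition feasible_dual :: "nat \<Rightarrow> nat \<Rightarrow> (nat \<Rightarrow> nat \<Rightarrow> 'a) \<Rightarrow> (nat \<Rightarrow> 'a) \<Rightarrow>
  (nat set \<Rightarrow> 'a::linordered_semidom) \<Rightarrow> bool" where
  "feasible_dual n r d z y \<longleftrightarrow> (\<forall>X. 0 \<le> y X) \<and> (\<forall>X. 0 < y X \<longrightarrow> r \<notin> X) \<and>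
     (\<forall>a<n. \<forall>b<n. moat_sum n (separates a b) y \<le> d a b) \<and>
     (\<forall>U\<subseteq>{..<n}. moat_sum n (\<lambda>X. X \<subseteq> U) y \<le> (\<Sum>u\<in>U. z u))"

abbreviation dual_value :: "nat \<Rightarrow> (nat set \<Rightarrow> 'a) \<Rightarrow> 'a::semiring_1" where
  "dual_value n \<equiv> moat_sum n (\<lambda>_. True)"

lemma feasible_dualD:
  assumes "feasible_dual n r d z y"
  shows "0 \<le> y X" "0 < y X \<Longrightarrow> r \<notin> X" "a < n \<Longrightarrow> b < n \<Longrightarrow> moat_sum n (separates a b) y \<le> d a b"
    "U \<subseteq> {..<n} \<Longrightarrow> moat_sum n (\<lambda>X. X \<subseteq> U) y \<le> (\<Sum>u\<in>U. z u)"
  using assms unfolding feasible_dual_def by blast+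

lemma dual_value_le_prizes:
  assumes "feasible_dual n r d z y"
  shows "dual_value n y \<le> (\<Sum>u<n. z u)"
proof -
  have "dual_value n y = moat_sum n (\<lambda>X. X \<subseteq> {..<n}) y" unfolding moat_sum_def by (rule sum.cong) auto
  then show ?thesis using feasible_dualD(4)[OF assms, of "{..<n}"] by simp
qed

context apriori
begin

lemma walk_len_ge_moats:
  assumes y: "feasible_dual n r d z y" and H: "H \<subseteq> Pow {..<n}" and "set (x # zs) \<subseteq> {..<n}"
  shows "(\<Sum>X\<in>H. of_bool (x \<notin> X \<and> (\<exists>v\<in>set zs. v \<in> X)) * y X) \<le> walk_len d (x # zs)"
  using assms(3)
proof (induction zs arbitrary: x)
  case (Cons v zs)
  have "(\<Sum>X\<in>H. of_bool (x \<notin> X \<and> (\<exists>u\<in>set (v # zs). u \<in> X)) * y X) \<le>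
      (\<Sum>X\<in>H. of_bool (separates x v X) * y X + of_bool (v \<notin> X \<and> (\<exists>u\<in>set zs. u \<in> X)) * y X)"
    by (intro sum_mono) (use feasible_dualD(1)[OF y] in \<open>auto simp: of_bool_def separates_def\<close>)
  also have "\<dots> \<le> moat_sum n (separates x v) y + walk_len d (v # zs)"
  proof (unfold sum.distrib, rule add_mono)
    show "(\<Sum>X\<in>H. of_bool (separates x v X) * y X) \<le> moat_sum n (separates x v) y"
      unfolding moat_sum_def by (rule sum_mono2) (use H feasible_dualD(1)[OF y] in auto)
  qed (use Cons in simp)
  also have "moat_sum n (separates x v) y \<le> d x v" using feasible_dualD(3)[OF y] Cons.prems by simp
  finally show ?case by simp
qed simp

lemma prefix_cost_ge_moats:
  assumes y: "feasible_dual n r d z y" and H: "H \<subseteq> Pow {..<n}" "\<And>X. X \<in> H \<Longrightarrow> 0 < y X"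
    and xs: "set xs \<subseteq> {..<n}" "distinct xs" and c: "\<And>v. v < n \<Longrightarrow> c v < n" "c r = r"
    and heavy: "\<And>X. X \<in> H \<Longrightarrow> 1 / 4 \<le> (\<Sum>u\<in>{u\<in>set (take k xs). c u \<in> X}. p u)"
  shows "(\<Sum>X\<in>H. y X) \<le> 5 * (prefix_cost xs k + 2 * (\<Sum>v\<in>set (take k xs). p v * d v (c v)))"
proof -
  let ?S = "set (take k xs)"
  let ?hit = "\<lambda>A X. of_bool (A \<inter> {u\<in>?S. c u \<in> X} \<noteq> {}) :: real"
  have S: "?S \<subseteq> {..<n}" using xs(1) subset_take by blast
  have pointwise: "(\<Sum>X\<in>H. y X * ?hit A X)
    \<le> walk_len d (r # filter (\<lambda>v. v \<in> A) (take k xs)) + 2 * (\<Sum>v\<in>?S. of_bool (v \<in> A) * d v (c v))" for A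
  proof -
    let ?zs = "filter (\<lambda>v. v \<in> A) (take k xs)"
    have "(\<Sum>X\<in>H. y X * ?hit A X) \<le> (\<Sum>X\<in>H. of_bool (r \<notin> X \<and> (\<exists>v\<in>set (map c ?zs). v \<in> X)) * y X)"
      by (intro sum_mono) (use feasible_dualD(2)[OF y] H(2) in \<open>auto simp: of_bool_def less_imp_le\<close>)
    also have "\<dots> \<le> walk_len d (r # map c ?zs)"
      by (rule walk_len_ge_moats[OF y H(1)]) (use S c r in auto)
    also have "\<dots> \<le> walk_len d (r # ?zs) + 2 * (\<Sum>v\<leftarrow>?zs. d v (c v))" by (rule walk_len_map_le(1)) (use S c in auto)
    also have "(\<Sum>v\<leftarrow>?zs. d v (c v)) = (\<Sum>v\<in>?S. of_bool (v \<in> A) * d v (c v))"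
      using xs(2) by (simp add: sum_list_distinct_conv_sum_set of_bool_def if_distrib[of "\<lambda>x. x * _"] sum.If_cases Int_def cong: if_cong)
    finally show ?thesis .
  qed
  have "1 / 5 \<le> E (\<lambda>A. ?hit A X)" if "X \<in> H" for X
  proof -
    have "1 / 5 \<le> (\<Sum>u\<in>{u\<in>?S. c u \<in> X}. p u) / (1 + (\<Sum>u\<in>{u\<in>?S. c u \<in> X}. p u))"
      using heavy[OF that] by (simp add: field_simps)
    also have "\<dots> \<le> E (\<lambda>A. ?hit A X)" by (rule hit_probability) (use S in auto)
    finally show ?thesis .
  qed
  then have "(\<Sum>X\<in>H. y X * (1 / 5)) \<le> (\<Sum>X\<in>H. y X * E (\<lambda>A. ?hit A X))"
    by (intro sum_mono mult_left_mono feasible_dualD(1)[OF y])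
  also have "\<dots> = E (\<lambda>A. \<Sum>X\<in>H. y X * ?hit A X)" by (simp add: expectation_sum expectation_cmult)
  also have "\<dots> \<le> E (\<lambda>A. walk_len d (r # filter (\<lambda>v. v \<in> A) (take k xs)) + 2 * (\<Sum>v\<in>?S. of_bool (v \<in> A) * d v (c v)))"
    by (rule E_mono) (rule pointwise)
  also have "\<dots> = prefix_cost xs k + 2 * (\<Sum>v\<in>?S. p v * d v (c v))"
    unfolding expectation_add expectation_cmult E_sum_indicator[OF S] prefix_cost_def ..
  finally show ?thesis by (simp add: sum_divide_distrib[symmetric])
qed

end

section \<open>Primal-dual algorithm for the prize-collecting tree problem\<close>

definition dist_at :: "nat list list \<Rightarrow> nat \<Rightarrow> nat \<Rightarrow> nat" where
  "dist_at ds u v = nth_default 0 (nth_default [] ds u) v"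

text \<open>An environment consists of the vertex list, the root, the distance matrix and a cap on all numbers;
  a state consists of component labels, the total moat width around each vertex, and the residual prize of
  each label.  The cap is never reached and only serves to bound the size of the state.\<close>

type_synonym pd_env = "nat list \<times> nat \<times> nat list list \<times> nat"
type_synonym pd_state = "nat list \<times> nat list \<times> nat list"
type_synonym pd_event = "nat list \<times> (nat \<times> nat) \<times> bool"

abbreviation env_vertices :: "pd_env \<Rightarrow> nat list" where "env_vertices g \<equiv> fst g"
abbreviation env_root :: "pd_env \<Rightarrow> nat" where "env_root g \<equiv> fst (snd g)"
abbreviation env_dists :: "pd_env \<Rightarrow> nat list list" where "env_dists g \<equiv> fst (snd (snd g))"
abbreviation env_cap :: "pd_env \<Rightarrow> nat" where "env_cap g \<equiv> snd (snd (snd g))"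

abbreviation label :: "pd_state \<Rightarrow> nat \<Rightarrow> nat" where "label s v \<equiv> nth_default 0 (fst s) v"
abbreviation width :: "pd_state \<Rightarrow> nat \<Rightarrow> nat" where "width s v \<equiv> nth_default 0 (fst (snd s)) v"
abbreviation residual :: "pd_state \<Rightarrow> nat \<Rightarrow> nat" where "residual s l \<equiv> nth_default 0 (snd (snd s)) l"

abbreviation ev_labels :: "pd_event \<Rightarrow> nat list" where "ev_labels ev \<equiv> fst ev"
abbreviation ev_edge :: "pd_event \<Rightarrow> nat \<times> nat" where "ev_edge ev \<equiv> fst (snd ev)"
abbreviation ev_active :: "pd_event \<Rightarrow> bool" where "ev_active ev \<equiv> snd (snd ev)"

definition is_active :: "pd_state \<Rightarrow> nat \<Rightarrow> bool" where
  "is_active s v \<longleftrightarrow> 0 < residual s (label s v)"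

definition crossing_pairs :: "pd_env \<Rightarrow> pd_state \<Rightarrow> (nat \<times> nat) list" where
  "crossing_pairs g s = filter (\<lambda>q. label s (fst q) \<noteq> label s (snd q) \<and> is_active s (fst q))
     (List.product (env_vertices g) (env_vertices g))"

definition half_gap :: "pd_env \<Rightarrow> pd_state \<Rightarrow> nat \<times> nat \<Rightarrow> nat" where
  "half_gap g s q = (dist_at (env_dists g) (fst q) (snd q) - (width s (fst q) + width s (snd q))) div 2"

definition step_size :: "pd_env \<Rightarrow> pd_state \<Rightarrow> nat" where
  "step_size g s = argmin 0 (\<lambda>x. x)
     (map (half_gap g s) (crossing_pairs g s) @ filter (\<lambda>a. 0 < a) (map (residual s) (env_vertices g)))"

definition grow :: "pd_env \<Rightarrow> pd_state \<Rightarrow> pd_state" where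
  "grow g s = (fst s,
     map (\<lambda>v. min (env_cap g) (width s v + (if is_active s v then step_size g s else 0))) (env_vertices g),
     map (\<lambda>l. residual s l - step_size g s) (env_vertices g))"

definition tight_pairs :: "pd_env \<Rightarrow> pd_state \<Rightarrow> pd_state \<Rightarrow> (nat \<times> nat) list" where
  "tight_pairs g s t = filter (\<lambda>q. is_active t (fst q) \<and>
     dist_at (env_dists g) (fst q) (snd q) \<le> 2 * (width t (fst q) + width t (snd q))) (crossing_pairs g s)"

definition merge_components :: "pd_env \<Rightarrow> pd_state \<Rightarrow> nat \<times> nat \<Rightarrow> pd_state" where
  "merge_components g t q =
    (map (\<lambda>v. if label t v = label t (snd q) then label t (fst q) else label t v) (env_vertices g),
     fst (snd t),
     map (\<lambda>l. if l = label t (fst q)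
       then (if label t (snd q) = label t (env_root g) then 0
         else min (env_cap g) (residual t (label t (fst q)) + residual t (label t (snd q))))
       else if l = label t (snd q) then 0 else residual t l) (env_vertices g))"

definition merge_first :: "pd_env \<Rightarrow> pd_state \<Rightarrow> (nat \<times> nat) list \<Rightarrow> pd_state" where
  "merge_first g t Q = (if Q = [] then t else merge_components g t (hd_default (0, 0) Q))"

definition pd_step :: "pd_env \<Rightarrow> pd_state \<Rightarrow> pd_state" where
  "pd_step g s = merge_first g (grow g s) (tight_pairs g s (grow g s))"

definition merge_events :: "pd_state \<Rightarrow> (nat \<times> nat) list \<Rightarrow> pd_event list" where
  "merge_events t Q = (if Q = [] then [] else [(fst t, hd_default (0, 0) Q, is_active t (snd (hd_default (0, 0) Q)))])"

definition step_events :: "pd_env \<Rightarrow> pd_state \<Rightarrow> pd_event list" where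
  "step_events g s = merge_events (grow g s) (tight_pairs g s (grow g s))"

definition tree_vertices :: "nat \<Rightarrow> (nat \<times> nat) list \<Rightarrow> nat list" where
  "tree_vertices r T = r # map fst T @ map snd T"

definition touches :: "nat list \<Rightarrow> nat list \<Rightarrow> nat \<Rightarrow> bool" where
  "touches ls vs x \<longleftrightarrow> (\<exists>v\<in>set vs. nth_default 0 ls v = nth_default 0 ls x)"

text \<open>Undoing a merge: the merging edge is kept if the merged component is used and the second
  component is either used or was active; the first one is always active.\<close>

definition select_edge :: "nat \<Rightarrow> (nat \<times> nat) list \<Rightarrow> pd_event \<Rightarrow> (nat \<times> nat) list" where
  "select_edge r T ev =
     (if (touches (ev_labels ev) (tree_vertices r T) (fst (ev_edge ev)) \<or> touches (ev_labels ev) (tree_vertices r T) (snd (ev_edge ev))) \<and>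
         (touches (ev_labels ev) (tree_vertices r T) (snd (ev_edge ev)) \<or> ev_active ev)
      then ev_edge ev # T else T)"

definition init_state :: "pd_env \<Rightarrow> nat list \<Rightarrow> pd_state" where
  "init_state g ps = (env_vertices g, map (\<lambda>v. 0) (env_vertices g), map (nth_default 0 ps) (env_vertices g))"

definition history :: "pd_env \<Rightarrow> pd_state \<times> pd_event list \<Rightarrow> nat list \<Rightarrow> pd_state \<times> pd_event list" where
  "history g h cs = foldl (\<lambda>h _. (pd_step g (fst h), step_events g (fst h) @ snd h)) h cs"

definition pd_edges :: "pd_env \<Rightarrow> nat list \<Rightarrow> (nat \<times> nat) list" where
  "pd_edges g ps = foldl (select_edge (env_root g)) [] (snd (history g (init_state g ps, []) (env_vertices g @ env_vertices g)))"

fun kept_edges :: "pd_env \<Rightarrow> nat \<Rightarrow> pd_state \<Rightarrow> (nat \<times> nat) list" where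
  "kept_edges g 0 s = []"
| "kept_edges g (Suc k) s = foldl (select_edge (env_root g)) (kept_edges g k (pd_step g s)) (step_events g s)"

lemma history_kept_edges:
  "\<exists>H. snd (history g (s, h) cs) = H @ h \<and> foldl (select_edge (env_root g)) [] H = kept_edges g (length cs) s"
proof (induction cs arbitrary: s h)
  case Nil
  show ?case by (simp add: history_def)
next
  case (Cons c cs)
  obtain H where "snd (history g (pd_step g s, step_events g s @ h) cs) = H @ step_events g s @ h"
    "foldl (select_edge (env_root g)) [] H = kept_edges g (length cs) (pd_step g s)"
    using Cons by blast
  then show ?case by (intro exI[of _ "H @ step_events g s"]) (simp add: history_def)
qed

lemma pd_edges_eq_kept_edges: "pd_edges g ps = kept_edges g (2 * length (env_vertices g)) (init_state g ps)"
  using history_kept_edges[of g "init_state g ps" "[]" "env_vertices g @ env_vertices g"]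
  by (auto simp: pd_edges_def mult_2)

lemma nth_default_map_upt [simp]: "v < n \<Longrightarrow> nth_default d (map f [0..<n]) v = f v"
  by (simp add: nth_default_def)

lemma nth_default_upt [simp]: "v < n \<Longrightarrow> nth_default d [0..<n] v = v"
  by (simp add: nth_default_def)

locale primal_dual =
  fixes n r :: nat and w :: "nat \<Rightarrow> nat \<Rightarrow> nat" and z :: "nat \<Rightarrow> nat" and ds :: "nat list list" and M :: nat
  assumes r: "r < n" and dist_at: "\<And>u v. u < n \<Longrightarrow> v < n \<Longrightarrow> dist_at ds u v = w u v"
    and sym: "\<And>u v. u < n \<Longrightarrow> v < n \<Longrightarrow> w u v = w v u"
    and even: "\<And>u v. u < n \<Longrightarrow> v < n \<Longrightarrow> even (w u v)"
    and prize_r: "z r = 0" and M: "M = (\<Sum>v<n. z v)"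
begin

definition env :: pd_env where "env = ([0..<n], r, ds, M)"

lemma env_simps [simp]:
  "env_vertices env = [0..<n]" "env_root env = r" "env_dists env = ds" "env_cap env = M"
  by (simp_all add: env_def)

definition component :: "pd_state \<Rightarrow> nat \<Rightarrow> nat set" where "component s l = {v. v < n \<and> label s v = l}"

definition active :: "pd_state \<Rightarrow> nat set" where "active s = {l. l < n \<and> 0 < residual s l}"

definition dual_inv :: "pd_state \<Rightarrow> (nat set \<Rightarrow> nat) \<Rightarrow> bool" where
  "dual_inv s y \<longleftrightarrow> (\<forall>v<n. label s v < n) \<and>
     (\<forall>v<n. width s v = moat_sum n (\<lambda>X. v \<in> X) y) \<and>
     (\<forall>a<n. \<forall>b<n. label s a \<noteq> label s b \<longrightarrow> width s a + width s b \<le> w a b) \<and>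
     (\<forall>a<n. \<forall>b<n. moat_sum n (separates a b) y \<le> w a b) \<and>
     (\<forall>X. 0 < y X \<longrightarrow> X \<subseteq> {..<n} - {r} \<and> (\<forall>a\<in>X. \<forall>b\<in>X. label s a = label s b)) \<and>
     (\<forall>U\<subseteq>{..<n}. moat_sum n (\<lambda>X. X \<subseteq> U) y + (\<Sum>l<n. of_bool (component s l \<subseteq> U) * residual s l) \<le> (\<Sum>u\<in>U. z u)) \<and>
     (\<forall>l<n. 0 < residual s l \<longrightarrow> component s l \<noteq> {}) \<and> residual s (label s r) = 0"

lemma
  assumes "dual_inv s y"
  shows label_less: "v < n \<Longrightarrow> label s v < n"
    and width_eq: "v < n \<Longrightarrow> width s v = moat_sum n (\<lambda>X. v \<in> X) y"
    and width_add_le: "a < n \<Longrightarrow> b < n \<Longrightarrow> label s a \<noteq> label s b \<Longrightarrow> width s a + width s b \<le> w a b"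
    and moat_sum_separates_le: "a < n \<Longrightarrow> b < n \<Longrightarrow> moat_sum n (separates a b) y \<le> w a b"
    and moat_subset: "0 < y X \<Longrightarrow> X \<subseteq> {..<n} - {r}"
    and moat_label_eq: "0 < y X \<Longrightarrow> a \<in> X \<Longrightarrow> b \<in> X \<Longrightarrow> label s a = label s b"
    and moat_sum_subset_le: "U \<subseteq> {..<n} \<Longrightarrow>
      moat_sum n (\<lambda>X. X \<subseteq> U) y + (\<Sum>l<n. of_bool (component s l \<subseteq> U) * residual s l) \<le> (\<Sum>u\<in>U. z u)"
    and component_nonempty: "l < n \<Longrightarrow> 0 < residual s l \<Longrightarrow> component s l \<noteq> {}"
    and residual_root: "residual s (label s r) = 0"
  using assms unfolding dual_inv_def by meson+

lemma dual_value_add_residual_le: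
  assumes "dual_inv s y"
  shows "dual_value n y + (\<Sum>l<n. residual s l) \<le> M"
proof -
  have "moat_sum n (\<lambda>X. X \<subseteq> {..<n}) y = dual_value n y" unfolding moat_sum_def by (rule sum.cong) auto
  moreover have "(\<Sum>l<n. of_bool (component s l \<subseteq> {..<n}) * residual s l) = (\<Sum>l<n. residual s l)"
    by (rule sum.cong) (auto simp: component_def)
  ultimately show ?thesis using moat_sum_subset_le[OF assms, of "{..<n}"] M by simp
qed

lemma moat_sum_mono: "(\<And>X. P X \<Longrightarrow> Q X) \<Longrightarrow> moat_sum n P y \<le> moat_sum n Q (y :: nat set \<Rightarrow> nat)"
  unfolding moat_sum_def by (intro sum_mono mult_le_mono1) auto

lemma init_state_simps:
  assumes "\<And>v. v < n \<Longrightarrow> nth_default 0 ps v = z v" "v < n"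
  shows "label (init_state env ps) v = v" "width (init_state env ps) v = 0" "residual (init_state env ps) v = z v"
  using assms by (simp_all add: init_state_def)

lemma dual_inv_init:
  assumes "\<And>v. v < n \<Longrightarrow> nth_default 0 ps v = z v"
  shows "dual_inv (init_state env ps) (\<lambda>_. 0)"
proof -
  let ?s = "init_state env ps"
  note init = init_state_simps[OF assms]
  have component: "component ?s v = {v}" if "v < n" for v using that init by (auto simp: component_def)
  have "(\<Sum>l<n. of_bool (component ?s l \<subseteq> U) * residual ?s l) \<le> (\<Sum>u\<in>U. z u)" if U: "U \<subseteq> {..<n}" for U
  proof -
    have "(\<Sum>l<n. of_bool (component ?s l \<subseteq> U) * residual ?s l) = (\<Sum>l<n. if l \<in> U then z l else 0)"
      by (rule sum.cong) (auto simp: init component)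
    also have "\<dots> = (\<Sum>u\<in>U. z u)" using U by (simp add: sum.If_cases Int_absorb1)
    finally show ?thesis by simp
  qed
  then show ?thesis unfolding dual_inv_def using init component r prize_r by (auto simp: moat_sum_def)
qed

subsection \<open>Growing the active moats\<close>

definition grown :: "pd_state \<Rightarrow> (nat set \<Rightarrow> nat) \<Rightarrow> nat set \<Rightarrow> nat" where
  "grown s y X = y X + (if X \<in> component s ` active s then step_size env s else 0)"

lemma crossing_pairs_iff: "(u, v) \<in> set (crossing_pairs env s) \<longleftrightarrow> u < n \<and> v < n \<and> label s u \<noteq> label s v \<and> is_active s u"
  by (auto simp: crossing_pairs_def)

lemma is_active_iff: "dual_inv s y \<Longrightarrow> v < n \<Longrightarrow> is_active s v \<longleftrightarrow> label s v \<in> active s"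
  by (auto simp: is_active_def active_def dest: label_less)

lemma finite_active: "finite (active s)" by (simp add: active_def)

lemma half_gap_env: "u < n \<Longrightarrow> v < n \<Longrightarrow> half_gap env s (u, v) = (w u v - (width s u + width s v)) div 2"
  by (simp add: half_gap_def dist_at)

lemma step_size_le_residual: "l \<in> active s \<Longrightarrow> step_size env s \<le> residual s l"
  unfolding step_size_def by (rule argmin_le[where k = "\<lambda>x. x"]) (auto simp: active_def)

lemma step_size_le_half_gap: "q \<in> set (crossing_pairs env s) \<Longrightarrow> step_size env s \<le> half_gap env s q"
  unfolding step_size_def by (rule argmin_le[where k = "\<lambda>x. x"]) auto

lemma step_size_attained:
  assumes "active s \<noteq> {}"
  obtains l where "l \<in> active s" "step_size env s = residual s l"
  | u v where "(u, v) \<in> set (crossing_pairs env s)" "step_size env s = half_gap env s (u, v)"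
proof -
  let ?xs = "map (half_gap env s) (crossing_pairs env s) @ filter (\<lambda>a. 0 < a) (map (residual s) [0..<n])"
  have "?xs \<noteq> []" using assms by (auto simp: active_def filter_empty_conv)
  then have "step_size env s \<in> set ?xs" unfolding step_size_def env_simps by (rule argmin_in)
  then show ?thesis using that by (auto simp: active_def)
qed

lemma inj_on_component: "dual_inv s y \<Longrightarrow> inj_on (component s) (active s)"
  by (rule inj_onI) (use component_nonempty in \<open>fastforce simp: active_def component_def\<close>)

lemma moat_sum_grown:
  assumes "dual_inv s y"
  shows "moat_sum n P (grown s y) = moat_sum n P y + step_size env s * (\<Sum>l\<in>active s. of_bool (P (component s l)))"
proof -
  let ?C = "component s ` active s" and ?e = "step_size env s"
  have sub: "?C \<subseteq> Pow {..<n}" by (auto simp: component_def)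
  have "moat_sum n P (grown s y) = moat_sum n P y + (\<Sum>X\<in>Pow {..<n}. if X \<in> ?C then of_bool (P X) * ?e else 0)"
    unfolding moat_sum_def grown_def sum.distrib[symmetric] by (rule sum.cong) (auto simp: algebra_simps)
  also have "(\<Sum>X\<in>Pow {..<n}. if X \<in> ?C then of_bool (P X) * ?e else 0) = (\<Sum>X\<in>?C. of_bool (P X) * ?e)"
    by (subst sum.If_cases) (use sub in \<open>auto simp: Int_absorb1\<close>)
  also have "\<dots> = ?e * (\<Sum>l\<in>active s. of_bool (P (component s l)))"
    by (simp add: sum.reindex[OF inj_on_component[OF assms]] sum_distrib_left mult.commute)
  finally show ?thesis .
qed

lemma sum_active_mem: "v < n \<Longrightarrow> (\<Sum>l\<in>active s. of_bool (v \<in> component s l)) = (of_bool (label s v \<in> active s) :: nat)"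
  using finite_active[of s] by (simp add: component_def of_bool_def)

lemma label_grow [simp]: "label (grow g s) v = label s v" by (simp add: grow_def)

lemma component_grow [simp]: "component (grow env s) l = component s l" by (simp add: component_def)

lemma residual_grow: "l < n \<Longrightarrow> residual (grow env s) l = residual s l - step_size env s" by (simp add: grow_def)

lemma active_grow_subset: "active (grow env s) \<subseteq> active s" by (auto simp: active_def residual_grow)

lemma width_grow:
  assumes "dual_inv s y" "v < n"
  shows "width (grow env s) v = width s v + (if label s v \<in> active s then step_size env s else 0)"
proof -
  have "width s v \<le> dual_value n y" unfolding width_eq[OF assms] by (rule moat_sum_mono) simp
  moreover have "residual s (label s v) \<le> (\<Sum>l<n. residual s l)"
    using label_less[OF assms] by (intro member_le_sum) auto
  then have "(if label s v \<in> active s then step_size env s else 0) \<le> (\<Sum>l<n. residual s l)"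
    using step_size_le_residual[of "label s v" s] by (cases "label s v \<in> active s") simp_all
  ultimately have "width s v + (if label s v \<in> active s then step_size env s else 0) \<le> M"
    using dual_value_add_residual_le[OF assms(1)] by linarith
  then show ?thesis using assms is_active_iff[OF assms] by (simp add: grow_def min_absorb2)
qed

lemma width_grow_eq_moat_sum:
  assumes "dual_inv s y" "v < n"
  shows "width (grow env s) v = moat_sum n (\<lambda>X. v \<in> X) (grown s y)"
  using assms by (simp add: width_grow moat_sum_grown sum_active_mem width_eq)

lemma width_grow_add_le:
  assumes inv: "dual_inv s y" and ab: "a < n" "b < n" "label s a \<noteq> label s b"
  shows "width (grow env s) a + width (grow env s) b \<le> w a b"
proof -
  have gap: "width s u + width s v + step_size env s + step_size env s \<le> w u v"
    if "u < n" "v < n" "label s u \<noteq> label s v" "label s u \<in> active s" for u v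
  proof -
    have "(u, v) \<in> set (crossing_pairs env s)" using that is_active_iff[OF inv] by (simp add: crossing_pairs_iff)
    from step_size_le_half_gap[OF this] show ?thesis
      using width_add_le[OF inv that(1-3)] that by (simp add: half_gap_env)
  qed
  show ?thesis using gap[of a b] gap[of b a] width_add_le[OF inv ab] ab sym[OF ab(1,2)]
    by (auto simp: width_grow[OF inv])
qed

lemma moat_sum_separates_grown_le:
  assumes inv: "dual_inv s y" and ab: "a < n" "b < n"
  shows "moat_sum n (separates a b) (grown s y) \<le> w a b"
proof (cases "label s a = label s b")
  case True
  then have "(\<Sum>l\<in>active s. of_bool (separates a b (component s l))) = (0::nat)"
    using ab by (auto simp: component_def separates_def)
  then show ?thesis using moat_sum_separates_le[OF inv ab] by (simp add: moat_sum_grown[OF inv])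
next
  case False
  have "moat_sum n (separates a b) (grown s y)
    \<le> moat_sum n (\<lambda>X. a \<in> X) (grown s y) + moat_sum n (\<lambda>X. b \<in> X) (grown s y)"
    unfolding moat_sum_def sum.distrib[symmetric] by (rule sum_mono) (auto simp: separates_def)
  also have "\<dots> = width (grow env s) a + width (grow env s) b" using ab by (simp add: width_grow_eq_moat_sum[OF inv])
  also have "\<dots> \<le> w a b" by (rule width_grow_add_le[OF inv ab False])
  finally show ?thesis .
qed

lemma grown_moat:
  assumes "dual_inv s y" "0 < grown s y X"
  shows "X \<subseteq> {..<n} - {r} \<and> (\<forall>a\<in>X. \<forall>b\<in>X. label s a = label s b)"
proof (cases "0 < y X")
  case True
  then show ?thesis using moat_subset[OF assms(1)] moat_label_eq[OF assms(1)] by blast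
next
  case False
  then obtain l where l: "l \<in> active s" "X = component s l" using assms(2) by (auto simp: grown_def split: if_splits)
  moreover have "l \<noteq> label s r" using l(1) residual_root[OF assms(1)] by (auto simp: active_def)
  ultimately show ?thesis by (auto simp: component_def)
qed

lemma moat_sum_subset_grown_le:
  assumes inv: "dual_inv s y" and U: "U \<subseteq> {..<n}"
  shows "moat_sum n (\<lambda>X. X \<subseteq> U) (grown s y) + (\<Sum>l<n. of_bool (component s l \<subseteq> U) * residual (grow env s) l)
    \<le> (\<Sum>u\<in>U. z u)"
proof -
  let ?e = "step_size env s" and ?in = "\<lambda>l. of_bool (component s l \<subseteq> U) :: nat"
  have "?e * (\<Sum>l\<in>active s. ?in l) = (\<Sum>l<n. if l \<in> active s then ?in l * ?e else 0)"
    by (subst sum.If_cases) (auto simp: active_def Int_def sum_distrib_left mult.commute intro: sum.cong)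
  then have "?e * (\<Sum>l\<in>active s. ?in l) + (\<Sum>l<n. ?in l * residual (grow env s) l) =
      (\<Sum>l<n. (if l \<in> active s then ?in l * ?e else 0) + ?in l * residual (grow env s) l)"
    by (simp add: sum.distrib)
  also have "\<dots> \<le> (\<Sum>l<n. ?in l * residual s l)"
  proof (rule sum_mono)
    fix l assume "l \<in> {..<n}"
    then show "(if l \<in> active s then ?in l * ?e else 0) + ?in l * residual (grow env s) l \<le> ?in l * residual s l"
      using step_size_le_residual[of l s] by (auto simp: residual_grow active_def)
  qed
  finally show ?thesis using moat_sum_subset_le[OF inv U] by (simp add: moat_sum_grown[OF inv])
qed

lemma dual_inv_grow:
  assumes inv: "dual_inv s y"
  shows "dual_inv (grow env s) (grown s y)"
proof -
  have "component s l \<noteq> {}" if "l < n" "0 < residual (grow env s) l" for l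
    using that component_nonempty[OF inv, of l] by (auto simp: residual_grow)
  moreover have "residual (grow env s) (label s r) = 0"
    using residual_root[OF inv] label_less[OF inv r] by (simp add: residual_grow)
  ultimately show ?thesis unfolding dual_inv_def label_grow component_grow
    using label_less[OF inv] width_grow_eq_moat_sum[OF inv] width_grow_add_le[OF inv]
      moat_sum_separates_grown_le[OF inv] grown_moat[OF inv] moat_sum_subset_grown_le[OF inv] by blast
qed

subsection \<open>Merging two components\<close>

context
  fixes t :: pd_state and y :: "nat set \<Rightarrow> nat" and x x' :: nat
  assumes inv: "dual_inv t y" and x: "x < n" and x': "x' < n" and labels_neq: "label t x \<noteq> label t x'"
    and active_x: "label t x \<in> active t"
begin

abbreviation merged :: pd_state where "merged \<equiv> merge_components env t (x, x')"

lemma labels_less: "label t x < n" "label t x' < n"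
  using label_less[OF inv] x x' by auto

lemma label_x_neq_root: "label t x \<noteq> label t r"
  using active_x residual_root[OF inv] by (auto simp: active_def)

lemma residual_x_pos: "0 < residual t (label t x)"
  using active_x by (simp add: active_def)

lemma label_merged: "v < n \<Longrightarrow> label merged v = (if label t v = label t x' then label t x else label t v)"
  by (simp add: merge_components_def)

lemma width_merged: "width merged v = width t v"
  by (simp add: merge_components_def)

lemma residual_merged:
  assumes "l < n"
  shows "residual merged l = (if l = label t x
       then (if label t x' = label t r then 0 else residual t (label t x) + residual t (label t x'))
       else if l = label t x' then 0 else residual t l)"
proof -
  have "residual t (label t x) + residual t (label t x') = (\<Sum>l\<in>{label t x, label t x'}. residual t l)"
    using labels_neq by simp
  also have "\<dots> \<le> (\<Sum>l<n. residual t l)" by (rule sum_mono2) (use labels_less in auto)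
  also have "\<dots> \<le> M" using dual_value_add_residual_le[OF inv] by simp
  finally show ?thesis using assms by (simp add: merge_components_def)
qed

lemma component_merged: "component merged l =
    (if l = label t x then component t (label t x) \<union> component t (label t x') else if l = label t x' then {} else component t l)"
  using label_merged labels_neq by (auto simp: component_def)

lemma moat_label_merged_eq:
  assumes "0 < y X" "a \<in> X" "b \<in> X"
  shows "label merged a = label merged b"
proof -
  have "a < n" "b < n" using moat_subset[OF inv assms(1)] assms by auto
  then show ?thesis using label_merged[of a] label_merged[of b] moat_label_eq[OF inv assms] by presburger
qed

lemma sum_split_labels:
  "(\<Sum>l<n. f l) = f (label t x) + f (label t x') + (\<Sum>l\<in>{..<n} - {label t x, label t x'}. f l)" for f :: "nat \<Rightarrow> nat"
proof -
  have "(\<Sum>l<n. f l) = (\<Sum>l\<in>{label t x, label t x'}. f l) + (\<Sum>l\<in>{..<n} - {label t x, label t x'}. f l)"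
    using sum.subset_diff[of "{label t x, label t x'}" "{..<n}" f] labels_less by (simp only: add.commute) auto
  then show ?thesis using labels_neq by simp
qed

lemma moat_sum_subset_merged_le:
  assumes U: "U \<subseteq> {..<n}"
  shows "moat_sum n (\<lambda>X. X \<subseteq> U) y + (\<Sum>l<n. of_bool (component merged l \<subseteq> U) * residual merged l) \<le> (\<Sum>u\<in>U. z u)"
proof -
  let ?a = "label t x" and ?b = "label t x'"
  let ?old = "\<lambda>l. of_bool (component t l \<subseteq> U) * residual t l"
    and ?new = "\<lambda>l. of_bool (component merged l \<subseteq> U) * residual merged l"
  have "(\<Sum>l\<in>{..<n} - {?a, ?b}. ?new l) = (\<Sum>l\<in>{..<n} - {?a, ?b}. ?old l)"
    by (rule sum.cong) (auto simp: component_merged residual_merged)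
  moreover have "?new ?a + ?new ?b \<le> ?old ?a + ?old ?b"
    using labels_neq labels_less by (auto simp: component_merged residual_merged)
  ultimately have "(\<Sum>l<n. ?new l) \<le> (\<Sum>l<n. ?old l)" unfolding sum_split_labels by linarith
  then show ?thesis using moat_sum_subset_le[OF inv U] by linarith
qed

lemma component_merged_nonempty:
  assumes "l < n" "0 < residual merged l"
  shows "component merged l \<noteq> {}"
  using assms residual_merged[OF assms(1)] component_nonempty[OF inv, of l] x
  by (auto simp: component_merged split: if_splits) (auto simp: component_def)

lemma residual_merged_root: "residual merged (label merged r) = 0"
  using label_merged[OF r] residual_merged[of "label merged r"] label_less[OF inv r] residual_root[OF inv]
    label_x_neq_root labels_less by auto

lemma dual_inv_merge: "dual_inv merged y"
  unfolding dual_inv_def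
proof (intro conjI allI impI)
  fix v assume v: "v < n"
  show "label merged v < n" using v label_merged label_less[OF inv] labels_less by simp
  show "width merged v = moat_sum n (\<lambda>X. v \<in> X) y" using v width_merged width_eq[OF inv] by simp
next
  fix a b assume ab: "a < n" "b < n"
  show "moat_sum n (separates a b) y \<le> w a b" using ab moat_sum_separates_le[OF inv] by blast
  assume "label merged a \<noteq> label merged b"
  then have "label t a \<noteq> label t b" using ab label_merged by metis
  then show "width merged a + width merged b \<le> w a b" unfolding width_merged using ab width_add_le[OF inv] by blast
next
  fix X assume "0 < y X"
  then show "X \<subseteq> {..<n} - {r}" "\<forall>a\<in>X. \<forall>b\<in>X. label merged a = label merged b"
    using moat_subset[OF inv] moat_label_merged_eq by blast+
next
  fix U assume "U \<subseteq> {..<n}"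
  then show "moat_sum n (\<lambda>X. X \<subseteq> U) y + (\<Sum>l<n. of_bool (component merged l \<subseteq> U) * residual merged l) \<le> (\<Sum>u\<in>U. z u)"
    by (rule moat_sum_subset_merged_le)
next
  fix l assume "l < n" "0 < residual merged l"
  then show "component merged l \<noteq> {}" by (rule component_merged_nonempty)
qed (rule residual_merged_root)

lemma active_merged_subset: "active merged \<subseteq> active t"
proof
  fix l assume "l \<in> active merged"
  then have "l < n" "0 < residual merged l" by (auto simp: active_def)
  then show "l \<in> active t"
    using residual_merged[of l] residual_x_pos labels_less by (auto simp: active_def split: if_splits)
qed

lemma labels_merged_psubset: "label merged ` {..<n} \<subset> label t ` {..<n}"
proof -
  have "label merged ` {..<n} \<subseteq> label t ` {..<n} - {label t x'}" using label_merged labels_neq x by auto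
  then show ?thesis using x' by blast
qed

end

subsection \<open>Termination\<close>

lemma tight_pairs_hd:
  assumes inv: "dual_inv s y" and tight: "tight_pairs env s (grow env s) \<noteq> []"
  obtains x x' where "hd_default (0, 0) (tight_pairs env s (grow env s)) = (x, x')" "x < n" "x' < n"
    "label (grow env s) x \<noteq> label (grow env s) x'" "label (grow env s) x \<in> active (grow env s)"
    "w x x' \<le> 2 * (width (grow env s) x + width (grow env s) x')"
proof -
  obtain x x' where hd: "hd_default (0, 0) (tight_pairs env s (grow env s)) = (x, x')" by fastforce
  then have "(x, x') \<in> set (tight_pairs env s (grow env s))"
    using tight by (cases "tight_pairs env s (grow env s)") (auto simp: hd_default_def)
  then have pair: "x < n" "x' < n" "label s x \<noteq> label s x'" and "is_active (grow env s) x"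
    and "dist_at ds x x' \<le> 2 * (width (grow env s) x + width (grow env s) x')"
    by (auto simp: tight_pairs_def crossing_pairs_iff)
  then show ?thesis using that[OF hd] is_active_iff[OF dual_inv_grow[OF inv]] dist_at by simp
qed

lemma pd_step_cases:
  assumes "dual_inv s y"
  obtains (grow) "tight_pairs env s (grow env s) = []" "pd_step env s = grow env s" "step_events env s = []"
  | (merge) x x' where "pd_step env s = merge_components env (grow env s) (x, x')"
      "step_events env s = [(fst (grow env s), (x, x'), is_active (grow env s) x')]" "x < n" "x' < n"
      "label (grow env s) x \<noteq> label (grow env s) x'" "label (grow env s) x \<in> active (grow env s)"
      "w x x' \<le> 2 * (width (grow env s) x + width (grow env s) x')"
proof (cases "tight_pairs env s (grow env s) = []")
  case True
  then show ?thesis by (intro grow) (simp_all add: pd_step_def merge_first_def step_events_def merge_events_def)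
next
  case False
  from tight_pairs_hd[OF assms this] show ?thesis
    using merge False by (metis (no_types, lifting) pd_step_def merge_first_def step_events_def merge_events_def snd_conv)
qed

lemma dual_inv_step:
  assumes "dual_inv s y"
  shows "dual_inv (pd_step env s) (grown s y)"
  using assms
proof (cases rule: pd_step_cases)
  case grow
  then show ?thesis using dual_inv_grow[OF assms] by simp
next
  case (merge x x')
  show ?thesis unfolding merge(1) using merge(3-6) by (intro dual_inv_merge dual_inv_grow[OF assms])
qed

lemma tight_of_step_size_eq_half_gap:
  assumes inv: "dual_inv s y" and uv: "(u, v) \<in> set (crossing_pairs env s)"
    and size: "step_size env s = half_gap env s (u, v)"
  shows "w u v \<le> 2 * (width (grow env s) u + width (grow env s) v)"
proof -
  have u: "u < n" "v < n" "label s u \<in> active s" using uv is_active_iff[OF inv] by (auto simp: crossing_pairs_iff)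
  define W where "W = width s u + width s v"
  have half: "step_size env s = (w u v - W) div 2" using size u by (simp add: half_gap_env W_def)
  have "w u v \<le> 2 * (W + step_size env s)"
  proof (cases "W = 0")
    case True
    then show ?thesis using half even[OF u(1,2)] by auto
  next
    case False
    then show ?thesis unfolding half by presburger
  qed
  also have "\<dots> \<le> 2 * (width (grow env s) u + width (grow env s) v)" using u by (simp add: width_grow[OF inv] W_def)
  finally show ?thesis .
qed

lemma active_grow_psubset:
  assumes inv: "dual_inv s y" and active: "active s \<noteq> {}" and tight: "tight_pairs env s (grow env s) = []"
  shows "active (grow env s) \<subset> active s"
  using active
proof (cases rule: step_size_attained)
  case (1 l)
  then have "l \<notin> active (grow env s)" by (auto simp: active_def residual_grow)
  then show ?thesis using active_grow_subset 1(1) by blast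
next
  case (2 u v)
  then have uv: "u < n" "v < n" "label s u \<in> active s" using is_active_iff[OF inv] by (auto simp: crossing_pairs_iff)
  have "\<not> is_active (grow env s) u"
    using tight 2(1) tight_of_step_size_eq_half_gap[OF inv 2] dist_at[OF uv(1,2)]
      by (auto simp: tight_pairs_def filter_empty_conv)
  then have "label s u \<notin> active (grow env s)" using is_active_iff[OF dual_inv_grow[OF inv] uv(1)] by simp
  then show ?thesis using active_grow_subset uv(3) by blast
qed

definition potential :: "pd_state \<Rightarrow> nat" where
  "potential s = card (label s ` {..<n}) + card (active s)"

lemma potential_step_less:
  assumes inv: "dual_inv s y" and active: "active s \<noteq> {}"
  shows "potential (pd_step env s) < potential s"
  using inv
proof (cases rule: pd_step_cases)
  case grow
  then have "card (active (grow env s)) < card (active s)"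
    using active_grow_psubset[OF inv active] finite_active by (blast intro: psubset_card_mono)
  then show ?thesis using grow by (simp add: potential_def)
next
  case (merge x x')
  note hyps = dual_inv_grow[OF inv] merge(3-6)
  have "active (pd_step env s) \<subseteq> active s" unfolding merge(1)
    using active_merged_subset[OF hyps] active_grow_subset by blast
  then have "card (active (pd_step env s)) \<le> card (active s)" by (rule card_mono[OF finite_active])
  moreover have "card (label (pd_step env s) ` {..<n}) < card (label s ` {..<n})"
    using labels_merged_psubset[OF hyps] merge(1) by (intro psubset_card_mono) simp_all
  ultimately show ?thesis by (simp add: potential_def)
qed

lemma active_step_empty:
  assumes "dual_inv s y" "active s = {}"
  shows "active (pd_step env s) = {}"
  using assms(1)
proof (cases rule: pd_step_cases)
  case grow
  then show ?thesis using assms(2) active_grow_subset by fastforce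
next
  case merge
  then show ?thesis using assms(2) active_grow_subset by blast
qed

lemma active_steps_empty:
  "dual_inv s y \<Longrightarrow> potential s \<le> k \<Longrightarrow> active ((pd_step env ^^ k) s) = {}"
proof (induction k arbitrary: s y)
  case 0
  then show ?case using finite_active by (simp add: potential_def)
next
  case (Suc k)
  show ?case
  proof (cases "active s = {}")
    case True
    have "\<exists>y. dual_inv ((pd_step env ^^ j) s) y \<and> active ((pd_step env ^^ j) s) = {}" for j
    proof (induction j)
      case 0
      then show ?case using Suc.prems True by auto
    next
      case (Suc j)
      then show ?case using dual_inv_step active_step_empty by (metis funpow.simps(2) o_apply)
    qed
    then show ?thesis by blast
  next
    case False
    have "potential (pd_step env s) \<le> k" using potential_step_less[OF Suc.prems(1) False] Suc.prems(2) by linarith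
    from Suc.IH[OF dual_inv_step[OF Suc.prems(1)] this] show ?thesis by (simp add: funpow_swap1)
  qed
qed

subsection \<open>The reverse pass\<close>

abbreviation verts :: "(nat \<times> nat) list \<Rightarrow> nat set" where "verts T \<equiv> set (tree_vertices r T)"

definition touched :: "pd_state \<Rightarrow> (nat \<times> nat) list \<Rightarrow> nat set" where "touched s T = label s ` verts T"

definition degree :: "pd_state \<Rightarrow> (nat \<times> nat) list \<Rightarrow> nat \<Rightarrow> nat" where
  "degree s T l = (\<Sum>e\<leftarrow>T. of_bool (label s (fst e) = l) + of_bool (label s (snd e) = l))"

definition edges_ok :: "pd_state \<Rightarrow> (nat \<times> nat) list \<Rightarrow> bool" where
  "edges_ok s T \<longleftrightarrow> (\<forall>e\<in>set T. fst e < n \<and> snd e < n \<and> label s (fst e) \<noteq> label s (snd e))"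

definition closed_under :: "pd_state \<Rightarrow> (nat \<times> nat) list \<Rightarrow> nat set \<Rightarrow> bool" where
  "closed_under s T P \<longleftrightarrow> P \<subseteq> {..<n} \<and> r \<in> P \<and> (\<forall>a\<in>P. component s (label s a) \<subseteq> P) \<and> (\<forall>e\<in>set T. fst e \<in> P \<longleftrightarrow> snd e \<in> P)"

definition connected_to_root :: "pd_state \<Rightarrow> (nat \<times> nat) list \<Rightarrow> bool" where
  "connected_to_root s T \<longleftrightarrow> (\<forall>P. closed_under s T P \<longrightarrow> verts T \<subseteq> P)"

definition no_idle_leaf :: "pd_state \<Rightarrow> (nat \<times> nat) list \<Rightarrow> bool" where
  "no_idle_leaf s T \<longleftrightarrow> (\<forall>l\<in>touched s T. l \<noteq> label s r \<longrightarrow> residual s l = 0 \<longrightarrow> 2 \<le> degree s T l)"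

definition reduced_cost :: "pd_state \<Rightarrow> nat \<times> nat \<Rightarrow> int" where
  "reduced_cost s e = int (w (fst e) (snd e)) - 2 * int (width s (fst e)) - 2 * int (width s (snd e))"

definition unpaid :: "pd_state \<Rightarrow> (nat \<times> nat) list \<Rightarrow> int" where
  "unpaid s T = (\<Sum>l\<in>{..<n} - touched s T. int (residual s l))"

text \<open>Invariant of the reverse pass: at every level the kept edges form a tree on the used
  components in which inactive components other than the root's are not leaves.\<close>

definition tree_inv :: "pd_state \<Rightarrow> (nat \<times> nat) list \<Rightarrow> nat \<Rightarrow> bool" where
  "tree_inv s T Y \<longleftrightarrow> edges_ok s T \<and> card (touched s T) = Suc (length T) \<and> no_idle_leaf s T \<and>
     connected_to_root s T \<and> (\<Sum>e\<leftarrow>T. reduced_cost s e) + 2 * unpaid s T \<le> 4 * int Y"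

lemma set_tree_vertices: "verts T = insert r (fst ` set T \<union> snd ` set T)"
  by (auto simp: tree_vertices_def)

lemma verts_Cons: "verts (e # T) = insert (fst e) (insert (snd e) (verts T))"
  by (auto simp: tree_vertices_def)

lemma edge_in_verts: "e \<in> set T \<Longrightarrow> fst e \<in> verts T \<and> snd e \<in> verts T"
  by (auto simp: tree_vertices_def)

lemma root_in_verts: "r \<in> verts T"
  by (simp add: tree_vertices_def)

lemma verts_less: "edges_ok s T \<Longrightarrow> v \<in> verts T \<Longrightarrow> v < n"
  using r by (auto simp: set_tree_vertices edges_ok_def)

lemma touched_less: "dual_inv s y \<Longrightarrow> edges_ok s T \<Longrightarrow> l \<in> touched s T \<Longrightarrow> l < n"
  using label_less[of s y] verts_less[of s T] by (auto simp: touched_def)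

lemma finite_touched: "finite (touched s T)" by (simp add: touched_def)

lemma tree_inv_final:
  assumes "dual_inv s y" "active s = {}"
  shows "tree_inv s [] 0"
proof -
  have "residual s l = 0" if "l < n" for l using that assms(2) by (auto simp: active_def)
  then show ?thesis using r
    by (auto simp: tree_inv_def edges_ok_def touched_def set_tree_vertices no_idle_leaf_def connected_to_root_def closed_under_def unpaid_def)
qed

lemma sum_degree:
  assumes "finite S"
  shows "(\<Sum>l\<in>S. degree s T l) = (\<Sum>e\<leftarrow>T. of_bool (label s (fst e) \<in> S) + of_bool (label s (snd e) \<in> S))"
proof (induction T)
  case (Cons e T)
  have "(\<Sum>l\<in>S. of_bool (label s v = l)) = (of_bool (label s v \<in> S) :: nat)" for v
    using assms by (simp add: of_bool_def)
  then show ?case using Cons by (simp add: degree_def sum.distrib)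
qed (simp add: degree_def)

lemma sum_degree_touched: "(\<Sum>l\<in>touched s T. degree s T l) = 2 * length T"
proof -
  have "(\<Sum>l\<in>touched s T. degree s T l) = (\<Sum>e\<leftarrow>T. 2)"
    unfolding sum_degree[OF finite_touched]
      by (rule arg_cong[where f = sum_list], rule map_cong) (auto simp: touched_def edge_in_verts)
  then show ?thesis by (simp add: sum_list_triv)
qed

text \<open>The average degree of a tree is below 2, and idle components other than the root's have degree at least 2.\<close>

lemma active_degree_le:
  assumes inv: "dual_inv s y" and ok: "edges_ok s T" and card: "card (touched s T) = Suc (length T)"
    and leaf: "no_idle_leaf s T"
  shows "(\<Sum>e\<leftarrow>T. of_bool (label s (fst e) \<in> active s) + of_bool (label s (snd e) \<in> active s))
    \<le> 2 * card (touched s T \<inter> active s)"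
proof -
  let ?idle = "touched s T - active s"
  have root: "label s r \<in> ?idle" using residual_root[OF inv] by (auto simp: touched_def root_in_verts active_def)
  have "(\<Sum>l\<in>?idle - {label s r}. 2) \<le> (\<Sum>l\<in>?idle - {label s r}. degree s T l)"
    using leaf touched_less[OF inv ok] by (intro sum_mono) (auto simp: no_idle_leaf_def active_def)
  also have "\<dots> \<le> (\<Sum>l\<in>?idle. degree s T l)" using finite_touched by (intro sum_mono2) auto
  finally have idle: "2 * card ?idle \<le> 2 + (\<Sum>l\<in>?idle. degree s T l)"
    using root finite_touched by (simp add: card_Diff_singleton)
  have "(\<Sum>e\<leftarrow>T. of_bool (label s (fst e) \<in> active s) + of_bool (label s (snd e) \<in> active s))
    = (\<Sum>l\<in>touched s T \<inter> active s. degree s T l)"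
    unfolding sum_degree[OF finite_Int[OF disjI1[OF finite_touched]]]
    by (rule arg_cong[where f = sum_list], rule map_cong) (auto simp: touched_def edge_in_verts)
  moreover have "(\<Sum>l\<in>touched s T. degree s T l) = (\<Sum>l\<in>touched s T \<inter> active s. degree s T l) + (\<Sum>l\<in>?idle. degree s T l)"
    by (rule sum.Int_Diff[OF finite_touched])
  moreover have "card (touched s T) = card (touched s T \<inter> active s) + card ?idle"
    by (rule card_Int_Diff[OF finite_touched])
  ultimately show ?thesis using idle card sum_degree_touched[of s T] by linarith
qed

subsubsection \<open>Undoing a growth step\<close>

lemma touched_grow [simp]: "touched (grow env s) T = touched s T" by (simp add: touched_def)

lemma sum_reduced_cost_grow:
  assumes "dual_inv s y" "edges_ok s T"
  shows "(\<Sum>e\<leftarrow>T. reduced_cost s e) = (\<Sum>e\<leftarrow>T. reduced_cost (grow env s) e) +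
    2 * int (step_size env s) * int (\<Sum>e\<leftarrow>T. of_bool (label s (fst e) \<in> active s) + of_bool (label s (snd e) \<in> active s))"
  using assms(2)
proof (induction T)
  case (Cons e T)
  have "fst e < n" "snd e < n" using Cons.prems by (auto simp: edges_ok_def)
  then have "width (grow env s) (fst e) = width s (fst e) + step_size env s * of_bool (label s (fst e) \<in> active s)"
    "width (grow env s) (snd e) = width s (snd e) + step_size env s * of_bool (label s (snd e) \<in> active s)"
    by (simp_all add: width_grow[OF assms(1)])
  then show ?case using Cons by (simp add: edges_ok_def reduced_cost_def algebra_simps)
qed simp

lemma unpaid_grow: "unpaid s T = unpaid (grow env s) T + int (step_size env s) * int (card (active s - touched s T))"
proof -
  let ?e = "step_size env s" and ?S = "{..<n} - touched s T"
  have "unpaid s T = (\<Sum>l\<in>?S. int (residual (grow env s) l) + (if l \<in> active s then int ?e else 0))"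
    unfolding unpaid_def
  proof (rule sum.cong)
    fix l assume "l \<in> ?S"
    then show "int (residual s l) = int (residual (grow env s) l) + (if l \<in> active s then int ?e else 0)"
      using step_size_le_residual[of l s] by (auto simp: residual_grow active_def of_nat_diff)
  qed simp
  also have "?S \<inter> active s = active s - touched s T" by (auto simp: active_def)
  then have "(\<Sum>l\<in>?S. int (residual (grow env s) l) + (if l \<in> active s then int ?e else 0)) =
      unpaid (grow env s) T + int ?e * int (card (active s - touched s T))"
    by (simp add: sum.distrib sum.If_cases unpaid_def mult.commute)
  finally show ?thesis .
qed

lemma no_idle_leaf_grow:
  assumes "dual_inv s y" "edges_ok s T" "no_idle_leaf (grow env s) T"
  shows "no_idle_leaf s T"
  using assms(3) touched_less[OF assms(1,2)] by (auto simp: no_idle_leaf_def degree_def residual_grow)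

lemma tree_inv_grow:
  assumes inv: "dual_inv s y" and tree: "tree_inv (grow env s) T Y"
  shows "tree_inv s T (step_size env s * card (active s) + Y)"
proof -
  let ?e = "step_size env s"
  let ?ends = "\<Sum>e\<leftarrow>T. of_bool (label s (fst e) \<in> active s) + of_bool (label s (snd e) \<in> active s) :: nat"
  have ok: "edges_ok s T" and card: "card (touched s T) = Suc (length T)" and conn: "connected_to_root s T"
    using tree by (auto simp: tree_inv_def edges_ok_def connected_to_root_def closed_under_def)
  have leaf: "no_idle_leaf s T" using no_idle_leaf_grow[OF inv ok] tree by (simp add: tree_inv_def)
  have "card (active s) = card (touched s T \<inter> active s) + card (active s - touched s T)"
    using card_Int_Diff[OF finite_active, of s "touched s T"] by (simp add: Int_commute)
  then have "2 * ?ends + 2 * card (active s - touched s T) \<le> 4 * card (active s)"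
    using active_degree_le[OF inv ok card leaf] by linarith
  then have "int ?e * int (2 * ?ends + 2 * card (active s - touched s T)) \<le> int ?e * int (4 * card (active s))"
    by (intro mult_left_mono) (simp_all only: of_nat_le_iff of_nat_0_le_iff)
  moreover have "(\<Sum>e\<leftarrow>T. reduced_cost (grow env s) e) + 2 * unpaid (grow env s) T \<le> 4 * int Y"
    using tree by (simp add: tree_inv_def)
  ultimately have "(\<Sum>e\<leftarrow>T. reduced_cost s e) + 2 * unpaid s T \<le> 4 * int (?e * card (active s) + Y)"
    unfolding sum_reduced_cost_grow[OF inv ok] unpaid_grow[of s T] by (simp add: algebra_simps)
  then show ?thesis using ok card leaf conn by (simp add: tree_inv_def)
qed

subsubsection \<open>Undoing a merge\<close>

context
  fixes t :: pd_state and y :: "nat set \<Rightarrow> nat" and x x' :: nat and T :: "(nat \<times> nat) list"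
  assumes inv: "dual_inv t y" and x: "x < n" and x': "x' < n" and labels_neq: "label t x \<noteq> label t x'"
    and active_x: "label t x \<in> active t" and ok_merged: "edges_ok (merged t x x') T"
begin

lemmas merge_hyps = inv x x' labels_neq active_x

lemma touches_iff: "touches (fst t) (tree_vertices r T) v \<longleftrightarrow> label t v \<in> touched t T"
  unfolding touches_def touched_def image_iff by metis

lemma edges_ok_unmerge: "edges_ok t T"
  using ok_merged label_merged[OF merge_hyps] unfolding edges_ok_def by metis

lemma degree_merged:
  assumes "l \<noteq> label t x" "l \<noteq> label t x'"
  shows "degree (merged t x x') T l = degree t T l"
  unfolding degree_def
  by (rule arg_cong[where f = sum_list], rule map_cong)
    (use ok_merged label_merged[OF merge_hyps] assms in \<open>auto simp: edges_ok_def\<close>)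

lemma reduced_cost_merged: "reduced_cost (merged t x x') = reduced_cost t"
  by (rule ext) (simp add: reduced_cost_def width_merged[OF merge_hyps])

lemma touched_merged: "touched (merged t x x') T =
    (if label t x' \<in> touched t T then insert (label t x) (touched t T - {label t x'}) else touched t T)"
proof -
  have "touched (merged t x x') T = (\<lambda>l. if l = label t x' then label t x else l) ` touched t T"
    unfolding touched_def image_image
    by (rule image_cong) (use label_merged[OF merge_hyps] verts_less[OF ok_merged] in auto)
  then show ?thesis by (auto simp: image_iff)
qed

lemma sum_residual_merged:
  assumes "S \<subseteq> {..<n} - {label t x, label t x'}"
  shows "(\<Sum>l\<in>S. int (residual (merged t x x') l)) = (\<Sum>l\<in>S. int (residual t l))"
proof (rule sum.cong)
  fix l assume "l \<in> S"
  then have "l < n" "l \<noteq> label t x" "l \<noteq> label t x'" using assms by auto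
  then show "int (residual (merged t x x') l) = int (residual t l)" by (simp add: residual_merged[OF merge_hyps])
qed simp

lemma degree_ge_2_of_merged:
  assumes leaf: "no_idle_leaf (merged t x x') T" and "l \<in> touched (merged t x x') T" "l < n"
    and l: "l \<noteq> label t x" "l \<noteq> label t x'" "l \<noteq> label t r" "residual t l = 0"
  shows "2 \<le> degree t T l"
proof -
  have "l \<noteq> label (merged t x x') r" using l label_merged[OF merge_hyps r] by auto
  moreover have "residual (merged t x x') l = 0" using l residual_merged[OF merge_hyps \<open>l < n\<close>] by simp
  ultimately have "2 \<le> degree (merged t x x') T l" using leaf assms(2) by (simp add: no_idle_leaf_def)
  then show ?thesis by (simp add: degree_merged[OF l(1,2)])
qed

context
  assumes used: "label t x \<in> touched t T \<or> label t x' \<in> touched t T"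
    and keep: "label t x' \<in> touched t T \<or> 0 < residual t (label t x')"
begin

lemma touched_keep: "touched t ((x, x') # T) = insert (label t x') (touched (merged t x x') T)"
  "label t x' \<notin> touched (merged t x x') T" "label t x \<in> touched (merged t x x') T"
  using used labels_neq by (auto simp: touched_merged) (auto simp: touched_def verts_Cons)

lemma edges_ok_keep: "edges_ok t ((x, x') # T)"
  using edges_ok_unmerge x x' labels_neq by (auto simp: edges_ok_def)

lemma no_idle_leaf_keep:
  assumes "no_idle_leaf (merged t x x') T"
  shows "no_idle_leaf t ((x, x') # T)"
  unfolding no_idle_leaf_def
proof (intro ballI impI)
  fix l assume l: "l \<in> touched t ((x, x') # T)" "l \<noteq> label t r" "residual t l = 0"
  have neq: "l \<noteq> label t x" using residual_x_pos[OF merge_hyps] l by auto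
  show "2 \<le> degree t ((x, x') # T) l"
  proof (cases "l = label t x'")
    case True
    then obtain v where v: "v \<in> verts T" "label t v = l" using keep l(3) by (auto simp: touched_def)
    then obtain e where e: "e \<in> set T" "v = fst e \<or> v = snd e" using l(2) by (auto simp: set_tree_vertices)
    have "1 \<le> (of_bool (label t (fst e) = l) + of_bool (label t (snd e) = l) :: nat)" using e v by auto
    also have "\<dots> \<le> degree t T l" unfolding degree_def using e(1) by (intro member_le_sum_list) auto
    finally show ?thesis using True labels_neq by (simp add: degree_def)
  next
    case False
    then have "l \<in> touched (merged t x x') T" using touched_keep(1) l(1) by simp
    then have "2 \<le> degree t T l"
      using degree_ge_2_of_merged[OF assms] touched_less[OF inv edges_ok_keep l(1)] neq False l by blast
    then show ?thesis by (simp add: degree_def)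
  qed
qed

lemma closed_under_keep:
  assumes Q: "closed_under t ((x, x') # T) Q"
  shows "closed_under (merged t x x') T Q" "v \<in> Q \<Longrightarrow> label t v \<in> {label t x, label t x'} \<Longrightarrow> x \<in> Q"
proof -
  have iff: "x \<in> Q \<longleftrightarrow> x' \<in> Q" using Q by (simp add: closed_under_def)
  show mem: "x \<in> Q" if "v \<in> Q" "label t v \<in> {label t x, label t x'}" for v
  proof -
    have "x \<in> component t (label t v) \<or> x' \<in> component t (label t v)" using that x x' by (auto simp: component_def)
    then show ?thesis using Q that(1) iff unfolding closed_under_def by blast
  qed
  have "component (merged t x x') (label (merged t x x') v) \<subseteq> Q" if v: "v \<in> Q" for v
  proof -
    have less: "v < n" using Q v by (auto simp: closed_under_def)
    have comp: "component t (label t u) \<subseteq> Q" if "u \<in> Q" for u using Q that by (simp add: closed_under_def)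
    show ?thesis
    proof (cases "label t v \<in> {label t x, label t x'}")
      case True
      then have "component t (label t x) \<subseteq> Q" "component t (label t x') \<subseteq> Q" using comp mem[OF v True] iff by blast+
      then show ?thesis using label_merged[OF merge_hyps less] component_merged[OF merge_hyps] True by auto
    next
      case False
      then show ?thesis using label_merged[OF merge_hyps less] component_merged[OF merge_hyps] comp[OF v] by auto
    qed
  qed
  then show "closed_under (merged t x x') T Q" using Q by (simp add: closed_under_def)
qed

lemma connected_keep:
  assumes "connected_to_root (merged t x x') T"
  shows "connected_to_root t ((x, x') # T)"
  unfolding connected_to_root_def
proof (intro allI impI)
  fix Q assume Q: "closed_under t ((x, x') # T) Q"
  have sub: "verts T \<subseteq> Q" using assms closed_under_keep(1)[OF Q] by (simp add: connected_to_root_def)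
  obtain v where "v \<in> verts T" "label t v \<in> {label t x, label t x'}" using used by (auto simp: touched_def)
  then have "x \<in> Q" using sub closed_under_keep(2)[OF Q] by blast
  moreover from this have "x' \<in> Q" using Q by (simp add: closed_under_def)
  ultimately show "verts ((x, x') # T) \<subseteq> Q" using sub by (simp add: verts_Cons)
qed

lemma unpaid_keep: "unpaid (merged t x x') T = unpaid t ((x, x') # T)"
proof -
  let ?S = "{..<n} - touched t ((x, x') # T)"
  have "{..<n} - touched (merged t x x') T = insert (label t x') ?S" "label t x' \<notin> ?S"
    using touched_keep labels_less[OF merge_hyps] by auto
  then have "unpaid (merged t x x') T
    = int (residual (merged t x x') (label t x')) + (\<Sum>l\<in>?S. int (residual (merged t x x') l))"
    by (simp add: unpaid_def)
  also have "\<dots> = (\<Sum>l\<in>?S. int (residual t l))"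
    using sum_residual_merged[of ?S] touched_keep residual_merged[OF merge_hyps labels_less(2)[OF merge_hyps]]
      labels_neq by auto
  finally show ?thesis by (simp add: unpaid_def)
qed

lemma tree_inv_keep:
  assumes tree: "tree_inv (merged t x x') T Y" and tight: "w x x' \<le> 2 * (width t x + width t x')"
  shows "tree_inv t ((x, x') # T) Y"
proof -
  have "card (touched t ((x, x') # T)) = Suc (length ((x, x') # T))"
    using touched_keep finite_touched tree by (simp add: tree_inv_def)
  moreover have "reduced_cost t (x, x') \<le> 0" using tight by (simp add: reduced_cost_def)
  ultimately show ?thesis
    using tree edges_ok_keep no_idle_leaf_keep connected_keep unpaid_keep
      by (simp add: tree_inv_def reduced_cost_merged)
qed

end

context
  assumes drop: "\<not> ((label t x \<in> touched t T \<or> label t x' \<in> touched t T) \<and> (label t x' \<in> touched t T \<or> 0 < residual t (label t x')))"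
begin

lemma touched_drop: "label t x' \<notin> touched t T" "touched (merged t x x') T = touched t T"
  using drop touched_merged by auto

lemma no_idle_leaf_drop:
  assumes "no_idle_leaf (merged t x x') T"
  shows "no_idle_leaf t T"
  unfolding no_idle_leaf_def
proof (intro ballI impI)
  fix l assume l: "l \<in> touched t T" "l \<noteq> label t r" "residual t l = 0"
  then show "2 \<le> degree t T l"
    using degree_ge_2_of_merged[OF assms] touched_less[OF inv edges_ok_unmerge l(1)] touched_drop
      residual_x_pos[OF merge_hyps]
    by (metis less_irrefl)
qed

text \<open>The dropped component contains no tree vertex, so it may be added to or removed from a closed set.\<close>

lemma closed_under_drop:
  assumes Q: "closed_under t T Q"
  defines "Q' \<equiv> if x \<in> Q then Q \<union> component t (label t x') else Q - component t (label t x')"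
  shows "closed_under (merged t x x') T Q'" "v \<in> verts T \<Longrightarrow> v \<in> Q' \<longleftrightarrow> v \<in> Q"
proof -
  have "v \<notin> component t (label t x')" if "v \<in> verts T" for v
    using touched_drop(1) that unfolding touched_def component_def
      by (metis (mono_tags, lifting) image_eqI mem_Collect_eq)
  then show mem: "v \<in> Q' \<longleftrightarrow> v \<in> Q" if "v \<in> verts T" for v using that by (auto simp: Q'_def)
  have comp: "component t (label t v) \<subseteq> Q" if "v \<in> Q" for v using Q that by (simp add: closed_under_def)
  have sub: "Q' \<subseteq> {..<n}" using Q by (auto simp: Q'_def component_def closed_under_def)
  have "component (merged t x x') (label (merged t x x') v) \<subseteq> Q'" if v: "v \<in> Q'" for v
  proof -
    have less: "v < n" using sub v by auto
    show ?thesis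
    proof (cases "label t v \<in> {label t x, label t x'}")
      case True
      have "x \<in> Q"
      proof (rule ccontr)
        assume "x \<notin> Q"
        then have "v \<in> Q" "label t v = label t x" using v less True by (auto simp: Q'_def component_def)
        moreover from this(2) have "x \<in> component t (label t v)" using x by (simp add: component_def)
        ultimately show False using comp \<open>x \<notin> Q\<close> by blast
      qed
      then show ?thesis using label_merged[OF merge_hyps less] component_merged[OF merge_hyps] True comp
        by (auto simp: Q'_def)
    next
      case False
      then have "v \<in> Q" using v by (auto simp: Q'_def component_def split: if_splits)
      then have "component t (label t v) \<subseteq> Q" by (rule comp)
      moreover have "component t (label t v) \<inter> component t (label t x') = {}" using False by (auto simp: component_def)
      ultimately show ?thesis
        using label_merged[OF merge_hyps less] component_merged[OF merge_hyps] False by (auto simp: Q'_def)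
    qed
  qed
  moreover have "r \<in> Q'" using mem[OF root_in_verts] Q by (simp add: closed_under_def)
  moreover have "fst e \<in> Q' \<longleftrightarrow> snd e \<in> Q'" if "e \<in> set T" for e
    using Q that mem edge_in_verts[OF that] by (simp add: closed_under_def)
  ultimately show "closed_under (merged t x x') T Q'" using sub by (simp add: closed_under_def)
qed

lemma connected_drop:
  assumes "connected_to_root (merged t x x') T"
  shows "connected_to_root t T"
  using assms closed_under_drop unfolding connected_to_root_def by blast

lemma unpaid_drop: "unpaid (merged t x x') T = unpaid t T"
proof -
  let ?a = "label t x" and ?b = "label t x'" and ?S = "{..<n} - touched t T"
  have b: "?b \<in> ?S" "residual (merged t x x') ?b = 0"
    using touched_drop(1) labels_less[OF merge_hyps] residual_merged[OF merge_hyps] labels_neq by auto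
  have remove: "(\<Sum>l\<in>?S. int (f l)) = int (f ?b) + (\<Sum>l\<in>?S - {?b}. int (f l))" for f
    by (rule sum.remove) (use b in auto)
  have "(\<Sum>l\<in>?S. int (residual (merged t x x') l)) = (\<Sum>l\<in>?S. int (residual t l))"
  proof (cases "?a \<in> touched t T")
    case True
    then have "residual t ?b = 0" using drop by auto
    moreover have "(\<Sum>l\<in>?S - {?b}. int (residual (merged t x x') l)) = (\<Sum>l\<in>?S - {?b}. int (residual t l))"
      by (rule sum_residual_merged) (use True in auto)
    ultimately show ?thesis unfolding remove using b(2) by simp
  next
    case False
    have remove2: "(\<Sum>l\<in>?S - {?b}. int (f l)) = int (f ?a) + (\<Sum>l\<in>?S - {?b} - {?a}. int (f l))" for f
      by (rule sum.remove) (use False labels_neq labels_less[OF merge_hyps] in auto)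
    have "label t r \<noteq> ?b" using touched_drop(1) root_in_verts unfolding touched_def by (metis image_eqI)
    then have "residual (merged t x x') ?a = residual t ?a + residual t ?b"
      using residual_merged[OF merge_hyps labels_less(1)[OF merge_hyps]] by auto
    moreover have "(\<Sum>l\<in>?S - {?b} - {?a}. int (residual (merged t x x') l)) = (\<Sum>l\<in>?S - {?b} - {?a}. int (residual t l))"
      by (rule sum_residual_merged) auto
    ultimately show ?thesis unfolding remove remove2 using b(2) by simp
  qed
  then show ?thesis by (simp add: unpaid_def touched_drop(2))
qed

lemma tree_inv_drop: "tree_inv (merged t x x') T Y \<Longrightarrow> tree_inv t T Y"
  using edges_ok_unmerge no_idle_leaf_drop connected_drop unpaid_drop
  by (simp add: tree_inv_def touched_drop(2) reduced_cost_merged)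

end

lemma tree_inv_select_edge:
  assumes "tree_inv (merged t x x') T Y" "w x x' \<le> 2 * (width t x + width t x')"
  shows "tree_inv t (select_edge r T (fst t, (x, x'), is_active t x')) Y"
proof (cases "(label t x \<in> touched t T \<or> label t x' \<in> touched t T) \<and> (label t x' \<in> touched t T \<or> 0 < residual t (label t x'))")
  case True
  then show ?thesis using tree_inv_keep assms by (simp add: select_edge_def touches_iff is_active_def)
next
  case False
  then have "select_edge r T (fst t, (x, x'), is_active t x') = T"
    by (auto simp: select_edge_def touches_iff is_active_def)
  then show ?thesis using tree_inv_drop[OF False assms(1)] by simp
qed

end

fun total_growth :: "nat \<Rightarrow> pd_state \<Rightarrow> nat" where
  "total_growth 0 s = 0"
| "total_growth (Suc k) s = step_size env s * card (active s) + total_growth k (pd_step env s)"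

lemma tree_inv_kept_edges:
  "dual_inv s y \<Longrightarrow> active ((pd_step env ^^ k) s) = {} \<Longrightarrow> tree_inv s (kept_edges env k s) (total_growth k s)"
proof (induction k arbitrary: s y)
  case 0
  then show ?case using tree_inv_final by simp
next
  case (Suc k)
  have IH: "tree_inv (pd_step env s) (kept_edges env k (pd_step env s)) (total_growth k (pd_step env s))"
    by (rule Suc.IH[OF dual_inv_step[OF Suc.prems(1)]]) (use Suc.prems(2) in \<open>simp add: funpow_swap1\<close>)
  have "tree_inv (grow env s) (kept_edges env (Suc k) s) (total_growth k (pd_step env s))"
    using Suc.prems(1)
  proof (cases rule: pd_step_cases)
    case grow
    then show ?thesis using IH by simp
  next
    case (merge x x')
    have "tree_inv (grow env s) (select_edge r T (fst (grow env s), (x, x'), is_active (grow env s) x')) Y"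
      if tree: "tree_inv (pd_step env s) T Y" for T Y
    proof -
      have "edges_ok (merge_components env (grow env s) (x, x')) T" using tree merge(1) by (simp add: tree_inv_def)
      from tree_inv_select_edge[OF dual_inv_grow[OF Suc.prems(1)] merge(3-6) this tree[unfolded merge(1)] merge(7)]
      show ?thesis .
    qed
    from this[OF IH] show ?thesis using merge(2) by simp
  qed
  then show ?case using tree_inv_grow[OF Suc.prems(1)] by simp
qed

lemma dual_value_total_growth:
  "dual_inv s y \<Longrightarrow> \<exists>y'. dual_inv ((pd_step env ^^ k) s) y' \<and> dual_value n y' = dual_value n y + total_growth k s"
proof (induction k arbitrary: s y)
  case (Suc k)
  obtain y' where "dual_inv ((pd_step env ^^ k) (pd_step env s)) y'"
    "dual_value n y' = dual_value n (grown s y) + total_growth k (pd_step env s)"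
    using Suc.IH[OF dual_inv_step[OF Suc.prems]] by blast
  then show ?case using moat_sum_grown[OF Suc.prems, of "\<lambda>_. True"] by (intro exI[of _ y']) (simp add: funpow_swap1)
qed auto

lemma feasible_dual_of_dual_inv: "dual_inv s y \<Longrightarrow> feasible_dual n r w z y"
  unfolding feasible_dual_def
  using moat_subset[of s y] moat_sum_separates_le[of s y] add_leD1[OF moat_sum_subset_le[of s y]] by auto

end

definition rooted_tree :: "nat \<Rightarrow> nat \<Rightarrow> (nat \<times> nat) list \<Rightarrow> bool" where
  "rooted_tree n r T \<longleftrightarrow> (\<forall>e\<in>set T. fst e < n \<and> snd e < n) \<and>
     (\<forall>P\<subseteq>{..<n}. r \<in> P \<longrightarrow> (\<forall>e\<in>set T. fst e \<in> P \<longleftrightarrow> snd e \<in> P) \<longrightarrow> set (tree_vertices r T) \<subseteq> P)"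

context primal_dual
begin

lemma active_final_empty:
  assumes "\<And>v. v < n \<Longrightarrow> nth_default 0 ps v = z v"
  shows "active ((pd_step env ^^ (2 * n)) (init_state env ps)) = {}"
proof (rule active_steps_empty[OF dual_inv_init[OF assms]])
  let ?s = "init_state env ps"
  have "card (label ?s ` {..<n}) \<le> n" using card_image_le[of "{..<n}" "label ?s"] by simp
  moreover have "card (active ?s) \<le> n" using card_mono[of "{..<n}" "active ?s"] by (auto simp: active_def)
  ultimately show "potential ?s \<le> 2 * n" by (simp add: potential_def)
qed

lemma tree_inv_pd_edges:
  assumes "\<And>v. v < n \<Longrightarrow> nth_default 0 ps v = z v"
  shows "tree_inv (init_state env ps) (pd_edges env ps) (total_growth (2 * n) (init_state env ps))"
  unfolding pd_edges_eq_kept_edges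
  using tree_inv_kept_edges[OF dual_inv_init[OF assms] active_final_empty[OF assms]] by simp

theorem rooted_tree_pd_edges:
  assumes "\<And>v. v < n \<Longrightarrow> nth_default 0 ps v = z v"
  shows "rooted_tree n r (pd_edges env ps)"
proof -
  let ?s = "init_state env ps" and ?T = "pd_edges env ps"
  note tree = tree_inv_pd_edges[OF assms]
  have "closed_under ?s ?T P" if "P \<subseteq> {..<n}" "r \<in> P" "\<forall>e\<in>set ?T. fst e \<in> P \<longleftrightarrow> snd e \<in> P" for P
    using that init_state_simps[OF assms] by (auto simp: closed_under_def component_def)
  then show ?thesis using tree by (simp add: rooted_tree_def tree_inv_def edges_ok_def connected_to_root_def)
qed

theorem pd_edges_cost:
  assumes "\<And>v. v < n \<Longrightarrow> nth_default 0 ps v = z v"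
  obtains y where "feasible_dual n r w z y"
    "(\<Sum>e\<leftarrow>pd_edges env ps. w (fst e) (snd e)) + 2 * (\<Sum>v\<in>{..<n} - verts (pd_edges env ps). z v) \<le> 4 * dual_value n y"
proof -
  let ?s = "init_state env ps" and ?T = "pd_edges env ps"
  note init = init_state_simps[OF assms] and tree = tree_inv_pd_edges[OF assms]
  obtain y where y: "dual_inv ((pd_step env ^^ (2 * n)) ?s) y" "dual_value n y = total_growth (2 * n) ?s"
    using dual_value_total_growth[OF dual_inv_init[OF assms], of "2 * n"] by (auto simp: moat_sum_def)
  have ok: "edges_ok ?s ?T" using tree by (simp add: tree_inv_def)
  have "touched ?s ?T = verts ?T" unfolding touched_def using init verts_less[OF ok] by force
  then have unpaid: "unpaid ?s ?T = int (\<Sum>v\<in>{..<n} - verts ?T. z v)" by (simp add: unpaid_def init)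
  have "\<forall>e\<in>set T. fst e < n \<and> snd e < n \<Longrightarrow> (\<Sum>e\<leftarrow>T. reduced_cost ?s e) = int (\<Sum>e\<leftarrow>T. w (fst e) (snd e))" for T
    by (induction T) (auto simp: reduced_cost_def init)
  then have cost: "(\<Sum>e\<leftarrow>?T. reduced_cost ?s e) = int (\<Sum>e\<leftarrow>?T. w (fst e) (snd e))"
    using ok by (simp add: edges_ok_def)
  have "(\<Sum>e\<leftarrow>?T. reduced_cost ?s e) + 2 * unpaid ?s ?T \<le> 4 * int (dual_value n y)"
    using tree by (simp add: tree_inv_def y(2))
  then have "(\<Sum>e\<leftarrow>?T. w (fst e) (snd e)) + 2 * (\<Sum>v\<in>{..<n} - verts ?T. z v) \<le> 4 * dual_value n y"
    unfolding unpaid cost by linarith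
  then show ?thesis using that feasible_dual_of_dual_inv[OF y(1)] by blast
qed

end

section \<open>From a tree to a tour\<close>

definition insert_after :: "nat \<Rightarrow> nat \<Rightarrow> nat list \<Rightarrow> nat list" where
  "insert_after x y zs = concat (map (\<lambda>z. if z = x then [x, y] else [z]) zs)"

definition attach_edge :: "nat list \<Rightarrow> nat \<times> nat \<Rightarrow> nat list" where
  "attach_edge zs e = (if fst e \<in> set zs \<and> snd e \<notin> set zs then insert_after (fst e) (snd e) zs
     else if snd e \<in> set zs \<and> fst e \<notin> set zs then insert_after (snd e) (fst e) zs else zs)"

text \<open>Every pass over the edges enlarges the tour until it covers the tree, hence one pass per vertex suffices.\<close>

definition tree_tour :: "nat list \<Rightarrow> nat \<Rightarrow> (nat \<times> nat) list \<Rightarrow> nat list" where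
  "tree_tour vs r T = foldl attach_edge [r] (concat (map (\<lambda>_. T) vs))"

lemma insert_after_split:
  assumes "x \<notin> set as" "x \<notin> set bs"
  shows "insert_after x y (as @ x # bs) = as @ x # y # bs"
proof -
  have "x \<notin> set zs \<Longrightarrow> concat (map (\<lambda>z. if z = x then [x, y] else [z]) zs) = zs" for zs by (induction zs) auto
  then show ?thesis using assms by (simp add: insert_after_def)
qed

lemma insert_after_props:
  assumes "distinct zs" "x \<in> set zs" "y \<notin> set zs"
  shows "set (insert_after x y zs) = insert y (set zs)" "distinct (insert_after x y zs)"
    "length (insert_after x y zs) = Suc (length zs)" "hd (insert_after x y zs) = hd zs"
proof -
  obtain as bs where zs: "zs = as @ x # bs" using assms(2) by (meson split_list)
  then have "insert_after x y zs = as @ x # y # bs" using assms(1) insert_after_split by simp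
  then show "set (insert_after x y zs) = insert y (set zs)" "distinct (insert_after x y zs)"
    "length (insert_after x y zs) = Suc (length zs)" "hd (insert_after x y zs) = hd zs"
    using assms zs by (auto simp: hd_append)
qed

context apriori
begin

definition inner_weight :: "(nat \<times> nat) list \<Rightarrow> nat set \<Rightarrow> real" where
  "inner_weight T Z = (\<Sum>e\<leftarrow>T. of_bool (fst e \<in> Z \<and> snd e \<in> Z) * d (fst e) (snd e))"

lemma inner_weight_append: "inner_weight (T @ T') Z = inner_weight T Z + inner_weight T' Z"
  by (simp add: inner_weight_def)

lemma inner_weight_insert:
  assumes T: "\<forall>e\<in>set T. fst e < n \<and> snd e < n" and e: "e \<in> set T"
    and xy: "e = (x, y) \<or> e = (y, x)" "x \<in> Z" "y \<notin> Z"
  shows "inner_weight T Z + d x y \<le> inner_weight T (insert y Z)"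
proof -
  obtain as bs where split: "T = as @ [e] @ bs" using e split_list by fastforce
  have mono: "inner_weight es Z \<le> inner_weight es (insert y Z)" if "set es \<subseteq> set T" for es
    unfolding inner_weight_def using that T nonneg by (intro sum_list_mono mult_right_mono) auto
  have "inner_weight [e] Z + d x y \<le> inner_weight [e] (insert y Z)"
    using xy T e sym by (auto simp: inner_weight_def)
  moreover have "inner_weight as Z \<le> inner_weight as (insert y Z)" "inner_weight bs Z \<le> inner_weight bs (insert y Z)"
    by (rule mono; auto simp: split)+
  ultimately show ?thesis unfolding split inner_weight_append by linarith
qed

lemma walk_len_insert_after:
  assumes "set zs \<subseteq> {..<n}" "distinct zs" "x \<in> set zs" "y < n"
  shows "walk_len d (insert_after x y zs @ [r]) \<le> walk_len d (zs @ [r]) + 2 * d x y"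
proof -
  obtain as bs where zs: "zs = as @ x # bs" using assms(3) by (meson split_list)
  then have insert: "insert_after x y zs = as @ x # y # bs" using assms(2) insert_after_split by simp
  obtain u us where u: "bs @ [r] = u # us" "u < n" using assms(1) r zs by (cases bs) auto
  have "x < n" using assms by auto
  have "walk_len d (insert_after x y zs @ [r]) = walk_len d (as @ [x]) + walk_len d (x # y # u # us)"
    unfolding insert using walk_len_append[of d as x "y # bs @ [r]"] u(1) by simp
  also have "\<dots> \<le> walk_len d (as @ [x]) + (2 * d x y + walk_len d (x # u # us))"
    using tri[OF \<open>y < n\<close> \<open>x < n\<close> u(2)] sym[OF \<open>x < n\<close> \<open>y < n\<close>] by simp
  also have "\<dots> = walk_len d (zs @ [r]) + 2 * d x y"
    unfolding zs using walk_len_append[of d as x "bs @ [r]"] u(1) by simp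
  finally show ?thesis .
qed

definition tour_inv :: "(nat \<times> nat) list \<Rightarrow> nat list \<Rightarrow> bool" where
  "tour_inv T zs \<longleftrightarrow> hd zs = r \<and> r \<in> set zs \<and> distinct zs \<and> set zs \<subseteq> set (tree_vertices r T) \<and>
     walk_len d (zs @ [r]) \<le> 2 * inner_weight T (set zs)"

lemma tour_inv_subset: "\<forall>e\<in>set T. fst e < n \<and> snd e < n \<Longrightarrow> tour_inv T zs \<Longrightarrow> set zs \<subseteq> {..<n}"
  using r by (fastforce simp: tour_inv_def tree_vertices_def)

lemma tour_inv_insert_after:
  assumes T: "\<forall>e\<in>set T. fst e < n \<and> snd e < n" and inv: "tour_inv T zs" and e: "e \<in> set T"
    and xy: "e = (x, y) \<or> e = (y, x)" "x \<in> set zs" "y \<notin> set zs"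
  shows "tour_inv T (insert_after x y zs)"
proof -
  have distinct: "distinct zs" using inv by (simp add: tour_inv_def)
  note props = insert_after_props[OF distinct xy(2,3)]
  have y: "y < n" "y \<in> set (tree_vertices r T)" using e xy(1) T by (force simp: tree_vertices_def)+
  have "walk_len d (insert_after x y zs @ [r]) \<le> walk_len d (zs @ [r]) + 2 * d x y"
    by (rule walk_len_insert_after[OF tour_inv_subset[OF T inv] distinct xy(2) y(1)])
  also have "\<dots> \<le> 2 * inner_weight T (insert y (set zs))"
    using inv inner_weight_insert[OF T e xy] by (simp add: tour_inv_def)
  finally show ?thesis using inv y(2) props by (simp add: tour_inv_def)
qed

lemma attach_edge_props:
  assumes T: "\<forall>e\<in>set T. fst e < n \<and> snd e < n" and inv: "tour_inv T zs" and e: "e \<in> set T"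
  shows "tour_inv T (attach_edge zs e)" "set zs \<subseteq> set (attach_edge zs e)"
    "(fst e \<in> set zs) \<noteq> (snd e \<in> set zs) \<Longrightarrow> set (attach_edge zs e) \<noteq> set zs"
proof -
  have "tour_inv T (attach_edge zs e) \<and> set zs \<subseteq> set (attach_edge zs e) \<and>
    ((fst e \<in> set zs) \<noteq> (snd e \<in> set zs) \<longrightarrow> set (attach_edge zs e) \<noteq> set zs)"
  proof (cases "fst e \<in> set zs \<longleftrightarrow> snd e \<in> set zs")
    case True
    then show ?thesis using inv by (auto simp: attach_edge_def)
  next
    case False
    then obtain x y where xy: "e = (x, y) \<or> e = (y, x)" "x \<in> set zs" "y \<notin> set zs"
      and attach: "attach_edge zs e = insert_after x y zs"
      unfolding attach_edge_def by (metis prod.collapse)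
    have "distinct zs" using inv by (simp add: tour_inv_def)
    then show ?thesis
      unfolding attach using tour_inv_insert_after[OF T inv e xy] insert_after_props(1)[OF _ xy(2,3)] xy(3) by blast
  qed
  then show "tour_inv T (attach_edge zs e)" "set zs \<subseteq> set (attach_edge zs e)"
    "(fst e \<in> set zs) \<noteq> (snd e \<in> set zs) \<Longrightarrow> set (attach_edge zs e) \<noteq> set zs" by blast+
qed

lemma attach_edges_props:
  assumes T: "\<forall>e\<in>set T. fst e < n \<and> snd e < n" and "tour_inv T zs" and "set es \<subseteq> set T"
  shows "tour_inv T (foldl attach_edge zs es) \<and> set zs \<subseteq> set (foldl attach_edge zs es) \<and>
    (set (foldl attach_edge zs es) = set zs \<longrightarrow> (\<forall>e\<in>set es. fst e \<in> set zs \<longleftrightarrow> snd e \<in> set zs))"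
  using assms(2,3)
proof (induction es arbitrary: zs)
  case (Cons e es)
  have e: "e \<in> set T" using Cons.prems by auto
  note attach = attach_edge_props[OF T Cons.prems(1) e]
  have IH: "tour_inv T (foldl attach_edge (attach_edge zs e) es)"
    "set (attach_edge zs e) \<subseteq> set (foldl attach_edge (attach_edge zs e) es)"
    "set (foldl attach_edge (attach_edge zs e) es) = set (attach_edge zs e) \<longrightarrow>
      (\<forall>e'\<in>set es. fst e' \<in> set (attach_edge zs e) \<longleftrightarrow> snd e' \<in> set (attach_edge zs e))"
    using Cons.IH[OF attach(1)] Cons.prems by auto
  show ?case
  proof (intro conjI impI)
    show "tour_inv T (foldl attach_edge zs (e # es))" "set zs \<subseteq> set (foldl attach_edge zs (e # es))"
      using IH attach(2) by auto
    assume "set (foldl attach_edge zs (e # es)) = set zs"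
    then have "set (attach_edge zs e) = set zs" "set (foldl attach_edge (attach_edge zs e) es) = set (attach_edge zs e)"
      using IH(2) attach(2) by auto
    then show "\<forall>e'\<in>set (e # es). fst e' \<in> set zs \<longleftrightarrow> snd e' \<in> set zs" using IH(3) attach(3) by auto
  qed
qed simp

lemma attach_passes:
  assumes T: "\<forall>e\<in>set T. fst e < n \<and> snd e < n"
  defines "zs k \<equiv> ((\<lambda>zs. foldl attach_edge zs T) ^^ k) [r]"
  shows "tour_inv T (zs k) \<and> ((\<forall>e\<in>set T. fst e \<in> set (zs k) \<longleftrightarrow> snd e \<in> set (zs k)) \<or> k < card (set (zs k)))"
proof (induction k)
  case 0
  have "0 \<le> inner_weight T {r}" unfolding inner_weight_def using T nonneg by (intro sum_list_nonneg) auto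
  then show ?case using refl[OF r] by (simp add: zs_def tour_inv_def tree_vertices_def)
next
  case (Suc k)
  have next_pass: "zs (Suc k) = foldl attach_edge (zs k) T" by (simp add: zs_def)
  have inv: "tour_inv T (zs k)" using Suc by blast
  note pass = attach_edges_props[OF T inv, of T]
  show ?case
  proof (cases "\<forall>e\<in>set T. fst e \<in> set (zs k) \<longleftrightarrow> snd e \<in> set (zs k)")
    case True
    have "foldl attach_edge (zs k) es = zs k" if "set es \<subseteq> set T" for es
      using that by (induction es) (use True in \<open>auto simp: attach_edge_def\<close>)
    then show ?thesis using inv True by (simp add: next_pass)
  next
    case False
    then have "set (zs k) \<subset> set (zs (Suc k))" using pass next_pass by auto
    then have "card (set (zs k)) < card (set (zs (Suc k)))" by (intro psubset_card_mono) auto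
    then show ?thesis using pass False Suc next_pass by auto
  qed
qed

lemma tree_tour_correct:
  assumes "rooted_tree n r T"
  defines "zs \<equiv> tree_tour [0..<n] r T"
  shows "hd zs = r" "distinct zs" "set zs = set (tree_vertices r T)"
    "walk_len d (zs @ [r]) \<le> 2 * (\<Sum>e\<leftarrow>T. d (fst e) (snd e))"
proof -
  have T: "\<forall>e\<in>set T. fst e < n \<and> snd e < n" using assms by (simp add: rooted_tree_def)
  have "foldl attach_edge ws (concat (map (\<lambda>_. T) ks)) = ((\<lambda>zs. foldl attach_edge zs T) ^^ length ks) ws"
    for ws and ks :: "nat list"
    by (induction ks arbitrary: ws) (simp_all add: funpow_Suc_right del: funpow.simps(2))
  from this[of "[r]" "[0..<n]"] have zs: "zs = ((\<lambda>zs. foldl attach_edge zs T) ^^ n) [r]"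
    by (simp add: zs_def tree_tour_def)
  have inv: "tour_inv T zs" using attach_passes[OF T, of n] zs by simp
  note sub = tour_inv_subset[OF T inv]
  have "\<not> n < card (set zs)" using card_mono[OF _ sub] by simp
  then have "\<forall>e\<in>set T. fst e \<in> set zs \<longleftrightarrow> snd e \<in> set zs" using attach_passes[OF T, of n] zs by simp
  then have "set (tree_vertices r T) \<subseteq> set zs" using assms sub inv by (simp add: rooted_tree_def tour_inv_def)
  then show "set zs = set (tree_vertices r T)" "hd zs = r" "distinct zs" using inv by (auto simp: tour_inv_def)
  have "inner_weight T (set zs) \<le> (\<Sum>e\<leftarrow>T. d (fst e) (snd e))"
    unfolding inner_weight_def using T nonneg by (intro sum_list_mono) auto
  then show "walk_len d (zs @ [r]) \<le> 2 * (\<Sum>e\<leftarrow>T. d (fst e) (snd e))" using inv by (simp add: tour_inv_def)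
qed

end

section \<open>Summation over geometric scales\<close>

lemma telescope_below:
  fixes B :: "nat \<Rightarrow> real"
  assumes "mono B" "0 \<le> B 0" "0 \<le> x"
  shows "(\<Sum>j\<le>J. (B j - (if j = 0 then 0 else B (j - 1))) * of_bool (B j \<le> x)) \<le> x"
proof (induction J)
  case 0
  then show ?case using assms by (simp add: of_bool_def)
next
  case (Suc J)
  show ?case
  proof (cases "B (Suc J) \<le> x")
    case True
    have "(\<Sum>j\<le>K. (B j - (if j = 0 then 0 else B (j - 1))) * of_bool (B j \<le> x)) = B K" if "K \<le> Suc J" for K
      using that
    proof (induction K)
      case 0
      then show ?case using True monoD[OF assms(1), of 0 "Suc J"] by auto
    next
      case (Suc K)
      then show ?case using True monoD[OF assms(1), of "Suc K" "Suc J"] by auto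
    qed
    from this[of "Suc J"] show ?thesis using True by simp
  next
    case False
    then show ?thesis using Suc by simp
  qed
qed

locale staircase =
  fixes m :: nat and l q :: "nat \<Rightarrow> real"
  assumes l_nonneg: "\<And>i. i < m \<Longrightarrow> 0 \<le> l i" and l_mono: "\<And>i j. i \<le> j \<Longrightarrow> j < m \<Longrightarrow> l i \<le> l j"
    and q_nonneg: "\<And>i. i < m \<Longrightarrow> 0 \<le> q i"
begin

definition mass_from :: "nat \<Rightarrow> real" where "mass_from k = (\<Sum>i\<in>{k..<m}. q i)"

text \<open>The height at which the ray of slope \<open>1/t\<close> meets the boundary of the region below the
  staircase \<open>l k \<mapsto> mass_from k\<close>.\<close>

definition crossing :: "real \<Rightarrow> real" where
  "crossing t = Max (insert 0 ((\<lambda>k. min (l k) (t * mass_from k)) ` {..<m}))"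

lemma mass_from_nonneg: "0 \<le> mass_from k"
  unfolding mass_from_def by (intro sum_nonneg) (use q_nonneg in auto)

lemma crossing_nonneg: "0 \<le> crossing t"
  unfolding crossing_def by (rule Max_ge) auto

lemma crossing_ge: "k < m \<Longrightarrow> min (l k) (t * mass_from k) \<le> crossing t"
  unfolding crossing_def by (rule Max_ge) auto

lemma crossing_le:
  assumes "0 \<le> x" "\<And>k. k < m \<Longrightarrow> min (l k) (t * mass_from k) \<le> x"
  shows "crossing t \<le> x"
  unfolding crossing_def using assms by (intro Max.boundedI) auto

lemma crossing_attained:
  obtains "crossing t = 0" | k where "k < m" "crossing t = min (l k) (t * mass_from k)"
proof -
  have "crossing t \<in> insert 0 ((\<lambda>k. min (l k) (t * mass_from k)) ` {..<m})"
    unfolding crossing_def by (rule Max_in) auto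
  then show ?thesis using that by blast
qed

lemma crossing_mono:
  assumes "s \<le> t"
  shows "crossing s \<le> crossing t"
proof (rule crossing_le[OF crossing_nonneg])
  fix k assume k: "k < m"
  have "s * mass_from k \<le> t * mass_from k" using assms mass_from_nonneg by (rule mult_right_mono)
  then show "min (l k) (s * mass_from k) \<le> crossing t" using crossing_ge[OF k, of t] by linarith
qed

lemma crossing_scale:
  assumes "1 \<le> c"
  shows "crossing (c * t) \<le> c * crossing t"
proof (rule crossing_le)
  show "0 \<le> c * crossing t" using assms crossing_nonneg by simp
  fix k assume k: "k < m"
  have "l k \<le> c * l k" using assms l_nonneg[OF k] mult_right_mono[of 1 c "l k"] by simp
  then have "min (l k) (c * t * mass_from k) \<le> min (c * l k) (c * (t * mass_from k))"
    by (intro min.mono) (auto simp: mult.assoc)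
  also have "\<dots> = c * min (l k) (t * mass_from k)" using assms by (simp add: min_mult_distrib_left)
  also have "\<dots> \<le> c * crossing t" using crossing_ge[OF k] assms by (intro mult_left_mono) auto
  finally show "min (l k) (c * t * mass_from k) \<le> c * crossing t" .
qed

lemma crossing_split:
  obtains k where "k \<le> m" "\<And>i. i < k \<Longrightarrow> l i \<le> crossing t" "t * mass_from k \<le> crossing t"
proof -
  define k where "k = (LEAST k. k = m \<or> crossing t < l k)"
  have k: "k = m \<or> crossing t < l k" unfolding k_def by (rule LeastI[of _ m]) simp
  have "k \<le> m" unfolding k_def by (rule Least_le) simp
  moreover have "l i \<le> crossing t" if "i < k" for i using not_less_Least[OF that[unfolded k_def]] by simp
  moreover have "t * mass_from k \<le> crossing t"
  proof (cases "k = m")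
    case True
    then show ?thesis using crossing_nonneg by (simp add: mass_from_def)
  next
    case False
    then show ?thesis using k \<open>k \<le> m\<close> crossing_ge[of k t] by auto
  qed
  ultimately show ?thesis using that by blast
qed

lemma crossing_slope:
  assumes "0 < t"
  shows "crossing t / t \<le> (\<Sum>k<m. q k * of_bool (crossing t \<le> l k))"
proof (cases rule: crossing_attained[of t])
  case 1
  then show ?thesis using q_nonneg by (auto intro!: sum_nonneg)
next
  case (2 k)
  then have "crossing t \<le> l k" "crossing t / t \<le> mass_from k" using assms by (auto simp: field_simps)
  note this(2)
  also have "mass_from k = (\<Sum>i\<in>{k..<m}. q i * of_bool (crossing t \<le> l i))"
    unfolding mass_from_def
  proof (rule sum.cong)
    fix i assume "i \<in> {k..<m}"
    then have "l k \<le> l i" by (intro l_mono) auto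
    then show "q i = q i * of_bool (crossing t \<le> l i)" using \<open>crossing t \<le> l k\<close> by simp
  qed simp
  also have "\<dots> \<le> (\<Sum>i<m. q i * of_bool (crossing t \<le> l i))" by (rule sum_mono2) (use q_nonneg in auto)
  finally show ?thesis .
qed

definition increment :: "nat \<Rightarrow> real" where
  "increment j = crossing (16 ^ j) - (if j = 0 then 0 else crossing (16 ^ (j - 1)))"

lemma increment_nonneg: "0 \<le> increment j"
  using crossing_mono[of "16 ^ (j - 1)" "16 ^ j"] crossing_nonneg by (auto simp: increment_def power_increasing)

lemma sum_increment_area_le: "(\<Sum>j\<le>J. increment j * (crossing (16 ^ j) / 16 ^ j)) \<le> (\<Sum>k<m. q k * l k)"
proof -
  let ?B = "\<lambda>j. crossing (16 ^ j)"
  have "(\<Sum>j\<le>J. increment j * (?B j / 16 ^ j)) \<le> (\<Sum>j\<le>J. increment j * (\<Sum>k<m. q k * of_bool (?B j \<le> l k)))"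
    using increment_nonneg by (intro sum_mono mult_left_mono crossing_slope) auto
  also have "\<dots> = (\<Sum>j\<le>J. \<Sum>k<m. q k * (increment j * of_bool (?B j \<le> l k)))"
    unfolding sum_distrib_left by (intro sum.cong) (simp_all only: mult.left_commute)
  also have "\<dots> = (\<Sum>k<m. q k * (\<Sum>j\<le>J. increment j * of_bool (?B j \<le> l k)))"
    unfolding sum_distrib_left by (rule sum.swap)
  also have "\<dots> \<le> (\<Sum>k<m. q k * l k)"
  proof (intro sum_mono mult_left_mono)
    fix k assume k: "k \<in> {..<m}"
    then show "0 \<le> q k" using q_nonneg by auto
    have "mono ?B" by (rule monoI, rule crossing_mono) (auto intro: power_increasing)
    then show "(\<Sum>j\<le>J. increment j * of_bool (?B j \<le> l k)) \<le> l k"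
      unfolding increment_def using l_nonneg crossing_nonneg k by (intro telescope_below) auto
  qed
  finally show ?thesis .
qed

definition scaled_square :: "nat \<Rightarrow> real" where
  "scaled_square j = (crossing (16 ^ j))\<^sup>2 / 16 ^ j"

lemma scaled_square_nonneg: "0 \<le> scaled_square j" by (simp add: scaled_square_def)

lemma scaled_square_0: "scaled_square 0 = increment 0 * (crossing (16 ^ 0) / 16 ^ 0)"
  by (simp add: scaled_square_def increment_def power2_eq_square)

lemma scaled_square_Suc_le:
  "scaled_square (Suc i) \<le> 2 * (increment (Suc i) * (crossing (16 ^ Suc i) / 16 ^ Suc i)) + scaled_square i / 4"
proof -
  let ?b = "crossing (16 ^ i)" and ?c = "crossing (16 ^ Suc i)"
  have nonneg: "0 \<le> ?b" "0 \<le> ?c" by (rule crossing_nonneg)+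
  show ?thesis
  proof (cases "2 * ?b \<le> ?c")
    case True
    then have "?c / 2 * (?c / 16 ^ Suc i) \<le> increment (Suc i) * (?c / 16 ^ Suc i)"
      using nonneg by (intro mult_right_mono) (auto simp: increment_def)
    moreover have "?c / 2 * (?c / 16 ^ Suc i) = scaled_square (Suc i) / 2"
      by (simp add: scaled_square_def power2_eq_square)
    ultimately show ?thesis using scaled_square_nonneg[of i] by linarith
  next
    case False
    then have "?c\<^sup>2 \<le> (2 * ?b)\<^sup>2" using nonneg by (intro power_mono) auto
    then have "scaled_square (Suc i) \<le> (2 * ?b)\<^sup>2 / 16 ^ Suc i" unfolding scaled_square_def
      by (rule divide_right_mono) simp
    also have "\<dots> = scaled_square i / 4" by (simp add: scaled_square_def power_mult_distrib field_simps)
    also have "\<dots> \<le> 2 * (increment (Suc i) * (?c / 16 ^ Suc i)) + scaled_square i / 4"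
      using increment_nonneg[of "Suc i"] nonneg by simp
    finally show ?thesis .
  qed
qed

lemma sum_scaled_square_le: "(\<Sum>j\<le>J. scaled_square j) \<le> 3 * (\<Sum>k<m. q k * l k)"
proof -
  have "(\<Sum>j\<le>J. scaled_square j) \<le> 2 * (\<Sum>j\<le>J. increment j * (crossing (16 ^ j) / 16 ^ j)) + (\<Sum>j<J. scaled_square j) / 4"
  proof (induction J)
    case 0
    then show ?case using scaled_square_nonneg[of 0] by (simp add: scaled_square_0 mult.commute)
  next
    case (Suc J)
    have "(\<Sum>j<Suc J. scaled_square j) / 4 = (\<Sum>j<J. scaled_square j) / 4 + scaled_square J / 4" by simp
    then show ?case using Suc scaled_square_Suc_le[of J] unfolding sum.atMost_Suc distrib_left by linarith
  qed
  moreover have "(\<Sum>j<J. scaled_square j) \<le> (\<Sum>j\<le>J. scaled_square j)"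
    by (rule sum_mono2) (auto simp: scaled_square_nonneg)
  moreover have "0 \<le> (\<Sum>k<m. q k * l k)" using q_nonneg l_nonneg by (intro sum_nonneg) auto
  ultimately show ?thesis using sum_increment_area_le[of J] by linarith
qed

end

section \<open>Concatenating stages into one master tour\<close>

definition snoc_new :: "nat list \<Rightarrow> nat \<Rightarrow> nat list" where
  "snoc_new xs a = (if a \<in> set xs then xs else xs @ [a])"

lemma foldl_snoc_new_prefix: "\<exists>zs. foldl snoc_new ys xs = ys @ zs \<and> subseq zs xs"
proof (induction xs arbitrary: ys)
  case (Cons a xs)
  obtain zs where zs: "foldl snoc_new (snoc_new ys a) xs = snoc_new ys a @ zs" "subseq zs xs" using Cons by blast
  show ?case
  proof (cases "a \<in> set ys")
    case True
    then have "snoc_new ys a = ys" by (simp add: snoc_new_def)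
    then show ?thesis using zs by (intro exI[of _ zs]) auto
  next
    case False
    then have "snoc_new ys a = ys @ [a]" by (simp add: snoc_new_def)
    then show ?thesis using zs by (intro exI[of _ "a # zs"]) auto
  qed
qed simp

lemma distinct_foldl_snoc_new: "distinct ys \<Longrightarrow> distinct (foldl snoc_new ys xs)"
  by (induction xs arbitrary: ys) (auto simp: snoc_new_def)

lemma set_foldl_snoc_new: "set (foldl snoc_new ys xs) = set ys \<union> set xs"
  by (induction xs arbitrary: ys) (auto simp: snoc_new_def)

definition stage :: "nat list \<Rightarrow> (nat \<Rightarrow> nat \<Rightarrow> bool) \<Rightarrow> nat list \<Rightarrow> nat list" where
  "stage vs Q Tr = concat (map (\<lambda>a. filter (\<lambda>v. Q v a) vs) Tr)"

lemma sum_UN_le: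
  fixes f :: "'a \<Rightarrow> real"
  assumes "finite K" "\<And>k. k \<in> K \<Longrightarrow> finite (A k)" "\<And>k x. k \<in> K \<Longrightarrow> x \<in> A k \<Longrightarrow> 0 \<le> f x"
  shows "(\<Sum>x\<in>(\<Union>k\<in>K. A k). f x) \<le> (\<Sum>k\<in>K. \<Sum>x\<in>A k. f x)"
  using assms
proof (induction K rule: finite_induct)
  case (insert k K)
  have "0 \<le> (\<Sum>x\<in>A k \<inter> (\<Union>k\<in>K. A k). f x)" using insert.prems(2) by (intro sum_nonneg) auto
  moreover have "(\<Sum>x\<in>A k \<union> (\<Union>k\<in>K. A k). f x) =
      (\<Sum>x\<in>A k. f x) + (\<Sum>x\<in>(\<Union>k\<in>K. A k). f x) - (\<Sum>x\<in>A k \<inter> (\<Union>k\<in>K. A k). f x)"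
    using insert by (intro sum_Un) auto
  ultimately show ?case using insert by force
qed simp

context apriori
begin

lemma walk_len_stutter:
  assumes "set (x # T) \<subseteq> {..<n}" "\<And>a. a \<in> set T \<Longrightarrow> set (f a) \<subseteq> {a}" "set ws \<subseteq> {..<n}"
  shows "walk_len d (x # concat (map f T) @ ws) \<le> walk_len d (x # T @ ws)"
  using assms(1,2)
proof (induction T arbitrary: x)
  case (Cons a T)
  have repeat: "walk_len d (a # us @ zs) = walk_len d (a # zs)" if "set us \<subseteq> {a}" for us zs
    using that by (induction us) (use refl Cons.prems in auto)
  have f: "set (f a) \<subseteq> {a}" using Cons.prems by auto
  have "set (concat (map f T) @ ws) \<subseteq> {..<n}" using Cons.prems assms(3) by fastforce
  then have "walk_len d (x # f a @ concat (map f T) @ ws) \<le> walk_len d (x # a # f a @ concat (map f T) @ ws)"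
    using Cons.prems f by (intro walk_len_drop_second) auto
  also have "\<dots> = d x a + walk_len d (a # concat (map f T) @ ws)" using repeat[OF f] by simp
  also have "\<dots> \<le> d x a + walk_len d (a # T @ ws)" using Cons.IH[of a] Cons.prems by auto
  finally show ?case by simp
qed simp

lemma walk_len_concat_tours:
  assumes "\<And>T. T \<in> set Ts \<Longrightarrow> set T \<subseteq> {..<n} \<and> (\<exists>ws. T = r # ws)"
  shows "walk_len d (r # concat Ts) \<le> (\<Sum>T\<leftarrow>Ts. walk_len d (T @ [r]))"
  using assms
proof (induction Ts)
  case (Cons T Ts)
  have "set T \<subseteq> {..<n} \<and> (\<exists>ws. T = r # ws)" using Cons.prems by simp
  then obtain ws where T: "T = r # ws" "set T \<subseteq> {..<n}" by blast
  have sub: "set (concat Ts) \<subseteq> {..<n}" using Cons.prems by fastforce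
  have "walk_len d (r # T @ concat Ts) \<le> walk_len d (r # T @ r # concat Ts)"
    by (rule walk_len_subseq_Cons) (use T sub r in \<open>auto intro: list_emb_append_mono\<close>)
  also have "\<dots> = walk_len d (r # T @ [r]) + walk_len d (r # concat Ts)"
    using walk_len_append[of d "r # T" r "concat Ts"] by simp
  also have "walk_len d (r # T @ [r]) = walk_len d (T @ [r])" using T refl[OF r] by simp
  finally show ?case using Cons by simp
qed simp

end

locale centre_map = apriori +
  fixes c :: "nat \<Rightarrow> nat"
  assumes c_less: "\<And>v. v < n \<Longrightarrow> c v < n" and c_root: "c r = r"
begin

lemma dist_centre_nonneg: "v < n \<Longrightarrow> 0 \<le> d v (c v)"
  using nonneg c_less by blast

end

locale staged_tour = centre_map +
  fixes lam :: "nat \<Rightarrow> real" and Tr :: "nat \<Rightarrow> nat list" and J :: nat and xs :: "nat list"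
  assumes tour: "\<And>j. set (Tr j) \<subseteq> {..<n} \<and> (\<exists>ws. Tr j = r # ws)"
    and all_served: "\<And>v. v < n \<Longrightarrow> c v \<in> set (Tr J) \<and> d v (c v) \<le> lam J"
    and xs: "r # xs = foldl snoc_new [r]
      (concat (map (\<lambda>j. stage [0..<n] (\<lambda>v a. c v = a \<and> d v a \<le> lam j) (Tr j)) [0..<Suc J]) @ [0..<n])"
begin

definition served :: "nat \<Rightarrow> nat set" where
  "served j = {v. v < n \<and> c v \<in> set (Tr j) \<and> d v (c v) \<le> lam j}"

definition stage_cost :: "nat \<Rightarrow> real" where
  "stage_cost j = walk_len d (Tr j @ [r]) + 2 * (\<Sum>u\<in>served j. p u * d u (c u))"

definition pending_mass :: "nat \<Rightarrow> real" where
  "pending_mass j = (\<Sum>v\<in>{v. v < n \<and> (j = 0 \<or> v \<notin> served (j - 1))}. p v)"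

abbreviation stage_list :: "nat \<Rightarrow> nat list" where
  "stage_list j \<equiv> stage [0..<n] (\<lambda>v a. c v = a \<and> d v a \<le> lam j) (Tr j)"

lemma served_subset: "served j \<subseteq> {..<n}" by (auto simp: served_def)

lemma set_stage_list: "set (stage_list j) = served j"
  unfolding stage_def served_def by auto

lemma stage_cost_nonneg: "0 \<le> stage_cost j"
  unfolding stage_cost_def using tour[of j] r prob dist_centre_nonneg served_subset[of j]
  by (intro add_nonneg_nonneg walk_len_nonneg mult_nonneg_nonneg sum_nonneg) auto

lemma distinct_xs: "distinct xs" and set_xs: "set xs = {..<n} - {r}"
proof -
  have "distinct (r # xs)" unfolding xs by (rule distinct_foldl_snoc_new) simp
  moreover have "set (r # xs) = {..<n}"
    unfolding xs set_foldl_snoc_new using r set_stage_list served_subset by (auto simp: lessThan_def)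
  ultimately show "distinct xs" "set xs = {..<n} - {r}" by auto
qed

lemma xs_less: "set (take k xs) \<subseteq> {..<n}"
  using set_take_subset[of k xs] set_xs by auto

lemma subseq_prefix_stages:
  assumes i: "i < length xs" and j: "xs ! i \<in> served j" "j \<le> J"
  shows "subseq (take (Suc i) xs) (concat (map stage_list [0..<Suc j]))"
proof -
  let ?stages = "concat (map stage_list [0..<Suc j])"
  have "[0..<Suc J] = [0..<Suc j] @ [Suc j..<Suc J]"
    using j(2) upt_add_eq_append[of 0 "Suc j" "J - j"] by (simp del: upt_Suc)
  then have tail: "r # xs = foldl snoc_new (foldl snoc_new [r] ?stages) (concat (map stage_list [Suc j..<Suc J]) @ [0..<n])"
    using xs by (simp del: upt_Suc)
  obtain zs where zs: "r # xs = foldl snoc_new [r] ?stages @ zs"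
    unfolding tail using foldl_snoc_new_prefix by blast
  obtain us where us: "foldl snoc_new [r] ?stages = r # us" "subseq us ?stages"
    using foldl_snoc_new_prefix[of "[r]" ?stages] by auto
  have split: "xs = us @ zs" using zs us(1) by simp
  have "xs ! i \<in> set ?stages" using j(1) set_stage_list by (auto simp del: upt_Suc)
  moreover have "xs ! i \<noteq> r" using set_xs nth_mem[OF i] by auto
  ultimately have "xs ! i \<in> set us"
    using set_foldl_snoc_new[of "[r]" ?stages] us(1) by auto
  have "i < length us"
  proof (rule ccontr)
    assume "\<not> i < length us"
    then have "xs ! i \<in> set zs" using i split by (simp add: nth_append)
    then show False using \<open>xs ! i \<in> set us\<close> distinct_xs split by auto
  qed
  then have take: "take (Suc i) xs = take (Suc i) us" using split by simp
  show ?thesis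
    unfolding take using us(2) subseq_order.order_trans[OF prefix_imp_subseq[OF take_is_prefix]] by blast
qed

lemma walk_len_stage_centres:
  assumes "x < n"
  shows "walk_len d (x # map c (concat (map stage_list ks))) \<le> walk_len d (x # concat (map Tr ks))"
  using assms
proof (induction ks arbitrary: x)
  case (Cons k ks)
  let ?f = "\<lambda>a. map c (filter (\<lambda>v. c v = a \<and> d v a \<le> lam k) [0..<n])"
  let ?rest = "map c (concat (map stage_list ks))"
  have rest: "set ?rest \<subseteq> {..<n}" using set_stage_list served_subset c_less by fastforce
  have "map c (stage_list k) = concat (map ?f (Tr k))" unfolding stage_def by (simp add: map_concat comp_def)
  then have "walk_len d (x # map c (concat (map stage_list (k # ks))))
    = walk_len d (x # concat (map ?f (Tr k)) @ ?rest)" by simp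
  also have "\<dots> \<le> walk_len d (x # Tr k @ ?rest)"
    by (rule walk_len_stutter) (use tour[of k] rest Cons.prems in auto)
  also have "\<dots> \<le> walk_len d (x # Tr k @ concat (map Tr ks))"
  proof -
    obtain ys b where b: "x # Tr k = ys @ [b]" "b < n"
      using Cons.prems tour[of k] by (metis append_butlast_last_id last_in_set lessThan_iff list.distinct(1) set_ConsD subsetD)
    have "walk_len d (x # Tr k @ zs) = walk_len d (ys @ [b]) + walk_len d (b # zs)" for zs
      using walk_len_append[of d ys b zs] b(1) by (metis append_Cons append_assoc append_Nil)
    then show ?thesis using Cons.IH[OF b(2)] by simp
  qed
  finally show ?case by simp
qed simp

lemma walk_len_prefix:
  assumes i: "i < length xs" and j: "xs ! i \<in> served j" "j \<le> J"
  defines "X \<equiv> set (take (Suc i) xs) - {xs ! i}"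
  shows "walk_len d (r # filter (\<lambda>u. u \<in> insert (xs ! i) A) (take (Suc i) xs)) \<le>
    (\<Sum>k\<le>j. walk_len d (Tr k @ [r])) + 2 * d (xs ! i) (c (xs ! i)) + 2 * (\<Sum>u\<in>X. of_bool (u \<in> A) * d u (c u))"
proof -
  let ?v = "xs ! i" and ?zs = "filter (\<lambda>u. u \<in> insert (xs ! i) A) (take (Suc i) xs)"
  let ?stages = "concat (map stage_list [0..<Suc j])"
  have "walk_len d (r # ?zs) \<le> walk_len d (r # map c ?zs) + 2 * (\<Sum>u\<leftarrow>?zs. d u (c u))"
    by (rule walk_len_map_le(2)) (use xs_less[of "Suc i"] c_less c_root in auto)
  also have "(\<Sum>u\<leftarrow>?zs. d u (c u)) = (\<Sum>u\<in>set ?zs. d u (c u))"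
    using distinct_xs by (simp add: sum_list_distinct_conv_sum_set)
  also have "\<dots> = d ?v (c ?v) + (\<Sum>u\<in>set ?zs - {?v}. d u (c u))"
    using i by (intro sum.remove) (auto simp: take_Suc_conv_app_nth)
  also have "(\<Sum>u\<in>set ?zs - {?v}. d u (c u)) = (\<Sum>u\<in>X. of_bool (u \<in> A) * d u (c u))"
    unfolding X_def by (rule sum.mono_neutral_cong_left) auto
  also have "walk_len d (r # map c ?zs) \<le> walk_len d (r # map c ?stages)"
  proof (rule walk_len_subseq_Cons)
    show "subseq (map c ?zs) (map c ?stages)"
      using subseq_prefix_stages[OF assms(1-3)] subseq_filter_left subseq_map subseq_order.order_trans by blast
    show "set (map c ?stages) \<subseteq> {..<n}" using set_stage_list served_subset c_less by (fastforce simp del: upt_Suc)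
  qed (rule r)
  also have "\<dots> \<le> walk_len d (r # concat (map Tr [0..<Suc j]))" by (rule walk_len_stage_centres[OF r])
  also have "\<dots> \<le> (\<Sum>T\<leftarrow>map Tr [0..<Suc j]. walk_len d (T @ [r]))"
    by (rule walk_len_concat_tours) (use tour in auto)
  also have "\<dots> = (\<Sum>k\<le>j. walk_len d (Tr k @ [r]))"
    by (simp add: interv_sum_list_conv_sum_set_nat atLeast0LessThan lessThan_Suc_atMost comp_def del: upt_Suc)
  finally show ?thesis by (simp add: algebra_simps)
qed

lemma E_walk_len_prefix:
  assumes i: "i < length xs" and j: "xs ! i \<in> served j" "j \<le> J"
  shows "E (\<lambda>A. walk_len d (r # filter (\<lambda>u. u \<in> insert (xs ! i) A) (take (Suc i) xs))) \<le>
    (\<Sum>k\<le>j. stage_cost k) + 2 * d (xs ! i) (c (xs ! i))"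
proof -
  let ?v = "xs ! i" and ?X = "set (take (Suc i) xs) - {xs ! i}"
  have "?X \<subseteq> set (concat (map stage_list [0..<Suc j]))"
    using list_emb_set[OF subseq_prefix_stages[OF assms]] by blast
  then have X: "?X \<subseteq> (\<Union>k\<in>{..j}. served k)" using set_stage_list by (auto simp: less_Suc_eq_le simp del: upt_Suc)
  have "E (\<lambda>A. walk_len d (r # filter (\<lambda>u. u \<in> insert ?v A) (take (Suc i) xs))) \<le>
      E (\<lambda>A. (\<Sum>k\<le>j. walk_len d (Tr k @ [r])) + 2 * d ?v (c ?v) + 2 * (\<Sum>u\<in>?X. of_bool (u \<in> A) * d u (c u)))"
    by (rule E_mono) (rule walk_len_prefix[OF assms])
  also have "\<dots> = (\<Sum>k\<le>j. walk_len d (Tr k @ [r])) + 2 * d ?v (c ?v) + 2 * (\<Sum>u\<in>?X. p u * d u (c u))"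
  proof -
    have "?X \<subseteq> {..<n}" using xs_less by blast
    then show ?thesis unfolding expectation_add expectation_cmult
      by (subst E_sum_indicator) (simp_all add: expectation_const)
  qed
  also have "(\<Sum>u\<in>?X. p u * d u (c u)) \<le> (\<Sum>k\<le>j. \<Sum>u\<in>served k. p u * d u (c u))"
  proof -
    have "(\<Sum>u\<in>?X. p u * d u (c u)) \<le> (\<Sum>u\<in>(\<Union>k\<in>{..j}. served k). p u * d u (c u))"
      by (rule sum_mono2) (use X prob dist_centre_nonneg in \<open>auto simp: served_def\<close>)
    also have "\<dots> \<le> (\<Sum>k\<le>j. \<Sum>u\<in>served k. p u * d u (c u))"
      by (rule sum_UN_le) (use prob dist_centre_nonneg in \<open>auto simp: served_def\<close>)
    finally show ?thesis .
  qed
  finally show ?thesis by (simp add: stage_cost_def sum.distrib sum_distrib_left)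
qed

definition latency_bound :: "nat \<Rightarrow> real" where
  "latency_bound v = (\<Sum>j\<le>J. stage_cost j * of_bool (j = 0 \<or> v \<notin> served (j - 1))) + 2 * d v (c v)"

lemma E_walk_len_le_latency_bound:
  assumes i: "i < length xs"
  shows "E (\<lambda>A. walk_len d (r # filter (\<lambda>u. u \<in> insert (xs ! i) A) (take (Suc i) xs))) \<le> latency_bound (xs ! i)"
proof -
  let ?v = "xs ! i"
  have v: "?v < n" using set_xs nth_mem[OF i] by auto
  define j where "j = (LEAST j. ?v \<in> served j)"
  have J: "?v \<in> served J" using all_served[OF v] v by (simp add: served_def)
  have j: "?v \<in> served j" "j \<le> J" unfolding j_def using J by (rule LeastI, rule Least_le)
  have least: "?v \<notin> served k" if "k < j" for k using that not_less_Least unfolding j_def by blast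
  have "(\<Sum>k\<le>j. stage_cost k) = (\<Sum>k\<le>j. stage_cost k * of_bool (k = 0 \<or> ?v \<notin> served (k - 1)))"
    by (rule sum.cong) (use least in auto)
  also have "\<dots> \<le> (\<Sum>k\<le>J. stage_cost k * of_bool (k = 0 \<or> ?v \<notin> served (k - 1)))"
    by (rule sum_mono2) (use j(2) stage_cost_nonneg in auto)
  finally show ?thesis using E_walk_len_prefix[OF i j] by (simp add: latency_bound_def)
qed

lemma sum_latency_bound:
  "(\<Sum>v<n. p v * latency_bound v) = (\<Sum>j\<le>J. stage_cost j * pending_mass j) + 2 * (\<Sum>v<n. p v * d v (c v))"
proof -
  have "(\<Sum>v<n. p v * latency_bound v) =
      (\<Sum>v<n. \<Sum>j\<le>J. p v * (stage_cost j * of_bool (j = 0 \<or> v \<notin> served (j - 1)))) + 2 * (\<Sum>v<n. p v * d v (c v))"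
    by (simp add: latency_bound_def algebra_simps sum.distrib sum_distrib_left)
  also have "(\<Sum>v<n. \<Sum>j\<le>J. p v * (stage_cost j * of_bool (j = 0 \<or> v \<notin> served (j - 1)))) =
      (\<Sum>j\<le>J. \<Sum>v<n. p v * (stage_cost j * of_bool (j = 0 \<or> v \<notin> served (j - 1))))"
    by (rule sum.swap)
  also have "\<dots> = (\<Sum>j\<le>J. stage_cost j * pending_mass j)"
    unfolding pending_mass_def sum_distrib_left
    by (intro sum.cong[OF HOL.refl] sum.mono_neutral_cong_right) (auto simp: of_bool_def)
  finally show ?thesis .
qed

theorem expected_latency_stages:
  "expected_latency n r d p xs \<le> (\<Sum>j\<le>J. stage_cost j * pending_mass j) + 2 * (\<Sum>v<n. p v * d v (c v))"
proof -
  have "expected_latency n r d p xs \<le> (\<Sum>i<length xs. p (xs ! i) * latency_bound (xs ! i))"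
    unfolding expected_latency_def
  proof (intro sum_mono mult_left_mono E_walk_len_le_latency_bound)
    fix i assume "i \<in> {..<length xs}"
    then show i: "i < length xs" by simp
    have "xs ! i < n" using set_xs nth_mem[OF i] by auto
    then show "0 \<le> p (xs ! i)" using prob by blast
  qed
  also have "\<dots> = (\<Sum>v\<leftarrow>xs. p v * latency_bound v)" by (simp add: sum_list_sum_nth atLeast0LessThan)
  also have "\<dots> = (\<Sum>v\<in>{..<n} - {r}. p v * latency_bound v)"
    using set_xs distinct_xs by (simp add: sum_list_distinct_conv_sum_set)
  also have "\<dots> \<le> (\<Sum>v<n. p v * latency_bound v)"
    by (rule sum_mono2) (use prob stage_cost_nonneg dist_centre_nonneg in \<open>auto simp: latency_bound_def intro!:
      mult_nonneg_nonneg add_nonneg_nonneg sum_nonneg\<close>)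
  finally show ?thesis unfolding sum_latency_bound .
qed

end

section \<open>Lower bounds from a clustering\<close>

locale clustering = centre_map +
  fixes R :: "nat \<Rightarrow> real"
  assumes R_nonneg: "\<And>v. v < n \<Longrightarrow> 0 \<le> R v" and R_le: "\<And>v. v < n \<Longrightarrow> R v \<le> d r v"
    and light: "\<And>v. v < n \<Longrightarrow> v \<noteq> r \<Longrightarrow> (\<Sum>u\<in>punctured_ball v (R v). p u) \<le> 1 / 2"
    and dist_centre_le: "\<And>v. v < n \<Longrightarrow> d v (c v) \<le> 2 * R v"
    and heavy: "\<And>v. v < n \<Longrightarrow> c v \<noteq> r \<Longrightarrow> 1 / 2 \<le> (\<Sum>u\<in>{u. u < n \<and> c u = c v}. p u)"
begin

definition cell :: "nat \<Rightarrow> nat set" where "cell u = {v. v < n \<and> c v = u}"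

definition cell_prize :: "real \<Rightarrow> nat \<Rightarrow> real" where
  "cell_prize lam u = (if u = r then 0 else \<Sum>v\<in>cell u. p v * max 0 (lam - d v u))"

definition truncated_dist :: "real \<Rightarrow> real" where
  "truncated_dist lam = (\<Sum>v<n. p v * min lam (d v (c v)))"

lemma prob_nonneg: "v < n \<Longrightarrow> 0 \<le> p v" using prob by blast

lemma cell_prize_nonneg: "0 \<le> cell_prize lam u"
  unfolding cell_prize_def by (auto simp: cell_def prob_nonneg intro!: sum_nonneg)

lemma truncated_dist_nonneg: "0 \<le> lam \<Longrightarrow> 0 \<le> truncated_dist lam"
  unfolding truncated_dist_def by (intro sum_nonneg mult_nonneg_nonneg) (auto simp: prob_nonneg dist_centre_nonneg)

context
  fixes xo :: "nat list" and k :: nat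
  assumes xo: "set xo = {..<n} - {r}" "distinct xo"
begin

abbreviation visited :: "nat set" where "visited \<equiv> set (take k xo)"
abbreviation unvisited :: "nat set" where "unvisited \<equiv> set (drop k xo)"

lemma visited_partition: "visited \<union> unvisited = {..<n} - {r}" "visited \<inter> unvisited = {}"
  using xo by (metis append_take_drop_id set_append, metis append_take_drop_id distinct_append)

lemma visited_subset: "visited \<subseteq> {..<n} - {r}" "unvisited \<subseteq> {..<n} - {r}"
  using visited_partition(1) by auto

lemma sum_visited_dist_centre_le: "(\<Sum>v\<in>visited. p v * d v (c v)) \<le> 4 * prefix_cost xo k"
proof -
  have "(\<Sum>v\<in>visited. p v * d v (c v)) \<le> (\<Sum>v\<in>visited. p v * (2 * R v))"
    by (intro sum_mono mult_left_mono dist_centre_le prob_nonneg) (use visited_subset in auto)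
  also have "\<dots> = 2 * (\<Sum>v\<in>visited. p v * R v)" by (simp add: sum_distrib_left algebra_simps)
  also have "(\<Sum>v\<in>visited. p v * R v) \<le> 2 * prefix_cost xo k"
    by (rule prefix_cost_ge_radius) (use xo R_nonneg R_le light in auto)
  finally show ?thesis by simp
qed

lemma truncated_dist_le:
  assumes "0 \<le> lam"
  shows "truncated_dist lam \<le> 4 * prefix_cost xo k + lam * (\<Sum>v\<in>unvisited. p v)"
proof -
  have "truncated_dist lam = (\<Sum>v\<in>{..<n} - {r}. p v * min lam (d v (c v)))"
    unfolding truncated_dist_def using refl[OF r] c_root assms r by (subst sum.remove[of _ r]) auto
  also have "\<dots> = (\<Sum>v\<in>visited. p v * min lam (d v (c v))) + (\<Sum>v\<in>unvisited. p v * min lam (d v (c v)))"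
    unfolding visited_partition(1)[symmetric] by (rule sum.union_disjoint) (use visited_partition in auto)
  also have "\<dots> \<le> (\<Sum>v\<in>visited. p v * d v (c v)) + (\<Sum>v\<in>unvisited. p v * lam)"
    by (intro add_mono sum_mono mult_left_mono) (use visited_subset prob_nonneg in auto)
  also have "\<dots> \<le> 4 * prefix_cost xo k + lam * (\<Sum>v\<in>unvisited. p v)"
    using sum_visited_dist_centre_le by (simp add: sum_distrib_left mult.commute)
  finally show ?thesis .
qed

definition half_visited :: "nat \<Rightarrow> bool" where
  "half_visited u \<longleftrightarrow> u \<noteq> r \<and> u \<in> c ` {..<n} \<and> (\<Sum>v\<in>cell u. p v) \<le> 2 * (\<Sum>v\<in>{v\<in>visited. c v = u}. p v)"

lemma sum_half_visited_moats_le: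
  assumes y: "feasible_dual n r d z y"
  shows "(\<Sum>X\<in>{X\<in>Pow {..<n}. 0 < y X \<and> (\<exists>u\<in>X. half_visited u)}. y X) \<le> 45 * prefix_cost xo k"
proof -
  let ?H = "{X\<in>Pow {..<n}. 0 < y X \<and> (\<exists>u\<in>X. half_visited u)}"
  have "(\<Sum>X\<in>?H. y X) \<le> 5 * (prefix_cost xo k + 2 * (\<Sum>v\<in>visited. p v * d v (c v)))"
  proof (rule prefix_cost_ge_moats[OF y])
    fix X assume "X \<in> ?H"
    then obtain u where u: "u \<in> X" "half_visited u" by blast
    then obtain v where v: "v < n" "u = c v" by (auto simp: half_visited_def)
    have "1 / 2 \<le> (\<Sum>v\<in>cell u. p v)" using heavy[OF v(1)] u(2) v(2) by (auto simp: half_visited_def cell_def)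
    then have "1 / 4 \<le> (\<Sum>v\<in>{v\<in>visited. c v = u}. p v)" using u(2) by (auto simp: half_visited_def)
    also have "\<dots> \<le> (\<Sum>v\<in>{v\<in>visited. c v \<in> X}. p v)" by (rule sum_mono2) (use u(1) visited_subset prob_nonneg in auto)
    finally show "1 / 4 \<le> (\<Sum>v\<in>{v\<in>visited. c v \<in> X}. p v)" .
  qed (use xo c_less c_root in auto)
  then show ?thesis using sum_visited_dist_centre_le by simp
qed

lemma cell_prize_unvisited_le:
  assumes "0 \<le> lam" "u < n" "\<not> half_visited u"
  shows "cell_prize lam u \<le> 2 * (lam * (\<Sum>v\<in>{v\<in>unvisited. c v = u}. p v))"
proof (cases "u = r \<or> u \<notin> c ` {..<n}")
  case True
  then have "cell_prize lam u = 0" by (auto simp: cell_prize_def cell_def intro!: sum.neutral)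
  then show ?thesis using assms(1) visited_subset prob_nonneg by (auto intro!: mult_nonneg_nonneg sum_nonneg)
next
  case False
  have "cell_prize lam u \<le> (\<Sum>v\<in>cell u. p v * lam)"
    unfolding cell_prize_def using False prob_nonneg assms
      by (auto simp: cell_def intro!: sum_mono mult_left_mono nonneg)
  also have "\<dots> = lam * (\<Sum>v\<in>cell u. p v)" by (simp add: sum_distrib_left mult.commute)
  also have "\<dots> \<le> lam * (2 * (\<Sum>v\<in>{v\<in>unvisited. c v = u}. p v))"
  proof (rule mult_left_mono)
    have "v \<in> visited \<union> unvisited" if "v < n" "c v = u" for v
      unfolding visited_partition(1) using that False c_root by auto
    then have "cell u = {v\<in>visited. c v = u} \<union> {v\<in>unvisited. c v = u}" using visited_subset by (auto simp: cell_def)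
    then have "(\<Sum>v\<in>cell u. p v) = (\<Sum>v\<in>{v\<in>visited. c v = u}. p v) + (\<Sum>v\<in>{v\<in>unvisited. c v = u}. p v)"
      using visited_partition(2) by (simp only:) (rule sum.union_disjoint, auto)
    moreover have "\<not> (\<Sum>v\<in>cell u. p v) \<le> 2 * (\<Sum>v\<in>{v\<in>visited. c v = u}. p v)"
      using assms(3) False by (auto simp: half_visited_def)
    ultimately show "(\<Sum>v\<in>cell u. p v) \<le> 2 * (\<Sum>v\<in>{v\<in>unvisited. c v = u}. p v)" by linarith
  qed (rule assms(1))
  finally show ?thesis by simp
qed

lemma sum_cell_prize_unvisited_le:
  assumes "0 \<le> lam"
  shows "(\<Sum>u\<in>{u. u < n \<and> \<not> half_visited u}. cell_prize lam u) \<le> 2 * (lam * (\<Sum>v\<in>unvisited. p v))"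
proof -
  let ?U = "{u. u < n \<and> \<not> half_visited u}" and ?mass = "\<lambda>u. \<Sum>v\<in>{v\<in>unvisited. c v = u}. p v"
  have "(\<Sum>u\<in>?U. cell_prize lam u) \<le> (\<Sum>u\<in>?U. 2 * (lam * ?mass u))"
    by (rule sum_mono) (use assms cell_prize_unvisited_le in auto)
  also have "\<dots> = 2 * (lam * (\<Sum>u\<in>?U. ?mass u))" by (simp add: sum_distrib_left)
  also have "(\<Sum>u\<in>?U. ?mass u) \<le> (\<Sum>u<n. ?mass u)"
    by (rule sum_mono2) (use visited_subset prob_nonneg in \<open>auto intro!: sum_nonneg\<close>)
  also have "\<dots> = (\<Sum>v\<in>unvisited. p v)" by (rule sum.group) (use visited_subset c_less in auto)
  finally show ?thesis using assms by (simp add: mult_left_mono)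
qed

theorem dual_value_le:
  assumes lam: "0 \<le> lam" and y: "feasible_dual n r d (cell_prize lam) y"
  shows "dual_value n y \<le> 45 * prefix_cost xo k + 2 * (lam * (\<Sum>v\<in>unvisited. p v))"
proof -
  let ?H = "{X\<in>Pow {..<n}. 0 < y X \<and> (\<exists>u\<in>X. half_visited u)}" and ?U = "{u. u < n \<and> \<not> half_visited u}"
  have "(\<Sum>X\<in>Pow {..<n} - ?H. y X) \<le> (\<Sum>X\<in>Pow {..<n} - ?H. of_bool (X \<subseteq> ?U) * y X)"
  proof (rule sum_mono)
    fix X assume X: "X \<in> Pow {..<n} - ?H"
    show "y X \<le> of_bool (X \<subseteq> ?U) * y X"
    proof (cases "0 < y X")
      case True
      then have "X \<subseteq> ?U" using X by blast
      then show ?thesis by simp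
    next
      case False
      then have "y X = 0" using feasible_dualD(1)[OF y, of X] by linarith
      then show ?thesis by simp
    qed
  qed
  also have "\<dots> \<le> moat_sum n (\<lambda>X. X \<subseteq> ?U) y"
    unfolding moat_sum_def by (rule sum_mono2) (simp_all add: feasible_dualD(1)[OF y])
  also have "\<dots> \<le> (\<Sum>u\<in>?U. cell_prize lam u)" by (rule feasible_dualD(4)[OF y]) auto
  also have "\<dots> \<le> 2 * (lam * (\<Sum>v\<in>unvisited. p v))" by (rule sum_cell_prize_unvisited_le[OF lam])
  finally have "(\<Sum>X\<in>Pow {..<n} - ?H. y X) \<le> 2 * (lam * (\<Sum>v\<in>unvisited. p v))" .
  moreover have "dual_value n y = (\<Sum>X\<in>Pow {..<n} - ?H. y X) + (\<Sum>X\<in>?H. y X)"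
    unfolding moat_sum_def by (simp, rule sum.subset_diff) auto
  ultimately show ?thesis using sum_half_visited_moats_le[OF y] by linarith
qed

end

end

section \<open>The approximation guarantee\<close>

locale staged_solution = clustering n r d p c R + staged_tour n r d p c "\<lambda>j. 16 ^ j" Tr J xs
  for n r d p c R Tr J xs +
  fixes y :: "nat \<Rightarrow> nat set \<Rightarrow> real"
  assumes dual: "\<And>j. feasible_dual n r d (cell_prize (16 ^ j)) (y j)"
    and tour_len: "\<And>j. walk_len d (Tr j @ [r]) \<le> 8 * dual_value n (y j)"
    and missed_prize: "\<And>j. (\<Sum>u\<in>{..<n} - set (Tr j). cell_prize (16 ^ j) u) \<le> 2 * dual_value n (y j)"
    and first_tour: "walk_len d (Tr 0 @ [r]) \<le> 0"
    and short_dist: "\<And>v. v < n \<Longrightarrow> d v (c v) \<le> 1 \<Longrightarrow> d v (c v) = 0"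
begin

lemma dual_value_nonneg: "0 \<le> dual_value n (y j)"
  unfolding moat_sum_def by (intro sum_nonneg) (simp add: feasible_dualD(1)[OF dual])

lemma sum_served_dist_centre_le: "(\<Sum>u\<in>served j. p u * d u (c u)) \<le> truncated_dist (16 ^ j)"
proof -
  have "(\<Sum>u\<in>served j. p u * d u (c u)) = (\<Sum>u\<in>served j. p u * min (16 ^ j) (d u (c u)))"
    by (rule sum.cong) (auto simp: served_def)
  also have "\<dots> \<le> truncated_dist (16 ^ j)"
    unfolding truncated_dist_def by (rule sum_mono2) (use prob_nonneg dist_centre_nonneg in \<open>auto simp: served_def\<close>)
  finally show ?thesis .
qed

lemma sum_missed_cell_prize:
  "(\<Sum>u\<in>{..<n} - set (Tr j). cell_prize lam u) = (\<Sum>v\<in>{v. v < n \<and> c v \<notin> set (Tr j)}. p v * max 0 (lam - d v (c v)))"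
proof -
  let ?M = "{v. v < n \<and> c v \<notin> set (Tr j)}"
  have "cell_prize lam u = (\<Sum>v\<in>{v\<in>?M. c v = u}. p v * max 0 (lam - d v (c v)))" if u: "u \<in> {..<n} - set (Tr j)" for u
  proof -
    have "{v\<in>?M. c v = u} = cell u" "u \<noteq> r" using u tour[of j] by (auto simp: cell_def)
    then show ?thesis by (simp add: cell_prize_def cell_def)
  qed
  then have "(\<Sum>u\<in>{..<n} - set (Tr j). cell_prize lam u) =
      (\<Sum>u\<in>{..<n} - set (Tr j). \<Sum>v\<in>{v\<in>?M. c v = u}. p v * max 0 (lam - d v (c v)))"
    by (rule sum.cong[OF HOL.refl])
  also have "\<dots> = (\<Sum>v\<in>?M. p v * max 0 (lam - d v (c v)))" by (rule sum.group) (use c_less in auto)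
  finally show ?thesis .
qed

lemma pending_mass_Suc_le:
  "16 ^ i * pending_mass (Suc i) \<le> truncated_dist (16 ^ i) + 2 * dual_value n (y i)"
proof -
  let ?lam = "16 ^ i :: real"
  let ?missed = "\<lambda>v. if c v \<notin> set (Tr i) then p v * max 0 (?lam - d v (c v)) else 0"
  have "?lam * pending_mass (Suc i) = (\<Sum>v<n. if v \<notin> served i then p v * ?lam else 0)"
    by (simp add: pending_mass_def sum.If_cases sum_distrib_left mult.commute Int_def)
  also have "\<dots> \<le> (\<Sum>v<n. p v * min ?lam (d v (c v)) + ?missed v)"
  proof (rule sum_mono)
    fix v assume "v \<in> {..<n}"
    then have v: "v < n" "0 \<le> p v" "0 \<le> d v (c v)" using prob_nonneg dist_centre_nonneg by auto
    have split: "p v * min ?lam (d v (c v)) + p v * max 0 (?lam - d v (c v)) = p v * ?lam"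
      unfolding distrib_left[symmetric] by (auto simp: min_def max_def)
    consider "v \<in> served i" | "v \<notin> served i" "?lam < d v (c v)" | "v \<notin> served i" "c v \<notin> set (Tr i)"
      using v(1) by (force simp: served_def)
    then show "(if v \<notin> served i then p v * ?lam else 0) \<le> p v * min ?lam (d v (c v)) + ?missed v"
      by cases (use v split in auto)
  qed
  also have "\<dots> = truncated_dist ?lam + (\<Sum>v\<in>{v. v < n \<and> c v \<notin> set (Tr i)}. p v * max 0 (?lam - d v (c v)))"
    by (simp add: truncated_dist_def sum.distrib sum.If_cases Int_def)
  finally show ?thesis using missed_prize[of i] unfolding sum_missed_cell_prize by linarith
qed

lemma stage_cost_0: "stage_cost 0 = 0"
proof -
  have "p u * d u (c u) = 0" if "u \<in> served 0" for u using short_dist[of u] that by (auto simp: served_def)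
  then have "(\<Sum>u\<in>served 0. p u * d u (c u)) = 0" by (intro sum.neutral) auto
  moreover have "0 \<le> walk_len d (Tr 0 @ [r])" using tour[of 0] r by (intro walk_len_nonneg) auto
  ultimately show ?thesis using first_tour by (simp add: stage_cost_def)
qed

context
  fixes xo :: "nat list"
  assumes xo: "set xo = {..<n} - {r}" "distinct xo"
begin

lemma xo_subset: "set xo \<subseteq> {..<n}" using xo by auto

lemma nth_xo_less: "i < length xo \<Longrightarrow> xo ! i < n" using xo_subset nth_mem by blast

interpretation staircase "length xo" "\<lambda>i. prefix_cost xo (Suc i)" "\<lambda>i. p (xo ! i)"
proof
  show "0 \<le> prefix_cost xo (Suc i)" for i using prefix_cost_mono[OF xo_subset, of 0 "Suc i"]
    by (simp add: prefix_cost_0)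
  show "i \<le> j \<Longrightarrow> prefix_cost xo (Suc i) \<le> prefix_cost xo (Suc j)" for i j using prefix_cost_mono[OF xo_subset] by blast
  show "i < length xo \<Longrightarrow> 0 \<le> p (xo ! i)" for i using prob_nonneg nth_xo_less by blast
qed

lemma mass_from_eq:
  assumes "k \<le> length xo"
  shows "mass_from k = (\<Sum>v\<in>set (drop k xo). p v)"
proof -
  have "(\<Sum>v\<in>set (drop k xo). p v) = (\<Sum>v\<leftarrow>drop k xo. p v)" using xo(2) by (simp add: sum_list_distinct_conv_sum_set)
  also have "\<dots> = (\<Sum>i<length xo - k. p (xo ! (k + i)))" using assms by (simp add: sum_list_sum_nth atLeast0LessThan)
  also have "\<dots> = mass_from k"
    unfolding mass_from_def by (rule sum.reindex_bij_witness[of _ "\<lambda>i. i - k" "\<lambda>i. k + i"]) auto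
  finally show ?thesis by simp
qed

lemma resources_le: "8 * dual_value n (y j) + 2 * truncated_dist (16 ^ j) \<le> 736 * crossing (16 ^ j)"
proof -
  obtain k where k: "k \<le> length xo" "\<And>i. i < k \<Longrightarrow> prefix_cost xo (Suc i) \<le> crossing (16 ^ j)"
    "16 ^ j * mass_from k \<le> crossing (16 ^ j)"
    using crossing_split by blast
  have "prefix_cost xo k \<le> crossing (16 ^ j)" using k(2)[of "k - 1"] crossing_nonneg
    by (cases k) (auto simp: prefix_cost_0)
  then show ?thesis
    using dual_value_le[OF xo _ dual, of j k] truncated_dist_le[OF xo, of "16 ^ j" k] k(3) mass_from_eq[OF k(1)]
      crossing_nonneg[of "16 ^ j"]
    by simp
qed

lemma stage_cost_le: "stage_cost j \<le> 736 * crossing (16 ^ j)"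
  unfolding stage_cost_def using tour_len[of j] sum_served_dist_centre_le[of j] resources_le[of j] by linarith

lemma stage_product_le: "stage_cost (Suc i) * pending_mass (Suc i) \<le> 8667136 * scaled_square i"
proof -
  let ?b = "crossing (16 ^ i)"
  have "crossing (16 ^ Suc i) \<le> 16 * ?b" using crossing_scale[of 16 "16 ^ i"] by simp
  then have cost: "stage_cost (Suc i) \<le> 11776 * ?b" using stage_cost_le[of "Suc i"] by linarith
  have "16 ^ i * pending_mass (Suc i) \<le> 736 * ?b"
    using pending_mass_Suc_le[of i] resources_le[of i] truncated_dist_nonneg[of "16 ^ i"]
      dual_value_nonneg[of i] by simp
  then have mass: "pending_mass (Suc i) \<le> 736 * ?b / 16 ^ i" by (simp add: field_simps)
  have "stage_cost (Suc i) * pending_mass (Suc i) \<le> 11776 * ?b * (736 * ?b / 16 ^ i)"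
    by (rule mult_mono[OF cost mass])
      (use crossing_nonneg prob_nonneg in \<open>auto simp: pending_mass_def intro!: sum_nonneg\<close>)
  then show ?thesis by (simp add: scaled_square_def power2_eq_square)
qed

lemma sum_stage_products_le: "(\<Sum>j\<le>J. stage_cost j * pending_mass j) \<le> 26001408 * expected_latency n r d p xo"
proof -
  have "(\<Sum>j\<le>J. stage_cost j * pending_mass j) = (\<Sum>j<J. stage_cost (Suc j) * pending_mass (Suc j))"
    by (simp add: sum.atMost_shift stage_cost_0)
  also have "\<dots> \<le> (\<Sum>j<J. 8667136 * scaled_square j)" by (rule sum_mono) (rule stage_product_le)
  also have "\<dots> \<le> (\<Sum>j\<le>J. 8667136 * scaled_square j)" by (rule sum_mono2) (auto simp: scaled_square_nonneg)
  also have "\<dots> = 8667136 * (\<Sum>j\<le>J. scaled_square j)" by (rule sum_distrib_left[symmetric])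
  finally show ?thesis
    using sum_scaled_square_le[of J] expected_latency_ge_prefix_costs[OF xo_subset] by linarith
qed

lemma sum_dist_centre_le: "(\<Sum>v<n. p v * d v (c v)) \<le> 2 * expected_latency n r d p xo"
proof -
  have "(\<Sum>v<n. p v * d v (c v)) \<le> (\<Sum>v<n. p v * (2 * d r v))"
  proof (intro sum_mono mult_left_mono)
    fix v assume "v \<in> {..<n}"
    then show "d v (c v) \<le> 2 * d r v" "0 \<le> p v" using dist_centre_le[of v] R_le[of v] prob_nonneg by auto
  qed
  also have "\<dots> = 2 * (\<Sum>v\<in>set xo. p v * d r v)"
    using r refl[OF r] by (simp add: xo(1) sum_distrib_left sum.remove[of _ r] algebra_simps)
  also have "(\<Sum>v\<in>set xo. p v * d r v) = (\<Sum>i<length xo. p (xo ! i) * d r (xo ! i))"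
    using xo(2) by (simp add: sum_list_distinct_conv_sum_set[symmetric] sum_list_sum_nth atLeast0LessThan)
  also have "\<dots> \<le> expected_latency n r d p xo" by (rule expected_latency_ge_dists[OF xo_subset])
  finally show ?thesis by simp
qed

theorem approximation: "expected_latency n r d p xs \<le> 30000000 * expected_latency n r d p xo"
proof -
  have "0 \<le> (\<Sum>v<n. p v * d v (c v))" using prob_nonneg dist_centre_nonneg by (intro sum_nonneg mult_nonneg_nonneg) auto
  then have "0 \<le> expected_latency n r d p xo" using sum_dist_centre_le by linarith
  then show ?thesis using expected_latency_stages sum_stage_products_le sum_dist_centre_le by linarith
qed

end

end

declare One_nat_def [simp del]

section \<open>Running time of the primal-dual algorithm\<close>

lemma polytime_product [polytime_intros]:
  "polytime xs \<Longrightarrow> polytime ys \<Longrightarrow> polytime (\<lambda>x. List.product (xs x) (ys x))"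
  by (rule polytime_app2[of List.product]) (unfold product_concat_map, intro polytime_intros)

lemma polytime_dist_at [polytime_intros]:
  "polytime ds \<Longrightarrow> polytime u \<Longrightarrow> polytime v \<Longrightarrow> polytime (\<lambda>x. dist_at (ds x) (u x) (v x))"
  unfolding dist_at_def by (intro polytime_intros)

lemma polytime_is_active [polytime_intros]: "polytime s \<Longrightarrow> polytime v \<Longrightarrow> polytime (\<lambda>x. is_active (s x) (v x))"
  unfolding is_active_def by (intro polytime_intros)

lemma polytime_crossing_pairs [polytime_intros]: "polytime g \<Longrightarrow> polytime s \<Longrightarrow> polytime (\<lambda>x. crossing_pairs (g x) (s x))"
  by (rule polytime_app2[of crossing_pairs]) (unfold crossing_pairs_def, intro polytime_intros)

lemma polytime_half_gap [polytime_intros]: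
  "polytime g \<Longrightarrow> polytime s \<Longrightarrow> polytime q \<Longrightarrow> polytime (\<lambda>x. half_gap (g x) (s x) (q x))"
  unfolding half_gap_def by (intro polytime_intros)

lemma polytime_step_size [polytime_intros]: "polytime g \<Longrightarrow> polytime s \<Longrightarrow> polytime (\<lambda>x. step_size (g x) (s x))"
  by (rule polytime_app2[of step_size]) (unfold step_size_def, intro polytime_intros)

lemma polytime_grow [polytime_intros]: "polytime g \<Longrightarrow> polytime s \<Longrightarrow> polytime (\<lambda>x. grow (g x) (s x))"
  by (rule polytime_app2[of grow]) (unfold grow_def, intro polytime_intros)

lemma polytime_tight_pairs [polytime_intros]:
  "polytime g \<Longrightarrow> polytime s \<Longrightarrow> polytime t \<Longrightarrow> polytime (\<lambda>x. tight_pairs (g x) (s x) (t x))"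
  by (rule polytime_app3[of tight_pairs]) (unfold tight_pairs_def, intro polytime_intros)

lemma polytime_merge_components [polytime_intros]:
  "polytime g \<Longrightarrow> polytime t \<Longrightarrow> polytime q \<Longrightarrow> polytime (\<lambda>x. merge_components (g x) (t x) (q x))"
  by (rule polytime_app3[of merge_components]) (unfold merge_components_def, intro polytime_intros)

lemma polytime_pd_step [polytime_intros]: "polytime g \<Longrightarrow> polytime s \<Longrightarrow> polytime (\<lambda>x. pd_step (g x) (s x))"
  unfolding pd_step_def merge_first_def by (intro polytime_intros)

lemma polytime_step_events [polytime_intros]: "polytime g \<Longrightarrow> polytime s \<Longrightarrow> polytime (\<lambda>x. step_events (g x) (s x))"
  unfolding step_events_def merge_events_def by (intro polytime_intros)

lemma polytime_init_state [polytime_intros]: "polytime g \<Longrightarrow> polytime ps \<Longrightarrow> polytime (\<lambda>x. init_state (g x) (ps x))"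
  by (rule polytime_app2[of init_state]) (unfold init_state_def, intro polytime_intros)

definition bounded_labels :: "nat list \<Rightarrow> nat list \<Rightarrow> bool" where
  "bounded_labels vs ls \<longleftrightarrow> length ls \<le> length vs \<and> set ls \<subseteq> insert 0 (set vs)"

definition bounded_state :: "pd_env \<Rightarrow> nat \<Rightarrow> pd_state \<Rightarrow> bool" where
  "bounded_state g m s \<longleftrightarrow> bounded_labels (env_vertices g) (fst s) \<and>
     length (fst (snd s)) \<le> length (env_vertices g) \<and> (\<forall>a\<in>set (fst (snd s)). a \<le> m) \<and>
     length (snd (snd s)) \<le> length (env_vertices g) \<and> (\<forall>a\<in>set (snd (snd s)). a \<le> m)"

definition bounded_event :: "nat list \<Rightarrow> pd_event \<Rightarrow> bool" where
  "bounded_event vs ev \<longleftrightarrow> bounded_labels vs (ev_labels ev) \<and> fst (ev_edge ev) \<in> insert 0 (set vs) \<and>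
    snd (ev_edge ev) \<in> insert 0 (set vs)"

lemma nth_default_in_set: "nth_default 0 xs i \<in> insert 0 (set xs)" by (auto simp: nth_default_def)

lemma nth_default_le: "(\<forall>a\<in>set xs. a \<le> m) \<Longrightarrow> nth_default 0 xs i \<le> (m::nat)" by (auto simp: nth_default_def)

lemma bounded_state_init:
  assumes "sum_list ps \<le> m"
  shows "bounded_state g m (init_state g ps)"
proof -
  have "nth_default 0 ps v \<le> sum_list ps" for v by (auto simp: nth_default_def intro!: member_le_sum_list)
  then have "nth_default 0 ps v \<le> m" for v using assms by (rule le_trans)
  then show ?thesis by (auto simp: bounded_state_def bounded_labels_def init_state_def)
qed

lemma bounded_state_grow:
  assumes "bounded_state g m s" "env_cap g \<le> m"
  shows "bounded_state g m (grow g s)"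
proof -
  have "residual s l - e \<le> m" for l e
    using nth_default_le[of "snd (snd s)" m l] assms unfolding bounded_state_def by (meson diff_le_self order_trans)
  then show ?thesis using assms by (auto simp: bounded_state_def grow_def)
qed

lemma hd_tight_pairs:
  "fst (hd_default (0, 0) (tight_pairs g s t)) \<in> insert 0 (set (env_vertices g))"
  "snd (hd_default (0, 0) (tight_pairs g s t)) \<in> insert 0 (set (env_vertices g))"
proof -
  have "set (tight_pairs g s t) \<subseteq> set (env_vertices g) \<times> set (env_vertices g)"
    by (auto simp: tight_pairs_def crossing_pairs_def)
  then show "fst (hd_default (0, 0) (tight_pairs g s t)) \<in> insert 0 (set (env_vertices g))"
    "snd (hd_default (0, 0) (tight_pairs g s t)) \<in> insert 0 (set (env_vertices g))"
    by (auto simp: hd_default_def split: list.split)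
qed

lemma bounded_state_merge:
  assumes "bounded_state g m t" "env_cap g \<le> m"
  shows "bounded_state g m (merge_components g t q)"
proof -
  have "residual t l \<le> m" for l
    using nth_default_le[of "snd (snd t)" m l] assms unfolding bounded_state_def by blast
  moreover have "label t v \<in> insert 0 (set (env_vertices g))" for v
    using nth_default_in_set[of "fst t" v] assms unfolding bounded_state_def bounded_labels_def by blast
  then have "bounded_labels (env_vertices g) (map (\<lambda>v. if label t v = label t (snd q) then label t (fst q) else label t v) (env_vertices g))"
    by (auto simp: bounded_labels_def)
  ultimately show ?thesis using assms by (auto simp: bounded_state_def merge_components_def min_le_iff_disj)
qed

lemma bounded_state_step:
  assumes "bounded_state g m s" "env_cap g \<le> m"
  shows "bounded_state g m (pd_step g s)" "\<forall>ev\<in>set (step_events g s). bounded_event (env_vertices g) ev"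
    "length (step_events g s) \<le> 1"
proof -
  have grow: "bounded_state g m (grow g s)" by (rule bounded_state_grow[OF assms])
  then show "bounded_state g m (pd_step g s)"
    using bounded_state_merge[OF grow assms(2)] by (simp add: pd_step_def merge_first_def)
  show "length (step_events g s) \<le> 1" by (simp add: step_events_def merge_events_def)
  show "\<forall>ev\<in>set (step_events g s). bounded_event (env_vertices g) ev"
    using grow hd_tight_pairs[of g s "grow g s"]
    by (auto simp: step_events_def merge_events_def bounded_event_def bounded_state_def)
qed

lemma enc_size_mem_insert_0: "x \<in> insert 0 (set vs) \<Longrightarrow> enc_size (x::nat) \<le> 1 + enc_size vs"
  using enc_size_mem[of x vs] by (auto simp: enc_size_def enc_nat_def)

lemma enc_size_bounded_labels:
  assumes "bounded_labels vs ls"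
  shows "enc_size ls \<le> 1 + enc_size vs * (1 + (1 + enc_size vs))"
  using assms length_le_enc_size[of vs] unfolding bounded_labels_def
  by (intro enc_size_list_le enc_size_mem_insert_0) auto

lemma enc_size_bounded_event:
  assumes "bounded_event vs ev"
  shows "enc_size ev \<le> 9 + 2 * enc_size vs + enc_size vs * (1 + (1 + enc_size vs))"
proof -
  have "enc_size (fst (ev_edge ev)) \<le> 1 + enc_size vs" "enc_size (snd (ev_edge ev)) \<le> 1 + enc_size vs"
    using assms by (auto simp: bounded_event_def intro: enc_size_mem_insert_0)
  moreover have "enc_size (ev_labels ev) \<le> 1 + enc_size vs * (1 + (1 + enc_size vs))"
    using assms by (intro enc_size_bounded_labels) (simp add: bounded_event_def)
  ultimately show ?thesis
    unfolding enc_size_pair[of ev] enc_size_pair[of "snd ev"] enc_size_pair[of "ev_edge ev"]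
    using enc_size_bool[of "ev_active ev"] by linarith
qed

lemma enc_size_bounded_state:
  assumes "bounded_state g m s"
  defines "N \<equiv> enc_size (env_vertices g)"
  shows "enc_size s \<le> 5 + N * (1 + (1 + N)) + 2 * (N * (1 + (4 * enc_size m + 1)))"
proof -
  have nats: "enc_size xs \<le> 1 + N * (1 + (4 * enc_size m + 1))"
    if "length xs \<le> length (env_vertices g)" "\<forall>a\<in>set xs. a \<le> m" for xs
    by (rule enc_size_list_le)
      (use that enc_size_nat_mono length_le_enc_size[of "env_vertices g"] in \<open>auto simp: N_def intro: order_trans\<close>)
  have "enc_size (fst s) \<le> 1 + N * (1 + (1 + N))"
    unfolding N_def using assms by (intro enc_size_bounded_labels) (simp add: bounded_state_def)
  moreover have "enc_size (fst (snd s)) \<le> 1 + N * (1 + (4 * enc_size m + 1))"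
    "enc_size (snd (snd s)) \<le> 1 + N * (1 + (4 * enc_size m + 1))"
    by (rule nats; use assms in \<open>simp add: bounded_state_def\<close>)+
  ultimately show ?thesis unfolding enc_size_pair[of s] enc_size_pair[of "snd s"] by linarith
qed

lemma polytime_history:
  assumes g: "polytime g" and ps: "polytime ps"
  shows "polytime (\<lambda>x. history (g x) (init_state (g x) (ps x), []) (env_vertices (g x) @ env_vertices (g x)))"
  unfolding history_def
proof -
  let ?m = "\<lambda>x. env_cap (g x) + sum_list (ps x)" and ?vs = "\<lambda>x. env_vertices (g x)"
  let ?I = "\<lambda>x i h. bounded_state (g x) (?m x) (fst h) \<and> length (snd h) \<le> i \<and>
    (\<forall>ev\<in>set (snd h). bounded_event (?vs x) ev)"
  let ?N = "\<lambda>x. enc_size (?vs x)"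
  let ?E = "\<lambda>x. 9 + 2 * ?N x + ?N x * (1 + (1 + ?N x))"
  let ?S = "\<lambda>x. 5 + ?N x * (1 + (1 + ?N x)) + 2 * (?N x * (1 + (4 * enc_size (?m x) + 1)))"
  let ?b = "\<lambda>x. 1 + ?S x + (1 + (2 * ?N x) * (1 + ?E x))"
  note g_fst = polytime_comp[OF g polytime_fst[OF polytime_id]]
  show "polytime (\<lambda>x. foldl (\<lambda>h _. (pd_step (g x) (fst h), step_events (g x) (fst h) @ snd h))
    (init_state (g x) (ps x), []) (env_vertices (g x) @ env_vertices (g x)))"
  proof (rule polytime_foldl_inv[where I = ?I and b = ?b])
    show "polytime (\<lambda>z. (pd_step (g (fst z)) (fst (fst (snd z))), step_events (g (fst z)) (fst (fst (snd z))) @ snd (fst (snd z))))"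
      by (intro polytime_intros g_fst)
    show "polytime (\<lambda>x. (init_state (g x) (ps x), []))" "polytime (\<lambda>x. ?vs x @ ?vs x)"
      by (intro polytime_intros g ps)+
    have "polytime ?m" "polytime ?vs" by (intro polytime_intros polytime_comp[OF ps] g ps)+
    then show "poly_in_size ?b" by (intro poly_in_size_intros)
    fix x i h
    show "?I x 0 (init_state (g x) (ps x), [])" by (simp add: bounded_state_init)
    show "?I x (Suc i) (pd_step (g x) (fst h), step_events (g x) (fst h) @ snd h)" if "?I x i h"
      using bounded_state_step[of "g x" "?m x" "fst h"] that by auto
    assume i: "i \<le> length (?vs x @ ?vs x)" and I: "?I x i h"
    have "length (snd h) \<le> 2 * ?N x" using I i length_le_enc_size[of "?vs x"] by simp
    then have "enc_size (snd h) \<le> 1 + (2 * ?N x) * (1 + ?E x)"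
      using I enc_size_bounded_event by (intro enc_size_list_le) auto
    moreover have "enc_size (fst h) \<le> ?S x" using I by (intro enc_size_bounded_state) simp
    ultimately show "enc_size h \<le> ?b x" unfolding enc_size_pair[of h] by linarith
  qed
qed

lemma polytime_touches [polytime_intros]:
  "polytime ls \<Longrightarrow> polytime vs \<Longrightarrow> polytime v \<Longrightarrow> polytime (\<lambda>x. touches (ls x) (vs x) (v x))"
  by (rule polytime_app3[of touches]) (unfold touches_def, intro polytime_intros)

lemma polytime_tree_vertices [polytime_intros]: "polytime r \<Longrightarrow> polytime T \<Longrightarrow> polytime (\<lambda>x. tree_vertices (r x) (T x))"
  by (rule polytime_app2[of tree_vertices]) (unfold tree_vertices_def, intro polytime_intros)

lemma polytime_select_edge [polytime_intros]:
  "polytime r \<Longrightarrow> polytime T \<Longrightarrow> polytime ev \<Longrightarrow> polytime (\<lambda>x. select_edge (r x) (T x) (ev x))"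
  unfolding select_edge_def by (intro polytime_intros)

lemma polytime_pd_edges [polytime_intros]:
  assumes g: "polytime g" and ps: "polytime ps"
  shows "polytime (\<lambda>x. pd_edges (g x) (ps x))"
proof -
  define evs where "evs x = snd (history (g x) (init_state (g x) (ps x), []) (env_vertices (g x) @ env_vertices (g x)))" for x
  have evs: "polytime evs" unfolding evs_def by (intro polytime_snd polytime_history g ps)
  let ?I = "\<lambda>x i T. length T \<le> i \<and> (\<forall>e\<in>set T. \<exists>ev\<in>set (evs x). e = ev_edge ev)"
  have "polytime (\<lambda>x. foldl (select_edge (env_root (g x))) [] (evs x))"
  proof (rule polytime_foldl_inv[where I = ?I and b = "\<lambda>x. 1 + enc_size (evs x) * (1 + enc_size (evs x))"])
    show "polytime (\<lambda>z. select_edge (env_root (g (fst z))) (fst (snd z)) (snd (snd z)))"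
      by (intro polytime_intros polytime_comp[OF g])
    show "poly_in_size (\<lambda>x. 1 + enc_size (evs x) * (1 + enc_size (evs x)))" by (intro poly_in_size_intros evs)
    fix x i T
    show "?I x (Suc i) (select_edge (env_root (g x)) T (evs x ! i))" if "i < length (evs x)" "?I x i T"
      using that by (auto simp: select_edge_def)
    assume i: "i \<le> length (evs x)" and I: "?I x i T"
    show "enc_size T \<le> 1 + enc_size (evs x) * (1 + enc_size (evs x))"
    proof (rule enc_size_list_le)
      show "length T \<le> enc_size (evs x)" using I i length_le_enc_size[of "evs x"] by linarith
      fix e assume "e \<in> set T"
      then obtain ev where ev: "ev \<in> set (evs x)" "e = ev_edge ev" using I by blast
      show "enc_size e \<le> enc_size (evs x)"
        using enc_size_fst[of "snd ev"] enc_size_snd[of ev] enc_size_mem[OF ev(1)] unfolding ev(2) by linarith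
    qed
  qed (auto intro!: polytime_const evs)
  then show ?thesis by (simp add: pd_edges_def evs_def)
qed

lemma polytime_insert_after [polytime_intros]:
  "polytime a \<Longrightarrow> polytime b \<Longrightarrow> polytime zs \<Longrightarrow> polytime (\<lambda>x. insert_after (a x) (b x) (zs x))"
  by (rule polytime_app3[of insert_after]) (unfold insert_after_def, intro polytime_intros)

lemma polytime_attach_edge [polytime_intros]: "polytime zs \<Longrightarrow> polytime e \<Longrightarrow> polytime (\<lambda>x. attach_edge (zs x) (e x))"
  unfolding attach_edge_def by (intro polytime_intros)

lemma attach_edge_bounded:
  assumes "distinct zs"
  shows "distinct (attach_edge zs e)" "length (attach_edge zs e) \<le> Suc (length zs)"
    "set (attach_edge zs e) \<subseteq> {fst e, snd e} \<union> set zs"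
  using insert_after_props[OF assms, of "fst e" "snd e"] insert_after_props[OF assms, of "snd e" "fst e"] assms
  by (auto simp: attach_edge_def)

lemma polytime_tree_tour [polytime_intros]:
  assumes "polytime vs" "polytime r" "polytime T"
  shows "polytime (\<lambda>x. tree_tour (vs x) (r x) (T x))"
proof -
  define es where "es x = concat (map (\<lambda>_. T x) (vs x))" for x
  have es: "polytime es" unfolding es_def by (intro polytime_intros polytime_comp[OF assms(3)] assms)
  let ?I = "\<lambda>x i zs. distinct zs \<and> length zs \<le> 1 + i \<and> set zs \<subseteq> insert (r x) (fst ` set (es x) \<union> snd ` set (es x))"
  let ?b = "\<lambda>x. 1 + (1 + enc_size (es x)) * (1 + (enc_size (r x) + enc_size (es x)))"
  have "polytime (\<lambda>x. foldl attach_edge [r x] (es x))"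
  proof (rule polytime_foldl_inv[where I = ?I and b = ?b])
    show "polytime (\<lambda>z. attach_edge (fst (snd z)) (snd (snd z)))" by (intro polytime_intros)
    show "polytime (\<lambda>x. [r x])" by (intro polytime_intros assms)
    show "poly_in_size ?b" by (intro poly_in_size_intros es assms)
    fix x i zs
    show "?I x (Suc i) (attach_edge zs (es x ! i))" if "i < length (es x)" "?I x i zs"
    proof -
      have "fst (es x ! i) \<in> fst ` set (es x)" "snd (es x ! i) \<in> snd ` set (es x)" using that(1) by simp_all
      then have "set (attach_edge zs (es x ! i)) \<subseteq> insert (r x) (fst ` set (es x) \<union> snd ` set (es x))"
        using attach_edge_bounded(3)[of zs "es x ! i"] that(2) by blast
      then show ?thesis using attach_edge_bounded(1,2)[of zs "es x ! i"] that(2) by simp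
    qed
    assume i: "i \<le> length (es x)" and I: "?I x i zs"
    show "enc_size zs \<le> ?b x"
    proof (rule enc_size_list_le)
      show "length zs \<le> 1 + enc_size (es x)" using I i length_le_enc_size[of "es x"] by linarith
      fix z assume "z \<in> set zs"
      then consider "z = r x" | e where "e \<in> set (es x)" "z = fst e \<or> z = snd e" using I by blast
      then show "enc_size z \<le> enc_size (r x) + enc_size (es x)"
      proof cases
        case (2 e)
        then show ?thesis using enc_size_mem[OF 2(1)] enc_size_fst[of e] enc_size_snd[of e] by fastforce
      qed simp
    qed
  qed (simp_all add: es)
  then show ?thesis by (simp add: tree_tour_def es_def)
qed

lemma polytime_stage:
  assumes vs: "polytime vs" and Q: "polytime (\<lambda>z. Q (fst z) (fst (snd z)) (snd (snd z)))" and T: "polytime T"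
  shows "polytime (\<lambda>x. stage (vs x) (Q x) (T x))"
  unfolding stage_def
  by (intro polytime_intros polytime_app3[OF Q] polytime_comp[OF vs] T)

lemma enc_size_subseq_le: "subseq xs ys \<Longrightarrow> enc_size xs \<le> enc_size (ys :: 'a::enc list)"
proof (induction rule: list_emb.induct)
  case (list_emb_Nil ys)
  then show ?case using enc_size_pos[of ys] by simp
qed auto

lemma polytime_foldl_snoc_new [polytime_intros]:
  assumes "polytime a" "polytime xs"
  shows "polytime (\<lambda>x. foldl snoc_new (a x) (xs x))"
proof (rule polytime_foldl[where b = "\<lambda>x. enc_size (a x) + enc_size (xs x)"])
  show "polytime (\<lambda>z. snoc_new (fst (snd z)) (snd (snd z)))" unfolding snoc_new_def by (intro polytime_intros)
  fix x i
  obtain zs where zs: "foldl snoc_new (a x) (take i (xs x)) = a x @ zs" "subseq zs (take i (xs x))"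
    using foldl_snoc_new_prefix by blast
  have "enc_size (foldl snoc_new (a x) (take i (xs x))) + 1 = enc_size (a x) + enc_size zs" unfolding zs(1)
    by (rule enc_size_append)
  then show "enc_size (foldl snoc_new (a x) (take i (xs x))) \<le> enc_size (a x) + enc_size (xs x)"
    using enc_size_subseq_le[OF zs(2)] enc_size_take[of i "xs x"] by linarith
qed (intro poly_in_size_intros assms)+

section \<open>The algorithm\<close>

text \<open>The components are the vertices, the root, the distances, the weights \<open>w\<close> and a common denominator
  \<open>Q\<close> of the activation probabilities \<open>p v = w v / Q\<close>.\<close>

type_synonym inst = "nat list \<times> nat \<times> nat list list \<times> nat list \<times> nat"

abbreviation inst_vertices :: "inst \<Rightarrow> nat list" where "inst_vertices I \<equiv> fst I"
abbreviation inst_root :: "inst \<Rightarrow> nat" where "inst_root I \<equiv> fst (snd I)"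
abbreviation inst_dists :: "inst \<Rightarrow> nat list list" where "inst_dists I \<equiv> fst (snd (snd I))"
abbreviation inst_weights :: "inst \<Rightarrow> nat list" where "inst_weights I \<equiv> fst (snd (snd (snd I)))"
abbreviation inst_denom :: "inst \<Rightarrow> nat" where "inst_denom I \<equiv> snd (snd (snd (snd I)))"

text \<open>The root counts as always active, so that no radius exceeds the distance to the root.\<close>

definition ball_mass :: "inst \<Rightarrow> nat \<Rightarrow> nat \<Rightarrow> nat" where
  "ball_mass I v t = sum_list (map (\<lambda>x. if dist_at (inst_dists I) v x \<le> t
     then (if x = inst_root I then inst_denom I else nth_default 0 (inst_weights I) x) else 0) (inst_vertices I))"

definition radius :: "inst \<Rightarrow> nat \<Rightarrow> nat" where
  "radius I v = argmin 0 (\<lambda>t. t) (filter (\<lambda>t. inst_denom I \<le> 2 * ball_mass I v t) (map (dist_at (inst_dists I) v) (inst_vertices I)))"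

definition uncovered :: "inst \<Rightarrow> nat list \<Rightarrow> nat list" where
  "uncovered I C = filter (\<lambda>v. \<not> (\<exists>a\<in>set C. dist_at (inst_dists I) v a \<le> 2 * radius I v)) (inst_vertices I)"

definition add_centre :: "inst \<Rightarrow> nat list \<Rightarrow> nat list" where
  "add_centre I C = (if uncovered I C = [] then C else argmin 0 (radius I) (uncovered I C) # C)"

definition centres :: "inst \<Rightarrow> nat list" where
  "centres I = foldl (\<lambda>C _. add_centre I C) [inst_root I] (inst_vertices I)"

definition nearest_centres :: "inst \<Rightarrow> nat list" where
  "nearest_centres I = map (\<lambda>v. argmin 0 (dist_at (inst_dists I) v) (centres I)) (inst_vertices I)"

definition prizes :: "inst \<Rightarrow> nat list \<Rightarrow> nat \<Rightarrow> nat list" where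
  "prizes I cs t = map (\<lambda>u. if u = inst_root I then 0
     else sum_list (map (\<lambda>v. if nth_default 0 cs v = u then nth_default 0 (inst_weights I) v * (t - dist_at (inst_dists I) v u) else 0)
       (inst_vertices I))) (inst_vertices I)"

definition scaled_env :: "inst \<Rightarrow> nat list \<Rightarrow> pd_env" where
  "scaled_env I ps = (inst_vertices I, inst_root I, map (\<lambda>row. map (\<lambda>a. inst_denom I * a) row) (inst_dists I), sum_list ps)"

definition tour_at :: "inst \<Rightarrow> nat list \<Rightarrow> nat \<Rightarrow> nat list" where
  "tour_at I cs t = tree_tour (inst_vertices I) (inst_root I) (pd_edges (scaled_env I (prizes I cs t)) (prizes I cs t))"

definition stage_at :: "inst \<Rightarrow> nat list \<Rightarrow> nat \<Rightarrow> nat list" where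
  "stage_at I cs t = stage (inst_vertices I) (\<lambda>v a. nth_default 0 cs v = a \<and> dist_at (inst_dists I) v a \<le> t) (tour_at I cs t)"

definition powers16 :: "bool list \<Rightarrow> nat list" where
  "powers16 cs = foldl (\<lambda>ts _. 1 # map (\<lambda>a. 16 * a) ts) [] cs"

text \<open>At a scale above this bound the prize of any cell exceeds what the dual solution can pay for, so
  the tour of that scale visits all centres.\<close>

definition horizon :: "inst \<Rightarrow> nat" where
  "horizon I = 5 * sum_list (map (\<lambda>_. 1) (inst_vertices I)) * sum_list (map sum_list (inst_dists I))"

definition solve :: "inst \<Rightarrow> nat list" where
  "solve I = foldl snoc_new [inst_root I]
     (concat (map (stage_at I (nearest_centres I)) (powers16 (True # bits (horizon I)))) @ inst_vertices I)"

lemma polytime_ball_mass [polytime_intros]: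
  "polytime a \<Longrightarrow> polytime b \<Longrightarrow> polytime c \<Longrightarrow> polytime (\<lambda>x. ball_mass (a x) (b x) (c x))"
  by (rule polytime_app3[of ball_mass]) (unfold ball_mass_def, intro polytime_intros)

lemma polytime_radius [polytime_intros]: "polytime a \<Longrightarrow> polytime b \<Longrightarrow> polytime (\<lambda>x. radius (a x) (b x))"
  by (rule polytime_app2[of radius]) (unfold radius_def, intro polytime_intros)

lemma polytime_uncovered [polytime_intros]: "polytime a \<Longrightarrow> polytime b \<Longrightarrow> polytime (\<lambda>x. uncovered (a x) (b x))"
  by (rule polytime_app2[of uncovered]) (unfold uncovered_def, intro polytime_intros)

lemma polytime_add_centre [polytime_intros]: "polytime a \<Longrightarrow> polytime b \<Longrightarrow> polytime (\<lambda>x. add_centre (a x) (b x))"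
  by (rule polytime_app2[of add_centre]) (unfold add_centre_def, intro polytime_intros)

lemma uncovered_subset: "set (uncovered I C) \<subseteq> set (inst_vertices I)" by (auto simp: uncovered_def)

lemma add_centre_subset: "set (add_centre I C) \<subseteq> set C \<union> set (inst_vertices I)"
  using argmin_in[of "uncovered I C" 0 "radius I"] uncovered_subset[of I C] by (auto simp: add_centre_def)

lemma polytime_centres [polytime_intros]: "polytime a \<Longrightarrow> polytime (\<lambda>x. centres (a x))"
proof (rule polytime_comp[of centres])
  let ?I = "\<lambda>I i C. length C \<le> 1 + i \<and> set C \<subseteq> insert (inst_root I) (set (inst_vertices I))"
  let ?b = "\<lambda>I :: inst. 1 + (1 + enc_size (inst_vertices I))
    * (1 + (enc_size (inst_root I) + enc_size (inst_vertices I)))"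
  show "polytime centres" unfolding centres_def
  proof (rule polytime_foldl_inv[where I = ?I and b = ?b])
    show "polytime (\<lambda>z. add_centre (fst z) (fst (snd z)))" by (intro polytime_intros)
    show "polytime (\<lambda>I::inst. [inst_root I])" "polytime (\<lambda>I::inst. inst_vertices I)" by (intro polytime_intros)+
    show "poly_in_size ?b" by (intro poly_in_size_intros polytime_intros)
    fix I :: inst and i C
    show "?I I (Suc i) (add_centre I C)" if "?I I i C"
      using that add_centre_subset[of I C] by (auto simp: add_centre_def)
    assume i: "i \<le> length (inst_vertices I)" and I: "?I I i C"
    show "enc_size C \<le> ?b I"
    proof (rule enc_size_list_le)
      show "length C \<le> 1 + enc_size (inst_vertices I)" using I i length_le_enc_size[of "inst_vertices I"] by linarith
      fix x assume "x \<in> set C"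
      then show "enc_size x \<le> enc_size (inst_root I) + enc_size (inst_vertices I)"
        using I enc_size_mem[of x "inst_vertices I"] by fastforce
    qed
  qed simp
qed

lemma polytime_nearest_centres [polytime_intros]: "polytime a \<Longrightarrow> polytime (\<lambda>x. nearest_centres (a x))"
  by (rule polytime_comp[of nearest_centres]) (unfold nearest_centres_def, intro polytime_intros)

lemma polytime_prizes [polytime_intros]:
  "polytime a \<Longrightarrow> polytime b \<Longrightarrow> polytime c \<Longrightarrow> polytime (\<lambda>x. prizes (a x) (b x) (c x))"
  by (rule polytime_app3[of prizes]) (unfold prizes_def, intro polytime_intros)

lemma polytime_scaled_env [polytime_intros]: "polytime a \<Longrightarrow> polytime b \<Longrightarrow> polytime (\<lambda>x. scaled_env (a x) (b x))"
  by (rule polytime_app2[of scaled_env]) (unfold scaled_env_def, intro polytime_intros)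

lemma polytime_tour_at [polytime_intros]:
  "polytime a \<Longrightarrow> polytime b \<Longrightarrow> polytime c \<Longrightarrow> polytime (\<lambda>x. tour_at (a x) (b x) (c x))"
  unfolding tour_at_def by (intro polytime_intros)

lemma polytime_stage_at [polytime_intros]:
  "polytime a \<Longrightarrow> polytime b \<Longrightarrow> polytime c \<Longrightarrow> polytime (\<lambda>x. stage_at (a x) (b x) (c x))"
  by (rule polytime_app3[of stage_at]) (unfold stage_at_def, intro polytime_stage polytime_intros)

lemma powers16_eq: "powers16 cs = map (\<lambda>j. 16 ^ j) [0..<length cs]"
proof (induction cs rule: rev_induct)
  case (snoc c cs)
  have "map (\<lambda>j. 16 ^ j :: nat) [0..<length (cs @ [c])] = 1 # map (\<lambda>j. 16 ^ Suc j) [0..<length cs]"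
    by (simp add: upt_conv_Cons map_Suc_upt[symmetric] o_def del: upt_Suc)
  then show ?case using snoc by (simp add: powers16_def o_def del: upt_Suc)
qed (simp add: powers16_def)

lemma enc_size_powers16:
  assumes "length bs \<le> k"
  shows "enc_size (powers16 bs) \<le> 1 + k * (1 + (4 * (4 * k + 1) + 1))"
proof (rule enc_size_list_le)
  fix t assume "t \<in> set (powers16 bs)"
  then obtain j where j: "t = 16 ^ j" "j < length bs" by (auto simp: powers16_eq)
  have "length (bits t) \<le> 4 * j + 1"
    unfolding length_bits_le j using power_mult[of "2::nat" 4 j] by (simp add: power_add)
  then show "enc_size t \<le> 4 * (4 * k + 1) + 1" using enc_size_nat_le[of t] j(2) assms by arith
qed (use assms in \<open>simp add: powers16_eq\<close>)

lemma polytime_powers16 [polytime_intros]: "polytime a \<Longrightarrow> polytime (\<lambda>x. powers16 (a x))"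
proof (rule polytime_comp[of powers16])
  let ?b = "\<lambda>cs::bool list. 1 + enc_size cs * (1 + (4 * (4 * enc_size cs + 1) + 1))"
  show "polytime powers16" unfolding powers16_def
  proof (rule polytime_foldl[where b = ?b])
    show "polytime (\<lambda>z. 1 # map (\<lambda>a. 16 * a :: nat) (fst (snd z)))" by (intro polytime_intros)
    fix cs :: "bool list" and i
    have "length (take i cs) \<le> enc_size cs" using length_le_enc_size[of cs] by simp
    from enc_size_powers16[OF this]
    show "enc_size (foldl (\<lambda>ts _. 1 # map (\<lambda>a. 16 * a :: nat) ts) [] (take i cs)) \<le> ?b cs"
      by (simp only: powers16_def)
  qed (intro polytime_intros poly_in_size_intros)+
qed

lemma polytime_solve [polytime_intros]: "polytime a \<Longrightarrow> polytime (\<lambda>x. solve (a x))"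
  by (rule polytime_comp[of solve]) (unfold solve_def horizon_def, intro polytime_intros)

section \<open>Reading and writing instances\<close>

definition add_fraction :: "nat list \<times> nat \<Rightarrow> nat \<times> nat \<Rightarrow> nat list \<times> nat" where
  "add_fraction s q = (fst q * snd s # map (\<lambda>a. snd q * a) (fst s), snd q * snd s)"

definition common_denom :: "(nat \<times> nat) list \<Rightarrow> nat list \<times> nat" where
  "common_denom qs = foldl add_fraction ([], 1) (rev qs)"

lemma common_denom_simps: "common_denom [] = ([], 1)" "common_denom (q # qs) = add_fraction (common_denom qs) q"
  by (simp_all add: common_denom_def)

lemma length_common_denom: "length (fst (common_denom qs)) = length qs"
  by (induction qs) (auto simp: common_denom_simps add_fraction_def)

lemma length_bits_common_denom:
  "length (bits (snd (common_denom qs))) \<le> enc_size qs \<and>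
    (\<forall>a\<in>set (fst (common_denom qs)). length (bits a) \<le> enc_size qs)"
proof (induction qs)
  case Nil
  show ?case by (simp add: common_denom_simps bits_pos)
next
  case (Cons q qs)
  have size: "enc_size (q # qs) = 2 + (enc_size (fst q) + enc_size (snd q) + enc_size qs)"
    by (simp add: enc_size_pair[of q])
  have mult: "length (bits (u * v)) \<le> enc_size (q # qs)"
    if "length (bits u) \<le> enc_size (fst q) + enc_size (snd q)" "length (bits v) \<le> enc_size qs" for u v
    using length_bits_mult[of u v] that unfolding size by linarith
  have "length (bits (fst q)) \<le> enc_size (fst q) + enc_size (snd q)"
    "length (bits (snd q)) \<le> enc_size (fst q) + enc_size (snd q)"
    using length_bits_le_enc_size[of "fst q"] length_bits_le_enc_size[of "snd q"] by linarith+
  from this[THEN mult] show ?case using Cons by (auto simp: common_denom_simps add_fraction_def)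
qed

lemma enc_size_common_denom:
  assumes "enc_size qs \<le> N"
  shows "enc_size (common_denom qs) \<le> 1 + (1 + N * (1 + (4 * N + 1))) + (4 * N + 1)"
proof -
  have nat: "enc_size a \<le> 4 * N + 1" if "length (bits a) \<le> enc_size qs" for a
    using enc_size_nat_le[of a] that assms by linarith
  have "enc_size (fst (common_denom qs)) \<le> 1 + N * (1 + (4 * N + 1))"
    using nat length_bits_common_denom[of qs] length_common_denom[of qs] length_le_enc_size[of qs] assms
    by (intro enc_size_list_le) auto
  moreover have "enc_size (snd (common_denom qs)) \<le> 4 * N + 1" using nat length_bits_common_denom by blast
  ultimately show ?thesis unfolding enc_size_pair[of "common_denom qs"] by linarith
qed

lemma polytime_common_denom [polytime_intros]: "polytime a \<Longrightarrow> polytime (\<lambda>x. common_denom (a x))"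
proof (rule polytime_comp[of common_denom])
  let ?N = "\<lambda>qs::(nat \<times> nat) list. enc_size qs"
  let ?b = "\<lambda>qs. 1 + (1 + ?N qs * (1 + (4 * ?N qs + 1))) + (4 * ?N qs + 1)"
  show "polytime common_denom" unfolding common_denom_def
  proof (rule polytime_foldl[where b = ?b])
    show "polytime (\<lambda>z. add_fraction (fst (snd z)) (snd (snd z)))" unfolding add_fraction_def by (intro polytime_intros)
    fix qs :: "(nat \<times> nat) list" and i
    have "enc_size (rev (take i (rev qs))) \<le> enc_size qs"
      using enc_size_take[of i "rev qs"] by (simp add: enc_size_rev)
    from enc_size_common_denom[OF this] show "enc_size (foldl add_fraction ([], 1) (take i (rev qs))) \<le> ?b qs"
      by (simp only: common_denom_def rev_rev_ident)
  qed (intro polytime_intros poly_in_size_intros)+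
qed

text \<open>Every separator ends a number.  The separator in front of the probabilities directly follows
  another one and reads as an additional 0.\<close>

definition read_token :: "nat list \<times> bool list \<Rightarrow> unit list \<Rightarrow> nat list \<times> bool list" where
  "read_token s a = (if tl (tl a) = [] then (fst s, (tl a \<noteq> []) # snd s) else (fst s @ [nat_of_bits (snd s)], []))"

definition tokens :: "unit list list \<Rightarrow> nat list" where
  "tokens w = fst (foldl read_token ([], []) w)"

lemma polytime_tokens [polytime_intros]: "polytime a \<Longrightarrow> polytime (\<lambda>x. tokens (a x))"
proof (rule polytime_comp[of tokens])
  let ?I = "\<lambda>w i s. length (fst s) \<le> i \<and> length (snd s) \<le> i \<and> (\<forall>a\<in>set (fst s). length (bits a) \<le> i)"
  let ?b = "\<lambda>w::unit list list. 1 + (1 + enc_size w * (1 + (4 * enc_size w + 1))) + (1 + enc_size w * (1 + 3))"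
  have "polytime (\<lambda>w. foldl read_token ([], []) w)"
  proof (rule polytime_foldl_inv[where I = ?I and b = ?b])
    show "polytime (\<lambda>z. read_token (fst (snd z)) (snd (snd z)))" unfolding read_token_def by (intro polytime_intros)
    show "poly_in_size ?b" by (intro poly_in_size_intros)
    fix w i and s :: "nat list \<times> bool list"
    show "?I w (Suc i) (read_token s (w ! i))" if I: "?I w i s"
    proof -
      have "length (bits (nat_of_bits (snd s))) \<le> length (snd s)" unfolding length_bits_le by (rule nat_of_bits_less)
      then show ?thesis using I by (auto simp: read_token_def)
    qed
    assume i: "i \<le> length w" and I: "?I w i s"
    have i_le: "i \<le> enc_size w" using i length_le_enc_size[of w] by linarith
    have nat: "enc_size a \<le> 4 * enc_size w + 1" if "a \<in> set (fst s)" for a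
      using enc_size_nat_le[of a] I i_le that by fastforce
    have "enc_size (fst s) \<le> 1 + enc_size w * (1 + (4 * enc_size w + 1))"
      by (rule enc_size_list_le[OF nat]) (use I i_le in linarith)+
    moreover have "enc_size (snd s) \<le> 1 + enc_size w * (1 + 3)"
      by (rule enc_size_list_le[OF enc_size_bool]) (use I i_le in linarith)
    ultimately show "enc_size s \<le> ?b w" using enc_size_pair[of s] by linarith
  qed (auto intro!: polytime_const polytime_id)
  then show "polytime tokens" unfolding tokens_def by (rule polytime_fst)
qed

definition token_vertices :: "nat list \<Rightarrow> nat list" where
  "token_vertices ts = filter (\<lambda>v. v < nth_default 0 ts 0) [0..<length ts]"

definition pair_indices :: "nat list \<Rightarrow> nat list" where
  "pair_indices ts = concat (map (\<lambda>u. map (\<lambda>v. u * nth_default 0 ts 0 + v) (token_vertices ts)) (token_vertices ts))"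

text \<open>After scaling by \<open>8n\<close> distances are even, and nonzero ones are so long that the tree built at
  scale 1 has length 0.\<close>

definition scaled_matrix :: "nat list \<Rightarrow> nat list \<Rightarrow> nat list list" where
  "scaled_matrix ts ns = map (\<lambda>u. map (\<lambda>v. 8 * nth_default 0 ts 0
    * nth_default 0 ns (u * nth_default 0 ts 0 + v)) (token_vertices ts)) (token_vertices ts)"

definition dist_fractions :: "nat list \<Rightarrow> nat list \<times> nat" where
  "dist_fractions ts = common_denom (map (\<lambda>k. (nth_default 0 ts (2 + 2 * k), nth_default 0 ts (3 + 2 * k))) (pair_indices ts))"

definition prob_fractions :: "nat list \<Rightarrow> nat list \<times> nat" where
  "prob_fractions ts = common_denom (map (\<lambda>v. (nth_default 0 ts (3 + 2 * (nth_default 0 ts 0 * nth_default 0 ts 0) + 2 * v),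
     nth_default 0 ts (4 + 2 * (nth_default 0 ts 0 * nth_default 0 ts 0) + 2 * v))) (token_vertices ts))"

definition parse :: "nat list \<Rightarrow> inst" where
  "parse ts = (token_vertices ts, nth_default 0 ts 1, scaled_matrix ts (fst (dist_fractions ts)),
    fst (prob_fractions ts), snd (prob_fractions ts))"

definition print_tour :: "nat list \<Rightarrow> unit list list" where
  "print_tour xs = concat (map (\<lambda>v. map (\<lambda>b. if b then unary 2 else unary 1) (bits v) @ [unary 3]) xs)"

definition algorithm :: "unit list list \<Rightarrow> unit list list" where
  "algorithm w = print_tour (solve (parse (tokens w)))"

lemma polytime_token_vertices [polytime_intros]: "polytime a \<Longrightarrow> polytime (\<lambda>x. token_vertices (a x))"
  by (rule polytime_comp[of token_vertices]) (unfold token_vertices_def, intro polytime_intros)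

lemma polytime_pair_indices [polytime_intros]: "polytime a \<Longrightarrow> polytime (\<lambda>x. pair_indices (a x))"
  by (rule polytime_comp[of pair_indices]) (unfold pair_indices_def, intro polytime_intros)

lemma polytime_scaled_matrix [polytime_intros]: "polytime a \<Longrightarrow> polytime b \<Longrightarrow> polytime (\<lambda>x. scaled_matrix (a x) (b x))"
  by (rule polytime_app2[of scaled_matrix]) (unfold scaled_matrix_def, intro polytime_intros)

lemma polytime_parse [polytime_intros]: "polytime a \<Longrightarrow> polytime (\<lambda>x. parse (a x))"
  by (rule polytime_comp[of parse]) (unfold parse_def dist_fractions_def prob_fractions_def, intro polytime_intros)

lemma polytime_print_tour [polytime_intros]: "polytime a \<Longrightarrow> polytime (\<lambda>x. print_tour (a x))"
  by (rule polytime_comp[of print_tour]) (unfold print_tour_def, intro polytime_intros)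

theorem polytime_algorithm: "polytime algorithm"
  unfolding algorithm_def by (intro polytime_intros)

declare One_nat_def [simp]

section \<open>Correctness of the algorithm\<close>

lemma sum_list_upt_if: "sum_list (map (\<lambda>x. if P x then f x else 0) [0..<n])
  = (\<Sum>x\<in>{x. x < n \<and> P x}. f x :: 'a::comm_monoid_add)"
proof -
  have "sum_list (map (\<lambda>x. if P x then f x else 0) [0..<n]) = (\<Sum>x\<in>{0..<n}. if P x then f x else 0)"
    by (simp add: sum_list_distinct_conv_sum_set)
  also have "\<dots> = (\<Sum>x\<in>{x\<in>{0..<n}. P x}. f x)" by (rule sum.inter_filter[symmetric]) simp
  also have "{x\<in>{0..<n}. P x} = {x. x < n \<and> P x}" by auto
  finally show ?thesis .
qed

lemma dist_at_scale: "dist_at (map (\<lambda>row. map (\<lambda>a. Q * a) row) ds) u v = Q * dist_at ds u v"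
  by (auto simp: dist_at_def nth_default_def)

lemma dist_at_le_sum: "dist_at ds u v \<le> sum_list (map sum_list ds)"
proof -
  have "dist_at ds u v \<le> sum_list (nth_default [] ds u)"
    by (auto simp: dist_at_def nth_default_def intro!: member_le_sum_list)
  also have "\<dots> \<le> sum_list (map sum_list ds)" by (auto simp: nth_default_def intro!: member_le_sum_list)
  finally show ?thesis .
qed

lemma feasible_dual_scale:
  fixes y :: "nat set \<Rightarrow> nat" and d :: "nat \<Rightarrow> nat \<Rightarrow> real"
  assumes y: "feasible_dual n r w z y" and Q: "0 < Q"
    and w: "\<And>u v. u < n \<Longrightarrow> v < n \<Longrightarrow> real (w u v) = Q * d u v" and z: "\<And>u. u < n \<Longrightarrow> real (z u) = Q * z' u"
  shows "feasible_dual n r d z' (\<lambda>X. real (y X) / Q)"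
proof -
  have scale: "moat_sum n P (\<lambda>X. real (y X) / Q) = real (moat_sum n P y) / Q" for P
    unfolding moat_sum_def of_nat_sum of_nat_mult of_nat_of_bool sum_divide_distrib times_divide_eq_right ..
  have "real (moat_sum n (separates a b) y) / Q \<le> d a b" if "a < n" "b < n" for a b
    using of_nat_mono[OF feasible_dualD(3)[OF y that], where 'a = real] Q w[OF that]
      by (simp add: divide_le_eq mult.commute)
  moreover have "real (moat_sum n (\<lambda>X. X \<subseteq> U) y) / Q \<le> (\<Sum>u\<in>U. z' u)" if U: "U \<subseteq> {..<n}" for U
  proof -
    have "real (\<Sum>u\<in>U. z u) = Q * (\<Sum>u\<in>U. z' u)" unfolding of_nat_sum sum_distrib_left using U z by (intro sum.cong) auto
    then show ?thesis using of_nat_mono[OF feasible_dualD(4)[OF y U], where 'a = real] Q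
      by (simp add: divide_le_eq mult.commute)
  qed
  ultimately show ?thesis
    using feasible_dualD(2)[OF y] Q unfolding feasible_dual_def scale by (auto simp: zero_less_divide_iff)
qed

lemma dual_value_le_dists:
  fixes y :: "nat set \<Rightarrow> real"
  assumes y: "feasible_dual n r d z y" and r: "r < n"
  shows "dual_value n y \<le> (\<Sum>v<n. d v r)"
proof -
  have "y {} \<le> moat_sum n (\<lambda>X. X \<subseteq> {}) y"
    unfolding moat_sum_def using member_le_sum[of "{}" "Pow {..<n}" "\<lambda>X. of_bool (X \<subseteq> {}) * y X"]
      feasible_dualD(1)[OF y] by simp
  then have empty: "y {} = 0" using feasible_dualD(4)[OF y, of "{}"] feasible_dualD(1)[OF y, of "{}"] by simp
  have "y X \<le> (\<Sum>v<n. of_bool (separates v r X) * y X)" if X: "X \<in> Pow {..<n}" for X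
  proof (cases "y X = 0")
    case False
    then have pos: "0 < y X" using feasible_dualD(1)[OF y, of X] by linarith
    then have "r \<notin> X" by (rule feasible_dualD(2)[OF y])
    obtain v where "v \<in> X" using False empty by fastforce
    then have "v < n" "separates v r X" using X \<open>r \<notin> X\<close> by (auto simp: separates_def)
    then show ?thesis
      using member_le_sum[of v "{..<n}" "\<lambda>v. of_bool (separates v r X) * y X"] feasible_dualD(1)[OF y, of X] by simp
  qed simp
  then have "dual_value n y \<le> (\<Sum>X\<in>Pow {..<n}. \<Sum>v<n. of_bool (separates v r X) * y X)"
    unfolding moat_sum_def of_bool_eq mult_1_left by (rule sum_mono)
  also have "\<dots> = (\<Sum>v<n. moat_sum n (\<lambda>X. separates v r X) y)" unfolding moat_sum_def by (rule sum.swap)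
  also have "\<dots> \<le> (\<Sum>v<n. d v r)" by (rule sum_mono) (use feasible_dualD(3)[OF y _ r] in auto)
  finally show ?thesis .
qed

locale integral_instance =
  fixes n r :: nat and ds :: "nat list list" and ws :: "nat list" and Q :: nat
  assumes root_less: "r < n"
    and dist_sym: "\<And>u v. u < n \<Longrightarrow> v < n \<Longrightarrow> dist_at ds u v = dist_at ds v u"
    and dist_zero: "\<And>u. u < n \<Longrightarrow> dist_at ds u u = 0"
    and dist_triangle: "\<And>u v w. u < n \<Longrightarrow> v < n \<Longrightarrow> w < n \<Longrightarrow> dist_at ds u w \<le> dist_at ds u v + dist_at ds v w"
    and coarse: "\<And>u v. u < n \<Longrightarrow> v < n \<Longrightarrow> 8 * n dvd dist_at ds u v"
    and weight_le: "\<And>v. v < n \<Longrightarrow> nth_default 0 ws v \<le> Q" and Q_pos: "0 < Q"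
begin

definition I :: inst where "I = ([0..<n], r, ds, ws, Q)"

lemma I_simps [simp]:
  "inst_vertices I = [0..<n]" "inst_root I = r" "inst_dists I = ds" "inst_weights I = ws" "inst_denom I = Q"
  by (simp_all add: I_def)

abbreviation weight :: "nat \<Rightarrow> nat" where "weight v \<equiv> nth_default 0 ws v"
abbreviation dist :: "nat \<Rightarrow> nat \<Rightarrow> nat" where "dist u v \<equiv> dist_at ds u v"
abbreviation rad :: "nat \<Rightarrow> nat" where "rad v \<equiv> radius I v"

subsection \<open>Radii and centres\<close>

lemma ball_mass_eq: "ball_mass I v t = (\<Sum>x\<in>{x. x < n \<and> dist v x \<le> t}. if x = r then Q else weight x)"
  unfolding ball_mass_def I_simps by (rule sum_list_upt_if)

lemma ball_mass_ge: "A \<subseteq> {x. x < n \<and> dist v x \<le> t} \<Longrightarrow> (\<Sum>x\<in>A. if x = r then Q else weight x) \<le> ball_mass I v t"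
  unfolding ball_mass_eq by (rule sum_mono2) auto

lemma
  assumes v: "v < n"
  shows ball_mass_radius: "Q \<le> 2 * ball_mass I v (rad v)"
    and radius_le: "rad v \<le> dist v r"
    and ball_mass_below_radius: "u < n \<Longrightarrow> dist v u < rad v \<Longrightarrow> 2 * ball_mass I v (dist v u) < Q"
proof -
  let ?ts = "filter (\<lambda>t. Q \<le> 2 * ball_mass I v t) (map (dist v) [0..<n])"
  have rad: "rad v = argmin 0 (\<lambda>t. t) ?ts" by (simp add: radius_def)
  have "Q \<le> ball_mass I v (dist v r)" using ball_mass_ge[of "{r}" v "dist v r"] root_less by simp
  then have root: "dist v r \<in> set ?ts" using root_less by auto
  then have "?ts \<noteq> []" by (metis empty_iff empty_set)
  then have "rad v \<in> set ?ts" unfolding rad by (rule argmin_in)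
  then show "Q \<le> 2 * ball_mass I v (rad v)" by simp
  show "rad v \<le> dist v r" unfolding rad using argmin_le[OF root, of "\<lambda>t. t"] by simp
  assume u: "u < n" "dist v u < rad v"
  show "2 * ball_mass I v (dist v u) < Q"
  proof (rule ccontr)
    assume "\<not> ?thesis"
    then have "dist v u \<in> set ?ts" using u by auto
    from argmin_le[OF this, of "\<lambda>t. t" 0] show False using u(2) unfolding rad by simp
  qed
qed

lemma light_ball:
  assumes v: "v < n"
  shows "2 * (\<Sum>u\<in>{u. u < n \<and> u \<noteq> v \<and> dist u v < rad v}. weight u) \<le> Q"
proof (cases "{u. u < n \<and> u \<noteq> v \<and> dist u v < rad v} = {}")
  case True
  show ?thesis unfolding True by simp
next
  case False
  let ?S = "{u. u < n \<and> u \<noteq> v \<and> dist u v < rad v}"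
  have "Max (dist v ` ?S) \<in> dist v ` ?S" using False by (intro Max_in) auto
  then obtain u where u: "u \<in> ?S" "Max (dist v ` ?S) = dist v u" by auto
  have "x \<in> ?S \<Longrightarrow> dist v x \<le> dist v u" for x using Max_ge[of "dist v ` ?S" "dist v x"] u(2) by auto
  then have "(\<Sum>x\<in>?S. if x = r then Q else weight x) \<le> ball_mass I v (dist v u)" by (intro ball_mass_ge) auto
  moreover have "(\<Sum>x\<in>?S. if x = r then Q else weight x) = (\<Sum>x\<in>?S. weight x)"
    using radius_le[OF v] dist_sym[OF v root_less] by (intro sum.cong) auto
  moreover have "2 * ball_mass I v (dist v u) < Q"
    using ball_mass_below_radius[OF v, of u] u(1) dist_sym[OF v, of u] by simp
  ultimately show ?thesis by linarith
qed

definition separated :: "nat list \<Rightarrow> bool" where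
  "separated C \<longleftrightarrow> set C \<subseteq> {..<n} \<and> r \<in> set C \<and>
     (\<forall>a\<in>set C. \<forall>b\<in>set C. a \<noteq> r \<longrightarrow> a \<noteq> b \<longrightarrow> 2 * rad a < dist a b) \<and>
     (\<forall>a\<in>set C. \<forall>v\<in>set (uncovered I C). a \<noteq> r \<longrightarrow> rad a \<le> rad v)"

lemma separatedD:
  assumes "separated C"
  shows "a \<in> set C \<Longrightarrow> a < n" "r \<in> set C" "a \<in> set C \<Longrightarrow> b \<in> set C \<Longrightarrow> a \<noteq> r \<Longrightarrow> a \<noteq> b \<Longrightarrow> 2 * rad a < dist a b"
    "a \<in> set C \<Longrightarrow> v \<in> set (uncovered I C) \<Longrightarrow> a \<noteq> r \<Longrightarrow> rad a \<le> rad v"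
  using assms by (auto simp: separated_def)

lemma set_uncovered: "v \<in> set (uncovered I C) \<longleftrightarrow> v < n \<and> (\<forall>a\<in>set C. 2 * rad v < dist v a)"
  by (auto simp: uncovered_def not_le)

lemma set_uncovered_Cons: "a < n \<Longrightarrow> set (uncovered I (a # C)) \<subseteq> set (uncovered I C) - {a}"
  using dist_zero by (auto simp: set_uncovered)

lemma separated_Cons:
  assumes sep: "separated C" and a: "a \<in> set (uncovered I C)" and least: "\<And>v. v \<in> set (uncovered I C) \<Longrightarrow> rad a \<le> rad v"
  shows "separated (a # C)"
proof -
  have far: "a < n" "b \<in> set C \<Longrightarrow> 2 * rad a < dist a b" for b using a by (auto simp: set_uncovered)
  have far': "2 * rad b < dist b a" if "b \<in> set C" "b \<noteq> r" for b
    using separatedD(4)[OF sep that(1) a that(2)] far(2)[OF that(1)]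
      dist_sym[OF separatedD(1)[OF sep that(1)] far(1)] by linarith
  show ?thesis unfolding separated_def
  proof (intro conjI ballI impI)
    show "set (a # C) \<subseteq> {..<n}" "r \<in> set (a # C)" using separatedD(1,2)[OF sep] far(1) by auto
    show "2 * rad x < dist x b" if "x \<in> set (a # C)" "b \<in> set (a # C)" "x \<noteq> r" "x \<noteq> b" for x b
      using that far' far(2) separatedD(3)[OF sep] by auto
    show "rad x \<le> rad v" if x: "x \<in> set (a # C)" "x \<noteq> r" and v: "v \<in> set (uncovered I (a # C))" for x v
    proof -
      have "v \<in> set (uncovered I C)" using v set_uncovered_Cons[OF far(1)] by blast
      then show ?thesis using x least separatedD(4)[OF sep] by auto
    qed
  qed
qed

lemma separated_add_centre:
  assumes sep: "separated C"
  shows "separated (add_centre I C) \<and> card (set (uncovered I (add_centre I C))) \<le> card (set (uncovered I C)) - 1"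
proof (cases "uncovered I C = []")
  case True
  then show ?thesis using sep by (simp add: add_centre_def)
next
  case False
  define a where "a = argmin 0 rad (uncovered I C)"
  have add: "add_centre I C = a # C" using False by (simp add: add_centre_def a_def)
  have a: "a \<in> set (uncovered I C)" unfolding a_def by (rule argmin_in[OF False])
  have "rad a \<le> rad v" if "v \<in> set (uncovered I C)" for v
    unfolding a_def using argmin_le[OF that, of rad 0] by simp
  then have "separated (a # C)" by (rule separated_Cons[OF sep a])
  moreover have "card (set (uncovered I (a # C))) \<le> card (set (uncovered I C) - {a})"
    using a by (intro card_mono set_uncovered_Cons) (auto simp: set_uncovered)
  ultimately show ?thesis using a by (simp add: add)
qed

lemma separated_centres: "separated (centres I)" and uncovered_centres: "uncovered I (centres I) = []"
proof -
  have init: "separated [r]" using root_less by (auto simp: separated_def)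
  have iter: "separated C \<Longrightarrow> separated (foldl (\<lambda>C _. add_centre I C) C ks) \<and>
      card (set (uncovered I (foldl (\<lambda>C _. add_centre I C) C ks))) \<le> card (set (uncovered I C)) -
        length ks" for C and ks :: "nat list"
  proof (induction ks arbitrary: C)
    case (Cons k ks)
    then show ?case using Cons.IH[of "add_centre I C"] separated_add_centre[of C] by fastforce
  qed simp
  have "set (uncovered I [r]) \<subseteq> {..<n}" using uncovered_subset[of I "[r]"] by auto
  then have "card (set (uncovered I [r])) \<le> n" using card_mono[of "{..<n}"] by fastforce
  then show "separated (centres I)" "uncovered I (centres I) = []"
    using iter[OF init, of "[0..<n]"] by (auto simp: centres_def)
qed

definition centre :: "nat \<Rightarrow> nat" where "centre v = nth_default 0 (nearest_centres I) v"

lemma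
  assumes v: "v < n"
  shows centre_in_centres: "centre v \<in> set (centres I)"
    and dist_centre_minimal: "a \<in> set (centres I) \<Longrightarrow> dist v (centre v) \<le> dist v a"
    and centre_less: "centre v < n"
proof -
  have centre: "centre v = argmin 0 (dist v) (centres I)" using v by (simp add: centre_def nearest_centres_def)
  have "centres I \<noteq> []" using separatedD(2)[OF separated_centres] by auto
  then show "centre v \<in> set (centres I)" unfolding centre by (rule argmin_in)
  then show "centre v < n" by (rule separatedD(1)[OF separated_centres])
  show "a \<in> set (centres I) \<Longrightarrow> dist v (centre v) \<le> dist v a" unfolding centre by (rule argmin_le)
qed

lemma centre_root: "centre r = r"
proof (rule ccontr)
  note root = separatedD(2)[OF separated_centres]
  assume "centre r \<noteq> r"
  then have "2 * rad (centre r) < dist (centre r) r"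
    using separatedD(3)[OF separated_centres centre_in_centres[OF root_less] root] by blast
  moreover have "dist r (centre r) \<le> dist r r" by (rule dist_centre_minimal[OF root_less root])
  ultimately show False using dist_zero[OF root_less] dist_sym[OF root_less centre_less[OF root_less]] by simp
qed

lemma dist_centre_le_radius:
  assumes v: "v < n"
  shows "dist v (centre v) \<le> 2 * rad v"
proof -
  have "v \<notin> set (uncovered I (centres I))" using uncovered_centres by simp
  then obtain a where "a \<in> set (centres I)" "dist v a \<le> 2 * rad v" using v by (auto simp: set_uncovered not_less)
  then show ?thesis using dist_centre_minimal[OF v] by fastforce
qed

lemma centre_eq_of_near:
  assumes a: "a \<in> set (centres I)" "a \<noteq> r" and x: "x < n" "dist a x \<le> rad a"
  shows "centre x = a"
proof (rule ccontr)
  assume neq: "centre x \<noteq> a"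
  have less: "a < n" by (rule separatedD(1)[OF separated_centres a(1)])
  have "2 * rad a < dist a (centre x)"
    using separatedD(3)[OF separated_centres a(1) centre_in_centres[OF x(1)] a(2)] neq by simp
  also have "\<dots> \<le> dist a x + dist x (centre x)" by (rule dist_triangle[OF less x(1) centre_less[OF x(1)]])
  also have "dist x (centre x) \<le> dist x a" by (rule dist_centre_minimal[OF x(1) a(1)])
  also have "dist x a = dist a x" by (rule dist_sym[OF x(1) less])
  finally show False using x(2) by linarith
qed

lemma heavy_cell:
  assumes v: "v < n" and root: "centre v \<noteq> r"
  shows "Q \<le> 2 * (\<Sum>u\<in>{u. u < n \<and> centre u = centre v}. weight u)"
proof -
  let ?a = "centre v"
  note near = centre_eq_of_near[OF centre_in_centres[OF v] root]
  have "ball_mass I ?a (rad ?a) = (\<Sum>x\<in>{x. x < n \<and> dist ?a x \<le> rad ?a}. weight x)"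
    unfolding ball_mass_eq using near[OF root_less] centre_root root by (intro sum.cong) auto
  also have "\<dots> \<le> (\<Sum>u\<in>{u. u < n \<and> centre u = ?a}. weight u)" using near by (intro sum_mono2) auto
  finally show ?thesis using ball_mass_radius[OF centre_less[OF v]] by linarith
qed

definition d :: "nat \<Rightarrow> nat \<Rightarrow> real" where "d u v = real (dist u v)"

definition p :: "nat \<Rightarrow> real" where "p v = real (weight v) / real Q"

sublocale apriori n r d p
proof
  show "r < n" by (rule root_less)
  show "d i j = d j i" if "i < n" "j < n" for i j using dist_sym[OF that] by (simp add: d_def)
  show "d i i = 0" if "i < n" for i using dist_zero[OF that] by (simp add: d_def)
  show "d i k \<le> d i j + d j k" if "i < n" "j < n" "k < n" for i j k
    using dist_triangle[OF that] unfolding d_def by (simp flip: of_nat_add)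
  show "0 \<le> p i \<and> p i \<le> 1" if "i < n" for i using weight_le[OF that] Q_pos by (simp add: p_def)
qed (simp add: d_def)

lemma half_le_sum_prob_iff: "1 / 2 \<le> (\<Sum>u\<in>A. p u) \<longleftrightarrow> Q \<le> 2 * (\<Sum>u\<in>A. weight u)"
  and sum_prob_le_half_iff: "(\<Sum>u\<in>A. p u) \<le> 1 / 2 \<longleftrightarrow> 2 * (\<Sum>u\<in>A. weight u) \<le> Q"
proof -
  define s where "s = (\<Sum>u\<in>A. p u)"
  have "real Q * (2 * s) = real (2 * (\<Sum>u\<in>A. weight u))"
    using Q_pos by (simp add: s_def p_def sum_divide_distrib[symmetric])
  moreover have "1 / 2 \<le> s \<longleftrightarrow> real Q \<le> real Q * (2 * s)" "s \<le> 1 / 2 \<longleftrightarrow> real Q * (2 * s) \<le> real Q"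
    using Q_pos by (auto simp: mult_le_cancel_left1 mult_le_cancel_left2)
  ultimately show "1 / 2 \<le> (\<Sum>u\<in>A. p u) \<longleftrightarrow> Q \<le> 2 * (\<Sum>u\<in>A. weight u)" "(\<Sum>u\<in>A. p u) \<le> 1 / 2 \<longleftrightarrow> 2 * (\<Sum>u\<in>A. weight u) \<le> Q"
    by (simp_all only: s_def of_nat_le_iff)
qed

sublocale clustering n r d p centre "\<lambda>v. real (rad v)"
proof
  show "centre v < n" if "v < n" for v by (rule centre_less[OF that])
  show "centre r = r" by (rule centre_root)
  show "real (rad v) \<le> d r v" if "v < n" for v
    using radius_le[OF that] dist_sym[OF that root_less] by (simp add: d_def)
  show "(\<Sum>u\<in>punctured_ball v (real (rad v)). p u) \<le> 1 / 2" if "v < n" for v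
    using light_ball[OF that] unfolding sum_prob_le_half_iff punctured_ball_def d_def of_nat_less_iff .
  show "d v (centre v) \<le> 2 * real (rad v)" if "v < n" for v
    using of_nat_mono[OF dist_centre_le_radius[OF that], where 'a = real] by (simp add: d_def)
  show "1 / 2 \<le> (\<Sum>u\<in>{u. u < n \<and> centre u = centre v}. p u)" if "v < n" "centre v \<noteq> r" for v
    using heavy_cell[OF that] unfolding half_le_sum_prob_iff .
qed simp

subsection \<open>The tour of one scale\<close>

abbreviation prize_list :: "nat \<Rightarrow> nat list" where "prize_list t \<equiv> prizes I (nearest_centres I) t"

definition edges_at :: "nat \<Rightarrow> (nat \<times> nat) list" where
  "edges_at t = pd_edges (scaled_env I (prize_list t)) (prize_list t)"

definition Tr :: "nat \<Rightarrow> nat list" where "Tr t = tour_at I (nearest_centres I) t"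

lemma prize_eq:
  assumes u: "u < n"
  shows "real (nth_default 0 (prize_list t) u) = real Q * cell_prize (real t) u"
proof (cases "u = r")
  case True
  then show ?thesis using u by (simp add: prizes_def cell_prize_def)
next
  case False
  have diff: "real (t - dist v u) = max 0 (real t - d v u)" for v
    by (cases "dist v u \<le> t") (auto simp: d_def of_nat_diff)
  have "nth_default 0 (prize_list t) u = (\<Sum>v\<in>cell u. weight v * (t - dist v u))"
    using u False by (simp add: prizes_def sum_list_upt_if centre_def cell_def)
  then have "real (nth_default 0 (prize_list t) u) = (\<Sum>v\<in>cell u. real (weight v) * max 0 (real t - d v u))"
    by (simp add: diff)
  also have "\<dots> = real Q * cell_prize (real t) u"
    using False Q_pos by (simp add: cell_prize_def sum_distrib_left p_def)
  finally show ?thesis .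
qed

lemma primal_dual_scaled:
  "primal_dual n r (\<lambda>u v. Q * dist u v) (nth_default 0 (prize_list t)) (map (\<lambda>row. map (\<lambda>a. Q * a) row) ds) (sum_list (prize_list t))"
proof
  show "dist_at (map (\<lambda>row. map (\<lambda>a. Q * a) row) ds) u v = Q * dist u v" for u v by (rule dist_at_scale)
  show "Q * dist u v = Q * dist v u" if "u < n" "v < n" for u v using dist_sym[OF that] by simp
  show "even (Q * dist u v)" if "u < n" "v < n" for u v
    using dvd_trans[OF _ coarse[OF that], of 2] by (simp add: dvd_mult)
  show "nth_default 0 (prize_list t) r = 0" using root_less by (simp add: prizes_def)
  have "length (prize_list t) = n" by (simp add: prizes_def)
  then show "sum_list (prize_list t) = (\<Sum>v<n. nth_default 0 (prize_list t) v)"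
    by (simp add: sum_list_sum_nth nth_default_def atLeast0LessThan)
qed (rule root_less)

lemma scaled_env_eq:
  "scaled_env I (prize_list t) = primal_dual.env n r (map (\<lambda>row. map (\<lambda>a. Q * a) row) ds) (sum_list (prize_list t))"
  unfolding primal_dual.env_def[OF primal_dual_scaled] by (simp add: scaled_env_def)

lemma rooted_tree_edges_at: "rooted_tree n r (edges_at t)"
  unfolding edges_at_def scaled_env_eq by (rule primal_dual.rooted_tree_pd_edges[OF primal_dual_scaled HOL.refl])

lemma Tr_eq: "Tr t = tree_tour [0..<n] r (edges_at t)"
  by (simp add: Tr_def tour_at_def edges_at_def)

lemmas Tr_props = tree_tour_correct[OF rooted_tree_edges_at, folded Tr_eq]

lemma set_Tr_subset: "set (Tr t) \<subseteq> {..<n}"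
  using rooted_tree_edges_at[of t] r unfolding Tr_props(3) by (auto simp: rooted_tree_def tree_vertices_def)

lemma Tr_root: "set (Tr t) \<subseteq> {..<n} \<and> (\<exists>ws. Tr t = r # ws)"
proof -
  have "Tr t \<noteq> []" using Tr_props(3)[of t] by (auto simp: tree_vertices_def)
  then show ?thesis using set_Tr_subset Tr_props(1)[of t] by (metis list.collapse)
qed

lemma dual_exists:
  "\<exists>y. feasible_dual n r d (cell_prize (real t)) y \<and>
    (\<Sum>e\<leftarrow>edges_at t. d (fst e) (snd e)) + 2 * (\<Sum>u\<in>{..<n} - set (Tr t). cell_prize (real t) u) \<le> 4 * dual_value n y"
proof -
  obtain y where y: "feasible_dual n r (\<lambda>u v. Q * dist u v) (nth_default 0 (prize_list t)) y"
    and cost: "(\<Sum>e\<leftarrow>edges_at t. Q * dist (fst e) (snd e)) + 2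
      * (\<Sum>v\<in>{..<n} - set (Tr t). nth_default 0 (prize_list t) v) \<le> 4 * dual_value n y"
    using primal_dual.pd_edges_cost[OF primal_dual_scaled HOL.refl, folded scaled_env_eq]
      unfolding edges_at_def[symmetric] Tr_props(3) by blast
  let ?y = "\<lambda>X. real (y X) / real Q" and ?Z = "\<Sum>u\<in>{..<n} - set (Tr t). cell_prize (real t) u"
  have "real (\<Sum>e\<leftarrow>T. Q * dist (fst e) (snd e)) = real Q * (\<Sum>e\<leftarrow>T. d (fst e) (snd e))" for T :: "(nat \<times> nat) list"
    by (induction T) (simp_all add: d_def algebra_simps)
  moreover have "real (\<Sum>v\<in>{..<n} - set (Tr t). nth_default 0 (prize_list t) v) = real Q * ?Z"
    by (simp add: prize_eq sum_distrib_left)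
  moreover have "real (dual_value n y) = real Q * dual_value n ?y" using Q_pos
    by (simp add: moat_sum_def sum_divide_distrib[symmetric])
  ultimately have "real Q * (\<Sum>e\<leftarrow>edges_at t. d (fst e) (snd e)) + 2 * (real Q * ?Z) \<le> 4 * (real Q * dual_value n ?y)"
    using of_nat_mono[OF cost, where 'a = real] by (simp only: of_nat_add of_nat_mult of_nat_numeral)
  then have "real Q * ((\<Sum>e\<leftarrow>edges_at t. d (fst e) (snd e)) + 2 * ?Z) \<le> real Q * (4 * dual_value n ?y)"
    by (simp only: distrib_left mult.left_commute[of 2] mult.left_commute[of 4])
  then have "(\<Sum>e\<leftarrow>edges_at t. d (fst e) (snd e)) + 2 * ?Z \<le> 4 * dual_value n ?y" using Q_pos
    by (simp only: mult_le_cancel_left_pos of_nat_0_less_iff)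
  moreover have "feasible_dual n r d (cell_prize (real t)) ?y"
    using Q_pos by (intro feasible_dual_scale[OF y]) (simp_all add: d_def prize_eq)
  ultimately show ?thesis by blast
qed

definition y :: "nat \<Rightarrow> nat set \<Rightarrow> real" where
  "y t = (SOME y. feasible_dual n r d (cell_prize (real t)) y \<and>
    (\<Sum>e\<leftarrow>edges_at t. d (fst e) (snd e)) + 2 * (\<Sum>u\<in>{..<n} - set (Tr t). cell_prize (real t) u) \<le> 4 * dual_value n y)"

lemma feasible_y: "feasible_dual n r d (cell_prize (real t)) (y t)"
  and dual_cost: "(\<Sum>e\<leftarrow>edges_at t. d (fst e) (snd e)) + 2 * (\<Sum>u\<in>{..<n} - set (Tr t). cell_prize (real t) u)
    \<le> 4 * dual_value n (y t)"
  using someI_ex[OF dual_exists[of t], folded y_def] by blast+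

lemma edges_cost_le: "(\<Sum>e\<leftarrow>edges_at t. d (fst e) (snd e)) \<le> 4 * dual_value n (y t)"
  using dual_cost[of t] sum_nonneg[of "{..<n} - set (Tr t)" "cell_prize (real t)"] cell_prize_nonneg by simp

lemma missed_prize_le: "(\<Sum>u\<in>{..<n} - set (Tr t). cell_prize (real t) u) \<le> 2 * dual_value n (y t)"
proof -
  have "0 \<le> (\<Sum>e\<leftarrow>edges_at t. d (fst e) (snd e))" by (rule sum_list_nonneg) (auto simp: d_def)
  then show ?thesis using dual_cost[of t] by linarith
qed

lemma walk_len_Tr_le: "walk_len d (Tr t @ [r]) \<le> 8 * dual_value n (y t)"
  using Tr_props(4)[of t] edges_cost_le[of t] by linarith

subsection \<open>The last and the first scale\<close>

definition total_dist :: real where "total_dist = real (sum_list (map sum_list ds))"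

definition scales :: nat where "scales = length (bits (horizon I))"

lemma d_le_total_dist: "d u v \<le> total_dist"
  unfolding d_def total_dist_def using dist_at_le_sum[of ds u v] by simp

lemma n_ge_1: "1 \<le> real n" using root_less by simp

lemma horizon_less: "5 * (real n * total_dist) < 16 ^ scales"
proof -
  have "horizon I < 2 ^ scales" unfolding scales_def by (rule less_power_length_bits)
  also have "(2::nat) ^ scales \<le> 16 ^ scales" by (rule power_mono) auto
  finally have "real (horizon I) < real (16 ^ scales)" by (simp only: of_nat_less_iff)
  then show ?thesis by (simp add: horizon_def total_dist_def sum_list_triv)
qed

lemma total_dist_le: "0 \<le> total_dist" "total_dist \<le> real n * total_dist"
  using mult_right_mono[OF n_ge_1, of total_dist] by (simp_all add: total_dist_def)

lemma dual_value_y_le: "dual_value n (y t) \<le> real n * total_dist"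
proof -
  have "dual_value n (y t) \<le> (\<Sum>v<n. d v r)" by (rule dual_value_le_dists[OF feasible_y root_less])
  also have "\<dots> \<le> (\<Sum>v<n. total_dist)" by (rule sum_mono) (rule d_le_total_dist)
  finally show ?thesis by simp
qed

lemma last_tour_serves:
  assumes v: "v < n"
  shows "centre v \<in> set (Tr (16 ^ scales)) \<and> d v (centre v) \<le> 16 ^ scales"
proof
  let ?t = "16 ^ scales :: nat"
  show "d v (centre v) \<le> 16 ^ scales" using d_le_total_dist[of v "centre v"] total_dist_le horizon_less by linarith
  show "centre v \<in> set (Tr ?t)"
  proof (rule ccontr)
    assume missed: "centre v \<notin> set (Tr ?t)"
    then have root: "centre v \<noteq> r" using Tr_root[of ?t] by auto
    have "0 \<le> 16 ^ scales - total_dist" using total_dist_le horizon_less by linarith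
    moreover have "1 / 2 \<le> (\<Sum>u\<in>cell (centre v). p u)" using heavy[OF v root] by (simp add: cell_def)
    ultimately have "1 / 2 * (16 ^ scales - total_dist) \<le> (\<Sum>u\<in>cell (centre v). p u) * (16 ^ scales - total_dist)"
      by (intro mult_right_mono)
    also have "\<dots> = (\<Sum>u\<in>cell (centre v). p u * (16 ^ scales - total_dist))" by (rule sum_distrib_right)
    also have "\<dots> \<le> (\<Sum>u\<in>cell (centre v). p u * max 0 (real ?t - d u (centre v)))"
    proof (intro sum_mono mult_left_mono)
      fix u assume "u \<in> cell (centre v)"
      then show "0 \<le> p u" using prob_nonneg by (simp add: cell_def)
      show "16 ^ scales - total_dist \<le> max 0 (real ?t - d u (centre v))" using d_le_total_dist[of u "centre v"] by simp
    qed
    also have "\<dots> = cell_prize (real ?t) (centre v)" using root by (simp add: cell_prize_def)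
    also have "\<dots> \<le> (\<Sum>u\<in>{..<n} - set (Tr ?t). cell_prize (real ?t) u)"
      using missed centre_less[OF v] by (intro member_le_sum cell_prize_nonneg) auto
    also have "\<dots> \<le> 2 * (real n * total_dist)" using missed_prize_le[of ?t] dual_value_y_le[of ?t] by linarith
    finally have "16 ^ scales - total_dist \<le> 4 * (real n * total_dist)" by simp
    then show False using total_dist_le horizon_less by linarith
  qed
qed

lemma d_zero_or_large:
  assumes "u < n" "v < n"
  shows "d u v = 0 \<or> 8 * real n \<le> d u v"
proof -
  have "dist u v = 0 \<or> 8 * n \<le> dist u v" using coarse[OF assms] by (auto dest: dvd_imp_le)
  then show ?thesis using of_nat_mono[of "8 * n" "dist u v", where 'a = real] unfolding d_def by auto
qed

lemma sum_cell_prize_1_le: "(\<Sum>u<n. cell_prize 1 u) \<le> real n"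
proof -
  have "(\<Sum>u<n. cell_prize 1 u) \<le> (\<Sum>u<n. \<Sum>v\<in>{v\<in>{..<n}. centre v = u}. 1)"
  proof (rule sum_mono)
    fix u
    have "p v * max 0 (1 - d v u) \<le> 1 * 1" if "v < n" for v
      using prob[OF that] by (intro mult_mono) (auto simp: d_def)
    then have "(\<Sum>v\<in>cell u. p v * max 0 (1 - d v u)) \<le> (\<Sum>v\<in>cell u. 1)" by (intro sum_mono) (simp add: cell_def)
    then show "cell_prize 1 u \<le> (\<Sum>v\<in>{v\<in>{..<n}. centre v = u}. 1)" by (simp add: cell_prize_def cell_def)
  qed
  also have "\<dots> = (\<Sum>v<n. 1)" by (rule sum.group) (use centre_less in auto)
  finally show ?thesis by simp
qed

lemma walk_len_first_tour: "walk_len d (Tr 1 @ [r]) \<le> 0"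
proof -
  have "dual_value n (y 1) \<le> real n" using dual_value_le_prizes[OF feasible_y[of 1]] sum_cell_prize_1_le by simp
  then have cost: "(\<Sum>e\<leftarrow>edges_at 1. d (fst e) (snd e)) \<le> 4 * real n" using edges_cost_le[of 1] by linarith
  have "d (fst e) (snd e) = 0" if e: "e \<in> set (edges_at 1)" for e
  proof (rule ccontr)
    assume "d (fst e) (snd e) \<noteq> 0"
    then have "8 * real n \<le> d (fst e) (snd e)"
      using d_zero_or_large rooted_tree_edges_at[of 1] e by (auto simp: rooted_tree_def)
    also have "\<dots> \<le> (\<Sum>e\<leftarrow>edges_at 1. d (fst e) (snd e))" using e by (intro member_le_sum_list) (auto simp: d_def)
    finally show False using cost n_ge_1 by linarith
  qed
  then have "(\<Sum>e\<leftarrow>edges_at 1. d (fst e) (snd e)) = 0" by (simp cong: map_cong)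
  then show ?thesis using Tr_props(4)[of 1] by simp
qed

lemma solve_eq:
  "solve I = foldl snoc_new [r]
    (concat (map (\<lambda>j. stage [0..<n] (\<lambda>v a. centre v = a \<and> d v a \<le> 16 ^ j) (Tr (16 ^ j))) [0..<Suc scales]) @ [0..<n])"
  unfolding solve_def powers16_eq stage_at_def scales_def
  by (simp add: o_def centre_def d_def Tr_def del: upt_Suc)

lemma staged_solution_solve:
  assumes "solve I = r # xs"
  shows "staged_solution n r d p centre (\<lambda>v. real (rad v)) (\<lambda>j. Tr (16 ^ j)) scales xs (\<lambda>j. y (16 ^ j))"
proof
  show "set (Tr (16 ^ j)) \<subseteq> {..<n} \<and> (\<exists>ws. Tr (16 ^ j) = r # ws)" for j by (rule Tr_root)
  show "centre v \<in> set (Tr (16 ^ scales)) \<and> d v (centre v) \<le> 16 ^ scales" if "v < n" for v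
    by (rule last_tour_serves[OF that])
  show "r # xs = foldl snoc_new [r]
    (concat (map (\<lambda>j. stage [0..<n] (\<lambda>v a. centre v = a \<and> d v a \<le> 16 ^ j) (Tr (16 ^ j))) [0..<Suc scales]) @ [0..<n])"
    using assms solve_eq by simp
  show "feasible_dual n r d (cell_prize (16 ^ j)) (y (16 ^ j))" for j using feasible_y[of "16 ^ j"] by simp
  show "walk_len d (Tr (16 ^ j) @ [r]) \<le> 8 * dual_value n (y (16 ^ j))" for j by (rule walk_len_Tr_le)
  show "(\<Sum>u\<in>{..<n} - set (Tr (16 ^ j)). cell_prize (16 ^ j) u) \<le> 2 * dual_value n (y (16 ^ j))" for j
    using missed_prize_le[of "16 ^ j"] by simp
  show "walk_len d (Tr (16 ^ 0) @ [r]) \<le> 0" using walk_len_first_tour by simp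
  show "d v (centre v) = 0" if "v < n" "d v (centre v) \<le> 1" for v
    using d_zero_or_large[OF that(1) centre_less[OF that(1)]] that(2) n_ge_1 by linarith
qed

theorem solve_correct:
  assumes xo: "set xo = {..<n} - {r}" "distinct xo"
  obtains xs where "solve I = r # xs" "set xs = {..<n} - {r}" "distinct xs"
    "expected_latency n r d p xs \<le> 30000000 * expected_latency n r d p xo"
proof -
  have "\<exists>xs. foldl snoc_new [r] ys = r # xs" for ys using foldl_snoc_new_prefix[of "[r]" ys] by auto
  then obtain xs where solve: "solve I = r # xs" unfolding solve_eq by blast
  then interpret staged_solution n r d p centre "\<lambda>v. real (rad v)" "\<lambda>j. Tr (16 ^ j)" scales xs "\<lambda>j. y (16 ^ j)"
    by (rule staged_solution_solve)
  show ?thesis using that[OF solve set_xs distinct_xs approximation[OF xo]] .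
qed

end

section \<open>Reading the instance\<close>

definition reads :: "nat list \<Rightarrow> nat list \<Rightarrow> bool" where
  "reads w us \<longleftrightarrow> (\<forall>ts. foldl read_token (ts, []) (map unary w) = (ts @ us, []))"

lemma reads_Nil: "reads [] []" by (simp add: reads_def)

lemma reads_append: "reads w us \<Longrightarrow> reads w' us' \<Longrightarrow> reads (w @ w') (us @ us')" by (simp add: reads_def)

lemma reads_concat: "(\<And>i. i \<in> set js \<Longrightarrow> reads (f i) (g i)) \<Longrightarrow> reads (concat (map f js)) (concat (map g js))"
  by (induction js) (auto intro!: reads_append reads_Nil)

lemma reads_nat:
  assumes "2 < k"
  shows "reads (nat_enc m @ [k]) [m]"
proof -
  have unary: "unary (Suc 0) = [()]" "unary 2 = [(), ()]" by (simp_all add: unary_def numeral_2_eq_2)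
  have bits: "foldl read_token (ts, bs') (map unary (map (\<lambda>b. if b then 2 else 1) bs))
    = (ts, rev bs @ bs')" for ts bs' bs
    by (induction bs arbitrary: bs') (auto simp: read_token_def unary)
  have "length (tl (tl (unary k))) = k - 2" by (simp add: unary_def)
  then have "tl (tl (unary k)) \<noteq> []" using assms by force
  then show ?thesis by (simp add: reads_def nat_enc_def bits read_token_def nat_of_bits_rev_bits del: map_map)
qed

definition rat_tokens :: "rat \<Rightarrow> nat list" where
  "rat_tokens q = [nat (fst (quotient_of q)), nat (snd (quotient_of q))]"

lemma reads_rat: "reads (rat_enc q) (rat_tokens q)"
proof -
  have "rat_enc q = (nat_enc (nat (fst (quotient_of q))) @ [3]) @ (nat_enc (nat (snd (quotient_of q))) @ [4])"
    by (simp add: rat_enc_def split: prod.split)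
  then show ?thesis using reads_append[OF reads_nat[of 3] reads_nat[of 4]] by (simp add: rat_tokens_def)
qed

lemma quotient_of_nonneg:
  assumes "0 \<le> q"
  shows "0 < nat (snd (quotient_of q))"
    "real (nat (fst (quotient_of q))) = real_of_rat q * real (nat (snd (quotient_of q)))"
proof -
  obtain a b where ab: "quotient_of q = (a, b)" by fastforce
  have b: "0 < b" using quotient_of_denom_pos[OF ab] .
  have q: "q = of_int a / of_int b" by (rule quotient_of_div[OF ab])
  then have "0 \<le> a" using assms b by (simp add: zero_le_divide_iff)
  moreover have "real_of_rat q = real_of_int a / real_of_int b" by (simp add: q of_rat_divide)
  ultimately show "0 < nat (snd (quotient_of q))"
    "real (nat (fst (quotient_of q))) = real_of_rat q * real (nat (snd (quotient_of q)))"
    using b by (simp_all add: ab)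
qed

lemma tokens_inst_enc:
  "tokens (map unary (inst_enc n r d p))
    = n # r # concat (map (\<lambda>i. concat (map (\<lambda>j. rat_tokens (d i j)) [0..<n])) [0..<n]) @
     0 # concat (map (\<lambda>i. rat_tokens (p i)) [0..<n])"
proof -
  have "reads ((nat_enc n @ [5]) @ (nat_enc r @ [5]) @ concat (map (\<lambda>i. concat (map (\<lambda>j. rat_enc (d i j)) [0..<n])) [0..<n]) @
      (nat_enc 0 @ [5]) @ concat (map (\<lambda>i. rat_enc (p i)) [0..<n]))
    ([n] @ [r] @ concat (map (\<lambda>i. concat (map (\<lambda>j. rat_tokens (d i j)) [0..<n])) [0..<n]) @ [0] @ concat (map (\<lambda>i. rat_tokens (p i)) [0..<n]))"
    by (intro reads_append reads_concat reads_nat reads_rat) simp_all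
  then show ?thesis by (simp add: reads_def tokens_def inst_enc_def nat_enc_def)
qed

lemma length_concat_map_const: "(\<And>u. length (f u) = k) \<Longrightarrow> length (concat (map f [0..<m])) = m * k"
  by (induction m) simp_all

lemma nth_concat_map_const:
  assumes length: "\<And>u. length (f u) = k" and "u < m" "v < k"
  shows "concat (map f [0..<m]) ! (u * k + v) = f u ! v"
  using assms(2)
proof (induction m)
  case (Suc m)
  note len = length_concat_map_const[OF length]
  show ?case
  proof (cases "u = m")
    case True
    then show ?thesis using assms(3) by (simp add: nth_append len)
  next
    case False
    then have "u * k + v < m * k" using Suc.prems assms(3) mult_le_mono1[of "Suc u" m k] by simp
    then show ?thesis using Suc False by (simp add: nth_append len)
  qed
qed simp

lemma common_denom_eq:
  assumes "\<forall>q\<in>set qs. 0 < snd q"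
  shows "0 < snd (common_denom qs) \<and>
    (\<forall>i<length qs. fst (common_denom qs) ! i * snd (qs ! i) = fst (qs ! i) * snd (common_denom qs))"
  using assms
proof (induction qs)
  case (Cons q qs)
  show ?case
  proof (intro conjI allI impI)
    show "0 < snd (common_denom (q # qs))" using Cons by (simp add: common_denom_simps add_fraction_def)
    fix i assume "i < length (q # qs)"
    then show "fst (common_denom (q # qs)) ! i * snd ((q # qs) ! i) = fst ((q # qs) ! i) * snd (common_denom (q # qs))"
      using Cons length_common_denom[of qs] by (cases i) (auto simp: common_denom_simps add_fraction_def algebra_simps)
  qed
qed (simp add: common_denom_simps)

lemma common_denom_ratio:
  assumes "\<forall>q\<in>set qs. 0 < snd q" "i < length qs" "real (fst (qs ! i)) = x * real (snd (qs ! i))"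
  shows "real (nth_default 0 (fst (common_denom qs)) i) = x * real (snd (common_denom qs))"
proof -
  have "real (fst (common_denom qs) ! i) * real (snd (qs ! i)) = x * real (snd (qs ! i)) * real (snd (common_denom qs))"
    using common_denom_eq[OF assms(1)] assms(2,3) by (metis of_nat_mult)
  moreover have "0 < snd (qs ! i)" using assms(1,2) by simp
  ultimately show ?thesis using assms(2) length_common_denom[of qs] by (simp add: nth_default_def)
qed

lemma filter_less_upt: "n \<le> m \<Longrightarrow> filter (\<lambda>v. v < n) [0..<m] = [0..<n]"
  using upt_add_eq_append[of 0 n "m - n"] by simp

lemma mult_add_less_square: "u < n \<Longrightarrow> v < k \<Longrightarrow> u * k + v < n * (k::nat)"
  using mult_le_mono1[of "Suc u" n k] by simp

context
  fixes n r :: nat and d :: "nat \<Rightarrow> nat \<Rightarrow> rat" and p :: "nat \<Rightarrow> rat"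
  assumes valid: "valid_instance n r d p"
begin

lemma valid_root: "r < n"
  and valid_dist: "u < n \<Longrightarrow> v < n \<Longrightarrow> 0 \<le> d u v" "u < n \<Longrightarrow> v < n \<Longrightarrow> d u v = d v u" "u < n \<Longrightarrow> d u u = 0"
    "u < n \<Longrightarrow> v < n \<Longrightarrow> w < n \<Longrightarrow> d u w \<le> d u v + d v w"
  and valid_prob: "v < n \<Longrightarrow> 0 \<le> p v" "v < n \<Longrightarrow> p v \<le> 1"
  using valid by (auto simp: valid_instance_def)

definition toks :: "nat list" where "toks = tokens (map unary (inst_enc n r d p))"

abbreviation row_tokens :: "(nat \<Rightarrow> rat) \<Rightarrow> nat list" where
  "row_tokens f \<equiv> concat (map (\<lambda>j. rat_tokens (f j)) [0..<n])"

abbreviation dist_tokens :: "nat list" where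
  "dist_tokens \<equiv> concat (map (\<lambda>i. row_tokens (d i)) [0..<n])"

lemma toks_eq: "toks = n # r # dist_tokens @ 0 # row_tokens p"
  by (simp add: toks_def tokens_inst_enc)

lemma length_rat_tokens: "length (rat_tokens q) = 2"
  by (simp add: rat_tokens_def)

lemma length_row_tokens: "length (row_tokens f) = n * 2"
  by (rule length_concat_map_const[OF length_rat_tokens])

lemma length_dist_tokens: "length dist_tokens = n * (n * 2)"
  by (rule length_concat_map_const[OF length_row_tokens])

lemma nth_row_tokens:
  assumes "v < n"
  shows "row_tokens f ! (v * 2) = nat (fst (quotient_of (f v)))"
    "row_tokens f ! (v * 2 + 1) = nat (snd (quotient_of (f v)))"
  using nth_concat_map_const[OF length_rat_tokens assms, of 0] nth_concat_map_const[OF length_rat_tokens assms, of 1]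
  by (simp_all add: rat_tokens_def)

lemma length_toks: "length toks = 3 + n * (n * 2) + n * 2"
  by (simp add: toks_eq length_dist_tokens length_row_tokens)

lemma toks_0: "nth_default 0 toks 0 = n" and toks_1: "nth_default 0 toks 1 = r"
  by (simp_all add: toks_eq nth_default_def)

lemma toks_dist:
  assumes "u < n" "v < n"
  shows "nth_default 0 toks (2 + 2 * (u * n + v)) = nat (fst (quotient_of (d u v)))"
    "nth_default 0 toks (3 + 2 * (u * n + v)) = nat (snd (quotient_of (d u v)))"
proof -
  have entry: "nth_default 0 toks (2 + (u * (n * 2) + x)) = row_tokens (d u) ! x" if x: "x < n * 2" for x
  proof -
    have less: "u * (n * 2) + x < n * (n * 2)" using mult_add_less_square[OF assms(1) x] .
    then have "nth_default 0 toks (2 + (u * (n * 2) + x)) = toks ! Suc (Suc (u * (n * 2) + x))"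
      using length_toks by (simp add: nth_default_def)
    also have "\<dots> = dist_tokens ! (u * (n * 2) + x)"
      unfolding toks_eq using less length_dist_tokens by (simp add: nth_append)
    finally show ?thesis using nth_concat_map_const[OF length_row_tokens assms(1) x] by simp
  qed
  have index: "2 + 2 * (u * n + v) = 2 + (u * (n * 2) + v * 2)"
    "3 + 2 * (u * n + v) = 2 + (u * (n * 2) + (v * 2 + 1))" by simp_all
  show "nth_default 0 toks (2 + 2 * (u * n + v)) = nat (fst (quotient_of (d u v)))"
    unfolding index using entry[of "v * 2"] nth_row_tokens(1)[OF assms(2)] assms by simp
  show "nth_default 0 toks (3 + 2 * (u * n + v)) = nat (snd (quotient_of (d u v)))"
    unfolding index using entry[of "v * 2 + 1"] nth_row_tokens(2)[OF assms(2)] assms by simp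
qed

lemma toks_prob:
  assumes "v < n"
  shows "nth_default 0 toks (3 + 2 * (n * n) + 2 * v) = nat (fst (quotient_of (p v)))"
    "nth_default 0 toks (4 + 2 * (n * n) + 2 * v) = nat (snd (quotient_of (p v)))"
proof -
  have entry: "nth_default 0 toks (3 + n * (n * 2) + x) = row_tokens p ! x" if x: "x < n * 2" for x
  proof -
    have "nth_default 0 toks (3 + n * (n * 2) + x) = toks ! Suc (Suc (n * (n * 2) + Suc x))"
      using x length_toks by (simp add: nth_default_def numeral_3_eq_3)
    also have "\<dots> = row_tokens p ! x" unfolding toks_eq using length_dist_tokens by (simp add: nth_append)
    finally show ?thesis .
  qed
  have index: "3 + 2 * (n * n) + 2 * v = 3 + n * (n * 2) + v * 2"
    "4 + 2 * (n * n) + 2 * v = 3 + n * (n * 2) + (v * 2 + 1)" by simp_all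
  show "nth_default 0 toks (3 + 2 * (n * n) + 2 * v) = nat (fst (quotient_of (p v)))"
    unfolding index using entry[of "v * 2"] nth_row_tokens(1)[OF assms] assms by simp
  show "nth_default 0 toks (4 + 2 * (n * n) + 2 * v) = nat (snd (quotient_of (p v)))"
    unfolding index using entry[of "v * 2 + 1"] nth_row_tokens(2)[OF assms] assms by simp
qed

lemma token_vertices_toks: "token_vertices toks = [0..<n]"
  unfolding token_vertices_def toks_0 by (rule filter_less_upt) (simp add: length_toks)

lemma pair_indices_toks:
  "length (pair_indices toks) = n * n" "u < n \<Longrightarrow> v < n \<Longrightarrow> pair_indices toks ! (u * n + v) = u * n + v"
  "k \<in> set (pair_indices toks) \<Longrightarrow> \<exists>u<n. \<exists>v<n. k = u * n + v"
proof -
  have indices: "pair_indices toks = concat (map (\<lambda>u. map (\<lambda>v. u * n + v) [0..<n]) [0..<n])"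
    by (simp add: pair_indices_def token_vertices_toks toks_0)
  show "length (pair_indices toks) = n * n" unfolding indices by (rule length_concat_map_const) simp
  show "u < n \<Longrightarrow> v < n \<Longrightarrow> pair_indices toks ! (u * n + v) = u * n + v" for u v
    unfolding indices using nth_concat_map_const[of "\<lambda>u. map (\<lambda>v. u * n + v) [0..<n]" n u n v] by simp
  assume "k \<in> set (pair_indices toks)"
  then obtain u v where "u \<in> {0..<n}" "v \<in> {0..<n}" "k = u * n + v"
    unfolding indices set_concat set_map image_image set_upt by blast
  then show "\<exists>u<n. \<exists>v<n. k = u * n + v" by auto
qed

definition dist_denom :: nat where "dist_denom = snd (dist_fractions toks)"
definition scale :: real where "scale = 8 * real n * real dist_denom"
definition int_dists :: "nat list list" where "int_dists = scaled_matrix toks (fst (dist_fractions toks))"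
definition int_weights :: "nat list" where "int_weights = fst (prob_fractions toks)"
definition prob_denom :: nat where "prob_denom = snd (prob_fractions toks)"

lemma int_dists_eq:
  "u < n \<Longrightarrow> v < n \<Longrightarrow> dist_at int_dists u v = 8 * n * nth_default 0 (fst (dist_fractions toks)) (u * n + v)"
  by (simp add: int_dists_def dist_at_def scaled_matrix_def token_vertices_toks toks_0)

abbreviation dist_pairs :: "(nat \<times> nat) list" where
  "dist_pairs \<equiv> map (\<lambda>k. (nth_default 0 toks (2 + 2 * k), nth_default 0 toks (3 + 2 * k))) (pair_indices toks)"

lemma dist_pairs_pos: "\<forall>q\<in>set dist_pairs. 0 < snd q"
proof
  fix q assume "q \<in> set dist_pairs"
  then obtain k where k: "k \<in> set (pair_indices toks)" "snd q = nth_default 0 toks (3 + 2 * k)" by auto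
  then obtain u v where "u < n" "v < n" "k = u * n + v" using pair_indices_toks(3) by blast
  then show "0 < snd q" using k(2) toks_dist(2)[of u v] quotient_of_nonneg(1)[OF valid_dist(1)[of u v]] by simp
qed

lemma scale_pos: "0 < scale"
  using common_denom_eq[OF dist_pairs_pos] valid_root by (simp add: scale_def dist_denom_def dist_fractions_def)

lemma int_dists_scaled:
  assumes "u < n" "v < n"
  shows "real (dist_at int_dists u v) = scale * real_of_rat (d u v)"
proof -
  have index: "u * n + v < length dist_pairs" using mult_add_less_square[OF assms] by (simp add: pair_indices_toks(1))
  then have "dist_pairs ! (u * n + v)
    = (nth_default 0 toks (2 + 2 * (u * n + v)), nth_default 0 toks (3 + 2 * (u * n + v)))"
    using pair_indices_toks(2)[OF assms] by (simp only: nth_map length_map)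
  then have "dist_pairs ! (u * n + v) = (nat (fst (quotient_of (d u v))), nat (snd (quotient_of (d u v))))"
    unfolding toks_dist[OF assms] .
  then have "real (nth_default 0 (fst (common_denom dist_pairs)) (u * n + v))
    = real_of_rat (d u v) * real (snd (common_denom dist_pairs))"
    using quotient_of_nonneg(2)[OF valid_dist(1)[OF assms]]
    by (intro common_denom_ratio[OF dist_pairs_pos index]) (simp only: fst_conv snd_conv)
  then have "real (nth_default 0 (fst (dist_fractions toks)) (u * n + v)) = real_of_rat (d u v) * real dist_denom"
    by (simp add: dist_fractions_def dist_denom_def)
  then show ?thesis unfolding int_dists_eq[OF assms] scale_def by simp
qed

lemma prob_denom_pos: "0 < prob_denom"
  and int_weights_scaled: "v < n \<Longrightarrow> real (nth_default 0 int_weights v) = real_of_rat (p v) * real prob_denom"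
proof -
  let ?qs = "map (\<lambda>v. (nth_default 0 toks (3 + 2 * (n * n) + 2 * v), nth_default 0 toks (4 + 2 * (n * n) + 2 * v))) [0..<n]"
  have fractions: "prob_fractions toks = common_denom ?qs" by (simp add: prob_fractions_def toks_0 token_vertices_toks)
  have pos: "\<forall>q\<in>set ?qs. 0 < snd q" using quotient_of_nonneg(1)[OF valid_prob(1)] by (auto simp: toks_prob)
  show "0 < prob_denom" unfolding prob_denom_def fractions using common_denom_eq[OF pos] by blast
  assume v: "v < n"
  show "real (nth_default 0 int_weights v) = real_of_rat (p v) * real prob_denom"
    unfolding int_weights_def prob_denom_def fractions
    by (rule common_denom_ratio[OF pos])
      (use v quotient_of_nonneg(2)[OF valid_prob(1)[OF v]] in \<open>simp_all add: toks_prob\<close>)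
qed

lemma integral_instance_toks: "integral_instance n r int_dists int_weights prob_denom"
proof
  show "dist_at int_dists u v = dist_at int_dists v u" if "u < n" "v < n" for u v
    using int_dists_scaled[OF that] int_dists_scaled[OF that(2,1)] valid_dist(2)[OF that] by simp
  show "dist_at int_dists u u = 0" if "u < n" for u using int_dists_scaled[OF that that] valid_dist(3)[OF that] by simp
  show "dist_at int_dists u w \<le> dist_at int_dists u v + dist_at int_dists v w" if "u < n" "v < n" "w < n" for u v w
  proof -
    have "real_of_rat (d u w) \<le> real_of_rat (d u v) + real_of_rat (d v w)"
      using valid_dist(4)[OF that] by (simp flip: of_rat_add add: of_rat_less_eq)
    then have "scale * real_of_rat (d u w) \<le> scale * (real_of_rat (d u v) + real_of_rat (d v w))"
      using scale_pos by (intro mult_left_mono) auto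
    then have "real (dist_at int_dists u w) \<le> real (dist_at int_dists u v + dist_at int_dists v w)"
      using int_dists_scaled that by (simp add: distrib_left)
    then show ?thesis by (simp only: of_nat_le_iff)
  qed
  show "8 * n dvd dist_at int_dists u v" if "u < n" "v < n" for u v unfolding int_dists_eq[OF that] by simp
  show "nth_default 0 int_weights v \<le> prob_denom" if v: "v < n" for v
  proof -
    have "real_of_rat (p v) * real prob_denom \<le> 1 * real prob_denom" using valid_prob(2)[OF v]
      by (intro mult_right_mono) simp_all
    then show ?thesis using int_weights_scaled[OF v] by simp
  qed
qed (rule valid_root prob_denom_pos)+

interpretation int: integral_instance n r int_dists int_weights prob_denom
  by (rule integral_instance_toks)

lemma parse_toks: "parse toks = int.I"
  unfolding parse_def int.I_def token_vertices_toks toks_1 unfolding int_dists_def int_weights_def prob_denom_def ..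

lemma expected_latency_int:
  assumes "set xs \<subseteq> {..<n}"
  shows "expected_latency n r int.d int.p xs = scale * exp_latency n d p (r # xs)"
  unfolding exp_latency_eq_expected_latency[OF assms]
proof (rule expected_latency_scale[OF assms valid_root])
  show "int.d i j = scale * real_of_rat (d i j)" if "i < n" "j < n" for i j using int_dists_scaled[OF that]
    by (simp add: int.d_def)
  show "int.p i = real_of_rat (p i)" if "i < n" for i using int_weights_scaled[OF that] prob_denom_pos
    by (simp add: int.p_def)
qed

lemma master_tour_Cons: "master_tour n r (r # xs) \<longleftrightarrow> set xs = {..<n} - {r} \<and> distinct xs"
  using valid_root by (auto simp: master_tour_def)

lemma opt_latency_attained:
  obtains xo where "master_tour n r (r # xo)" "opt_latency n r d p = exp_latency n d p (r # xo)"
proof -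
  let ?M = "{\<tau>. master_tour n r \<tau>}"
  have "set \<tau> \<subseteq> {..<n} \<and> length \<tau> \<le> n" if "master_tour n r \<tau>" for \<tau>
    using that distinct_card[of \<tau>] by (simp add: master_tour_def)
  then have "?M \<subseteq> {\<tau>. set \<tau> \<subseteq> {..<n} \<and> length \<tau> \<le> n}" by blast
  then have "finite ?M" by (rule finite_subset) (rule finite_lists_length_le, simp)
  moreover have "master_tour n r (r # remove1 r [0..<n])" unfolding master_tour_Cons by (auto simp: set_remove1_eq)
  then have "?M \<noteq> {}" by blast
  ultimately have "opt_latency n r d p \<in> exp_latency n d p ` ?M" unfolding opt_latency_def by (intro Min_in) auto
  then obtain \<tau> where tour: "master_tour n r \<tau>" "opt_latency n r d p = exp_latency n d p \<tau>" by blast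
  moreover from tour(1) obtain xo where "\<tau> = r # xo" by (cases \<tau>) (auto simp: master_tour_def)
  ultimately show ?thesis using that by blast
qed

theorem algorithm_correct:
  obtains xs where "solve (parse toks) = r # xs" "master_tour n r (r # xs)"
    "exp_latency n d p (r # xs) \<le> 30000000 * opt_latency n r d p"
proof -
  obtain xo where tour: "master_tour n r (r # xo)" and opt: "opt_latency n r d p = exp_latency n d p (r # xo)"
    by (rule opt_latency_attained)
  then have xo: "set xo = {..<n} - {r}" "distinct xo" by (simp_all add: master_tour_Cons)
  obtain xs where xs: "solve int.I = r # xs" "set xs = {..<n} - {r}" "distinct xs"
    and approx: "expected_latency n r int.d int.p xs \<le> 30000000 * expected_latency n r int.d int.p xo"
    by (rule int.solve_correct[OF xo])
  have "set xs \<subseteq> {..<n}" "set xo \<subseteq> {..<n}" using xs(2) xo(1) by auto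
  then have "scale * exp_latency n d p (r # xs) \<le> scale * (30000000 * opt_latency n r d p)"
    using approx by (simp add: expected_latency_int opt)
  then have "exp_latency n d p (r # xs) \<le> 30000000 * opt_latency n r d p" using scale_pos by simp
  then show ?thesis using that xs by (simp add: parse_toks master_tour_Cons)
qed

end

lemma set_nat_enc: "set (nat_enc m) \<subseteq> {1, 2}" by (auto simp: nat_enc_def)

lemma set_inst_enc: "\<forall>a\<in>set (inst_enc n r d p). 0 < a \<and> a < 6"
proof -
  have nat: "a \<in> set (nat_enc m) \<Longrightarrow> 0 < a \<and> a < 6" for a m using set_nat_enc[of m] by auto
  have "a \<in> set (rat_enc q) \<Longrightarrow> 0 < a \<and> a < 6" for a q using nat by (auto simp: rat_enc_def split: prod.splits)
  then show ?thesis using nat by (auto simp: inst_enc_def)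
qed

lemma set_tour_enc: "set (tour_enc xs) \<subseteq> {1, 2, 3}"
proof (induction xs)
  case (Cons x xs)
  then show ?case using set_nat_enc[of x] by (auto simp: tour_enc_def)
qed (simp add: tour_enc_def)

lemma print_tour_eq: "print_tour xs = map unary (tour_enc xs)"
  by (induction xs) (auto simp: print_tour_def tour_enc_def nat_enc_def)

theorem theorem1:
  shows "\<exists>(\<alpha>::real) (M::tm) (c::nat) (k::nat). wf_tm M \<and>
     (\<forall>n r d p. valid_instance n r d p \<longrightarrow>
        (\<exists>\<tau>. master_tour n r \<tau> \<and>
              computes_within M (inst_enc n r d p) (c * (length (inst_enc n r d p) + 2) ^ k) (tour_enc \<tau>) \<and>
              exp_latency n d p \<tau> \<le> \<alpha> * opt_latency n r d p))"
proof -
  obtain M c k where M: "wf_tm M" "\<And>w ys. (\<forall>a\<in>set w. 0 < a \<and> a < 6) \<Longrightarrow> algorithm (map unary w) = map unary ys \<Longrightarrow>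
    set ys \<subseteq> {1, 2, 3} \<Longrightarrow>
     computes_within M w (c * (length w + 2) ^ k) ys"
    using polytime_computes_within[OF polytime_algorithm] by blast
  have "\<exists>\<tau>. master_tour n r \<tau> \<and> computes_within M (inst_enc n r d p) (c * (length (inst_enc n r d p) + 2) ^ k) (tour_enc \<tau>) \<and>
      exp_latency n d p \<tau> \<le> 30000000 * opt_latency n r d p" if valid: "valid_instance n r d p" for n r d p
  proof -
    obtain xs where xs: "solve (parse (tokens (map unary (inst_enc n r d p)))) = r # xs" "master_tour n r (r # xs)"
      "exp_latency n d p (r # xs) \<le> 30000000 * opt_latency n r d p"
      by (rule algorithm_correct[OF valid, unfolded toks_def[OF valid]])
    have "algorithm (map unary (inst_enc n r d p)) = map unary (tour_enc (r # xs))"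
      by (simp only: algorithm_def xs(1) print_tour_eq)
    from M(2)[OF set_inst_enc this set_tour_enc] show ?thesis using xs by blast
  qed
  then show ?thesis using M(1) by blast
qed

end
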